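(* In the uniform pairwise-comparison model of the context, let $\psi(T)=\langle\Gamma,T\rangle$ and let $$\hat\psi_{\rm ws}=\langle\Gamma,\hat T\rangle+\mathbb P_n\big[\tilde s(Y,\langle\hat T,X\rangle)\,\langle\hat H_{\rm ws},X\rangle\big],\qquad \hat H_{\rm ws}=d^\star\hat P_{\mathbb T}\Gamma,$$ where $\tilde s(y,\eta)=s(y,\eta)/I(\eta)$. Assume $\|T^\star\|_\infty\le B$; the initial-estimator assumption stated in the context; $\|T^\star\|_F\ge c\sqrt{d^\star}$ for an absolute constant $c>0$; $\|P_{\mathbb T}\Gamma\|_F\ge\alpha_\Gamma\,\bar d^{1/2}(d^\star)^{-1/2}\|\Gamma\|_F$ for a constant $\alpha_\Gamma>0$; and $n\gg\bar d\log^c\bar d$. Then $$\frac{\sqrt n\,(\hat\psi_{\rm ws}-\psi(T^\star))}{\sqrt{V_{\rm ws}}}\ \xrightarrow{d}\ \mathcal N(0,1),\qquad V_{\rm ws}=\mathbb E^\star\!\left[\frac{\langle d^\star P_{\mathbb T}\Gamma,X\rangle^2}{I(\eta^\star)}\right].$$ Also, the plug-in estimator $\widehat V_{\rm ws}=\mathbb P_n[\hat{\tilde\phi}^{\,2}]$, with $\hat{\tilde\phi}(X,Y)=\tilde s(Y,\langle\hat T,X\rangle)\langle d^\star\hat P_{\mathbb T}\Gamma,X\rangle$, satisfies, with probability at least $1-\bar d^{-c}$, $$\left|\frac{\widehat V_{\rm ws}-V_{\rm ws}}{V_{\rm ws}}\right|\ \lesssim\ C\sqrt{\frac{\bar d\log^c\bar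 d}{n}} .$$
   Context: Constants and asymptotics: $c>0$ denotes constants that may differ between occurrences; $\lesssim$ and $C$ hide constants not depending on $n$ or the dimensions. Limits are along sequences of problems with $n\to\infty$ and growing dimensions, with $m,r,\mu,\kappa,B,\alpha_\Gamma$ and the other assumption constants fixed. Notation. $m\ge2$; $\bar d=\max_jd_j$, $D=\prod_{k\ge2}d_k$. $d^\star$ denotes the effective comparison dimension $d^\star=D(d_1-1)/2$, the number for which $\mathbb E^\star[\langle H,X\rangle X]=\frac1{d^\star}H$ for every $H$ with $\sum_aH_{a,u}=0$ for all $u$ (it equals $\prod_jd_j$ up to a constant factor). Tensors in $\mathbb R^{d_1\times\cdots\times d_m}$ carry the trace inner product; $\|\cdot\|_F,\|\cdot\|_1,\|\cdot\|_\infty$ are entrywise norms. Modes $2,\dots,m$ are flattened into a context index $u\in[D]$; entries are $H_{a,u}$, $a\in[d_1]$, and $E_{a,u}$ are canonical basis tensors. For a matrix, $\|\cdot\|_{2,\infty}$ is the maximal row $\ell_2$ norm and $\|\cdot\|_\infty$ the maximal absolute entry. $P_U=UU^\top$ for $U$ with orthonormal columns. Signal. $T^\star=\mathcal C^\star\times_1U_1\cdots\times_mU_m$ with $U_j\in\mathbb R^{d_j\times r_j}$ having orthonormal columns, core $\mathcal C^\star\in\mathbb R^{r_1\times\cdots\times r_m}$, $r=(r_1,\dots,r_m)$. $\lambda_{\max}=\max_k\|\mathcal C^\star_{(k)}\|_{\rm op}$, $\lambda_{\min}=\min_k\sigma_{r_k}(\mathcal C^\star_{(k)})>0$, $\kappa=\lambda_{\max}/\lambda_{\min}$.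 Identification: $\sum_aT^\star_{a,u}=0$ for all $u$. Incoherence: $\max_a\|e_a^\top U_j\|_2^2\le\mu r_j/d_j$ for all $j$. $\Gamma$ has support size at most a constant $M$ and $\|\Gamma\|_1\le C_\psi$. Data (uniform design). $u\in[D]$ uniform, unordered pair $\{a,b\}\subset[d_1]$ uniform, $X=E_{a,u}-E_{b,u}$; given $X$, $Y\in\{0,1\}$ with $\mathbb P(Y=1\mid X)=\sigma(\eta^\star)$, $\eta^\star=\langle T^\star,X\rangle$, $\sigma(z)=1/(1+e^{-z})$. $s(y,\eta)=y-\sigma(\eta)$; $I(\eta)=\sigma(\eta)(1-\sigma(\eta))$. $\mathbb E^\star$ is expectation under the true law. $\hat T,\hat P_{\mathbb T}$ are computed from a first-stage sample of size of order $n$, independent of the evaluation sample of $n$ i.i.d. observations with empirical mean $\mathbb P_n$. Tangent spaces. $\mathbb T$ is the tangent space at $T^\star$ of the manifold of tensors of Tucker rank $(r_1,\dots,r_m)$ intersected with $\{H:\sum_aH_{a,u}=0\ \forall u\}$; $P_{\mathbb T}$ its orthogonal projector; $\hat P_{\mathbb T}$ the analogous projector at $\hat T$. Initial-estimator assumption. With $\varepsilon_n=\sqrt{\bar d\log^c\bar d/n}$ and constants $c_0,c,C_1>0$, $\hat T$ has Tucker rank $(r_1,\dots,r_m)$ with orthonormal mode factors $\hat U_j$, and with probability at least $1-\bar d^{-c_0}$ simultaneously: $\sum_a\hat T_{a,u}=0$ for all $u$; $\|\hat T-T^\star\|_\infty\le C_1\varepsilon_n$; for every $j$, $\|P_{\hat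 U_j}-P_{U_j}\|_{\rm op}\le C_1\varepsilon_n$, $\|P_{\hat U_j}-P_{U_j}\|_{2,\infty}\le C_1\varepsilon_n\sqrt{\mu r_j/d_j}$, $\|P_{\hat U_j}-P_{U_j}\|_\infty\le C_1\varepsilon_n\mu r_j/d_j$, $\max_a\|e_a^\top\hat U_j\|_2^2\le2\mu r_j/d_j$; and $\|\mathcal A\times_1P_{\hat U_1}\cdots\times_mP_{\hat U_m}\|_\infty\le\big(\prod_j\sqrt{2\mu r_j}\big)\|\mathcal A\|_\infty$ for every tensor $\mathcal A$. *)

theory Defs
  imports "HOL-Probability.Probability" "Jordan_Normal_Form.Char_Poly"
begin

text \<open>
  The dimensions vary along the sequence of problems, so they are carried by values rather than by
  types. A tensor of dimensions \<open>ds = [d_1, ..., d_m]\<close> is a function on multi-indices (lists of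
  indices counted from 0) that vanishes off \<open>idx ds\<close>. A multi-index is \<open>a # u\<close> with
  \<open>a\<close> the index in mode 1 and \<open>u \<in> idx (tl ds)\<close> the context index, so that the number of contexts
  is \<open>D = prod_list (tl ds)\<close>.
\<close>

type_synonym tensor = "nat list \<Rightarrow> real"

definition idx :: "nat list \<Rightarrow> nat list set" where
  "idx ds = {i. length i = length ds \<and> (\<forall>j<length ds. i ! j < ds ! j)}"

definition tensors :: "nat list \<Rightarrow> tensor set" where
  "tensors ds = {H. \<forall>i. i \<notin> idx ds \<longrightarrow> H i = 0}"

definition unit_tensor :: "nat list \<Rightarrow> tensor" where
  "unit_tensor i = (\<lambda>i'. if i' = i then 1 else 0)"

definition tinner :: "nat list \<Rightarrow> tensor \<Rightarrow> tensor \<Rightarrow> real" where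
  "tinner ds G H = (\<Sum>i\<in>idx ds. G i * H i)"

definition frob_norm :: "nat list \<Rightarrow> tensor \<Rightarrow> real" where
  "frob_norm ds H = L2_set H (idx ds)"

definition l1_norm :: "nat list \<Rightarrow> tensor \<Rightarrow> real" where
  "l1_norm ds H = (\<Sum>i\<in>idx ds. \<bar>H i\<bar>)"

definition linf_norm :: "nat list \<Rightarrow> tensor \<Rightarrow> real" where
  "linf_norm ds H = Max ((\<lambda>i. \<bar>H i\<bar>) ` idx ds)"

definition zero_sum :: "nat list \<Rightarrow> tensor \<Rightarrow> bool" where
  "zero_sum ds H \<longleftrightarrow> (\<forall>u\<in>idx (tl ds). (\<Sum>a<hd ds. H (a # u)) = 0)"

definition dbar :: "nat list \<Rightarrow> real" where
  "dbar ds = real (Max (set ds))"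

definition dstar :: "nat list \<Rightarrow> real" where
  "dstar ds = real (prod_list (tl ds)) * (real (hd ds) - 1) / 2"

text \<open>
  \<open>mode_product ds rs C A\<close> is \<open>C \<times>_1 A_1 ... \<times>_m A_m\<close>, for \<open>C\<close> of dimensions \<open>rs\<close> and \<open>A_j\<close> a
  \<open>ds!j\<close> by \<open>rs!j\<close> matrix.
\<close>

definition mode_product ::
  "nat list \<Rightarrow> nat list \<Rightarrow> tensor \<Rightarrow> (nat \<Rightarrow> nat \<Rightarrow> nat \<Rightarrow> real) \<Rightarrow> tensor" where
  "mode_product ds rs C A = (\<lambda>i. if i \<in> idx ds
     then (\<Sum>l\<in>idx rs. C l * (\<Prod>j<length ds. A j (i ! j) (l ! j))) else 0)"

text \<open>Matrices are functions of a row and a column index, with explicit finite index sets.\<close>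

definition op_norm :: "'i set \<Rightarrow> 'j set \<Rightarrow> ('i \<Rightarrow> 'j \<Rightarrow> real) \<Rightarrow> real" where
  "op_norm I J A = Sup {L2_set (\<lambda>i. \<Sum>j\<in>J. A i j * x j) I | x. L2_set x J \<le> 1}"

definition two_inf_norm :: "'i set \<Rightarrow> 'j set \<Rightarrow> ('i \<Rightarrow> 'j \<Rightarrow> real) \<Rightarrow> real" where
  "two_inf_norm I J A = Max ((\<lambda>i. L2_set (A i) J) ` I)"

definition max_norm :: "'i set \<Rightarrow> 'j set \<Rightarrow> ('i \<Rightarrow> 'j \<Rightarrow> real) \<Rightarrow> real" where
  "max_norm I J A = Max ((\<lambda>(i, j). \<bar>A i j\<bar>) ` (I \<times> J))"

definition indep_columns :: "'i set \<Rightarrow> ('i \<Rightarrow> 'j \<Rightarrow> real) \<Rightarrow> 'j set \<Rightarrow> bool" where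
  "indep_columns I A S \<longleftrightarrow>
     (\<forall>c. (\<forall>i\<in>I. (\<Sum>j\<in>S. c j * A i j) = 0) \<longrightarrow> (\<forall>j\<in>S. c j = 0))"

definition mat_rank :: "'i set \<Rightarrow> 'j set \<Rightarrow> ('i \<Rightarrow> 'j \<Rightarrow> real) \<Rightarrow> nat" where
  "mat_rank I J A = Max {card S | S. S \<subseteq> J \<and> indep_columns I A S}"

text \<open>
  \<open>sing_val p J A l\<close> is the \<open>l\<close>-th largest singular value (\<open>1 \<le> l \<le> p\<close>) of a matrix \<open>A\<close> with rows
  \<open>{..<p}\<close>: the square root of the \<open>l\<close>-th largest eigenvalue, with multiplicity, of \<open>A A^T\<close>.
\<close>

definition sing_val :: "nat \<Rightarrow> 'j set \<Rightarrow> (nat \<Rightarrow> 'j \<Rightarrow> real) \<Rightarrow> nat \<Rightarrow> real" where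
  "sing_val p J A l = sqrt (rev (sorted_list_of_multiset (proots (char_poly
     (Matrix.mat p p (\<lambda>(i, i'). \<Sum>j\<in>J. A i j * A i' j))))) ! (l - 1))"

definition orthonormal_cols :: "nat \<Rightarrow> nat \<Rightarrow> (nat \<Rightarrow> nat \<Rightarrow> real) \<Rightarrow> bool" where
  "orthonormal_cols d r U \<longleftrightarrow>
     (\<forall>l<r. \<forall>l'<r. (\<Sum>a<d. U a l * U a l') = (if l = l' then 1 else 0))"

definition col_proj :: "nat \<Rightarrow> (nat \<Rightarrow> nat \<Rightarrow> real) \<Rightarrow> nat \<Rightarrow> nat \<Rightarrow> real" where
  "col_proj r U = (\<lambda>a b. \<Sum>l<r. U a l * U b l)"

text \<open>The columns of the mode-\<open>k\<close> unfolding are indexed by the multi-indices with mode \<open>k\<close> removed.\<close>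

definition skip_mode :: "nat \<Rightarrow> nat list \<Rightarrow> nat list" where
  "skip_mode k ds = take k ds @ drop (Suc k) ds"

definition unfold_mode :: "nat \<Rightarrow> tensor \<Rightarrow> nat \<Rightarrow> nat list \<Rightarrow> real" where
  "unfold_mode k H = (\<lambda>a u. H (take k u @ a # drop k u))"

definition lambda_max :: "nat list \<Rightarrow> tensor \<Rightarrow> real" where
  "lambda_max r C =
     Max ((\<lambda>k. op_norm {..<r!k} (idx (skip_mode k r)) (unfold_mode k C)) ` {..<length r})"

definition lambda_min :: "nat list \<Rightarrow> tensor \<Rightarrow> real" where
  "lambda_min r C =
     Min ((\<lambda>k. sing_val (r!k) (idx (skip_mode k r)) (unfold_mode k C) (r!k)) ` {..<length r})"

definition tucker_manifold :: "nat list \<Rightarrow> nat list \<Rightarrow> tensor set" where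
  "tucker_manifold ds r = {H \<in> tensors ds. \<forall>k<length ds.
     mat_rank {..<ds!k} (idx (skip_mode k ds)) (unfold_mode k H) = r ! k}"

text \<open>Velocities at \<open>T\<close> of curves in \<open>S\<close>; for an embedded submanifold \<open>S\<close>, the tangent space.\<close>

definition velocities :: "tensor set \<Rightarrow> tensor \<Rightarrow> tensor set" where
  "velocities S T = {H. \<exists>\<gamma> e. e > 0 \<and> (\<forall>t. \<bar>t\<bar> < e \<longrightarrow> \<gamma> t \<in> S) \<and> \<gamma> 0 = T \<and>
     (\<forall>i. ((\<lambda>t::real. \<gamma> t i) has_real_derivative H i) (at 0))}"

text \<open>
  If \<open>zero_sum ds T\<close>, this is also the tangent space at \<open>T\<close> of the intersection of the manifold with
  the zero-sum tensors; in the form below it is a linear space for every \<open>T\<close> of Tucker rank \<open>r\<close>.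
\<close>

definition tangent_space :: "nat list \<Rightarrow> nat list \<Rightarrow> tensor \<Rightarrow> tensor set" where
  "tangent_space ds r T = velocities (tucker_manifold ds r) T \<inter> {H. zero_sum ds H}"

definition orth_proj :: "nat list \<Rightarrow> tensor set \<Rightarrow> tensor \<Rightarrow> tensor" where
  "orth_proj ds S G = (THE Q. Q \<in> S \<and> (\<forall>H\<in>S. tinner ds (\<lambda>i. G i - Q i) H = 0))"

definition tangent_proj :: "nat list \<Rightarrow> nat list \<Rightarrow> tensor \<Rightarrow> tensor \<Rightarrow> tensor" where
  "tangent_proj ds r T = orth_proj ds (tangent_space ds r T)"

definition sigma :: "real \<Rightarrow> real" where
  "sigma z = 1 / (1 + exp (- z))"

definition info :: "real \<Rightarrow> real" where
  "info \<eta> = sigma \<eta> * (1 - sigma \<eta>)"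

definition score :: "real \<Rightarrow> real \<Rightarrow> real" where
  "score y \<eta> = y - sigma \<eta>"

definition score_ws :: "real \<Rightarrow> real \<Rightarrow> real" where
  "score_ws y \<eta> = score y \<eta> / info \<eta>"

text \<open>
  The unordered pair \<open>{a, b}\<close> is represented by its increasing enumeration. The opposite orientation
  would replace \<open>(X, Y)\<close> by \<open>(-X, 1 - Y)\<close>, which leaves \<open>score_ws Y \<langle>T, X\<rangle> * \<langle>H, X\<rangle>\<close> unchanged.
\<close>

definition design :: "nat list \<Rightarrow> tensor pmf" where
  "design ds = map_pmf (\<lambda>(u, a, b) i. unit_tensor (a # u) i - unit_tensor (b # u) i)
     (pair_pmf (pmf_of_set (idx (tl ds))) (pmf_of_set {(a, b). a < b \<and> b < hd ds}))"

type_synonym obs = "tensor \<times> real"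

definition obs_law :: "nat list \<Rightarrow> tensor \<Rightarrow> obs pmf" where
  "obs_law ds T = do {
     X \<leftarrow> design ds;
     Y \<leftarrow> map_pmf of_bool (bernoulli_pmf (sigma (tinner ds T X)));
     return_pmf (X, Y) }"

text \<open>\<open>(\<lambda>_. 0, 0)\<close> is a dummy value outside \<open>{..<n}\<close>.\<close>

definition iid_law :: "nat list \<Rightarrow> tensor \<Rightarrow> nat \<Rightarrow> (nat \<Rightarrow> obs) pmf" where
  "iid_law ds T n = Pi_pmf {..<n} (\<lambda>_. 0, 0) (\<lambda>_. obs_law ds T)"

definition emp_mean :: "nat \<Rightarrow> (nat \<Rightarrow> obs) \<Rightarrow> (obs \<Rightarrow> real) \<Rightarrow> real" where
  "emp_mean n w f = (\<Sum>i<n. f (w i)) / real n"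

text \<open>
  One problem of the sequence. \<open>factor P j\<close> is \<open>U_j\<close>. The estimators \<open>est P\<close> (of the tensor) and
  \<open>est_factor P\<close> (of its mode factors) are functions of the first-stage sample alone.
\<close>

record problem =
  dims :: "nat list"
  nobs :: nat
  nfirst :: nat
  core :: tensor
  factor :: "nat \<Rightarrow> nat \<Rightarrow> nat \<Rightarrow> real"
  gam :: tensor
  est :: "(nat \<Rightarrow> obs) \<Rightarrow> tensor"
  est_factor :: "(nat \<Rightarrow> obs) \<Rightarrow> nat \<Rightarrow> nat \<Rightarrow> nat \<Rightarrow> real"

definition Tstar :: "nat list \<Rightarrow> problem \<Rightarrow> tensor" where
  "Tstar r P = mode_product (dims P) r (core P) (factor P)"

definition first_law :: "nat list \<Rightarrow> problem \<Rightarrow> (nat \<Rightarrow> obs) pmf" where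
  "first_law r P = iid_law (dims P) (Tstar r P) (nfirst P)"

definition sample_law :: "nat list \<Rightarrow> problem \<Rightarrow> ((nat \<Rightarrow> obs) \<times> (nat \<Rightarrow> obs)) pmf" where
  "sample_law r P = pair_pmf (first_law r P) (iid_law (dims P) (Tstar r P) (nobs P))"

definition signal_assms :: "nat list \<Rightarrow> real \<Rightarrow> real \<Rightarrow> problem \<Rightarrow> bool" where
  "signal_assms r \<mu> \<kappa> P \<longleftrightarrow>
     length (dims P) = length r \<and> (\<forall>j<length r. dims P ! j \<ge> 1) \<and> hd (dims P) \<ge> 2 \<and>
     core P \<in> tensors r \<and>
     (\<forall>j<length r. orthonormal_cols (dims P ! j) (r!j) (factor P j)) \<and>
     lambda_min r (core P) > 0 \<and>
     lambda_max r (core P) / lambda_min r (core P) \<le> \<kappa> \<and>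
     zero_sum (dims P) (Tstar r P) \<and>
     (\<forall>j<length r. \<forall>a<dims P ! j.
        (L2_set (factor P j a) {..<r!j})\<^sup>2 \<le> \<mu> * real (r!j) / real (dims P ! j))"

definition functional_assms :: "nat \<Rightarrow> real \<Rightarrow> problem \<Rightarrow> bool" where
  "functional_assms M C\<psi> P \<longleftrightarrow>
     gam P \<in> tensors (dims P) \<and>
     card {i \<in> idx (dims P). gam P i \<noteq> 0} \<le> M \<and>
     l1_norm (dims P) (gam P) \<le> C\<psi>"

definition rate :: "real \<Rightarrow> problem \<Rightarrow> real" where
  "rate c P = sqrt (dbar (dims P) * ln (dbar (dims P)) powr c / real (nobs P))"

definition good_estimate ::
  "nat list \<Rightarrow> real \<Rightarrow> real \<Rightarrow> real \<Rightarrow> problem \<Rightarrow> (nat \<Rightarrow> obs) \<Rightarrow> bool" where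
  "good_estimate r \<mu> c C\<^sub>1 P z \<longleftrightarrow>
     (let ds = dims P;
          Th = est P z;
          Q = (\<lambda>j. col_proj (r!j) (est_factor P z j));
          diff = (\<lambda>j a b. Q j a b - col_proj (r!j) (factor P j) a b)
      in zero_sum ds Th \<and>
         linf_norm ds (\<lambda>i. Th i - Tstar r P i) \<le> C\<^sub>1 * rate c P \<and>
         (\<forall>j<length r.
            op_norm {..<ds!j} {..<ds!j} (diff j) \<le> C\<^sub>1 * rate c P \<and>
            two_inf_norm {..<ds!j} {..<ds!j} (diff j)
              \<le> C\<^sub>1 * rate c P * sqrt (\<mu> * real (r!j) / real (ds!j)) \<and>
            max_norm {..<ds!j} {..<ds!j} (diff j)
              \<le> C\<^sub>1 * rate c P * \<mu> * real (r!j) / real (ds!j) \<and>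
            (\<forall>a<ds!j. (L2_set (est_factor P z j a) {..<r!j})\<^sup>2
              \<le> 2 * \<mu> * real (r!j) / real (ds!j))) \<and>
         (\<forall>A\<in>tensors ds. linf_norm ds (mode_product ds ds A Q)
              \<le> (\<Prod>j<length r. sqrt (2 * \<mu> * real (r!j))) * linf_norm ds A))"

definition initial_estimator ::
  "nat list \<Rightarrow> real \<Rightarrow> real \<Rightarrow> real \<Rightarrow> real \<Rightarrow> problem \<Rightarrow> bool" where
  "initial_estimator r \<mu> c\<^sub>0 c C\<^sub>1 P \<longleftrightarrow>
     (\<forall>z\<in>set_pmf (first_law r P).
        est P z \<in> tucker_manifold (dims P) r \<and>
        (\<forall>j<length r. orthonormal_cols (dims P ! j) (r!j) (est_factor P z j)) \<and>
        (\<exists>C\<in>tensors r. est P z = mode_product (dims P) r C (est_factor P z))) \<and>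
     measure_pmf.prob (first_law r P) {z. good_estimate r \<mu> c C\<^sub>1 P z}
       \<ge> 1 - dbar (dims P) powr (- c\<^sub>0)"

definition H_ws :: "nat list \<Rightarrow> problem \<Rightarrow> tensor \<Rightarrow> tensor" where
  "H_ws r P T = (\<lambda>i. dstar (dims P) * tangent_proj (dims P) r T (gam P) i)"

definition phi_ws :: "nat list \<Rightarrow> problem \<Rightarrow> tensor \<Rightarrow> obs \<Rightarrow> real" where
  "phi_ws r P T = (\<lambda>(X, Y). score_ws Y (tinner (dims P) T X) * tinner (dims P) (H_ws r P T) X)"

definition psi :: "problem \<Rightarrow> tensor \<Rightarrow> real" where
  "psi P T = tinner (dims P) (gam P) T"

definition psi_hat_ws :: "nat list \<Rightarrow> problem \<Rightarrow> (nat \<Rightarrow> obs) \<times> (nat \<Rightarrow> obs) \<Rightarrow> real" where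
  "psi_hat_ws r P = (\<lambda>(z, w). psi P (est P z) + emp_mean (nobs P) w (phi_ws r P (est P z)))"

definition V_ws :: "nat list \<Rightarrow> problem \<Rightarrow> real" where
  "V_ws r P = measure_pmf.expectation (obs_law (dims P) (Tstar r P))
     (\<lambda>(X, Y). (tinner (dims P) (H_ws r P (Tstar r P)) X)\<^sup>2
        / info (tinner (dims P) (Tstar r P) X))"

definition V_hat_ws :: "nat list \<Rightarrow> problem \<Rightarrow> (nat \<Rightarrow> obs) \<times> (nat \<Rightarrow> obs) \<Rightarrow> real" where
  "V_hat_ws r P = (\<lambda>(z, w). emp_mean (nobs P) w (\<lambda>x. (phi_ws r P (est P z) x)\<^sup>2))"

end

theory Submission
  imports Defs
begin

text \<open>
  The tangent space at a tensor of Tucker rank \<open>r\<close> is computed exactly: velocities of constant-rank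
  curves are killed by the product of the projectors onto the orthogonal complements of the column and
  row spaces of each unfolding, and conversely every tensor with this property is the velocity of a
  polynomial curve. This gives an explicit kernel for the tangent projector, built from the factor
  projectors and from the row-space projectors of the unfoldings. By incoherence, this kernel has
  bounded \<open>l_1\<close> row norms and entries of order \<open>dbar / d^*\<close>, and a Wedin-type argument shows that it moves
  by \<open>O(\<epsilon>_n)\<close> relative to the same scale when \<open>T^*\<close> is replaced by the estimate.

  Conditionally on the first stage, the estimator is a mean of i.i.d. bounded terms. Its bias is of
  order \<open>\<epsilon>_n^2\<close>: the linear part cancels because \<open>d^* E[\<langle>H, X\<rangle> X] = H\<close>, and the component of \<open>T^*\<close>
  orthogonal to the tangent space at the estimate is of second order. Its variance is at least of order
  \<open>dbar * \<parallel>\<Gamma>\<parallel>^2\<close> by the alignment assumption, which dominates bias and Lindeberg terms. The central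
  limit theorem follows from characteristic functions of triangular arrays that are uniform over good
  first-stage samples, and the variance estimate from a Bernstein bound.
\<close>

subsection \<open>Linear algebra with finite index sets\<close>

text \<open>Tangent spaces are sets of velocities of arbitrary curves, with no manifold structure at
  hand, so the projector is identified by proving both inclusions. Row spaces enter as abstract
  projectors instead of inverses of core Gram matrices: their incoherence is inherited from the
  factors, and their perturbation is governed by a lower bound on singular values. That bound has
  the order of the square root of d^* and comes from the Frobenius norm of the signal and \<kappa>.
  An entrywise error \<epsilon>_n moves an unfolding by the same order times \<epsilon>_n, so the
  relative error is \<epsilon>_n.

  The powers of logarithms: the standard deviation is at least of order sqrt(dbar) times the l_1
  norm of \<Gamma>, so the normalised bias is of order sqrt(n) \<epsilon>_n^2 / sqrt(dbar), whose
  square is dbar log^{2c} dbar / n. One more logarithm pays for the concentration of the variance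
  estimate. The normalised summands are of size sqrt(dbar), so dbar / n must vanish as well. All
  constants must precede the sequence of problems, which is why they are closed expressions in the
  fixed parameters.\<close>

lemma homogeneous_solution:
  fixes a :: "'i \<Rightarrow> 'j \<Rightarrow> real"
  assumes "finite I" "finite J" "card I < card J"
  shows "\<exists>c. (\<exists>j\<in>J. c j \<noteq> 0) \<and> (\<forall>i\<in>I. (\<Sum>j\<in>J. c j * a i j) = 0)"
  using assms
proof (induction I arbitrary: J a rule: finite_induct)
  case empty
  then show ?case by (intro exI[of _ "\<lambda>_. 1"]) (auto simp: card_gt_0_iff)
next
  case (insert i I)
  show ?case
  proof (cases "\<forall>j\<in>J. a i j = 0")
    case True
    moreover obtain c where "\<exists>j\<in>J. c j \<noteq> 0" "\<forall>i\<in>I. (\<Sum>j\<in>J. c j * a i j) = 0"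
      using insert.IH[of J a] insert.prems insert.hyps by auto
    ultimately show ?thesis by (intro exI[of _ c]) auto
  next
    case False
    then obtain j0 where j0: "j0 \<in> J" "a i j0 \<noteq> 0" by blast
    \<comment> \<open>Column elimination with pivot \<open>a i j0\<close>: every other column loses
      a multiple of column \<open>j0\<close>, which clears row \<open>i\<close>. The coefficient at
      \<open>j0\<close> is fixed afterwards so that equation \<open>i\<close> holds too.\<close>
    define a' where "a' = (\<lambda>k j. a k j - a k j0 * a i j / a i j0)"
    have "card I < card (J - {j0})" using insert j0 by simp
    then obtain c where c: "\<exists>j\<in>J - {j0}. c j \<noteq> 0" "\<forall>k\<in>I. (\<Sum>j\<in>J - {j0}. c j * a' k j) = 0"
      using insert.IH[of "J - {j0}" a'] insert.prems by auto
    define s where "s = (\<Sum>j\<in>J - {j0}. c j * a i j)"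
    define c' where "c' = c(j0 := - s / a i j0)"
    have sum: "(\<Sum>j\<in>J. c' j * a k j) = (\<Sum>j\<in>J - {j0}. c j * a k j) - s / a i j0 * a k j0" for k
    proof -
      have "(\<Sum>j\<in>J. c' j * a k j) = c' j0 * a k j0 + (\<Sum>j\<in>J - {j0}. c' j * a k j)"
        using j0 insert.prems by (simp add: sum.remove)
      also have "(\<Sum>j\<in>J - {j0}. c' j * a k j) = (\<Sum>j\<in>J - {j0}. c j * a k j)"
        by (rule sum.cong) (auto simp: c'_def)
      finally show ?thesis by (simp add: c'_def)
    qed
    have "(\<Sum>j\<in>J. c' j * a k j) = 0" if "k \<in> insert i I" for k
    proof (cases "k = i")
      case True
      then show ?thesis using sum[of i] j0 by (simp add: s_def)
    next
      case False
      then have "0 = (\<Sum>j\<in>J - {j0}. c j * a' k j)" using c that by auto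
      also have "\<dots> = (\<Sum>j\<in>J - {j0}. c j * a k j) - s / a i j0 * a k j0"
        unfolding a'_def s_def
        by (simp add: right_diff_distrib sum_subtractf sum_distrib_left sum_distrib_right sum_divide_distrib mult_ac)
      finally show ?thesis using sum[of k] by simp
    qed
    moreover have "\<exists>j\<in>J. c' j \<noteq> 0" using c(1) by (auto simp: c'_def)
    ultimately show ?thesis by blast
  qed
qed

section \<open>Column rank and factorisations\<close>

lemma mat_rank_set:
  assumes "finite J"
  shows "finite {card S | S. S \<subseteq> J \<and> indep_columns I A S}" "{card S | S. S \<subseteq> J \<and> indep_columns I A S} \<noteq> {}"
proof -
  have "{card S | S. S \<subseteq> J \<and> indep_columns I A S} \<subseteq> card ` Pow J" by auto
  then show "finite {card S | S. S \<subseteq> J \<and> indep_columns I A S}" using assms finite_subset by blast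
  have "indep_columns I A {}" by (simp add: indep_columns_def)
  then show "{card S | S. S \<subseteq> J \<and> indep_columns I A S} \<noteq> {}" by blast
qed

lemma card_le_mat_rank:
  assumes "finite J" "S \<subseteq> J" "indep_columns I A S"
  shows "card S \<le> mat_rank I J A"
  unfolding mat_rank_def using assms by (intro Max_ge mat_rank_set) auto

lemma mat_rank_attained:
  assumes "finite J"
  obtains S where "S \<subseteq> J" "indep_columns I A S" "card S = mat_rank I J A"
proof -
  have "mat_rank I J A \<in> {card S | S. S \<subseteq> J \<and> indep_columns I A S}"
    unfolding mat_rank_def using assms by (intro Max_in mat_rank_set)
  then show ?thesis using that by auto
qed

text \<open>A dependence among \<open>insert j S\<close> must involve \<open>j\<close>, because
  \<open>S\<close> is independent. Maximality is expressed by cardinality, so that a set chosen for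
  one matrix can be reused for another matrix of the same rank in which it is still
  independent.\<close>

lemma max_indep_columns_span:
  assumes J: "finite J" and S: "S \<subseteq> J" "indep_columns I A S" "mat_rank I J A \<le> card S" and j: "j \<in> J"
  shows "\<exists>\<beta>. \<forall>i\<in>I. A i j = (\<Sum>s\<in>S. \<beta> s * A i s)"
proof (cases "j \<in> S")
  case True
  have "finite S" using J S finite_subset by blast
  then have "\<forall>i\<in>I. A i j = (\<Sum>s\<in>S. (if s = j then 1 else 0) * A i s)"
    using True by (auto simp: if_distrib[of "\<lambda>x. x * _"] sum.delta cong: if_cong)
  then show ?thesis by (intro exI[of _ "\<lambda>s. if s = j then 1 else 0"])
next
  case False
  have fS: "finite S" using J S finite_subset by blast
  have "\<not> indep_columns I A (insert j S)"
  proof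
    assume "indep_columns I A (insert j S)"
    then have "card (insert j S) \<le> mat_rank I J A" using S j by (intro card_le_mat_rank[OF J]) auto
    then show False using S fS False by simp
  qed
  then obtain c where c: "\<forall>i\<in>I. (\<Sum>s\<in>insert j S. c s * A i s) = 0" "\<exists>s\<in>insert j S. c s \<noteq> 0"
    unfolding indep_columns_def by blast
  have c1: "c j * A i j = - (\<Sum>s\<in>S. c s * A i s)" if "i \<in> I" for i
    using c(1) that fS False by (auto simp: eq_neg_iff_add_eq_0)
  have "c j \<noteq> 0"
  proof
    assume 0: "c j = 0"
    then have "\<forall>i\<in>I. (\<Sum>s\<in>S. c s * A i s) = 0" using c1 by fastforce
    then have "\<forall>s\<in>S. c s = 0" using S(2) unfolding indep_columns_def by blast
    then show False using c(2) 0 by auto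
  qed
  then have "\<forall>i\<in>I. A i j = (\<Sum>s\<in>S. (- c s / c j) * A i s)"
    using c1 by (auto simp: sum_negf sum_divide_distrib[symmetric] field_simps)
  then show ?thesis by (intro exI[of _ "\<lambda>s. - c s / c j"])
qed

text \<open>Among more than \<open>card L\<close> columns some nontrivial combination is annihilated
  by every row of \<open>G\<close>, hence by \<open>A\<close>.\<close>

lemma mat_rank_le:
  assumes fin: "finite J" "finite L"
    and fac: "\<And>i j. i \<in> I \<Longrightarrow> j \<in> J \<Longrightarrow> A i j = (\<Sum>l\<in>L. F i l * G l j)"
  shows "mat_rank I J A \<le> card L"
proof (rule ccontr)
  assume *: "\<not> ?thesis"
  obtain S where S: "S \<subseteq> J" "indep_columns I A S" "card S = mat_rank I J A"
    using mat_rank_attained[OF fin(1)] by blast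
  have fS: "finite S" using fin S finite_subset by blast
  obtain c where c: "\<exists>j\<in>S. c j \<noteq> 0" "\<forall>l\<in>L. (\<Sum>j\<in>S. c j * G l j) = 0"
    using homogeneous_solution[OF fin(2) fS, of G] S * by auto
  have "(\<Sum>j\<in>S. c j * A i j) = 0" if "i \<in> I" for i
  proof -
    have "(\<Sum>j\<in>S. c j * A i j) = (\<Sum>j\<in>S. \<Sum>l\<in>L. F i l * (c j * G l j))"
      using fac that S by (intro sum.cong) (auto simp: sum_distrib_left mult_ac)
    also have "\<dots> = (\<Sum>l\<in>L. F i l * (\<Sum>j\<in>S. c j * G l j))"
      by (subst sum.swap) (simp add: sum_distrib_left)
    finally show ?thesis using c by simp
  qed
  then show False using S(2) c(1) unfolding indep_columns_def by blast
qed

section \<open>Orthogonal projectors as symmetric idempotent kernels\<close>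

definition is_proj :: "'i set \<Rightarrow> ('i \<Rightarrow> 'i \<Rightarrow> real) \<Rightarrow> bool" where
  "is_proj I V \<longleftrightarrow> (\<forall>i\<in>I. \<forall>j\<in>I. V i j = V j i) \<and> (\<forall>i\<in>I. \<forall>j\<in>I. (\<Sum>k\<in>I. V i k * V k j) = V i j)"

definition apply_kernel :: "'j set \<Rightarrow> ('i \<Rightarrow> 'j \<Rightarrow> real) \<Rightarrow> ('j \<Rightarrow> real) \<Rightarrow> 'i \<Rightarrow> real" where
  "apply_kernel J V x i = (\<Sum>j\<in>J. V i j * x j)"

lemma apply_kernel_selfadjoint:
  assumes "is_proj I V"
  shows "(\<Sum>i\<in>I. apply_kernel I V x i * y i) = (\<Sum>i\<in>I. x i * apply_kernel I V y i)"
proof -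
  have "(\<Sum>i\<in>I. apply_kernel I V x i * y i) = (\<Sum>i\<in>I. \<Sum>j\<in>I. V i j * x j * y i)"
    by (simp add: apply_kernel_def sum_distrib_right)
  also have "\<dots> = (\<Sum>j\<in>I. \<Sum>i\<in>I. V j i * x j * y i)"
    using assms by (subst sum.swap) (auto intro!: sum.cong simp: is_proj_def)
  finally show ?thesis by (simp add: apply_kernel_def sum_distrib_left mult_ac)
qed

lemma apply_kernel_idem:
  assumes "is_proj I V" "i \<in> I"
  shows "apply_kernel I V (apply_kernel I V x) i = apply_kernel I V x i"
proof -
  have "apply_kernel I V (apply_kernel I V x) i = (\<Sum>k\<in>I. \<Sum>j\<in>I. V i k * V k j * x j)"
    by (simp add: apply_kernel_def sum_distrib_left mult_ac)
  also have "\<dots> = (\<Sum>j\<in>I. (\<Sum>k\<in>I. V i k * V k j) * x j)"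
    by (subst sum.swap) (simp add: sum_distrib_right)
  also have "\<dots> = apply_kernel I V x i"
    using assms by (auto simp: is_proj_def apply_kernel_def)
  finally show ?thesis .
qed

lemma apply_kernel_diff:
  "apply_kernel I V (\<lambda>i. x i - y i) i = apply_kernel I V x i - apply_kernel I V y i"
  by (simp add: apply_kernel_def right_diff_distrib sum_subtractf)

lemma apply_kernel_cong:
  "(\<And>j. j \<in> J \<Longrightarrow> x j = y j) \<Longrightarrow> apply_kernel J V x i = apply_kernel J V y i"
  by (simp add: apply_kernel_def)

text \<open>The orthogonal projector onto the span of the \<open>v b\<close>: the second clause puts
  the span into the range, the third puts every row, hence by symmetry the range, into the span.
  Explicit coefficients \<open>n\<close> are kept because later proofs substitute them into
  sums.\<close>

definition span_proj :: "'i set \<Rightarrow> 'b set \<Rightarrow> ('b \<Rightarrow> 'i \<Rightarrow> real) \<Rightarrow> ('i \<Rightarrow> 'i \<Rightarrow> real) \<Rightarrow> bool" where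
  "span_proj I B v V \<longleftrightarrow> is_proj I V \<and> (\<forall>b\<in>B. \<forall>i\<in>I. apply_kernel I V (v b) i = v b i) \<and>
     (\<exists>n. \<forall>i\<in>I. \<forall>j\<in>I. V i j = (\<Sum>b\<in>B. n b i * v b j))"

text \<open>Gram-Schmidt. With \<open>w\<close> the residual of the new vector and \<open>s\<close>
  its squared norm, the new projector is \<open>V\<close> plus the rank-one kernel
  \<open>w i * w j / s\<close>; if \<open>s = 0\<close>, the vector already lies in the
  span.\<close>

lemma span_proj_exists:
  assumes "finite I" "finite B"
  shows "\<exists>V. span_proj I B v V"
  using assms(2)
proof (induction B rule: finite_induct)
  case empty
  show ?case by (intro exI[of _ "\<lambda>_ _. 0"]) (auto simp: span_proj_def is_proj_def)
next
  case (insert b B)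
  then obtain V where V: "is_proj I V" "\<forall>b\<in>B. \<forall>i\<in>I. apply_kernel I V (v b) i = v b i"
    and "\<exists>n. \<forall>i\<in>I. \<forall>j\<in>I. V i j = (\<Sum>b\<in>B. n b i * v b j)" unfolding span_proj_def by auto
  then obtain n where n: "\<forall>i\<in>I. \<forall>j\<in>I. V i j = (\<Sum>b\<in>B. n b i * v b j)" by blast
  define w where "w = (\<lambda>i. v b i - apply_kernel I V (v b) i)"
  define s where "s = (\<Sum>i\<in>I. w i * w i)"
  have Vw: "apply_kernel I V w i = 0" if "i \<in> I" for i
    using apply_kernel_idem[OF V(1) that, of "v b"] by (simp add: w_def apply_kernel_diff)
  have wv0: "(\<Sum>i\<in>I. w i * v b' i) = 0" if "b' \<in> B" for b'
  proof -
    have "(\<Sum>i\<in>I. w i * v b' i) = (\<Sum>i\<in>I. w i * apply_kernel I V (v b') i)"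
      using V(2) that by (intro sum.cong) auto
    also have "\<dots> = (\<Sum>i\<in>I. apply_kernel I V w i * v b' i)"
      using apply_kernel_selfadjoint[OF V(1)] by metis
    finally show ?thesis using Vw by simp
  qed
  have wvb: "(\<Sum>i\<in>I. w i * v b i) = s"
  proof -
    have "(\<Sum>i\<in>I. w i * v b i) = (\<Sum>i\<in>I. w i * w i) + (\<Sum>i\<in>I. w i * apply_kernel I V (v b) i)"
      unfolding sum.distrib[symmetric] by (intro sum.cong) (auto simp: w_def algebra_simps)
    also have "(\<Sum>i\<in>I. w i * apply_kernel I V (v b) i) = (\<Sum>i\<in>I. apply_kernel I V w i * v b i)"
      using apply_kernel_selfadjoint[OF V(1)] by metis
    finally show ?thesis using Vw by (simp add: s_def)
  qed
  show ?case
  proof (cases "s = 0")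
    case True
    then have "\<forall>i\<in>I. w i = 0" using assms(1)
      by (auto simp: s_def sum_nonneg_eq_0_iff)
    then have "\<forall>i\<in>I. apply_kernel I V (v b) i = v b i" by (simp add: w_def)
    moreover have "\<forall>i\<in>I. \<forall>j\<in>I. V i j = (\<Sum>b'\<in>insert b B. (n(b := \<lambda>_. 0)) b' i * v b' j)"
    proof (intro ballI)
      fix i j assume "i \<in> I" "j \<in> I"
      moreover have "(\<Sum>b'\<in>B. (n(b := \<lambda>_. 0)) b' i * v b' j) = (\<Sum>b'\<in>B. n b' i * v b' j)"
        using insert by (intro sum.cong) auto
      ultimately show "V i j = (\<Sum>b'\<in>insert b B. (n(b := \<lambda>_. 0)) b' i * v b' j)"
        using n insert by simp
    qed
    ultimately show ?thesis using V by (intro exI[of _ V]) (unfold span_proj_def, blast)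
  next
    case False
    define V' where "V' = (\<lambda>i j. V i j + w i * w j / s)"
    have ap: "apply_kernel I V' x i = apply_kernel I V x i + w i * (\<Sum>j\<in>I. w j * x j) / s" for x i
      unfolding apply_kernel_def V'_def sum_distrib_left sum_divide_distrib sum.distrib[symmetric]
      by (intro sum.cong) (auto simp: algebra_simps)
    have wV: "(\<Sum>k\<in>I. w k * V k j) = 0" if "j \<in> I" for j
    proof -
      have "(\<Sum>k\<in>I. w k * V k j) = apply_kernel I V w j"
        unfolding apply_kernel_def using V(1) that by (intro sum.cong) (auto simp: is_proj_def)
      then show ?thesis using Vw that by simp
    qed
    have "is_proj I V'" unfolding is_proj_def
    proof (intro conjI ballI)
      fix i j assume ij: "i \<in> I" "j \<in> I"
      show "V' i j = V' j i" using V(1) ij by (simp add: V'_def is_proj_def mult_ac)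
      have "(\<Sum>k\<in>I. V' i k * V' k j) = apply_kernel I V' (\<lambda>k. V' k j) i" by (simp add: apply_kernel_def)
      also have "\<dots> = apply_kernel I V (\<lambda>k. V' k j) i + w i * (\<Sum>k\<in>I. w k * V' k j) / s" by (rule ap)
      also have "apply_kernel I V (\<lambda>k. V' k j) i = (\<Sum>k\<in>I. V i k * V k j) + apply_kernel I V w i * w j / s"
        unfolding apply_kernel_def V'_def sum_distrib_right sum_divide_distrib sum.distrib[symmetric]
        by (intro sum.cong) (auto simp: algebra_simps)
      also have "(\<Sum>k\<in>I. V i k * V k j) = V i j" using V(1) ij unfolding is_proj_def by blast
      also have "(\<Sum>k\<in>I. w k * V' k j) = (\<Sum>k\<in>I. w k * V k j) + s * w j / s"
        unfolding s_def V'_def sum_distrib_right sum_divide_distrib sum.distrib[symmetric]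
        by (intro sum.cong) (auto simp: algebra_simps)
      also have "\<dots> = w j" using wV ij False by simp
      finally show "(\<Sum>k\<in>I. V' i k * V' k j) = V' i j" using Vw ij by (simp add: V'_def)
    qed
    moreover have "apply_kernel I V' (v b') i = v b' i" if "b' \<in> insert b B" "i \<in> I" for b' i
    proof (cases "b' = b")
      case True
      then show ?thesis using False that wvb by (simp add: ap) (simp add: w_def)
    next
      case False
      then show ?thesis using that wv0 V(2) by (simp add: ap)
    qed
    moreover
    \<comment> \<open>The residual \<open>w\<close> is \<open>v b\<close> minus the combination of
      the old vectors with coefficients \<open>q\<close>. Substituting this into the rank-one term
      yields the coefficients \<open>n'\<close> for the enlarged family.\<close>
    define q where "q = (\<lambda>b'. \<Sum>k\<in>I. n b' k * v b k)"
    define n' where "n' = (\<lambda>b' i. if b' = b then w i / s else n b' i - w i * q b' / s)"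
    have w_eq: "w j = v b j - (\<Sum>b'\<in>B. q b' * v b' j)" if "j \<in> I" for j
    proof -
      have "apply_kernel I V (v b) j = (\<Sum>k\<in>I. \<Sum>b'\<in>B. n b' k * v b' j * v b k)"
        unfolding apply_kernel_def using V(1) n that
        by (intro sum.cong) (auto simp: is_proj_def sum_distrib_right)
      also have "\<dots> = (\<Sum>b'\<in>B. q b' * v b' j)"
        by (subst sum.swap) (simp add: q_def sum_distrib_left sum_distrib_right mult_ac)
      finally show ?thesis by (simp add: w_def)
    qed
    have "V' i j = (\<Sum>b'\<in>insert b B. n' b' i * v b' j)" if ij: "i \<in> I" "j \<in> I" for i j
    proof -
      have "(\<Sum>b'\<in>insert b B. n' b' i * v b' j)
          = w i / s * v b j + (\<Sum>b'\<in>B. (n b' i - w i * q b' / s) * v b' j)"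
      proof -
        have "(\<Sum>b'\<in>B. n' b' i * v b' j) = (\<Sum>b'\<in>B. (n b' i - w i * q b' / s) * v b' j)"
          using insert by (intro sum.cong) (auto simp: n'_def)
        then show ?thesis using insert by (simp add: n'_def)
      qed
      also have "\<dots> = V i j + w i / s * (v b j - (\<Sum>b'\<in>B. q b' * v b' j))"
        using n ij by (simp add: left_diff_distrib sum_subtractf sum_distrib_left algebra_simps)
      also have "\<dots> = V' i j" using w_eq[of j] ij by (simp add: V'_def)
      finally show ?thesis by simp
    qed
    ultimately show ?thesis unfolding span_proj_def by blast
  qed
qed

text \<open>A dual basis: row \<open>s\<close> of \<open>L\<close> is the residual of column
  \<open>s\<close> against the span of the other columns, divided by its squared norm. That norm is
  nonzero exactly because the columns are independent.\<close>

lemma left_inverse_exists: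
  assumes "finite I" "finite S" and ind: "indep_columns I A S"
  shows "\<exists>L. \<forall>s\<in>S. \<forall>s'\<in>S. (\<Sum>i\<in>I. L s i * A i s') = (if s = s' then 1 else 0)"
proof -
  have "\<exists>l. \<forall>s'\<in>S. (\<Sum>i\<in>I. l i * A i s') = (if s = s' then 1 else 0)" if s: "s \<in> S" for s
  proof -
    obtain V where V: "is_proj I V" "\<forall>b\<in>S - {s}. \<forall>i\<in>I. apply_kernel I V (\<lambda>i. A i b) i = A i b"
      and n: "\<exists>n. \<forall>i\<in>I. \<forall>j\<in>I. V i j = (\<Sum>b\<in>S - {s}. n b i * A j b)"
      using span_proj_exists[OF assms(1), of "S - {s}" "\<lambda>b i. A i b"] assms(2)
      unfolding span_proj_def by auto
    then obtain n where n: "\<forall>i\<in>I. \<forall>j\<in>I. V i j = (\<Sum>b\<in>S - {s}. n b i * A j b)" by blast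
    define w where "w = (\<lambda>i. A i s - apply_kernel I V (\<lambda>i. A i s) i)"
    define q where "q = (\<Sum>i\<in>I. w i * w i)"
    have Vw: "apply_kernel I V w i = 0" if "i \<in> I" for i
      using apply_kernel_idem[OF V(1) that] by (simp add: w_def apply_kernel_diff)
    have wA0: "(\<Sum>i\<in>I. w i * A i s') = 0" if "s' \<in> S - {s}" for s'
    proof -
      have "(\<Sum>i\<in>I. w i * A i s') = (\<Sum>i\<in>I. w i * apply_kernel I V (\<lambda>i. A i s') i)"
        using V(2) that by (intro sum.cong) auto
      also have "\<dots> = (\<Sum>i\<in>I. apply_kernel I V w i * A i s')"
        using apply_kernel_selfadjoint[OF V(1), of w] by simp
      finally show ?thesis using Vw by simp
    qed
    have wAs: "(\<Sum>i\<in>I. w i * A i s) = q"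
    proof -
      have "(\<Sum>i\<in>I. w i * A i s) = q + (\<Sum>i\<in>I. w i * apply_kernel I V (\<lambda>i. A i s) i)"
        unfolding q_def sum.distrib[symmetric] by (intro sum.cong) (auto simp: w_def algebra_simps)
      also have "(\<Sum>i\<in>I. w i * apply_kernel I V (\<lambda>i. A i s) i) = (\<Sum>i\<in>I. apply_kernel I V w i * A i s)"
        using apply_kernel_selfadjoint[OF V(1), of w] by simp
      finally show ?thesis using Vw by simp
    qed
    have "q \<noteq> 0"
    proof
      assume "q = 0"
      then have w0: "\<forall>i\<in>I. w i = 0" using assms(1) by (auto simp: q_def sum_nonneg_eq_0_iff)
      define c where "c = (\<lambda>b. if b = s then 1 else - (\<Sum>k\<in>I. n b k * A k s))"
      have "(\<Sum>b\<in>S. c b * A i b) = 0" if i: "i \<in> I" for i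
      proof -
        have "A i s = (\<Sum>k\<in>I. V i k * A k s)" using w0 i by (simp add: w_def apply_kernel_def)
        also have "\<dots> = (\<Sum>k\<in>I. \<Sum>b\<in>S - {s}. n b k * A i b * A k s)"
          using V(1) n i by (intro sum.cong) (auto simp: is_proj_def sum_distrib_right)
        also have "\<dots> = (\<Sum>b\<in>S - {s}. - c b * A i b)"
          by (subst sum.swap) (auto intro!: sum.cong simp: c_def sum_distrib_left sum_distrib_right mult_ac)
        finally have "A i s = - (\<Sum>b\<in>S - {s}. c b * A i b)" by (simp add: sum_negf)
        moreover have "(\<Sum>b\<in>S. c b * A i b) = c s * A i s + (\<Sum>b\<in>S - {s}. c b * A i b)"
          using s assms(2) by (simp add: sum.remove)
        ultimately show ?thesis by (simp add: c_def)
      qed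
      then have "\<forall>b\<in>S. c b = 0" using ind unfolding indep_columns_def by blast
      then show False using s by (auto simp: c_def)
    qed
    then have "\<forall>s'\<in>S. (\<Sum>i\<in>I. w i / q * A i s') = (if s = s' then 1 else 0)"
      using wA0 wAs by (auto simp: sum_divide_distrib[symmetric])
    then show ?thesis by (intro exI[of _ "\<lambda>i. w i / q"])
  qed
  then show ?thesis by metis
qed

section \<open>Independence and rank along curves of matrices\<close>

lemma near_identity_bound:
  fixes E :: "'s \<Rightarrow> 's \<Rightarrow> real"
  assumes S: "finite S"
    and E: "\<And>s s'. s \<in> S \<Longrightarrow> s' \<in> S \<Longrightarrow> \<bar>E s s' - (if s = s' then 1 else 0)\<bar> \<le> 1 / (2 * (real (card S) + 1))"
    and s: "s \<in> S"
  shows "\<bar>c s\<bar> \<le> 2 * (\<Sum>s''\<in>S. \<bar>\<Sum>s'\<in>S. E s'' s' * c s'\<bar>)"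
proof -
  define M where "M = Max ((\<lambda>s. \<bar>c s\<bar>) ` S)"
  have "M \<in> (\<lambda>s. \<bar>c s\<bar>) ` S" unfolding M_def using S s by (intro Max_in) auto
  then obtain p where p: "p \<in> S" "M = \<bar>c p\<bar>" by auto
  have le: "\<bar>c s\<bar> \<le> M" if "s \<in> S" for s unfolding M_def using S that by (intro Max_ge) auto
  have M0: "M \<ge> 0" using p by simp
  have "c p = (\<Sum>s'\<in>S. (if p = s' then 1 else 0) * c s')"
    using p S by (auto simp: if_distrib[of "\<lambda>x. x * _"] cong: if_cong)
  then have "c p = (\<Sum>s'\<in>S. E p s' * c s') - (\<Sum>s'\<in>S. (E p s' - (if p = s' then 1 else 0)) * c s')"
    by (simp add: left_diff_distrib sum_subtractf)
  then have "M \<le> \<bar>\<Sum>s'\<in>S. E p s' * c s'\<bar> + \<bar>\<Sum>s'\<in>S. (E p s' - (if p = s' then 1 else 0)) * c s'\<bar>"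
    using p by linarith
  also have "\<bar>\<Sum>s'\<in>S. (E p s' - (if p = s' then 1 else 0)) * c s'\<bar> \<le> (\<Sum>s'\<in>S. 1 / (2 * (real (card S) + 1)) * M)"
    unfolding sum_distrib_right
    by (rule order_trans[OF sum_abs sum_mono], unfold abs_mult, rule mult_mono[OF E[OF p(1)] le]) auto
  also have "\<dots> = (real (card S) / (real (card S) + 1)) * M / 2" by (simp add: field_simps)
  also have "\<dots> \<le> 1 * M / 2" using M0 by (intro divide_right_mono mult_right_mono) auto
  finally have "M \<le> 2 * \<bar>\<Sum>s'\<in>S. E p s' * c s'\<bar>" by simp
  moreover have "\<bar>\<Sum>s'\<in>S. E p s' * c s'\<bar> \<le> (\<Sum>s''\<in>S. \<bar>\<Sum>s'\<in>S. E s'' s' * c s'\<bar>)"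
    using p S by (intro member_le_sum) auto
  ultimately show ?thesis using le[OF s] by linarith
qed

text \<open>A left inverse of \<open>A 0\<close> is nearly a left inverse of \<open>A t\<close>.
  Besides independence, the coefficients of a combination are bounded by the combination itself,
  with \<open>L\<close> independent of \<open>t\<close>; this is what forces coefficients to tend to
  0 when the combination does.\<close>

lemma indep_columns_stable:
  fixes A :: "real \<Rightarrow> 'i \<Rightarrow> 'j \<Rightarrow> real"
  assumes I: "finite I" and S: "finite S"
    and cont: "\<And>i j. i \<in> I \<Longrightarrow> j \<in> S \<Longrightarrow> ((\<lambda>t. A t i j) \<longlongrightarrow> A 0 i j) (at 0)"
    and ind: "indep_columns I (A 0) S"
  shows "\<exists>L. \<forall>\<^sub>F t in at 0. indep_columns I (A t) S \<and>
    (\<forall>c. \<forall>s\<in>S. \<bar>c s\<bar> \<le> 2 * (\<Sum>s'\<in>S. \<bar>\<Sum>i\<in>I. L s' i * (\<Sum>j\<in>S. c j * A t i j)\<bar>))"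
proof -
  obtain L where L: "\<forall>s\<in>S. \<forall>s'\<in>S. (\<Sum>i\<in>I. L s i * A 0 i s') = (if s = s' then 1 else 0)"
    using left_inverse_exists[OF I S ind] by blast
  define E where "E = (\<lambda>t s s'. \<Sum>i\<in>I. L s i * A t i s')"
  let ?d = "1 / (2 * (real (card S) + 1))"
  have lim: "((\<lambda>t. E t s s') \<longlongrightarrow> E 0 s s') (at 0)" if "s \<in> S" "s' \<in> S" for s s'
    unfolding E_def by (intro tendsto_intros cont that)
  have "\<forall>\<^sub>F t in at 0. \<bar>E t s s' - (if s = s' then 1 else 0)\<bar> \<le> ?d" if "s \<in> S" "s' \<in> S" for s s'
  proof -
    have "E 0 s s' = (if s = s' then 1 else 0)" using L that by (simp add: E_def)
    then have "\<forall>\<^sub>F t in at 0. dist (E t s s') (if s = s' then 1 else 0) < ?d"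
      using tendstoD[OF lim[OF that], of ?d] by simp
    then show ?thesis by eventually_elim (simp add: dist_real_def)
  qed
  then have "\<forall>\<^sub>F t in at 0. \<forall>s\<in>S. \<forall>s'\<in>S. \<bar>E t s s' - (if s = s' then 1 else 0)\<bar> \<le> ?d"
    using S by (intro eventually_ball_finite ballI) blast+
  then have "\<forall>\<^sub>F t in at 0. indep_columns I (A t) S \<and>
    (\<forall>c. \<forall>s\<in>S. \<bar>c s\<bar> \<le> 2 * (\<Sum>s'\<in>S. \<bar>\<Sum>i\<in>I. L s' i * (\<Sum>j\<in>S. c j * A t i j)\<bar>))"
  proof eventually_elim
    case (elim t)
    have eq: "(\<Sum>j\<in>S. E t s' j * c j) = (\<Sum>i\<in>I. L s' i * (\<Sum>j\<in>S. c j * A t i j))" for c s'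
      by (simp add: E_def sum_distrib_left sum_distrib_right, subst sum.swap) (simp add: mult_ac)
    have bd: "\<bar>c s\<bar> \<le> 2 * (\<Sum>s'\<in>S. \<bar>\<Sum>i\<in>I. L s' i * (\<Sum>j\<in>S. c j * A t i j)\<bar>)" if "s \<in> S" for c s
      using near_identity_bound[OF S, of "E t" s c] elim that by (simp add: eq)
    have "indep_columns I (A t) S" unfolding indep_columns_def
    proof (intro allI impI ballI)
      fix c s assume "\<forall>i\<in>I. (\<Sum>j\<in>S. c j * A t i j) = 0" "s \<in> S"
      then show "c s = 0" using bd[of s c] by simp
    qed
    then show ?case using bd by blast
  qed
  then show ?thesis by blast
qed

lemma mat_rank_lower_semicontinuous:
  fixes A :: "real \<Rightarrow> 'i \<Rightarrow> 'j \<Rightarrow> real"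
  assumes I: "finite I" and J: "finite J"
    and cont: "\<And>i j. i \<in> I \<Longrightarrow> j \<in> J \<Longrightarrow> ((\<lambda>t. A t i j) \<longlongrightarrow> A 0 i j) (at 0)"
  shows "\<forall>\<^sub>F t in at 0. mat_rank I J (A 0) \<le> mat_rank I J (A t)"
proof -
  obtain S where S: "S \<subseteq> J" "indep_columns I (A 0) S" "card S = mat_rank I J (A 0)"
    using mat_rank_attained[OF J] by blast
  have fS: "finite S" using J S finite_subset by blast
  obtain L where "\<forall>\<^sub>F t in at 0. indep_columns I (A t) S \<and>
    (\<forall>c. \<forall>s\<in>S. \<bar>c s\<bar> \<le> 2 * (\<Sum>s'\<in>S. \<bar>\<Sum>i\<in>I. L s' i * (\<Sum>j\<in>S. c j * A t i j)\<bar>))"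
    using indep_columns_stable[of I S A] I fS S(1,2) cont by (metis (no_types, lifting) subsetD)
  then show ?thesis
    by eventually_elim (use S card_le_mat_rank[OF J] in metis)
qed

text \<open>Since \<open>A t y\<close> lies in the span of the columns in \<open>S\<close>, with coefficients that tend to 0, the
  number \<open>x\<^sup>T A t y\<close> is a product of two quantities that vanish at 0.\<close>

lemma constant_rank_derivative:
  fixes A :: "real \<Rightarrow> 'i \<Rightarrow> 'j \<Rightarrow> real"
  assumes I: "finite I" and J: "finite J"
    and deriv: "\<And>i j. i \<in> I \<Longrightarrow> j \<in> J \<Longrightarrow> ((\<lambda>t. A t i j) has_real_derivative H i j) (at 0)"
    and rank: "\<forall>\<^sub>F t in at 0. mat_rank I J (A t) = mat_rank I J (A 0)"
    and x: "\<And>j. j \<in> J \<Longrightarrow> (\<Sum>i\<in>I. x i * A 0 i j) = 0"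
    and y: "\<And>i. i \<in> I \<Longrightarrow> (\<Sum>j\<in>J. A 0 i j * y j) = 0"
  shows "(\<Sum>i\<in>I. \<Sum>j\<in>J. x i * H i j * y j) = 0"
proof -
  obtain S where S: "S \<subseteq> J" "indep_columns I (A 0) S" "card S = mat_rank I J (A 0)"
    using mat_rank_attained[OF J] by blast
  have fS: "finite S" using J S finite_subset by blast
  have cont: "((\<lambda>t. A t i j) \<longlongrightarrow> A 0 i j) (at 0)" if "i \<in> I" "j \<in> J" for i j
    using DERIV_isCont[OF deriv[OF that]] by (simp add: isCont_def)
  obtain L where L: "\<forall>\<^sub>F t in at 0. indep_columns I (A t) S \<and>
    (\<forall>c. \<forall>s\<in>S. \<bar>c s\<bar> \<le> 2 * (\<Sum>s'\<in>S. \<bar>\<Sum>i\<in>I. L s' i * (\<Sum>j\<in>S. c j * A t i j)\<bar>))"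
    using indep_columns_stable[of I S A] I fS S(1,2) cont by (metis (no_types, lifting) subsetD)
  define g where "g = (\<lambda>t. \<Sum>s\<in>S. \<bar>\<Sum>i\<in>I. L s i * (\<Sum>j\<in>J. A t i j * y j)\<bar>)"
  define f where "f = (\<lambda>t. \<Sum>i\<in>I. x i * (\<Sum>j\<in>J. A t i j * y j))"
  define q where "q = (\<lambda>s t. \<Sum>i\<in>I. x i * A t i s)"
  define q' where "q' = (\<lambda>s. \<Sum>i\<in>I. x i * H i s)"
  define f' where "f' = (\<Sum>i\<in>I. x i * (\<Sum>j\<in>J. H i j * y j))"
  have g0: "(g \<longlongrightarrow> 0) (at 0)"
  proof -
    have "(g \<longlongrightarrow> g 0) (at 0)" unfolding g_def by (intro tendsto_intros cont)
    moreover have "g 0 = 0" using y by (simp add: g_def)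
    ultimately show ?thesis by simp
  qed
  have "(q s has_real_derivative q' s) (at 0)" if "s \<in> S" for s
    unfolding q_def q'_def using S(1) that by (auto intro!: DERIV_sum DERIV_cmult deriv)
  moreover have "q s 0 = 0" if "s \<in> S" for s using x S(1) that by (auto simp: q_def)
  ultimately have q: "((\<lambda>t. q s t / t) \<longlongrightarrow> q' s) (at 0)" if "s \<in> S" for s
    using that by (auto simp: has_field_derivative_iff)
  have "(f has_real_derivative f') (at 0)"
    unfolding f_def f'_def by (intro DERIV_sum DERIV_cmult DERIV_cmult_right deriv)
  moreover have "f 0 = 0" using y by (simp add: f_def)
  ultimately have f: "((\<lambda>t. f t / t) \<longlongrightarrow> f') (at 0)" by (simp add: has_field_derivative_iff)
  have "((\<lambda>t. f t / t) \<longlongrightarrow> 0) (at 0)"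
  proof (rule Lim_null_comparison)
    show "((\<lambda>t. \<Sum>s\<in>S. 2 * g t * \<bar>q s t / t\<bar>) \<longlongrightarrow> 0) (at 0)"
    proof (rule tendsto_null_sum)
      fix s assume "s \<in> S"
      then have "((\<lambda>t. 2 * g t * \<bar>q s t / t\<bar>) \<longlongrightarrow> 2 * 0 * \<bar>q' s\<bar>) (at 0)"
        by (intro tendsto_intros g0 q)
      then show "((\<lambda>t. 2 * g t * \<bar>q s t / t\<bar>) \<longlongrightarrow> 0) (at 0)" by simp
    qed
    show "\<forall>\<^sub>F t in at 0. norm (f t / t) \<le> (\<Sum>s\<in>S. 2 * g t * \<bar>q s t / t\<bar>)"
      using L rank
    proof eventually_elim
      case (elim t)
      \<comment> \<open>Constancy of the rank is used here: the columns chosen at 0 remain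
        independent and have the right number, so they still span all columns of
        \<open>A t\<close>.\<close>
      have "\<exists>\<beta>. \<forall>i\<in>I. A t i j = (\<Sum>s\<in>S. \<beta> s * A t i s)" if "j \<in> J" for j
        using max_indep_columns_span[OF J S(1), of I "A t" j] elim S(3) that by simp
      then obtain \<beta> where \<beta>: "\<And>j i. j \<in> J \<Longrightarrow> i \<in> I \<Longrightarrow> A t i j = (\<Sum>s\<in>S. \<beta> j s * A t i s)" by metis
      define c where "c = (\<lambda>s. \<Sum>j\<in>J. \<beta> j s * y j)"
      have Ay: "(\<Sum>j\<in>J. A t i j * y j) = (\<Sum>s\<in>S. c s * A t i s)" if "i \<in> I" for i
      proof -
        have "(\<Sum>j\<in>J. A t i j * y j) = (\<Sum>j\<in>J. \<Sum>s\<in>S. \<beta> j s * A t i s * y j)"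
          using \<beta>[OF _ that] by (intro sum.cong) (auto simp: sum_distrib_right)
        also have "\<dots> = (\<Sum>s\<in>S. c s * A t i s)"
          by (subst sum.swap) (simp add: c_def sum_distrib_left sum_distrib_right mult_ac)
        finally show ?thesis .
      qed
      have "\<bar>c s\<bar> \<le> 2 * g t" if "s \<in> S" for s
        using elim that Ay by (auto simp: g_def)
      moreover have "f t = (\<Sum>s\<in>S. c s * q s t)"
        unfolding f_def q_def using Ay by (simp add: sum_distrib_left, subst sum.swap) (simp add: mult_ac)
      ultimately have "\<bar>f t / t\<bar> \<le> (\<Sum>s\<in>S. 2 * g t * \<bar>q s t / t\<bar>)"
        by (simp only: sum_divide_distrib times_divide_eq_right[symmetric] abs_mult,
            intro order_trans[OF sum_abs] sum_mono) (simp only: abs_mult, intro mult_right_mono, auto)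
      then show ?case by simp
    qed
  qed
  then have "f' = 0" using tendsto_unique[OF _ f] by simp
  then show ?thesis by (simp add: f'_def sum_distrib_left mult_ac)
qed

subsection \<open>Multi-indices and mode products\<close>

lemma idx_Nil: "idx [] = {[]}"
  by (auto simp: idx_def)

lemma idx_Cons: "idx (d # ds) = (\<lambda>(a, u). a # u) ` ({..<d} \<times> idx ds)"
proof (rule subset_antisym; rule subsetI)
  fix i assume "i \<in> idx (d # ds)"
  then obtain a u where "i = a # u" "a < d" "u \<in> idx ds"
    unfolding idx_def by (cases i) (fastforce simp: nth_Cons')+
  then show "i \<in> (\<lambda>(a, u). a # u) ` ({..<d} \<times> idx ds)" by auto
qed (auto simp: idx_def nth_Cons')

lemma Cons_in_idx: "a # u \<in> idx (d # ds) \<longleftrightarrow> a < d \<and> u \<in> idx ds"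
  by (auto simp: idx_Cons)

lemma finite_idx [simp]: "finite (idx ds)"
  by (induction ds) (auto simp: idx_Nil idx_Cons)

lemma length_idx: "i \<in> idx ds \<Longrightarrow> length i = length ds"
  by (simp add: idx_def)

lemma nth_idx: "i \<in> idx ds \<Longrightarrow> j < length ds \<Longrightarrow> i ! j < ds ! j"
  by (simp add: idx_def)

lemma sum_idx_Cons: "(\<Sum>i\<in>idx (d # ds). f i) = (\<Sum>a<d. \<Sum>u\<in>idx ds. f (a # u))"
  unfolding idx_Cons sum.cartesian_product
  by (subst sum.reindex) (auto simp: inj_on_def intro!: sum.cong)

lemma sum_prod_idx:
  fixes f :: "nat \<Rightarrow> nat \<Rightarrow> 'a :: comm_semiring_1"
  shows "(\<Sum>i\<in>idx ds. \<Prod>k<length ds. f k (i ! k)) = (\<Prod>k<length ds. \<Sum>a<ds ! k. f k a)"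
proof (induction ds arbitrary: f)
  case Nil
  then show ?case by (simp add: idx_Nil)
next
  case (Cons d ds)
  have "(\<Sum>i\<in>idx (d # ds). \<Prod>k<length (d # ds). f k (i ! k))
      = (\<Sum>a<d. f 0 a * (\<Sum>u\<in>idx ds. \<Prod>k<length ds. f (Suc k) (u ! k)))"
    by (simp add: sum_idx_Cons prod.lessThan_Suc_shift sum_distrib_left del: prod.lessThan_Suc)
  also have "\<dots> = (\<Prod>k<length (d # ds). \<Sum>a<(d # ds) ! k. f k a)"
    unfolding Cons.IH[of "\<lambda>k. f (Suc k)"]
    by (simp add: prod.lessThan_Suc_shift sum_distrib_right del: prod.lessThan_Suc)
  finally show ?case .
qed

lemma card_idx: "card (idx ds) = prod_list ds"
proof (induction ds)
  case (Cons d ds)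
  have "card (idx (d # ds)) = card ({..<d} \<times> idx ds)"
    unfolding idx_Cons by (rule card_image) (auto simp: inj_on_def)
  then show ?case using Cons by (simp add: card_cartesian_product)
qed (simp add: idx_Nil)

lemma prod_list_nth: "prod_list ds = (\<Prod>k<length ds. ds ! k)"
  by (induction ds) (simp_all add: prod.lessThan_Suc_shift del: prod.lessThan_Suc)

section \<open>Splitting one mode off a multi-index\<close>

definition ins :: "nat \<Rightarrow> nat \<Rightarrow> nat list \<Rightarrow> nat list" where
  "ins j a u = take j u @ a # drop j u"

text \<open>The mode of the full tensor that sits at position \<open>k\<close> once mode
  \<open>j\<close> has been removed.\<close>

definition shift :: "nat \<Rightarrow> nat \<Rightarrow> nat" where
  "shift j k = (if k < j then k else Suc k)"

lemma unfold_mode_ins: "unfold_mode j H a u = H (ins j a u)"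
  by (simp add: unfold_mode_def ins_def)

lemma length_skip: "j < length ds \<Longrightarrow> length (skip_mode j ds) = length ds - 1"
  by (simp add: skip_mode_def)

lemma nth_skip: "j < length ds \<Longrightarrow> k < length ds - 1 \<Longrightarrow> skip_mode j ds ! k = ds ! shift j k"
  by (auto simp: skip_mode_def shift_def nth_append min_def)

lemma nth_ins_same: "j \<le> length u \<Longrightarrow> ins j a u ! j = a"
  by (simp add: ins_def nth_append)

lemma nth_ins_shift: "j \<le> length u \<Longrightarrow> k < length u \<Longrightarrow> ins j a u ! shift j k = u ! k"
  by (auto simp: ins_def shift_def nth_append nth_Cons' min_def)

lemma skip_ins: "j \<le> length u \<Longrightarrow> skip_mode j (ins j a u) = u"
  by (simp add: skip_mode_def ins_def)

lemma ins_skip: "j < length i \<Longrightarrow> ins j (i ! j) (skip_mode j i) = i"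
  by (simp add: skip_mode_def ins_def min_def id_take_nth_drop[symmetric])

lemma shift_less: "j < n \<Longrightarrow> k < n - 1 \<Longrightarrow> shift j k < n"
  by (auto simp: shift_def)

lemma shift_bij: "j < n \<Longrightarrow> bij_betw (shift j) {..<n - 1} ({..<n} - {j})"
proof (intro bij_betwI[where g = "\<lambda>k. if k < j then k else k - 1"])
qed (auto simp: shift_def split: if_splits)

lemma prod_shift:
  fixes f :: "nat \<Rightarrow> 'a :: comm_monoid_mult"
  assumes "j < n"
  shows "(\<Prod>k<n. f k) = f j * (\<Prod>k<n - 1. f (shift j k))"
proof -
  have "(\<Prod>k<n. f k) = f j * (\<Prod>k\<in>{..<n} - {j}. f k)"
    using assms by (subst prod.remove) auto
  also have "(\<Prod>k\<in>{..<n} - {j}. f k) = (\<Prod>k<n - 1. f (shift j k))"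
    using prod.reindex_bij_betw[OF shift_bij[OF assms]] by metis
  finally show ?thesis .
qed

lemma ins_in_idx:
  assumes "j < length ds" "a < ds ! j" "u \<in> idx (skip_mode j ds)"
  shows "ins j a u \<in> idx ds"
  unfolding idx_def
proof (intro CollectI conjI allI impI)
  have len: "length u = length ds - 1" using assms length_idx length_skip by metis
  then show "length (ins j a u) = length ds" using assms by (auto simp: ins_def)
  fix k assume k: "k < length ds"
  show "ins j a u ! k < ds ! k"
  proof (cases "k = j")
    case True
    then show ?thesis using assms nth_ins_same[of j u a] len by auto
  next
    case False
    then have "k \<in> shift j ` {..<length ds - 1}"
      using shift_bij[OF assms(1)] k by (auto simp: bij_betw_def)
    then obtain k' where k': "k = shift j k'" "k' < length ds - 1" by auto
    then show ?thesis
      using nth_ins_shift[of j u k' a] nth_idx[OF assms(3), of k'] nth_skip[OF assms(1), of k'] len assms(1)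
      by (auto simp: length_skip)
  qed
qed

lemma skip_in_idx:
  assumes "j < length ds" "i \<in> idx ds"
  shows "skip_mode j i \<in> idx (skip_mode j ds)"
  using assms length_skip[of j i] nth_skip[of j i] nth_skip[OF assms(1)] shift_less[OF assms(1)]
  by (auto simp: idx_def length_skip)

lemma sum_unfold:
  assumes j: "j < length ds"
  shows "(\<Sum>i\<in>idx ds. f i) = (\<Sum>a<ds ! j. \<Sum>u\<in>idx (skip_mode j ds). f (ins j a u))"
proof -
  have "bij_betw (\<lambda>(a, u). ins j a u) ({..<ds ! j} \<times> idx (skip_mode j ds)) (idx ds)"
  proof (intro bij_betwI[where g = "\<lambda>i. (i ! j, skip_mode j i)"])
    show "(\<lambda>(a, u). ins j a u) \<in> {..<ds ! j} \<times> idx (skip_mode j ds) \<rightarrow> idx ds"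
      using ins_in_idx[OF j] by auto
    show "(\<lambda>i. (i ! j, skip_mode j i)) \<in> idx ds \<rightarrow> {..<ds ! j} \<times> idx (skip_mode j ds)"
      using skip_in_idx[OF j] nth_idx j by auto
    show "(\<lambda>i. (i ! j, skip_mode j i)) ((\<lambda>(a, u). ins j a u) x) = x"
      if xin: "x \<in> {..<ds ! j} \<times> idx (skip_mode j ds)" for x
    proof -
      obtain a u where x: "x = (a, u)" "u \<in> idx (skip_mode j ds)" using xin by (cases x) auto
      then have "j \<le> length u" using length_idx[of u] length_skip[OF j] j by auto
      then show ?thesis using x by (simp add: nth_ins_same skip_ins)
    qed
    show "(\<lambda>(a, u). ins j a u) (i ! j, skip_mode j i) = i" if "i \<in> idx ds" for i
      using ins_skip[of j i] length_idx[OF that] j by simp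
  qed
  from sum.reindex_bij_betw[OF this, of f] show ?thesis
    by (simp add: sum.cartesian_product case_prod_unfold)
qed

section \<open>Mode products as sums against Kronecker-product kernels\<close>

definition kern :: "nat \<Rightarrow> (nat \<Rightarrow> nat \<Rightarrow> nat \<Rightarrow> real) \<Rightarrow> nat list \<Rightarrow> nat list \<Rightarrow> real" where
  "kern n A i l = (\<Prod>k<n. A k (i ! k) (l ! k))"

lemma mode_product_eq:
  "mode_product ds rs C A i = (if i \<in> idx ds then \<Sum>l\<in>idx rs. kern (length ds) A i l * C l else 0)"
  by (simp add: mode_product_def kern_def mult_ac)

lemma mode_product_in: "i \<in> idx ds \<Longrightarrow> mode_product ds rs C A i = (\<Sum>l\<in>idx rs. kern (length ds) A i l * C l)"
  by (simp add: mode_product_eq)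

lemma mode_product_tensors: "mode_product ds rs C A \<in> tensors ds"
  by (simp add: tensors_def mode_product_def)

lemma tensors_eqI:
  assumes "G \<in> tensors ds" "H \<in> tensors ds" "\<And>i. i \<in> idx ds \<Longrightarrow> G i = H i"
  shows "G = H"
proof
  fix i show "G i = H i" using assms by (cases "i \<in> idx ds") (auto simp: tensors_def)
qed

definition mmul :: "nat list \<Rightarrow> (nat \<Rightarrow> nat \<Rightarrow> nat \<Rightarrow> real) \<Rightarrow> (nat \<Rightarrow> nat \<Rightarrow> nat \<Rightarrow> real) \<Rightarrow> nat \<Rightarrow> nat \<Rightarrow> nat \<Rightarrow> real" where
  "mmul es A B = (\<lambda>k a b. \<Sum>c<es ! k. A k a c * B k c b)"

definition idm :: "nat \<Rightarrow> nat \<Rightarrow> real" where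
  "idm a b = (if a = b then 1 else 0)"

lemma kern_comp:
  assumes "length es = n"
  shows "(\<Sum>l\<in>idx es. kern n A i l * kern n B l q) = kern n (mmul es A B) i q"
proof -
  have "(\<Sum>l\<in>idx es. kern n A i l * kern n B l q) = (\<Sum>l\<in>idx es. \<Prod>k<length es. A k (i ! k) (l ! k) * B k (l ! k) (q ! k))"
    by (simp add: kern_def prod.distrib assms)
  also have "\<dots> = (\<Prod>k<length es. \<Sum>c<es ! k. A k (i ! k) c * B k c (q ! k))"
    by (rule sum_prod_idx[of "\<lambda>k c. A k (i ! k) c * B k c (q ! k)" es])
  finally show ?thesis by (simp add: kern_def mmul_def assms)
qed

lemma mode_product_comp:
  assumes "length es = length ds"
  shows "mode_product ds es (mode_product es rs C B) A = mode_product ds rs C (mmul es A B)"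
proof (rule tensors_eqI[OF mode_product_tensors mode_product_tensors])
  fix i assume i: "i \<in> idx ds"
  have "mode_product ds es (mode_product es rs C B) A i
      = (\<Sum>l\<in>idx es. \<Sum>q\<in>idx rs. kern (length ds) A i l * kern (length ds) B l q * C q)"
    by (simp add: mode_product_in i assms sum_distrib_left mult_ac)
  also have "\<dots> = (\<Sum>q\<in>idx rs. (\<Sum>l\<in>idx es. kern (length ds) A i l * kern (length ds) B l q) * C q)"
    by (subst sum.swap) (simp add: sum_distrib_right)
  also have "\<dots> = mode_product ds rs C (mmul es A B) i"
    by (simp add: kern_comp assms mode_product_in i)
  finally show "mode_product ds es (mode_product es rs C B) A i = mode_product ds rs C (mmul es A B) i" .
qed

lemma kern_cong:
  assumes "\<And>k. k < n \<Longrightarrow> A k (i ! k) (l ! k) = B k (i ! k) (l ! k)"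
  shows "kern n A i l = kern n B i l"
  unfolding kern_def using assms by (intro prod.cong) auto

lemma mode_product_cong:
  assumes "length rs = length ds"
    and "\<And>k a b. k < length ds \<Longrightarrow> a < ds ! k \<Longrightarrow> b < rs ! k \<Longrightarrow> A k a b = B k a b"
    and "\<And>l. l \<in> idx rs \<Longrightarrow> C l = C' l"
  shows "mode_product ds rs C A = mode_product ds rs C' B"
proof (rule tensors_eqI[OF mode_product_tensors mode_product_tensors])
  fix i assume i: "i \<in> idx ds"
  have "kern (length ds) A i l = kern (length ds) B i l" if "l \<in> idx rs" for l
    using assms i that nth_idx[OF i] nth_idx[OF that] by (intro kern_cong) auto
  then show "mode_product ds rs C A i = mode_product ds rs C' B i"
    using assms(3) by (simp add: mode_product_in i)
qed

lemma kern_idm: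
  assumes "length i = n" "length l = n"
  shows "kern n (\<lambda>_. idm) i l = (if i = l then 1 else 0)"
proof (cases "i = l")
  case False
  then obtain k where "k < n" "i ! k \<noteq> l ! k" using assms nth_equalityI by metis
  then have "kern n (\<lambda>_. idm) i l = 0" unfolding kern_def by (intro prod_zero) (auto simp: idm_def)
  then show ?thesis using False by simp
qed (simp add: kern_def idm_def)

lemma mode_product_idm:
  assumes "H \<in> tensors ds"
  shows "mode_product ds ds H (\<lambda>_. idm) = H"
proof (rule tensors_eqI[OF mode_product_tensors assms])
  fix i assume i: "i \<in> idx ds"
  then have "mode_product ds ds H (\<lambda>_. idm) i = (\<Sum>l\<in>idx ds. (if i = l then 1 else 0) * H l)"
    by (simp add: mode_product_in kern_idm length_idx cong: sum.cong)
  then show "mode_product ds ds H (\<lambda>_. idm) i = H i"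
    using i by (simp add: if_distrib[of "\<lambda>x. x * _"] cong: if_cong)
qed

lemma mode_product_sum:
  "mode_product ds rs (\<lambda>l. \<Sum>s\<in>S. x s * C s l) A i = (\<Sum>s\<in>S. x s * mode_product ds rs (C s) A i)"
  by (simp add: mode_product_eq sum_distrib_left, subst sum.swap) (simp add: mult_ac)

lemma kern_upd:
  assumes "j < n"
  shows "kern n (A(j := X)) i l = X (i ! j) (l ! j) * (\<Prod>k\<in>{..<n} - {j}. A k (i ! k) (l ! k))"
  unfolding kern_def using assms by (subst prod.remove[of _ j]) (auto intro!: prod.cong)

lemma mode_product_slot_lincomb:
  assumes "j < length ds"
  shows "mode_product ds rs C (A(j := (\<lambda>a b. x * X a b + y * Y a b))) i
    = x * mode_product ds rs C (A(j := X)) i + y * mode_product ds rs C (A(j := Y)) i"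
  using assms
  by (simp add: mode_product_eq kern_upd sum_distrib_left sum.distrib[symmetric])
     (auto intro!: sum.cong simp: algebra_simps)

lemma mode_product_slot_diff:
  assumes "j < length ds"
  shows "mode_product ds rs C (A(j := (\<lambda>a b. X a b - Y a b))) i
    = mode_product ds rs C (A(j := X)) i - mode_product ds rs C (A(j := Y)) i"
  using mode_product_slot_lincomb[OF assms, of rs C A 1 X "-1" Y i] by simp

lemma tinner_adjoint:
  assumes "length rs = length ds"
  shows "tinner ds (mode_product ds rs C A) G = tinner rs C (mode_product rs ds G (\<lambda>k a b. A k b a))"
proof -
  have "tinner ds (mode_product ds rs C A) G = (\<Sum>i\<in>idx ds. \<Sum>l\<in>idx rs. kern (length ds) A i l * C l * G i)"
    by (simp add: tinner_def mode_product_in sum_distrib_right)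
  also have "\<dots> = (\<Sum>l\<in>idx rs. \<Sum>i\<in>idx ds. C l * (kern (length ds) (\<lambda>k a b. A k b a) l i * G i))"
    by (subst sum.swap) (simp add: kern_def mult_ac)
  finally show ?thesis by (simp add: tinner_def mode_product_in sum_distrib_left assms)
qed

text \<open>In matrix form: \<open>A j\<close> times the unfolding of \<open>C\<close> times the
  transposed Kronecker product of the other factors. Facts about unfoldings thereby reduce to mode
  products with one mode fewer.\<close>

lemma mode_product_unfold:
  assumes j: "j < length ds" and len: "length rs = length ds" and a: "a < ds ! j"
    and u: "u \<in> idx (skip_mode j ds)"
  shows "mode_product ds rs C A (ins j a u) = (\<Sum>b<rs ! j. A j a b *
    mode_product (skip_mode j ds) (skip_mode j rs) (unfold_mode j C b) (\<lambda>k. A (shift j k)) u)"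
proof -
  let ?n = "length ds"
  have lu: "length u = ?n - 1" using length_idx[OF u] length_skip[OF j] by simp
  have k: "kern ?n A (ins j a u) (ins j b v) = A j a b * kern (?n - 1) (\<lambda>k. A (shift j k)) u v"
    if "v \<in> idx (skip_mode j rs)" for b v
  proof -
    have lv: "length v = ?n - 1" using length_idx[OF that] length_skip[of j rs] j len by simp
    have "kern ?n A (ins j a u) (ins j b v) = A j (ins j a u ! j) (ins j b v ! j) *
      (\<Prod>k<?n - 1. A (shift j k) (ins j a u ! shift j k) (ins j b v ! shift j k))"
      unfolding kern_def by (rule prod_shift[OF j])
    also have "(\<Prod>k<?n - 1. A (shift j k) (ins j a u ! shift j k) (ins j b v ! shift j k))
        = kern (?n - 1) (\<lambda>k. A (shift j k)) u v"
      unfolding kern_def using j lu lv by (intro prod.cong refl) (simp add: nth_ins_shift)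
    finally show ?thesis using j lu lv by (simp add: nth_ins_same)
  qed
  have "mode_product ds rs C A (ins j a u)
      = (\<Sum>b<rs ! j. \<Sum>v\<in>idx (skip_mode j rs). kern ?n A (ins j a u) (ins j b v) * C (ins j b v))"
    using ins_in_idx[OF j a u] sum_unfold[of j rs] j len by (simp add: mode_product_in)
  also have "\<dots> = (\<Sum>b<rs ! j. A j a b *
    mode_product (skip_mode j ds) (skip_mode j rs) (unfold_mode j C b) (\<lambda>k. A (shift j k)) u)"
    using u j k by (simp add: mode_product_in length_skip unfold_mode_ins sum_distrib_left mult_ac cong: sum.cong)
  finally show ?thesis .
qed

lemma mode_product_isometry:
  assumes len: "length rs = length ds"
    and U: "\<And>k. k < length ds \<Longrightarrow> orthonormal_cols (ds ! k) (rs ! k) (U k)"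
    and C: "C \<in> tensors rs"
  shows "(\<Sum>i\<in>idx ds. (mode_product ds rs C U i)\<^sup>2) = (\<Sum>l\<in>idx rs. (C l)\<^sup>2)"
proof -
  have "mode_product rs ds (mode_product ds rs C U) (\<lambda>k a b. U k b a)
      = mode_product rs rs C (mmul ds (\<lambda>k a b. U k b a) U)"
    by (rule mode_product_comp) (simp add: len)
  also have "\<dots> = mode_product rs rs C (\<lambda>_. idm)"
    using U by (intro mode_product_cong) (auto simp: mmul_def idm_def orthonormal_cols_def len)
  also have "\<dots> = C" by (rule mode_product_idm[OF C])
  finally have "tinner ds (mode_product ds rs C U) (mode_product ds rs C U) = tinner rs C C"
    using tinner_adjoint[OF len, of C U] by simp
  then show ?thesis by (simp add: tinner_def power2_eq_square)
qed

lemma zero_sum_mode_product: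
  assumes ds: "ds \<noteq> []" and len: "length rs = length ds"
    and A: "\<And>b. b < rs ! 0 \<Longrightarrow> (\<Sum>a<ds ! 0. A 0 a b) = 0"
  shows "zero_sum ds (mode_product ds rs C A)"
  unfolding zero_sum_def
proof
  fix u assume u: "u \<in> idx (tl ds)"
  have tl: "skip_mode 0 ds = tl ds" by (simp add: skip_mode_def drop_Suc)
  let ?g = "\<lambda>b. mode_product (skip_mode 0 ds) (skip_mode 0 rs) (unfold_mode 0 C b) (\<lambda>k. A (shift 0 k)) u"
  have "(\<Sum>a<hd ds. mode_product ds rs C A (a # u)) = (\<Sum>a<ds ! 0. \<Sum>b<rs ! 0. A 0 a b * ?g b)"
    using mode_product_unfold[of 0 ds rs _ u C A] ds len u tl
    by (auto simp: ins_def hd_conv_nth intro!: sum.cong)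
  also have "\<dots> = (\<Sum>b<rs ! 0. (\<Sum>a<ds ! 0. A 0 a b) * ?g b)"
    by (subst sum.swap) (simp add: sum_distrib_right)
  finally show "(\<Sum>a<hd ds. mode_product ds rs C A (a # u)) = 0" using A by simp
qed

section \<open>Norms of kernels of product form\<close>

lemma L2_set_squared: "(L2_set f A)\<^sup>2 = (\<Sum>i\<in>A. (f i)\<^sup>2)"
  by (simp add: L2_set_def sum_nonneg)

lemma L2_set_kern:
  "L2_set (kern (length ds) A i) (idx ds) = (\<Prod>k<length ds. L2_set (A k (i ! k)) {..<ds ! k})"
proof -
  have sq: "sqrt (\<Prod>k\<in>B. f k) = (\<Prod>k\<in>B. sqrt (f k))" for B :: "nat set" and f
    by (induction B rule: infinite_finite_induct) (auto simp: real_sqrt_mult)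
  show ?thesis
    by (simp add: L2_set_def kern_def sq[symmetric] prod_power_distrib sum_prod_idx[of "\<lambda>k l. (A k (i ! k) l)\<^sup>2" ds, symmetric])
qed

lemma l1_kern:
  "(\<Sum>l\<in>idx ds. \<bar>kern (length ds) A i l\<bar>) = (\<Prod>k<length ds. \<Sum>b<ds ! k. \<bar>A k (i ! k) b\<bar>)"
  by (simp add: kern_def abs_prod sum_prod_idx[of "\<lambda>k l. \<bar>A k (i ! k) l\<bar>" ds, symmetric])

lemma L2_set_outer:
  assumes j: "j < length ds"
  shows "L2_set (\<lambda>i. x (i ! j) * y (skip_mode j i)) (idx ds) = L2_set x {..<ds ! j} * L2_set y (idx (skip_mode j ds))"
proof -
  have "(\<Sum>i\<in>idx ds. (x (i ! j) * y (skip_mode j i))\<^sup>2)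
      = (\<Sum>a<ds ! j. \<Sum>u\<in>idx (skip_mode j ds). (x a)\<^sup>2 * (y u)\<^sup>2)"
    unfolding sum_unfold[OF j] using j length_idx[of _ "skip_mode j ds"] length_skip[OF j]
    by (auto intro!: sum.cong simp: nth_ins_same skip_ins power_mult_distrib)
  then show ?thesis
    by (simp add: L2_set_def real_sqrt_mult[symmetric] sum_product)
qed

lemma l1_outer:
  fixes x :: "nat \<Rightarrow> real" and y :: "nat list \<Rightarrow> real"
  assumes j: "j < length ds"
  shows "(\<Sum>i\<in>idx ds. \<bar>x (i ! j) * y (skip_mode j i)\<bar>) = (\<Sum>a<ds ! j. \<bar>x a\<bar>) * (\<Sum>u\<in>idx (skip_mode j ds). \<bar>y u\<bar>)"
proof -
  have "(\<Sum>i\<in>idx ds. \<bar>x (i ! j) * y (skip_mode j i)\<bar>)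
      = (\<Sum>a<ds ! j. \<Sum>u\<in>idx (skip_mode j ds). \<bar>x a\<bar> * \<bar>y u\<bar>)"
    unfolding sum_unfold[OF j] using j length_idx[of _ "skip_mode j ds"] length_skip[OF j]
    by (auto intro!: sum.cong simp: nth_ins_same skip_ins abs_mult)
  then show ?thesis by (simp add: sum_product)
qed

subsection \<open>Tangent spaces of the Tucker manifold\<close>

abbreviation one :: "nat \<Rightarrow> (nat \<Rightarrow> nat \<Rightarrow> real) \<Rightarrow> nat \<Rightarrow> nat \<Rightarrow> nat \<Rightarrow> real" where
  "one j X \<equiv> (\<lambda>_. idm)(j := X)"

lemma mode_product_idm_in: "i \<in> idx ds \<Longrightarrow> mode_product ds ds H (\<lambda>_. idm) i = H i"
  by (simp add: mode_product_in kern_idm length_idx if_distrib[of "\<lambda>x. x * _"] cong: sum.cong if_cong)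

lemma idm_mult_left: "(\<Sum>c<n. idm a c * f c) = (if a < n then f a else 0)" for n :: nat
  by (simp add: idm_def if_distrib[of "\<lambda>x. x * _"] cong: if_cong)

lemma idm_mult_right: "(\<Sum>c<n. f c * idm c a) = (if a < n then f a else 0)" for n :: nat
  by (simp add: idm_def if_distrib[of "\<lambda>x. _ * x"] cong: if_cong)

lemma mode_product_one:
  assumes j: "j < length ds" and a: "a < ds ! j" and u: "u \<in> idx (skip_mode j ds)"
  shows "mode_product ds ds H (one j X) (ins j a u) = (\<Sum>b<ds ! j. X a b * H (ins j b u))"
proof -
  have "(\<lambda>k. (one j X) (shift j k)) = (\<lambda>_. idm)" by (auto simp: shift_def fun_eq_iff)
  then show ?thesis
    using mode_product_unfold[OF j refl a u, of H "one j X"]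
    by (simp add: mode_product_idm_in[OF u] unfold_mode_ins)
qed

lemma mode_product_one_comp:
  assumes "j < length ds"
  shows "mode_product ds ds (mode_product ds ds H (one j Y)) (one j X)
    = mode_product ds ds H (one j (\<lambda>a b. \<Sum>c<ds ! j. X a c * Y c b))"
  unfolding mode_product_comp[OF refl]
  by (rule mode_product_cong) (auto simp: mmul_def idm_mult_left)

lemma mode_product_one_commute:
  assumes "j \<noteq> k"
  shows "mode_product ds ds (mode_product ds ds H (one j X)) (one k Y)
    = mode_product ds ds (mode_product ds ds H (one k Y)) (one j X)"
  unfolding mode_product_comp[OF refl]
  by (rule mode_product_cong) (use assms in \<open>auto simp: mmul_def idm_mult_left idm_mult_right\<close>)

lemma ins_exhaust:
  assumes "j < length ds" "i \<in> idx ds"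
  obtains a u where "i = ins j a u" "a < ds ! j" "u \<in> idx (skip_mode j ds)"
proof (rule that)
  show "i = ins j (i ! j) (skip_mode j i)" using ins_skip[of j i] assms length_idx by simp
qed (use assms nth_idx skip_in_idx in auto)

lemma col_proj_mult:
  assumes "orthonormal_cols d p U" "b < p"
  shows "(\<Sum>c<d. col_proj p U a c * U c b) = U a b"
proof -
  have "(\<Sum>c<d. col_proj p U a c * U c b) = (\<Sum>l<p. U a l * (\<Sum>c<d. U c l * U c b))"
    by (simp add: col_proj_def sum_distrib_right, subst sum.swap) (simp add: sum_distrib_left mult_ac)
  also have "\<dots> = (\<Sum>l<p. U a l * idm l b)"
    using assms by (intro sum.cong) (auto simp: orthonormal_cols_def idm_def)
  finally show ?thesis using assms by (simp add: idm_mult_right)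
qed

text \<open>\<open>U0\<close> is the form in which the zero-sum constraint enters. It makes
  \<open>P 0\<close> annihilate constant vectors, so that the constraint changes the projector only
  through \<open>Q 0\<close>. For the truth and for the estimate it is derived in
  \<open>zero_sum_factor\<close>.\<close>

locale tucker =
  fixes ds r :: "nat list" and C :: tensor and U :: "nat \<Rightarrow> nat \<Rightarrow> nat \<Rightarrow> real" and T :: tensor
  assumes len: "length r = length ds" and ds_ne: "ds \<noteq> []" and d0: "ds ! 0 \<ge> 1"
    and C: "C \<in> tensors r"
    and U: "\<And>k. k < length ds \<Longrightarrow> orthonormal_cols (ds ! k) (r ! k) (U k)"
    and T_def: "T = mode_product ds r C U"
    and T_manifold: "T \<in> tucker_manifold ds r"
    and U0: "\<And>b. b < r ! 0 \<Longrightarrow> (\<Sum>a<ds ! 0. U 0 a b) = 0"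
begin

abbreviation "m \<equiv> length ds"

definition P :: "nat \<Rightarrow> nat \<Rightarrow> nat \<Rightarrow> real" where "P k = col_proj (r ! k) (U k)"

definition V :: "nat \<Rightarrow> nat list \<Rightarrow> nat list \<Rightarrow> real" where
  "V j = (SOME V. span_proj (idx (skip_mode j ds)) {..<ds ! j} (unfold_mode j T) V)"

definition Q :: "nat \<Rightarrow> nat \<Rightarrow> nat \<Rightarrow> real" where
  "Q j a b = idm a b - P j a b - (if j = 0 then 1 / real (ds ! 0) else 0)"

text \<open>On tensors, \<open>V j\<close> projects the mode-\<open>j\<close> rows onto the row space of the unfolding of \<open>T\<close>. The
  projector onto the tangent space of the Tucker manifold is the tensor product of the \<open>P k\<close> plus the
  sum over \<open>j\<close> of \<open>(I - P j) \<otimes> V j\<close>; the term \<open>1 / d_1\<close> in \<open>Q 0\<close> enforces the zero-sum constraint.\<close>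

definition Ker :: "nat list \<Rightarrow> nat list \<Rightarrow> real" where
  "Ker i i' = kern m P i i' + (\<Sum>j<m. Q j (i ! j) (i' ! j) * V j (skip_mode j i) (skip_mode j i'))"

definition PT :: "tensor \<Rightarrow> tensor" where
  "PT G i = (if i \<in> idx ds then \<Sum>i'\<in>idx ds. Ker i i' * G i' else 0)"

text \<open>In the mode-\<open>j\<close> unfolding, right multiplication of \<open>H\<close> by
  \<open>V j\<close>.\<close>

definition R :: "nat \<Rightarrow> tensor \<Rightarrow> tensor" where
  "R j H i = (if i \<in> idx ds then \<Sum>u\<in>idx (skip_mode j ds). V j (skip_mode j i) u * H (ins j (i ! j) u) else 0)"

lemma m0: "0 < m" using ds_ne by simp

lemma V_span: "span_proj (idx (skip_mode j ds)) {..<ds ! j} (unfold_mode j T) (V j)"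
  unfolding V_def using someI_ex[OF span_proj_exists[OF finite_idx finite_lessThan]] by metis

lemma V_proj: "is_proj (idx (skip_mode j ds)) (V j)"
  using V_span unfolding span_proj_def by blast

lemma V_sym: "u \<in> idx (skip_mode j ds) \<Longrightarrow> u' \<in> idx (skip_mode j ds) \<Longrightarrow> V j u u' = V j u' u"
  using V_proj unfolding is_proj_def by blast

lemma V_T:
  assumes "a < ds ! j" "u \<in> idx (skip_mode j ds)"
  shows "(\<Sum>u'\<in>idx (skip_mode j ds). V j u u' * T (ins j a u')) = T (ins j a u)"
  using V_span[of j] assms by (auto simp: span_proj_def apply_kernel_def unfold_mode_ins)

lemma V_coeff:
  obtains n where "\<And>u u'. u \<in> idx (skip_mode j ds) \<Longrightarrow> u' \<in> idx (skip_mode j ds) \<Longrightarrow>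
    V j u u' = (\<Sum>b<ds ! j. n b u * T (ins j b u'))"
  using V_span[of j] by (auto simp: span_proj_def unfold_mode_ins)

lemma P_sym: "P k a b = P k b a"
  by (simp add: P_def col_proj_def mult_ac)

lemma PU:
  assumes "k < m" "b < r ! k"
  shows "(\<Sum>c<ds ! k. P k a c * U k c b) = U k a b"
  unfolding P_def using col_proj_mult[OF U[OF assms(1)] assms(2)] .

lemma P_idem:
  assumes "k < m"
  shows "(\<Sum>c<ds ! k. P k a c * P k c b) = P k a b"
proof -
  have "(\<Sum>c<ds ! k. P k a c * P k c b) = (\<Sum>l<r ! k. (\<Sum>c<ds ! k. P k a c * U k c l) * U k b l)"
    by (simp add: P_def[of k] col_proj_def sum_distrib_left sum_distrib_right, subst sum.swap) (simp add: mult_ac)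
  also have "\<dots> = (\<Sum>l<r ! k. U k a l * U k b l)" by (rule sum.cong) (simp_all add: PU[OF assms])
  finally show ?thesis by (simp add: P_def col_proj_def)
qed

lemma P_T: "mode_product ds ds T P = T"
  unfolding T_def mode_product_comp[OF refl]
  by (rule mode_product_cong) (auto simp: mmul_def PU len)

lemma P_one_T:
  assumes "k < m" shows "mode_product ds ds T (one k (P k)) = T"
  unfolding T_def mode_product_comp[OF refl]
  by (rule mode_product_cong) (auto simp: mmul_def PU len idm_mult_left)

lemma P0_colsum: "(\<Sum>a<ds ! 0. P 0 a b) = 0"
proof -
  have "(\<Sum>a<ds ! 0. P 0 a b) = (\<Sum>l<r ! 0. (\<Sum>a<ds ! 0. U 0 a l) * U 0 b l)"
    by (simp add: P_def col_proj_def, subst sum.swap) (simp add: sum_distrib_right)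
  then show ?thesis using U0 by simp
qed

lemma Q0_colsum: "b < ds ! 0 \<Longrightarrow> (\<Sum>a<ds ! 0. Q 0 a b) = 0"
  using P0_colsum[of b] d0 by (simp add: Q_def sum_subtractf idm_def)

text \<open>The rows of \<open>V j\<close> are combinations of rows of the unfolding of
  \<open>T\<close>, so projecting the rows of \<open>H\<close> onto the row space gives some matrix
  \<open>X\<close> times that unfolding. This exhibits the row-space part of the projector as a
  motion of \<open>T\<close> in mode \<open>j\<close>.\<close>

lemma R_eq: 
  assumes "j < m"
  shows "\<exists>X. R j H = mode_product ds ds T (one j X)"
proof -
  obtain n where n: "\<And>u u'. u \<in> idx (skip_mode j ds) \<Longrightarrow> u' \<in> idx (skip_mode j ds) \<Longrightarrow>
    V j u u' = (\<Sum>b<ds ! j. n b u * T (ins j b u'))" using V_coeff[of j] by blast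
  define X where "X = (\<lambda>a b. \<Sum>u\<in>idx (skip_mode j ds). n b u * H (ins j a u))"
  have "R j H = mode_product ds ds T (one j X)"
  proof (rule tensors_eqI[OF _ mode_product_tensors])
    show "R j H \<in> tensors ds" by (simp add: tensors_def R_def)
    fix i assume i: "i \<in> idx ds"
    then obtain a u where au: "i = ins j a u" "a < ds ! j" "u \<in> idx (skip_mode j ds)"
      using ins_exhaust[OF assms] by metis
    then have "i ! j = a" "skip_mode j i = u"
      using length_idx[of u] length_skip[OF assms] assms by (auto simp: nth_ins_same skip_ins)
    then have "R j H i = (\<Sum>u'\<in>idx (skip_mode j ds). \<Sum>b<ds ! j. n b u' * T (ins j b u) * H (ins j a u'))"
      using i au n by (auto simp: R_def V_sym[of u] sum_distrib_right intro!: sum.cong)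
    also have "\<dots> = (\<Sum>b<ds ! j. X a b * T (ins j b u))"
      by (subst sum.swap) (simp add: X_def sum_distrib_left sum_distrib_right mult_ac)
    also have "\<dots> = mode_product ds ds T (one j X) i"
      using au mode_product_one[OF assms] by simp
    finally show "R j H i = mode_product ds ds T (one j X) i" .
  qed
  then show ?thesis by blast
qed

lemma Q_V_eq:
  assumes j: "j < m" and i: "i \<in> idx ds"
  shows "(\<Sum>i'\<in>idx ds. Q j (i ! j) (i' ! j) * V j (skip_mode j i) (skip_mode j i') * G i')
    = mode_product ds ds (R j G) (one j (Q j)) i"
proof -
  obtain a u where au: "i = ins j a u" "a < ds ! j" "u \<in> idx (skip_mode j ds)"
    using ins_exhaust[OF j i] by metis
  have *: "ins j b v ! j = b \<and> skip_mode j (ins j b v) = v" if "v \<in> idx (skip_mode j ds)" for b v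
    using length_idx[OF that] length_skip[OF j] j by (auto simp: nth_ins_same skip_ins)
  have "R j G (ins j b u) = (\<Sum>v\<in>idx (skip_mode j ds). V j u v * G (ins j b v))" if "b < ds ! j" for b
    using ins_in_idx[OF j that au(3)] * au by (simp add: R_def)
  then show ?thesis
    unfolding sum_unfold[OF j] using au * by (simp add: mode_product_one[OF j] sum_distrib_left mult_ac)
qed

lemma PT_eq:
  "PT G i = mode_product ds ds G P i + (\<Sum>j<m. mode_product ds ds (R j G) (one j (Q j)) i)"
proof (cases "i \<in> idx ds")
  case True
  have "PT G i = (\<Sum>i'\<in>idx ds. kern m P i i' * G i')
    + (\<Sum>i'\<in>idx ds. \<Sum>j<m. Q j (i ! j) (i' ! j) * V j (skip_mode j i) (skip_mode j i') * G i')"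
    using True by (simp add: PT_def Ker_def distrib_right sum.distrib sum_distrib_right)
  then show ?thesis using Q_V_eq[OF _ True, of _ G]
    by (subst (asm) sum.swap) (simp add: mode_product_in[OF True])
qed (simp add: PT_def mode_product_eq)

lemma Q_sym: "Q j a b = Q j b a"
  by (simp add: Q_def P_sym[of j a b] idm_def)

lemma Ker_sym:
  assumes "i \<in> idx ds" "i' \<in> idx ds"
  shows "Ker i i' = Ker i' i"
  unfolding Ker_def using assms Q_sym V_sym[OF skip_in_idx skip_in_idx] P_sym
  by (auto simp: kern_def intro!: sum.cong arg_cong2[of _ _ _ _ "(+)"] prod.cong)

lemma PT_selfadjoint: "tinner ds (PT G) H = tinner ds G (PT H)"
proof -
  have "tinner ds (PT G) H = (\<Sum>i\<in>idx ds. \<Sum>i'\<in>idx ds. Ker i i' * G i' * H i)"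
    by (simp add: tinner_def PT_def sum_distrib_right)
  also have "\<dots> = (\<Sum>i'\<in>idx ds. \<Sum>i\<in>idx ds. Ker i' i * G i' * H i)"
    by (subst sum.swap) (auto intro!: sum.cong simp: Ker_sym)
  finally show ?thesis by (simp add: tinner_def PT_def sum_distrib_left mult_ac)
qed

section \<open>Tangent vectors and the range of the projector\<close>

text \<open>The product rule for a curve that moves the core linearly and every factor
  \<open>U k\<close> in the direction \<open>Y k\<close> times \<open>U k\<close>. Along it the
  ranks are at most \<open>r\<close> by factorisation and at least \<open>r\<close> near 0 by
  semicontinuity, so the curve stays in the manifold.\<close>

lemma velocity:
  "(\<lambda>i. mode_product ds ds G P i + (\<Sum>j<m. mode_product ds ds T (one j (Y j)) i))
    \<in> velocities (tucker_manifold ds r) T"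
proof -
  define YU where "YU = (\<lambda>k a b. \<Sum>c<ds ! k. Y k a c * U k c b)"
  \<comment> \<open>The core velocity is \<open>G\<close> compressed by the transposed factors, so
    that expanding it by \<open>U\<close> again gives \<open>G\<close> projected by \<open>P\<close>
    in every mode.\<close>
  define C' where "C' = mode_product r ds G (\<lambda>k a b. U k b a)"
  define A where "A = (\<lambda>t k a b. U k a b + t * YU k a b)"
  define \<gamma> where "\<gamma> = (\<lambda>t. mode_product ds r (\<lambda>l. C l + t * C' l) (A t))"
  have A0: "A 0 = U" by (simp add: A_def fun_eq_iff)
  have 0: "\<gamma> 0 = T" by (simp add: \<gamma>_def A_def T_def)
  have G': "mode_product ds r C' U = mode_product ds ds G P"
    unfolding C'_def mode_product_comp[OF len]
    by (rule mode_product_cong) (auto simp: mmul_def P_def col_proj_def)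
  have Y': "mode_product ds ds T (one j (Y j)) = mode_product ds r C (U(j := YU j))" if "j < m" for j
    unfolding T_def mode_product_comp[OF refl]
    by (rule mode_product_cong) (auto simp: mmul_def YU_def len idm_mult_left)
  have deriv: "((\<lambda>t. \<gamma> t i) has_real_derivative
    (mode_product ds ds G P i + (\<Sum>j<m. mode_product ds ds T (one j (Y j)) i))) (at 0)" for i
  proof (cases "i \<in> idx ds")
    case True
    have dk: "((\<lambda>t. kern m (A t) i l) has_real_derivative (\<Sum>j<m. kern m (U(j := YU j)) i l)) (at 0)" for l
    proof -
      have "((\<lambda>t. kern m (A t) i l) has_real_derivative
        (\<Sum>j<m. YU j (i ! j) (l ! j) * (\<Prod>k\<in>{..<m} - {j}. A 0 k (i ! k) (l ! k)))) (at 0)"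
        unfolding kern_def
        by (rule has_field_derivative_prod) (auto simp: A_def intro!: derivative_eq_intros)
      also have "(\<Sum>j<m. YU j (i ! j) (l ! j) * (\<Prod>k\<in>{..<m} - {j}. A 0 k (i ! k) (l ! k)))
        = (\<Sum>j<m. kern m (U(j := YU j)) i l)"
        by (intro sum.cong) (auto simp: kern_upd A_def)
      finally show ?thesis .
    qed
    have "((\<lambda>t. \<Sum>l\<in>idx r. kern m (A t) i l * (C l + t * C' l)) has_real_derivative
      (\<Sum>l\<in>idx r. (\<Sum>j<m. kern m (U(j := YU j)) i l) * C l + kern m U i l * C' l)) (at 0)"
      by (rule DERIV_sum) (auto intro!: derivative_eq_intros dk simp: A0)
    moreover have "(\<Sum>l\<in>idx r. (\<Sum>j<m. kern m (U(j := YU j)) i l) * C l + kern m U i l * C' l)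
      = mode_product ds ds G P i + (\<Sum>j<m. mode_product ds ds T (one j (Y j)) i)"
      using Y' G'[symmetric] by (simp add: mode_product_in[OF True] sum.distrib sum_distrib_right, subst sum.swap) simp
    ultimately show ?thesis by (simp add: \<gamma>_def mode_product_in[OF True])
  qed (simp add: \<gamma>_def mode_product_eq)
  have up: "mat_rank {..<ds ! k} (idx (skip_mode k ds)) (unfold_mode k (\<gamma> t)) \<le> r ! k" if "k < m" for k t
    using mat_rank_le[of "idx (skip_mode k ds)" "{..<r ! k}" "{..<ds ! k}" "unfold_mode k (\<gamma> t)" "A t k"]
      mode_product_unfold[OF that len, of _ _ "\<lambda>l. C l + t * C' l" "A t"]
    by (auto simp: unfold_mode_ins \<gamma>_def)
  have "\<forall>\<^sub>F t in at 0. r ! k \<le> mat_rank {..<ds ! k} (idx (skip_mode k ds)) (unfold_mode k (\<gamma> t))" if "k < m" for k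
  proof -
    have "\<forall>\<^sub>F t in at 0. mat_rank {..<ds ! k} (idx (skip_mode k ds)) (unfold_mode k (\<gamma> 0))
      \<le> mat_rank {..<ds ! k} (idx (skip_mode k ds)) (unfold_mode k (\<gamma> t))"
      using DERIV_isCont[OF deriv]
      by (intro mat_rank_lower_semicontinuous[of _ _ "\<lambda>t. unfold_mode k (\<gamma> t)"]) (auto simp: unfold_mode_ins isCont_def)
    moreover have "mat_rank {..<ds ! k} (idx (skip_mode k ds)) (unfold_mode k (\<gamma> 0)) = r ! k"
      using T_manifold that 0 by (simp add: tucker_manifold_def)
    ultimately show ?thesis by simp
  qed
  then have "\<forall>\<^sub>F t in at 0. \<forall>k\<in>{..<m}. r ! k \<le> mat_rank {..<ds ! k} (idx (skip_mode k ds)) (unfold_mode k (\<gamma> t))"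
    by (intro eventually_ball_finite) auto
  then have "\<forall>\<^sub>F t in at 0. \<gamma> t \<in> tucker_manifold ds r"
    by eventually_elim (use up in \<open>auto simp: tucker_manifold_def \<gamma>_def mode_product_tensors intro: le_antisym\<close>)
  then obtain e where e: "e > 0" "\<And>t. t \<noteq> 0 \<Longrightarrow> \<bar>t\<bar> < e \<Longrightarrow> \<gamma> t \<in> tucker_manifold ds r"
    by (auto simp: eventually_at)
  have "\<gamma> t \<in> tucker_manifold ds r" if "\<bar>t\<bar> < e" for t
    using e(2)[OF _ that] 0 T_manifold by (cases "t = 0") auto
  then show ?thesis unfolding velocities_def using e(1) 0 deriv by blast
qed

lemma zero_sum_add:
  assumes "zero_sum ds G" "\<And>j. j < n \<Longrightarrow> zero_sum ds (H j)"
  shows "zero_sum ds (\<lambda>i. G i + (\<Sum>j<n. H j i))"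
  unfolding zero_sum_def
proof
  fix u assume u: "u \<in> idx (tl ds)"
  have "(\<Sum>a<hd ds. \<Sum>j<n. H j (a # u)) = (\<Sum>j<n. \<Sum>a<hd ds. H j (a # u))" by (rule sum.swap)
  then show "(\<Sum>a<hd ds. G (a # u) + (\<Sum>j<n. H j (a # u))) = 0"
    using assms u by (simp add: zero_sum_def sum.distrib)
qed

lemma zero_sum_one_T:
  assumes "j \<noteq> 0" shows "zero_sum ds (mode_product ds ds T (one j Y))"
proof -
  have "mode_product ds ds T (one j Y) = mode_product ds ds T (mmul ds (one j Y) P)"
    using mode_product_comp[OF refl, of ds ds T P "one j Y"] P_T by simp
  then show ?thesis
    using assms P0_colsum ds_ne by (auto intro!: zero_sum_mode_product simp: mmul_def idm_mult_left)
qed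

text \<open>The zero-sum constraint restricts \<open>Y\<close> in the first mode alone: a motion in
  another mode keeps the factor \<open>P 0\<close>, whose columns sum to zero.\<close>

lemma tangent_spaceI:
  assumes Y: "\<And>b. b < ds ! 0 \<Longrightarrow> (\<Sum>a<ds ! 0. Y 0 a b) = 0"
  shows "(\<lambda>i. mode_product ds ds G P i + (\<Sum>j<m. mode_product ds ds T (one j (Y j)) i)) \<in> tangent_space ds r T"
proof -
  have "zero_sum ds (mode_product ds ds T (one j (Y j)))" for j
  proof (cases "j = 0")
    case True
    then show ?thesis using Y ds_ne by (auto intro!: zero_sum_mode_product)
  qed (rule zero_sum_one_T)
  moreover have "zero_sum ds (mode_product ds ds G P)"
    using P0_colsum ds_ne by (auto intro!: zero_sum_mode_product)
  ultimately show ?thesis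
    unfolding tangent_space_def
    using velocity zero_sum_add[of "mode_product ds ds G P" m "\<lambda>j. mode_product ds ds T (one j (Y j))"] by auto
qed

lemma PT_in_tangent_space: "PT G \<in> tangent_space ds r T"
proof -
  have "\<exists>X. \<forall>j<m. R j G = mode_product ds ds T (one j (X j))"
    using R_eq[of _ G] by metis
  then obtain X where X: "\<And>j. j < m \<Longrightarrow> R j G = mode_product ds ds T (one j (X j))" by blast
  define Y where "Y = (\<lambda>j a b. \<Sum>c<ds ! j. Q j a c * X j c b)"
  have "PT G = (\<lambda>i. mode_product ds ds G P i + (\<Sum>j<m. mode_product ds ds T (one j (Y j)) i))"
    unfolding PT_eq[abs_def] Y_def using X by (intro ext arg_cong2[of _ _ _ _ "(+)"] refl sum.cong) (simp add: mode_product_one_comp)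
  moreover have "(\<Sum>a<ds ! 0. Y 0 a b) = 0" for b
  proof -
    have "(\<Sum>a<ds ! 0. Y 0 a b) = (\<Sum>c<ds ! 0. (\<Sum>a<ds ! 0. Q 0 a c) * X 0 c b)"
      unfolding Y_def by (subst sum.swap) (simp add: sum_distrib_right)
    then show ?thesis using Q0_colsum by simp
  qed
  ultimately show ?thesis using tangent_spaceI[of Y G] by simp
qed

lemma tangent_space_tensors:
  assumes "H \<in> tangent_space ds r T"
  shows "H \<in> tensors ds"
proof -
  obtain \<gamma> e where \<gamma>: "e > 0" "\<And>t. \<bar>t\<bar> < e \<Longrightarrow> \<gamma> t \<in> tucker_manifold ds r"
    "\<And>i. ((\<lambda>t::real. \<gamma> t i) has_real_derivative H i) (at 0)"
    using assms by (auto simp: tangent_space_def velocities_def)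
  have "H i = 0" if i: "i \<notin> idx ds" for i
  proof -
    have "((\<lambda>t. \<gamma> t i) has_real_derivative 0) (at 0)"
    proof (rule has_field_derivative_transform_within[OF DERIV_const \<gamma>(1), of 0])
      show "0 = \<gamma> t i" if "dist t 0 < e" for t
        using \<gamma>(2)[of t] that i by (auto simp: tucker_manifold_def tensors_def)
    qed auto
    then show ?thesis using \<gamma>(3)[of i] DERIV_unique by blast
  qed
  then show ?thesis by (simp add: tensors_def)
qed

text \<open>\<open>constant_rank_derivative\<close> with \<open>x\<close> a row of I - P_j, in the
  left kernel of the unfolding of \<open>T\<close>, and \<open>y\<close> a row of I - V_j, in the
  right kernel. Varying both rows gives (I - P_j) H (I - V_j) = 0 for the unfolding of
  \<open>H\<close>.\<close>

lemma tangent_space_normal: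
  assumes H: "H \<in> tangent_space ds r T" and j: "j < m"
  shows "mode_product ds ds H (one j (\<lambda>a b. idm a b - P j a b))
    = mode_product ds ds (R j H) (one j (\<lambda>a b. idm a b - P j a b))"
proof (rule tensors_eqI[OF mode_product_tensors mode_product_tensors])
  let ?I = "idx (skip_mode j ds)"
  obtain \<gamma> e where \<gamma>: "e > 0" "\<And>t. \<bar>t\<bar> < e \<Longrightarrow> \<gamma> t \<in> tucker_manifold ds r" "\<gamma> 0 = T"
    "\<And>i. ((\<lambda>t::real. \<gamma> t i) has_real_derivative H i) (at 0)"
    using H by (auto simp: tangent_space_def velocities_def)
  fix i assume "i \<in> idx ds"
  then obtain a0 u0 where au: "i = ins j a0 u0" "a0 < ds ! j" "u0 \<in> ?I"
    using ins_exhaust[OF j] by metis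
  define x where "x = (\<lambda>a. idm a0 a - P j a0 a)"
  define y where "y = (\<lambda>u. (if u = u0 then 1 else 0) - V j u0 u)"
  have ysum: "(\<Sum>u\<in>?I. f u * y u) = f u0 - (\<Sum>u\<in>?I. V j u0 u * f u)" for f
    using au by (simp add: y_def right_diff_distrib sum_subtractf if_distrib[of "\<lambda>x. _ * x"] mult_ac cong: if_cong)
  have rank_T: "mat_rank {..<ds ! j} ?I (unfold_mode j S) = r ! j" if "S \<in> tucker_manifold ds r" for S
    using that j by (simp add: tucker_manifold_def)
  have rank: "\<forall>\<^sub>F t in at 0. mat_rank {..<ds ! j} ?I (unfold_mode j (\<gamma> t)) = mat_rank {..<ds ! j} ?I (unfold_mode j (\<gamma> 0))"
    unfolding eventually_at using \<gamma>(1,2) rank_T by (intro exI[of _ e]) auto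
  have "(\<Sum>a<ds ! j. \<Sum>u\<in>?I. x a * unfold_mode j H a u * y u) = 0"
  proof (rule constant_rank_derivative[OF _ _ _ rank])
    show "((\<lambda>t. unfold_mode j (\<gamma> t) a u) has_real_derivative unfold_mode j H a u) (at 0)" for a u
      by (simp add: unfold_mode_ins \<gamma>(4))
    show "(\<Sum>a<ds ! j. x a * unfold_mode j (\<gamma> 0) a u) = 0" if u: "u \<in> ?I" for u
      using mode_product_one[OF j au(2) u, of T "P j"] P_one_T[OF j] au(2)
      by (simp add: x_def unfold_mode_ins \<gamma>(3) left_diff_distrib sum_subtractf idm_mult_left)
    show "(\<Sum>u\<in>?I. unfold_mode j (\<gamma> 0) a u * y u) = 0" if "a \<in> {..<ds ! j}" for a
      using V_T[of a j u0] that au by (simp add: ysum \<gamma>(3) unfold_mode_ins)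
  qed auto
  moreover have "(\<Sum>a<ds ! j. \<Sum>u\<in>?I. x a * unfold_mode j H a u * y u)
      = (\<Sum>a<ds ! j. x a * (\<Sum>u\<in>?I. H (ins j a u) * y u))"
    by (simp add: unfold_mode_ins sum_distrib_left mult.assoc)
  ultimately have "(\<Sum>a<ds ! j. x a * (H (ins j a u0) - (\<Sum>u\<in>?I. V j u0 u * H (ins j a u)))) = 0"
    by (simp only: ysum)
  moreover have "R j H (ins j a u0) = (\<Sum>u\<in>?I. V j u0 u * H (ins j a u))" if "a < ds ! j" for a
    using ins_in_idx[OF j that au(3)] length_idx[OF au(3)] length_skip[OF j] j
    by (simp add: R_def nth_ins_same skip_ins)
  ultimately show "mode_product ds ds H (one j (\<lambda>a b. idm a b - P j a b)) i
    = mode_product ds ds (R j H) (one j (\<lambda>a b. idm a b - P j a b)) i"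
    using au by (simp add: mode_product_one[OF j] x_def right_diff_distrib sum_subtractf)
qed

text \<open>Telescoping of \<open>H\<close> minus its projection by all \<open>P k\<close>: the
  \<open>p\<close>-th difference carries \<open>P\<close> in the modes before \<open>p\<close>, I -
  P_p in mode \<open>p\<close> and the identity after it. By \<open>tangent_space_normal\<close> the
  defect \<open>D p\<close> is \<open>T\<close> altered in mode \<open>p\<close> only, hence is
  fixed by every other \<open>P k\<close>, and the \<open>p\<close>-th difference is
  \<open>D p\<close> itself.\<close>

lemma PT_fixes_tangent:
  assumes H: "H \<in> tangent_space ds r T"
  shows "PT H = H"
proof -
  define Pc where "Pc = (\<lambda>j a b. idm a b - P j a b)"
  define D where "D = (\<lambda>j. mode_product ds ds H (one j (Pc j)))"
  have D_R: "D j = mode_product ds ds (R j H) (one j (Pc j))" if "j < m" for j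
    unfolding D_def Pc_def by (rule tangent_space_normal[OF H that])
  have PD: "mode_product ds ds (D j) (one k (P k)) = D j" if "j < m" "k < m" "k \<noteq> j" for j k
  proof -
    obtain X where X: "R j H = mode_product ds ds T (one j X)" using R_eq[OF \<open>j < m\<close>] by blast
    then show ?thesis
      unfolding D_R[OF \<open>j < m\<close>] X mode_product_one_comp[OF \<open>j < m\<close>]
      using mode_product_one_commute[of j k ds T] that P_one_T[OF \<open>k < m\<close>] by simp
  qed
  define F where "F = (\<lambda>p k. if k < p then P k else idm)"
  have F_Suc: "F (Suc p) = (F p)(p := P p)" for p
    by (auto simp: F_def fun_eq_iff)
  have F_comp: "mode_product ds ds G (F (Suc q)) = mode_product ds ds (mode_product ds ds G (one q (P q))) (F q)" for G q
    unfolding mode_product_comp[OF refl]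
    by (rule mode_product_cong) (auto simp: mmul_def F_def idm_mult_left idm_mult_right)
  have FD: "mode_product ds ds (D j) (F q) = D j" if "q \<le> j" "j < m" for j q
    using that(1)
  proof (induction q)
    case 0
    then show ?case by (simp add: F_def mode_product_idm mode_product_tensors D_def)
  next
    case (Suc q)
    then show ?case using PD[of j q] that by (simp add: F_comp)
  qed
  have step: "mode_product ds ds H (F p) i - mode_product ds ds H (F (Suc p)) i = D p i" if "p < m" for p i
  proof -
    have "mode_product ds ds H (F p) i - mode_product ds ds H (F (Suc p)) i
      = mode_product ds ds H ((F p)(p := Pc p)) i"
      using mode_product_slot_diff[OF that, of ds H "F p" idm "P p" i] F_Suc
      by (simp add: Pc_def F_def fun_upd_idem)
    also have "mode_product ds ds H ((F p)(p := Pc p)) = mode_product ds ds (D p) (F p)"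
      unfolding D_def mode_product_comp[OF refl]
      by (rule mode_product_cong) (auto simp: mmul_def F_def idm_mult_left idm_mult_right)
    also have "\<dots> = D p" by (rule FD) (use that in auto)
    finally show ?thesis .
  qed
  have "H i - mode_product ds ds H P i = (\<Sum>p<m. D p i)" for i
  proof -
    have "(\<Sum>p<m. D p i) = (\<Sum>p<m. mode_product ds ds H (F p) i - mode_product ds ds H (F (Suc p)) i)"
      using step by simp
    also have "\<dots> = mode_product ds ds H (F 0) i - mode_product ds ds H (F m) i"
      by (rule sum_lessThan_telescope')
    also have "mode_product ds ds H (F m) = mode_product ds ds H P"
      by (rule mode_product_cong) (auto simp: F_def)
    also have "mode_product ds ds H (F 0) = H"
      using mode_product_idm[OF tangent_space_tensors[OF H]] by (simp add: F_def)
    finally show ?thesis by simp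
  qed
  moreover have "mode_product ds ds (R j H) (one j (Q j)) i = D j i" if j: "j < m" for j i
  proof (cases "j = 0")
    case False
    then have "Q j = Pc j" by (simp add: Q_def Pc_def fun_eq_iff)
    then show ?thesis using j by (simp add: D_R)
  next
    case True
    \<comment> \<open>Projecting rows commutes with summing over the first mode, so
      \<open>R 0 H\<close> inherits zero sums from \<open>H\<close> and the averaging term of
      \<open>Q 0\<close> vanishes on it.\<close>
    have "mode_product ds ds (R 0 H) (one 0 (\<lambda>_ _. 1 / real (ds ! 0))) i = 0"
    proof (cases "i \<in> idx ds")
      case i: True
      obtain a u where au: "i = ins 0 a u" "a < ds ! 0" "u \<in> idx (skip_mode 0 ds)"
        using ins_exhaust[OF m0 i] by metis
      have sk: "skip_mode 0 ds = tl ds" by (simp add: skip_mode_def drop_Suc)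
      have hd: "hd ds = ds ! 0" using ds_ne by (simp add: hd_conv_nth)
      have "(\<Sum>b<ds ! 0. R 0 H (ins 0 b u))
          = (\<Sum>b<ds ! 0. \<Sum>u'\<in>idx (skip_mode 0 ds). V 0 u u' * H (ins 0 b u'))"
        using ins_in_idx[OF m0 _ au(3)] by (intro sum.cong) (auto simp: R_def nth_ins_same skip_ins)
      also have "\<dots> = (\<Sum>u'\<in>idx (skip_mode 0 ds). V 0 u u' * (\<Sum>b<ds ! 0. H (b # u')))"
        by (subst sum.swap) (simp add: sum_distrib_left ins_def)
      also have "\<dots> = 0"
        using H by (auto simp: tangent_space_def zero_sum_def sk hd)
      finally show ?thesis
        using au by (simp add: mode_product_one[OF m0] sum_divide_distrib[symmetric])
    qed (simp add: mode_product_eq)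
    moreover have "mode_product ds ds (R 0 H) (one 0 (Q 0)) i
      = D 0 i - mode_product ds ds (R 0 H) (one 0 (\<lambda>_ _. 1 / real (ds ! 0))) i"
      using mode_product_slot_diff[OF m0, of ds "R 0 H" "\<lambda>_. idm" "Pc 0" "\<lambda>_ _. 1 / real (ds ! 0)" i]
      by (simp add: D_R[OF m0] Q_def[abs_def] Pc_def)
    ultimately show ?thesis using True by simp
  qed
  ultimately show ?thesis by (simp add: fun_eq_iff PT_eq algebra_simps)
qed

text \<open>\<open>orth_proj\<close> is a definite description, so uniqueness has to be shown. The
  difference of two candidates is tested against each of them, both being members of the tangent
  space; linearity of that space is not invoked.\<close>

lemma tangent_proj_eq: "tangent_proj ds r T G = PT G"
proof -
  let ?S = "tangent_space ds r T"
  have orth: "tinner ds (\<lambda>i. G i - PT G i) H = 0" if "H \<in> ?S" for H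
    using PT_selfadjoint[of G H] PT_fixes_tangent[OF that]
    by (simp add: tinner_def left_diff_distrib sum_subtractf)
  have uniq: "Q' = PT G" if Q': "Q' \<in> ?S" "\<forall>H\<in>?S. tinner ds (\<lambda>i. G i - Q' i) H = 0" for Q'
  proof (rule tensors_eqI[OF tangent_space_tensors[OF Q'(1)] tangent_space_tensors[OF PT_in_tangent_space]])
    have "tinner ds (\<lambda>i. Q' i - PT G i) H = 0" if "H \<in> ?S" for H
      using orth[OF that] Q'(2) that by (simp add: tinner_def left_diff_distrib sum_subtractf)
    from this[OF Q'(1)] this[OF PT_in_tangent_space[of G]]
    have "(\<Sum>i\<in>idx ds. (Q' i - PT G i)\<^sup>2) = 0"
      by (simp add: tinner_def power2_eq_square right_diff_distrib[of "_ - _"] sum_subtractf)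
    then show "Q' i = PT G i" if "i \<in> idx ds" for i
      using that by (simp add: sum_nonneg_eq_0_iff)
  qed
  show ?thesis unfolding tangent_proj_def orth_proj_def
    by (rule the_equality) (use orth PT_in_tangent_space uniq in auto)
qed

lemma PT_orth: "H \<in> tangent_space ds r T \<Longrightarrow> tinner ds (\<lambda>i. G i - PT G i) H = 0"
  using PT_selfadjoint[of G H] PT_fixes_tangent[of H]
  by (simp add: tinner_def left_diff_distrib sum_subtractf)

end

subsection \<open>Entrywise and row bounds for tangent projectors\<close>

lemma sqrt_prod: "sqrt (\<Prod>k\<in>B. f k) = (\<Prod>k\<in>B. sqrt (f k))"
  by (induction B rule: infinite_finite_induct) (auto simp: real_sqrt_mult)

lemma prod_ratio:
  fixes \<rho> :: real
  assumes "length es = n"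
  shows "(\<Prod>k<n. \<rho> / real (es ! k)) = \<rho> ^ n / real (prod_list es)"
  using assms by (simp add: prod_dividef prod_list_nth)

lemma prod_sqrt_ratio:
  fixes \<rho> :: real
  assumes "length es = n"
  shows "(\<Prod>k<n. sqrt (\<rho> / real (es ! k))) = sqrt (\<rho> ^ n / real (prod_list es))"
  by (simp add: sqrt_prod[symmetric] prod_ratio[OF assms] del: real_sqrt_divide)

lemma prod_list_skip:
  assumes "j < length ds"
  shows "prod_list ds = ds ! j * prod_list (skip_mode j ds)"
  using prod_shift[OF assms, of "\<lambda>k. ds ! k"] assms
  by (simp add: prod_list_nth length_skip nth_skip)

lemma L2_set_sum:
  assumes "finite S"
  shows "L2_set (\<lambda>i. \<Sum>s\<in>S. f s i) I \<le> (\<Sum>s\<in>S. L2_set (f s) I)"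
  using assms
proof (induction S rule: finite_induct)
  case (insert s S)
  then show ?case using L2_set_triangle_ineq[of "f s" "\<lambda>i. \<Sum>s\<in>S. f s i" I] by simp
qed (simp add: L2_set_def)

lemma L2_set_minus: "L2_set (\<lambda>i. - f i) I = L2_set f I"
  by (simp add: L2_set_def)

lemma L2_set_diff: "L2_set (\<lambda>i. f i - g i) I \<le> L2_set f I + L2_set g I"
  using L2_set_triangle_ineq[of f "\<lambda>i. - g i" I] L2_set_minus[of g I] by simp

lemma L2_set_scale: "L2_set (\<lambda>i. c * f i) I = \<bar>c\<bar> * L2_set f I"
  by (simp add: L2_set_def power_mult_distrib sum_distrib_left[symmetric] real_sqrt_mult)

lemma cauchy_schwarz_sum: "\<bar>\<Sum>i\<in>I. f i * g i\<bar> \<le> L2_set f I * L2_set g I"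
  by (rule order_trans[OF sum_abs]) (simp only: abs_mult, rule L2_set_mult_ineq)

section \<open>Projectors as contractions, and the distance between two of them\<close>

lemma proj_norm_inner:
  assumes "is_proj I V"
  shows "(L2_set (apply_kernel I V x) I)\<^sup>2 = (\<Sum>i\<in>I. apply_kernel I V x i * x i)"
proof -
  have "(L2_set (apply_kernel I V x) I)\<^sup>2 = (\<Sum>i\<in>I. apply_kernel I V x i * apply_kernel I V x i)"
    by (simp only: L2_set_squared) (simp add: power2_eq_square)
  also have "\<dots> = (\<Sum>i\<in>I. apply_kernel I V (apply_kernel I V x) i * x i)"
    using apply_kernel_selfadjoint[OF assms, of "apply_kernel I V x" x] by simp
  finally show ?thesis using apply_kernel_idem[OF assms] by simp
qed

lemma le_if_square_le:
  fixes x y :: real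
  assumes "x\<^sup>2 \<le> x * y" "x \<ge> 0" "y \<ge> 0"
  shows "x \<le> y"
  using assms by (cases "x = 0") (auto simp: power2_eq_square)

lemma proj_contraction:
  assumes "is_proj I V"
  shows "L2_set (apply_kernel I V x) I \<le> L2_set x I"
  by (rule le_if_square_le)
     (use proj_norm_inner[OF assms, of x] cauchy_schwarz_sum[of "apply_kernel I V x" x I] in auto)

lemma proj_compl_contraction:
  assumes "is_proj I V"
  shows "L2_set (\<lambda>i. x i - apply_kernel I V x i) I \<le> L2_set x I"
proof -
  have "(L2_set (\<lambda>i. x i - apply_kernel I V x i) I)\<^sup>2 = (L2_set x I)\<^sup>2 - (L2_set (apply_kernel I V x) I)\<^sup>2"
  proof -
    have "(L2_set (\<lambda>i. x i - apply_kernel I V x i) I)\<^sup>2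
      = (L2_set x I)\<^sup>2 - 2 * (\<Sum>i\<in>I. apply_kernel I V x i * x i) + (L2_set (apply_kernel I V x) I)\<^sup>2"
      by (simp add: L2_set_squared power2_diff sum.distrib sum_subtractf sum_distrib_left mult_ac)
    then show ?thesis using proj_norm_inner[OF assms, of x] by simp
  qed
  then have "(L2_set (\<lambda>i. x i - apply_kernel I V x i) I)\<^sup>2 \<le> (L2_set x I)\<^sup>2" by simp
  then show ?thesis by (rule power2_le_imp_le) (rule L2_set_nonneg)
qed

text \<open>V' - V = V'(I - V) - (I - V')V. The second term is the second gap. For the first, w =
  V'q with Vq = 0 satisfies |w|^2 = \<langle>w - Vw, q\<rangle> \<le> \<delta> |w| |q| by the first
  gap.\<close>

lemma proj_close:
  assumes V: "is_proj I V" and V': "is_proj I V'" and "\<delta> \<ge> 0"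
    and 1: "\<And>x. L2_set (\<lambda>i. apply_kernel I V' x i - apply_kernel I V (apply_kernel I V' x) i) I \<le> \<delta> * L2_set (apply_kernel I V' x) I"
    and 2: "\<And>x. L2_set (\<lambda>i. apply_kernel I V x i - apply_kernel I V' (apply_kernel I V x) i) I \<le> \<delta> * L2_set (apply_kernel I V x) I"
  shows "L2_set (\<lambda>i. apply_kernel I V' x i - apply_kernel I V x i) I \<le> 2 * \<delta> * L2_set x I"
proof -
  define q where "q = (\<lambda>i. x i - apply_kernel I V x i)"
  define w where "w = apply_kernel I V' q"
  have Vq: "apply_kernel I V q i = 0" if "i \<in> I" for i
    using apply_kernel_idem[OF V that, of x] by (simp add: q_def apply_kernel_diff)
  have "(L2_set w I)\<^sup>2 = (\<Sum>i\<in>I. w i * q i)" unfolding w_def by (rule proj_norm_inner[OF V'])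
  also have "\<dots> = (\<Sum>i\<in>I. (w i - apply_kernel I V w i) * q i)"
    using apply_kernel_selfadjoint[OF V, of w q] Vq by (simp add: left_diff_distrib sum_subtractf)
  also have "\<dots> \<le> L2_set (\<lambda>i. w i - apply_kernel I V w i) I * L2_set q I"
    using cauchy_schwarz_sum[of "\<lambda>i. w i - apply_kernel I V w i" q I] by linarith
  also have "\<dots> \<le> (\<delta> * L2_set w I) * L2_set q I"
    using 1[of q] by (intro mult_right_mono) (auto simp: w_def)
  finally have "(L2_set w I)\<^sup>2 \<le> L2_set w I * (\<delta> * L2_set q I)" by (simp add: mult_ac)
  then have "L2_set w I \<le> \<delta> * L2_set q I" using \<open>\<delta> \<ge> 0\<close> by (intro le_if_square_le[OF _ L2_set_nonneg] mult_nonneg_nonneg L2_set_nonneg)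
  also have "\<dots> \<le> \<delta> * L2_set x I"
    unfolding q_def using proj_compl_contraction[OF V] \<open>\<delta> \<ge> 0\<close> by (intro mult_left_mono)
  finally have w: "L2_set w I \<le> \<delta> * L2_set x I" .
  have "L2_set (\<lambda>i. apply_kernel I V x i - apply_kernel I V' (apply_kernel I V x) i) I \<le> \<delta> * L2_set (apply_kernel I V x) I"
    by (rule 2)
  also have "\<dots> \<le> \<delta> * L2_set x I" using proj_contraction[OF V] \<open>\<delta> \<ge> 0\<close> by (intro mult_left_mono)
  finally have z: "L2_set (\<lambda>i. apply_kernel I V x i - apply_kernel I V' (apply_kernel I V x) i) I \<le> \<delta> * L2_set x I" .
  have "(\<lambda>i. apply_kernel I V' x i - apply_kernel I V x i)
    = (\<lambda>i. w i - (apply_kernel I V x i - apply_kernel I V' (apply_kernel I V x) i))"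
    by (simp add: fun_eq_iff w_def q_def apply_kernel_diff)
  then have "L2_set (\<lambda>i. apply_kernel I V' x i - apply_kernel I V x i) I
     \<le> L2_set w I + L2_set (\<lambda>i. apply_kernel I V x i - apply_kernel I V' (apply_kernel I V x) i) I"
    using L2_set_diff[of w] by simp
  then show ?thesis using w z by simp
qed

section \<open>Telescoping differences of product kernels\<close>

definition hybrid :: "(nat \<Rightarrow> nat \<Rightarrow> nat \<Rightarrow> real) \<Rightarrow> (nat \<Rightarrow> nat \<Rightarrow> nat \<Rightarrow> real) \<Rightarrow> nat \<Rightarrow> nat \<Rightarrow> nat \<Rightarrow> nat \<Rightarrow> real" where
  "hybrid A B q = (\<lambda>k. if k < q then A k else if k = q then (\<lambda>a b. A k a b - B k a b) else B k)"

lemma kern_diff_telescope: "kern n A i l - kern n B i l = (\<Sum>q<n. kern n (hybrid A B q) i l)"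
proof -
  define F where "F = (\<lambda>q k. if k < q then A k else B k)"
  have "kern n (hybrid A B q) i l = kern n (F (Suc q)) i l - kern n (F q) i l" if "q < n" for q
  proof -
    have "hybrid A B q = (F q)(q := (\<lambda>a b. A q a b - B q a b))" "F (Suc q) = (F q)(q := A q)" "F q = (F q)(q := B q)"
      by (auto simp: hybrid_def F_def fun_eq_iff)
    then have "kern n (hybrid A B q) i l = (A q (i ! q) (l ! q) - B q (i ! q) (l ! q)) * (\<Prod>k\<in>{..<n} - {q}. F q k (i ! k) (l ! k))"
      "kern n (F (Suc q)) i l = A q (i ! q) (l ! q) * (\<Prod>k\<in>{..<n} - {q}. F q k (i ! k) (l ! k))"
      "kern n (F q) i l = B q (i ! q) (l ! q) * (\<Prod>k\<in>{..<n} - {q}. F q k (i ! k) (l ! k))"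
      subgoal using kern_upd[OF that, of "F q" _ i l] by simp
      subgoal using kern_upd[OF that, of "F q" _ i l] \<open>F (Suc q) = _\<close> by simp
      subgoal using kern_upd[OF that, of "F q" "B q" i l] \<open>F q = (F q)(q := B q)\<close> by simp
      done
    then show ?thesis by (simp add: left_diff_distrib)
  qed
  then have "(\<Sum>q<n. kern n (hybrid A B q) i l) = (\<Sum>q<n. kern n (F (Suc q)) i l - kern n (F q) i l)" by simp
  also have "\<dots> = kern n (F n) i l - kern n (F 0) i l" by (rule sum_lessThan_telescope)
  also have "kern n (F n) i l = kern n A i l" by (rule kern_cong) (simp add: F_def)
  also have "F 0 = B" by (simp add: F_def)
  finally show ?thesis by simp
qed

text \<open>As \<open>e \<le> 1\<close>, the rows of \<open>A\<close> have norm at most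
  \<open>2 * s k\<close>, which costs the crude factor \<open>2 ^ length ds\<close>. What matters
  later is that the bound is linear in \<open>e\<close> and keeps the full product of the row
  scales.\<close>

lemma kern_diff_L2:
  assumes e: "0 \<le> e" "e \<le> 1" and s: "\<And>k. k < length ds \<Longrightarrow> 0 \<le> s k"
    and B: "\<And>k. k < length ds \<Longrightarrow> L2_set (B k (i ! k)) {..<ds ! k} \<le> s k"
    and D: "\<And>k. k < length ds \<Longrightarrow> L2_set (\<lambda>b. A k (i ! k) b - B k (i ! k) b) {..<ds ! k} \<le> e * s k"
  shows "L2_set (\<lambda>l. kern (length ds) A i l - kern (length ds) B i l) (idx ds)
    \<le> real (length ds) * 2 ^ length ds * e * (\<Prod>k<length ds. s k)"
proof -
  let ?n = "length ds"
  have A: "L2_set (A k (i ! k)) {..<ds ! k} \<le> 2 * s k" if "k < ?n" for k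
  proof -
    have "L2_set (A k (i ! k)) {..<ds ! k} \<le> L2_set (\<lambda>b. A k (i ! k) b - B k (i ! k) b) {..<ds ! k} + L2_set (B k (i ! k)) {..<ds ! k}"
      using L2_set_triangle_ineq[of "\<lambda>b. A k (i ! k) b - B k (i ! k) b" "B k (i ! k)" "{..<ds ! k}"] by simp
    also have "\<dots> \<le> 1 * s k + s k"
      using B[OF that] D[OF that] e s[OF that] mult_right_mono[of e 1 "s k"] by linarith
    finally show ?thesis by simp
  qed
  have tm: "L2_set (kern ?n (hybrid A B q) i) (idx ds) \<le> 2 ^ ?n * e * (\<Prod>k<?n. s k)" if q: "q < ?n" for q
  proof -
    have "L2_set (kern ?n (hybrid A B q) i) (idx ds) \<le> (\<Prod>k<?n. (if k = q then e else 2) * s k)"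
      unfolding L2_set_kern
    proof (rule prod_mono, intro conjI L2_set_nonneg)
      fix k assume "k \<in> {..<?n}"
      then have k: "k < ?n" by simp
      show "L2_set (hybrid A B q k (i ! k)) {..<ds ! k} \<le> (if k = q then e else 2) * s k"
        using A[OF k] D[OF k] B[OF k] s[OF k] by (auto simp: hybrid_def)
    qed
    also have "\<dots> = (\<Prod>k<?n. (if k = q then e else 2)) * (\<Prod>k<?n. s k)" by (rule prod.distrib)
    also have "(\<Prod>k<?n. (if k = q then e else 2)) = e * 2 ^ (?n - 1)"
      using q by (subst prod.remove[of _ q]) (auto simp: card_Diff_singleton)
    also have "e * 2 ^ (?n - 1) * (\<Prod>k<?n. s k) \<le> e * 2 ^ ?n * (\<Prod>k<?n. s k)"
      using e s by (intro mult_right_mono mult_left_mono power_increasing prod_nonneg) auto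
    finally show ?thesis by (simp add: mult_ac)
  qed
  have "L2_set (\<lambda>l. kern ?n A i l - kern ?n B i l) (idx ds) \<le> (\<Sum>q<?n. L2_set (kern ?n (hybrid A B q) i) (idx ds))"
    unfolding kern_diff_telescope by (rule L2_set_sum) simp
  also have "\<dots> \<le> (\<Sum>q<?n. 2 ^ ?n * e * (\<Prod>k<?n. s k))" using tm by (intro sum_mono) auto
  finally show ?thesis by (simp add: mult_ac)
qed

lemma kern_l1_le:
  assumes "\<And>k. k < length ds \<Longrightarrow> (\<Sum>b<ds ! k. \<bar>A k (i ! k) b\<bar>) \<le> s k"
  shows "(\<Sum>l\<in>idx ds. \<bar>kern (length ds) A i l\<bar>) \<le> (\<Prod>k<length ds. s k)"
  unfolding l1_kern using assms by (intro prod_mono) (auto intro: sum_nonneg)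

text \<open>Second-order Taylor remainder of the multilinear map \<open>A \<mapsto> kern n A\<close>.\<close>

lemma kern_second_order:
  fixes A B :: "nat \<Rightarrow> nat \<Rightarrow> nat \<Rightarrow> real"
  assumes e: "0 \<le> e" and \<rho>: "1 \<le> \<rho>"
    and A: "\<And>k. k < length ds \<Longrightarrow> (\<Sum>b<ds ! k. \<bar>A k (i ! k) b\<bar>) \<le> \<rho>"
    and B: "\<And>k. k < length ds \<Longrightarrow> (\<Sum>b<ds ! k. \<bar>B k (i ! k) b\<bar>) \<le> \<rho>"
    and D: "\<And>k. k < length ds \<Longrightarrow> (\<Sum>b<ds ! k. \<bar>B k (i ! k) b - A k (i ! k) b\<bar>) \<le> e * \<rho>"
  shows "(\<Sum>l\<in>idx ds. \<bar>kern (length ds) B i l - kern (length ds) A i l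
      - (\<Sum>q<length ds. kern (length ds) (A(q := (\<lambda>a b. B q a b - A q a b))) i l)\<bar>)
    \<le> (real (length ds))\<^sup>2 * \<rho> ^ length ds * e\<^sup>2"
proof -
  let ?n = "length ds"
  let ?D = "\<lambda>q. (A(q := (\<lambda>a b. B q a b - A q a b)))"
  let ?F = "\<lambda>q p. hybrid (hybrid B A q) (?D q) p"
  \<comment> \<open>Slot \<open>p\<close> of the inner hybrid holds the difference of
    \<open>hybrid B A q\<close> and \<open>?D q\<close> there. For \<open>p < q\<close> it is B - A,
    giving a second factor \<open>e\<close> besides slot \<open>q\<close>; for
    \<open>p \<ge> q\<close> the two families agree at \<open>p\<close> and the kernel
    vanishes.\<close>
  have tm: "(\<Sum>l\<in>idx ds. \<bar>kern ?n (?F q p) i l\<bar>) \<le> \<rho> ^ ?n * e\<^sup>2" if q: "q < ?n" and p: "p < ?n" for q p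
  proof (cases "p < q")
    case True
    have "(\<Sum>l\<in>idx ds. \<bar>kern ?n (?F q p) i l\<bar>) \<le> (\<Prod>k<?n. (if k = p \<or> k = q then e else 1) * \<rho>)"
      using A B D True by (intro kern_l1_le) (auto simp: hybrid_def)
    also have "\<dots> = (\<Prod>k<?n. (if k = p \<or> k = q then e else 1)) * \<rho> ^ ?n"
      by (simp add: prod.distrib)
    also have "(\<Prod>k<?n. (if k = p \<or> k = q then e else 1)) = e ^ card {p, q}"
      using p q by (subst prod.If_cases) (auto intro!: arg_cong[of _ _ "\<lambda>S. e ^ card S"])
    also have "card {p, q} = 2" using True by simp
    finally show ?thesis by (simp only: mult_ac)
  next
    case False
    have "kern ?n (?F q p) i l = 0" for l
      unfolding kern_def using False p by (intro prod_zero) (auto simp: hybrid_def intro!: bexI[of _ p])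
    then show ?thesis using \<rho> by simp
  qed
  have "(\<Sum>l\<in>idx ds. \<bar>kern ?n B i l - kern ?n A i l - (\<Sum>q<?n. kern ?n (?D q) i l)\<bar>)
    \<le> (\<Sum>l\<in>idx ds. \<Sum>q<?n. \<Sum>p<?n. \<bar>kern ?n (?F q p) i l\<bar>)"
  proof (rule sum_mono)
    fix l assume "l \<in> idx ds"
    have "kern ?n B i l - kern ?n A i l - (\<Sum>q<?n. kern ?n (?D q) i l)
      = (\<Sum>q<?n. \<Sum>p<?n. kern ?n (?F q p) i l)"
      using kern_diff_telescope[of ?n B i l A] kern_diff_telescope[of ?n "hybrid B A _" i l "?D _"]
      by (simp flip: sum_subtractf)
    then show "\<bar>kern ?n B i l - kern ?n A i l - (\<Sum>q<?n. kern ?n (?D q) i l)\<bar>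
      \<le> (\<Sum>q<?n. \<Sum>p<?n. \<bar>kern ?n (?F q p) i l\<bar>)"
      by (auto intro!: order_trans[OF sum_abs] sum_mono)
  qed
  also have "\<dots> = (\<Sum>q<?n. \<Sum>p<?n. \<Sum>l\<in>idx ds. \<bar>kern ?n (?F q p) i l\<bar>)"
    by (subst sum.swap) (intro sum.cong refl sum.swap)
  also have "\<dots> \<le> (\<Sum>q<?n. \<Sum>p<?n. \<rho> ^ ?n * e\<^sup>2)" using tm by (intro sum_mono) auto
  finally show ?thesis by (simp add: power2_eq_square mult_ac)
qed

section \<open>Consequences of incoherence\<close>

locale tucker_inc = tucker +
  fixes \<rho> :: real
  assumes dk: "\<And>k. k < length ds \<Longrightarrow> 1 \<le> ds ! k"
    and rho: "1 \<le> \<rho>"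
    and inc: "\<And>k a. k < length ds \<Longrightarrow> a < ds ! k \<Longrightarrow> (L2_set (U k a) {..<r ! k})\<^sup>2 \<le> \<rho> / real (ds ! k)"
begin

lemma P_proj: "k < m \<Longrightarrow> is_proj {..<ds ! k} (P k)"
  unfolding is_proj_def using P_idem P_sym by blast

lemma P_abs:
  assumes "k < m" "a < ds ! k" "b < ds ! k"
  shows "\<bar>P k a b\<bar> \<le> \<rho> / real (ds ! k)"
proof -
  have "\<bar>P k a b\<bar> \<le> L2_set (U k a) {..<r ! k} * L2_set (U k b) {..<r ! k}"
    unfolding P_def col_proj_def by (rule cauchy_schwarz_sum)
  also have "\<dots> \<le> sqrt (\<rho> / real (ds ! k)) * sqrt (\<rho> / real (ds ! k))"
    by (intro mult_mono real_le_rsqrt inc assms real_sqrt_ge_zero L2_set_nonneg) (use rho in simp)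
  finally show ?thesis using rho by simp
qed

lemma P_row_L2:
  assumes "k < m" "a < ds ! k"
  shows "L2_set (P k a) {..<ds ! k} \<le> sqrt (\<rho> / real (ds ! k))"
proof -
  have "(L2_set (P k a) {..<ds ! k})\<^sup>2 = P k a a"
  proof -
    have "(L2_set (P k a) {..<ds ! k})\<^sup>2 = (\<Sum>b<ds ! k. P k a b * P k b a)"
      unfolding L2_set_squared by (intro sum.cong refl) (subst (3) P_sym, rule power2_eq_square)
    also have "\<dots> = P k a a"
      using P_proj[OF assms(1)] assms(2) unfolding is_proj_def by blast
    finally show ?thesis .
  qed
  then show ?thesis using P_abs[OF assms assms(2)] by (intro real_le_rsqrt) simp
qed

lemma P_row_l1:
  assumes "k < m" "a < ds ! k"
  shows "(\<Sum>b<ds ! k. \<bar>P k a b\<bar>) \<le> \<rho>"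
proof -
  have "(\<Sum>b<ds ! k. \<bar>P k a b\<bar>) \<le> (\<Sum>b<ds ! k. \<rho> / real (ds ! k))"
    using P_abs[OF assms] by (intro sum_mono) auto
  then show ?thesis using dk[OF assms(1)] by simp
qed

lemma Q_row_l1:
  assumes "j < m" "a < ds ! j"
  shows "(\<Sum>b<ds ! j. \<bar>Q j a b\<bar>) \<le> 2 + \<rho>"
proof -
  have "(\<Sum>b<ds ! j. \<bar>Q j a b\<bar>) \<le> (\<Sum>b<ds ! j. idm a b + \<bar>P j a b\<bar> + (if j = 0 then 1 / real (ds ! 0) else 0))"
  proof (rule sum_mono)
    fix b
    obtain q where "0 \<le> q" "q = (if j = 0 then 1 / real (ds ! 0) else 0)" by simp
    moreover have "0 \<le> idm a b" by (simp add: idm_def)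
    ultimately show "\<bar>Q j a b\<bar> \<le> idm a b + \<bar>P j a b\<bar> + (if j = 0 then 1 / real (ds ! 0) else 0)"
      unfolding Q_def by linarith
  qed
  also have "\<dots> = 1 + (\<Sum>b<ds ! j. \<bar>P j a b\<bar>) + (if j = 0 then 1 else 0)"
    using idm_mult_left[of a "\<lambda>_. 1" "ds ! j"] assms d0 by (auto simp: sum.distrib)
  finally show ?thesis using P_row_l1[OF assms] by (auto split: if_splits)
qed

lemma Q_abs:
  assumes "j < m" "a < ds ! j" "b < ds ! j"
  shows "\<bar>Q j a b\<bar> \<le> 2 + \<rho>"
proof -
  have "\<bar>Q j a b\<bar> \<le> (\<Sum>b<ds ! j. \<bar>Q j a b\<bar>)" using assms by (intro member_le_sum) auto
  then show ?thesis using Q_row_l1[OF assms(1,2)] by linarith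
qed

definition W :: "nat \<Rightarrow> real" where "W j = real (prod_list (skip_mode j ds))"

abbreviation "Wt \<equiv> real (prod_list ds)"

lemma W_eq: "j < m \<Longrightarrow> Wt = real (ds ! j) * W j"
  by (simp add: prod_list_skip W_def)

lemma Wt_pos: "0 < Wt"
  using dk by (auto simp: prod_list_nth intro!: prod_pos) fastforce

lemma W_pos: "j < m \<Longrightarrow> 0 < W j"
  using W_eq[of j] Wt_pos by (auto simp: W_def zero_less_mult_iff)

text \<open>The Kronecker product of the \<open>P k\<close> over all modes other than
  \<open>j\<close>: the projector onto a space that contains the row space of the
  mode-\<open>j\<close> unfolding.\<close>

definition pk :: "nat \<Rightarrow> nat list \<Rightarrow> nat list \<Rightarrow> real" where
  "pk j = kern (m - 1) (\<lambda>k. P (shift j k))"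

lemma pk_L2:
  assumes j: "j < m" and u: "u \<in> idx (skip_mode j ds)"
  shows "L2_set (pk j u) (idx (skip_mode j ds)) \<le> sqrt (\<rho> ^ (m - 1) / W j)"
proof -
  have l: "length (skip_mode j ds) = m - 1" using j by (rule length_skip)
  have "L2_set (pk j u) (idx (skip_mode j ds)) = (\<Prod>k<m - 1. L2_set (P (shift j k) (u ! k)) {..<skip_mode j ds ! k})"
    unfolding pk_def using L2_set_kern[of "skip_mode j ds" "\<lambda>k. P (shift j k)" u] l by simp
  also have "\<dots> \<le> (\<Prod>k<m - 1. sqrt (\<rho> / real (skip_mode j ds ! k)))"
    using P_row_L2 nth_idx[OF u] l shift_less[OF j] nth_skip[OF j]
    by (intro prod_mono) auto
  finally show ?thesis using prod_sqrt_ratio[OF l, of \<rho>] by (simp add: W_def)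
qed

lemma T_pk:
  assumes j: "j < m" and b: "b < ds ! j" and u: "u \<in> idx (skip_mode j ds)"
  shows "(\<Sum>w\<in>idx (skip_mode j ds). pk j u w * T (ins j b w)) = T (ins j b u)"
proof -
  have "mode_product ds ds T (P(j := idm)) = T"
    unfolding T_def mode_product_comp[OF refl]
    by (rule mode_product_cong) (auto simp: mmul_def PU len idm_mult_left)
  then have "T (ins j b u) = mode_product ds ds T (P(j := idm)) (ins j b u)" by simp
  also have "\<dots> = mode_product (skip_mode j ds) (skip_mode j ds) (unfold_mode j T b) (\<lambda>k. P (shift j k)) u"
  proof -
    have "(\<lambda>k. (P(j := idm)) (shift j k)) = (\<lambda>k. P (shift j k))" by (auto simp: shift_def fun_eq_iff)
    then show ?thesis unfolding mode_product_unfold[OF j refl b u] using b by (simp add: idm_mult_left)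
  qed
  finally show ?thesis using u j by (simp add: mode_product_in length_skip pk_def unfold_mode_ins)
qed

text \<open>The rows of \<open>V j\<close> are combinations of rows of the unfolding, which
  \<open>pk j\<close> fixes. No incoherence is assumed for the row spaces; this identity transfers
  it to them from the factors.\<close>

lemma V_pk:
  assumes j: "j < m" and u: "u \<in> idx (skip_mode j ds)" "u' \<in> idx (skip_mode j ds)"
  shows "apply_kernel (idx (skip_mode j ds)) (V j) (pk j u') u = V j u u'"
proof -
  obtain n where n: "\<And>u u'. u \<in> idx (skip_mode j ds) \<Longrightarrow> u' \<in> idx (skip_mode j ds) \<Longrightarrow>
    V j u u' = (\<Sum>b<ds ! j. n b u * T (ins j b u'))" using V_coeff[of j] by blast
  have "apply_kernel (idx (skip_mode j ds)) (V j) (pk j u') u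
    = (\<Sum>w\<in>idx (skip_mode j ds). \<Sum>b<ds ! j. n b u * T (ins j b w) * pk j u' w)"
    using n u by (auto simp: apply_kernel_def sum_distrib_right intro!: sum.cong)
  also have "\<dots> = (\<Sum>b<ds ! j. n b u * (\<Sum>w\<in>idx (skip_mode j ds). pk j u' w * T (ins j b w)))"
    by (subst sum.swap) (simp add: sum_distrib_left mult_ac)
  also have "\<dots> = V j u u'" using T_pk[OF j _ u(2)] n[OF u] by simp
  finally show ?thesis .
qed

lemma V_L2:
  assumes j: "j < m" and u: "u \<in> idx (skip_mode j ds)"
  shows "L2_set (V j u) (idx (skip_mode j ds)) \<le> sqrt (\<rho> ^ (m - 1) / W j)"
proof -
  have "L2_set (V j u) (idx (skip_mode j ds))
    = L2_set (apply_kernel (idx (skip_mode j ds)) (V j) (pk j u)) (idx (skip_mode j ds))"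
    using V_pk[OF j _ u] V_sym[OF u] by (intro L2_set_cong) auto
  also have "\<dots> \<le> L2_set (pk j u) (idx (skip_mode j ds))" by (rule proj_contraction[OF V_proj])
  finally show ?thesis using pk_L2[OF assms] by linarith
qed

text \<open>An entry of a projector is the inner product of two of its rows.\<close>

lemma V_abs:
  assumes j: "j < m" and u: "u \<in> idx (skip_mode j ds)" "u' \<in> idx (skip_mode j ds)"
  shows "\<bar>V j u u'\<bar> \<le> \<rho> ^ (m - 1) / W j"
proof -
  have "V j u u' = (\<Sum>w\<in>idx (skip_mode j ds). V j u w * V j u' w)"
  proof -
    have "V j u u' = (\<Sum>w\<in>idx (skip_mode j ds). V j u w * V j w u')"
      using V_proj[of j] u unfolding is_proj_def by metis
    then show ?thesis using V_sym[OF u(2)] by simp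
  qed
  then have "\<bar>V j u u'\<bar> \<le> L2_set (V j u) (idx (skip_mode j ds)) * L2_set (V j u') (idx (skip_mode j ds))"
    using cauchy_schwarz_sum by metis
  also have "\<dots> \<le> sqrt (\<rho> ^ (m - 1) / W j) * sqrt (\<rho> ^ (m - 1) / W j)"
    using rho W_pos[OF j] by (intro mult_mono V_L2[OF j] u real_sqrt_ge_zero L2_set_nonneg) simp
  finally show ?thesis using rho W_pos[OF j] by simp
qed

lemma V_l1:
  assumes j: "j < m" and u: "u \<in> idx (skip_mode j ds)"
  shows "(\<Sum>u'\<in>idx (skip_mode j ds). \<bar>V j u u'\<bar>) \<le> \<rho> ^ (m - 1)"
proof -
  have "(\<Sum>u'\<in>idx (skip_mode j ds). \<bar>V j u u'\<bar>) \<le> (\<Sum>u'\<in>idx (skip_mode j ds). \<rho> ^ (m - 1) / W j)"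
    using V_abs[OF j u] by (intro sum_mono) auto
  also have "\<dots> = W j * (\<rho> ^ (m - 1) / W j)" by (simp add: card_idx W_def)
  finally show ?thesis using W_pos[OF j] by simp
qed

text \<open>The first term comes from the product of the \<open>P k\<close>, and each of the
  \<open>m\<close> terms with \<open>Q j\<close> and \<open>V j\<close> contributes (2 + \<rho>)
  \<rho>^m. The same constant serves the row sums and, at scale \<open>dbar ds / Wt\<close>, the
  entries.\<close>

definition A1 :: real where "A1 = \<rho> ^ m + real m * (2 + \<rho>) * \<rho> ^ m"

lemma A1_ge_1: "1 \<le> A1"
  using rho one_le_power[OF rho, of m] by (auto simp: A1_def intro!: add_increasing2)

lemma rho_pow: "\<rho> ^ (m - 1) \<le> \<rho> ^ m" using rho by (intro power_increasing) auto

lemma dbar_ge: "k < m \<Longrightarrow> real (ds ! k) \<le> dbar ds"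
  by (simp add: dbar_def)

lemma dbar_ge_1: "1 \<le> dbar ds"
  using dbar_ge[OF m0] dk[OF m0] by linarith

text \<open>The origin of the scale \<open>dbar ds / Wt\<close>: the row-space projector of mode
  \<open>j\<close> is spread over \<open>Wt / ds ! j\<close> contexts only.\<close>

lemma inv_W: "j < m \<Longrightarrow> 1 / W j \<le> dbar ds / Wt"
  using dbar_ge[of j] W_eq[of j] W_pos[of j] Wt_pos dk[of j] by (simp add: field_simps)

lemma Ker_abs:
  assumes i: "i \<in> idx ds" "i' \<in> idx ds"
  shows "\<bar>Ker i i'\<bar> \<le> A1 * (dbar ds / Wt)"
proof -
  have "\<bar>kern m P i i'\<bar> \<le> (\<Prod>k<m. \<rho> / real (ds ! k))"
    unfolding kern_def abs_prod using P_abs nth_idx[OF i(1)] nth_idx[OF i(2)] by (intro prod_mono) auto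
  also have "\<dots> = \<rho> ^ m * (1 / Wt)" by (simp add: prod_ratio)
  also have "\<dots> \<le> \<rho> ^ m * (dbar ds / Wt)"
    using rho dbar_ge_1 Wt_pos by (intro mult_left_mono divide_right_mono) auto
  finally have 1: "\<bar>kern m P i i'\<bar> \<le> \<rho> ^ m * (dbar ds / Wt)" .
  have "\<bar>Q j (i ! j) (i' ! j) * V j (skip_mode j i) (skip_mode j i')\<bar> \<le> (2 + \<rho>) * \<rho> ^ m * (dbar ds / Wt)" if j: "j < m" for j
  proof -
    have "\<bar>Q j (i ! j) (i' ! j) * V j (skip_mode j i) (skip_mode j i')\<bar> \<le> (2 + \<rho>) * (\<rho> ^ (m - 1) / W j)"
      unfolding abs_mult using Q_abs[OF j] V_abs[OF j] nth_idx[OF i(1)] nth_idx[OF i(2)] skip_in_idx[OF j] i j rho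
      by (intro mult_mono) auto
    also have "\<dots> = (2 + \<rho>) * (\<rho> ^ (m - 1) * (1 / W j))" by simp
    also have "\<dots> \<le> (2 + \<rho>) * (\<rho> ^ m * (dbar ds / Wt))"
      using inv_W[OF j] W_pos[OF j] rho rho_pow by (intro mult_left_mono mult_mono) auto
    finally show ?thesis by (simp add: mult_ac)
  qed
  then have "(\<Sum>j<m. \<bar>Q j (i ! j) (i' ! j) * V j (skip_mode j i) (skip_mode j i')\<bar>) \<le> (\<Sum>j<m. (2 + \<rho>) * \<rho> ^ m * (dbar ds / Wt))"
    by (intro sum_mono) auto
  then have 2: "\<bar>\<Sum>j<m. Q j (i ! j) (i' ! j) * V j (skip_mode j i) (skip_mode j i')\<bar> \<le> real m * (2 + \<rho>) * \<rho> ^ m * (dbar ds / Wt)"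
    using order_trans[OF sum_abs] by (simp add: mult_ac)
  have "\<bar>Ker i i'\<bar> \<le> \<rho> ^ m * (dbar ds / Wt) + real m * (2 + \<rho>) * \<rho> ^ m * (dbar ds / Wt)"
    unfolding Ker_def using 1 2 by linarith
  also have "\<dots> = A1 * (dbar ds / Wt)" unfolding A1_def by (rule distrib_right[symmetric])
  finally show ?thesis .
qed

lemma Ker_row_l1:
  assumes i: "i \<in> idx ds"
  shows "(\<Sum>i'\<in>idx ds. \<bar>Ker i i'\<bar>) \<le> A1"
proof -
  have 1: "(\<Sum>i'\<in>idx ds. \<bar>kern m P i i'\<bar>) \<le> (\<Prod>k<m. \<rho>)"
    using P_row_l1 nth_idx[OF i] by (intro kern_l1_le) auto
  have "(\<Sum>i'\<in>idx ds. \<bar>Q j (i ! j) (i' ! j) * V j (skip_mode j i) (skip_mode j i')\<bar>) \<le> (2 + \<rho>) * \<rho> ^ m" if j: "j < m" for j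
  proof -
    have "(\<Sum>i'\<in>idx ds. \<bar>Q j (i ! j) (i' ! j) * V j (skip_mode j i) (skip_mode j i')\<bar>) \<le> (2 + \<rho>) * \<rho> ^ (m - 1)"
      unfolding l1_outer[OF j] using Q_row_l1[OF j] V_l1[OF j] nth_idx[OF i j] skip_in_idx[OF j i] rho
      by (intro mult_mono) (auto intro: sum_nonneg)
    also have "\<dots> \<le> (2 + \<rho>) * \<rho> ^ m" using rho rho_pow by (intro mult_left_mono) auto
    finally show ?thesis .
  qed
  then have 2: "(\<Sum>j<m. \<Sum>i'\<in>idx ds. \<bar>Q j (i ! j) (i' ! j) * V j (skip_mode j i) (skip_mode j i')\<bar>) \<le> (\<Sum>j<m. (2 + \<rho>) * \<rho> ^ m)"
    by (intro sum_mono) auto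
  have "(\<Sum>i'\<in>idx ds. \<bar>Ker i i'\<bar>) \<le> (\<Sum>i'\<in>idx ds. \<bar>kern m P i i'\<bar>
      + (\<Sum>j<m. \<bar>Q j (i ! j) (i' ! j) * V j (skip_mode j i) (skip_mode j i')\<bar>))"
    unfolding Ker_def by (intro sum_mono order_trans[OF abs_triangle_ineq] add_mono sum_abs order_refl)
  also have "\<dots> = (\<Sum>i'\<in>idx ds. \<bar>kern m P i i'\<bar>)
      + (\<Sum>j<m. \<Sum>i'\<in>idx ds. \<bar>Q j (i ! j) (i' ! j) * V j (skip_mode j i) (skip_mode j i')\<bar>)"
    by (subst sum.distrib, subst sum.swap) (rule refl)
  finally show ?thesis using 1 2 by (simp add: A1_def mult_ac)
qed

lemma PT_abs:
  assumes "i \<in> idx ds"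
  shows "\<bar>PT G i\<bar> \<le> A1 * (dbar ds / Wt) * l1_norm ds G"
proof -
  have "\<bar>PT G i\<bar> \<le> (\<Sum>i'\<in>idx ds. A1 * (dbar ds / Wt) * \<bar>G i'\<bar>)"
    using assms unfolding PT_def
    by (simp only: if_True, intro order_trans[OF sum_abs] sum_mono, unfold abs_mult, intro mult_right_mono Ker_abs[OF assms]) auto
  then show ?thesis by (simp add: l1_norm_def sum_distrib_left)
qed

lemma PT_l1: "l1_norm ds (PT G) \<le> A1 * l1_norm ds G"
proof -
  have "l1_norm ds (PT G) \<le> (\<Sum>i\<in>idx ds. \<Sum>i'\<in>idx ds. \<bar>Ker i i'\<bar> * \<bar>G i'\<bar>)"
    unfolding l1_norm_def PT_def by (intro sum_mono) (auto intro!: order_trans[OF sum_abs] sum_mono simp: abs_mult)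
  also have "\<dots> = (\<Sum>i'\<in>idx ds. (\<Sum>i\<in>idx ds. \<bar>Ker i' i\<bar>) * \<bar>G i'\<bar>)"
    by (subst sum.swap) (auto simp: sum_distrib_right Ker_sym intro!: sum.cong)
  also have "\<dots> \<le> (\<Sum>i'\<in>idx ds. A1 * \<bar>G i'\<bar>)"
    using Ker_row_l1 by (intro sum_mono mult_right_mono) auto
  finally show ?thesis by (simp add: l1_norm_def sum_distrib_left)
qed

end

subsection \<open>Perturbation of tangent projectors\<close>

text \<open>A crude bound on an operator norm by the entries. It suffices because the square root of
  the number of entries is also the order of the singular values of the signal.\<close>

lemma L2_set_matvec:
  fixes X :: "'a \<Rightarrow> 'b \<Rightarrow> real"
  assumes "finite J" "finite I" "0 \<le> e" and X: "\<And>a u. a \<in> J \<Longrightarrow> u \<in> I \<Longrightarrow> \<bar>X a u\<bar> \<le> e"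
  shows "L2_set (\<lambda>u. \<Sum>a\<in>J. y a * X a u) I \<le> e * sqrt (real (card J) * real (card I)) * L2_set y J"
proof -
  have const: "L2_set (\<lambda>_. x) A = sqrt (real (card A)) * x" if "x \<ge> 0" for x :: real and A :: "'c set"
    using that by (simp add: L2_set_def real_sqrt_mult)
  have "\<bar>\<Sum>a\<in>J. y a * X a u\<bar> \<le> L2_set y J * (sqrt (real (card J)) * e)" if "u \<in> I" for u
  proof -
    have "\<bar>\<Sum>a\<in>J. y a * X a u\<bar> \<le> L2_set y J * L2_set (\<lambda>a. X a u) J" by (rule cauchy_schwarz_sum)
    also have "L2_set (\<lambda>a. X a u) J = L2_set (\<lambda>a. \<bar>X a u\<bar>) J" by (simp add: L2_set_def)
    also have "\<dots> \<le> L2_set (\<lambda>_. e) J" using X that by (intro L2_set_mono) auto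
    also have "\<dots> = sqrt (real (card J)) * e" using assms by (intro const)
    finally show ?thesis by (simp add: mult_left_mono)
  qed
  then have "L2_set (\<lambda>u. \<bar>\<Sum>a\<in>J. y a * X a u\<bar>) I \<le> L2_set (\<lambda>_. L2_set y J * (sqrt (real (card J)) * e)) I"
    by (intro L2_set_mono) auto
  also have "\<dots> = sqrt (real (card I)) * (L2_set y J * (sqrt (real (card J)) * e))"
    using assms by (intro const) auto
  also have "L2_set (\<lambda>u. \<bar>\<Sum>a\<in>J. y a * X a u\<bar>) I = L2_set (\<lambda>u. \<Sum>a\<in>J. y a * X a u) I"
    by (simp add: L2_set_def)
  finally show ?thesis by (simp add: real_sqrt_mult mult_ac)
qed

text \<open>At least half of a vector in the range of \<open>Ph\<close> survives \<open>P\<close>,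
  since \<open>e \<le> 1 / 2\<close>; this leaves \<open>c / 2\<close>. Replacing \<open>T\<close>
  by \<open>Th\<close> costs another \<open>c / 4\<close>.\<close>

lemma perturbed_lower_bound:
  fixes T Th :: tensor
  assumes j: "j < length ds"
    and low: "\<And>y. c * sqrt (real (prod_list ds)) * L2_set (\<lambda>a. \<Sum>b<ds ! j. P a b * y b) {..<ds ! j}
        \<le> L2_set (\<lambda>u. \<Sum>a<ds ! j. y a * T (ins j a u)) (idx (skip_mode j ds))"
    and e: "0 \<le> e" "e \<le> 1 / 2" "e \<le> c / 4" and c: "0 < c"
    and dop: "\<And>y. L2_set (\<lambda>a. \<Sum>b<ds ! j. (Ph a b - P a b) * y b) {..<ds ! j} \<le> e * L2_set y {..<ds ! j}"
    and dinf: "\<And>i. i \<in> idx ds \<Longrightarrow> \<bar>Th i - T i\<bar> \<le> e"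
    and y: "\<And>a. a < ds ! j \<Longrightarrow> (\<Sum>b<ds ! j. Ph a b * y b) = y a"
  shows "c / 4 * sqrt (real (prod_list ds)) * L2_set y {..<ds ! j}
    \<le> L2_set (\<lambda>u. \<Sum>a<ds ! j. y a * Th (ins j a u)) (idx (skip_mode j ds))"
proof -
  let ?J = "{..<ds ! j}" and ?I = "idx (skip_mode j ds)" and ?W = "sqrt (real (prod_list ds))"
  let ?y = "L2_set y ?J"
  have "?y \<le> L2_set (\<lambda>a. \<Sum>b<ds ! j. P a b * y b) ?J + L2_set (\<lambda>a. \<Sum>b<ds ! j. (Ph a b - P a b) * y b) ?J"
  proof -
    have "?y = L2_set (\<lambda>a. (\<Sum>b<ds ! j. P a b * y b) + (\<Sum>b<ds ! j. (Ph a b - P a b) * y b)) ?J"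
      using y by (intro L2_set_cong refl) (auto simp: left_diff_distrib sum_subtractf)
    then show ?thesis using L2_set_triangle_ineq by simp
  qed
  also have "\<dots> \<le> L2_set (\<lambda>a. \<Sum>b<ds ! j. P a b * y b) ?J + 1 / 2 * ?y"
    using dop[of y] e(2) by (meson L2_set_nonneg add_left_mono mult_right_mono order_trans)
  finally have "?y / 2 \<le> L2_set (\<lambda>a. \<Sum>b<ds ! j. P a b * y b) ?J" by simp
  then have "c * ?W * (?y / 2) \<le> c * ?W * L2_set (\<lambda>a. \<Sum>b<ds ! j. P a b * y b) ?J"
    using c by (intro mult_left_mono) auto
  also have "\<dots> \<le> L2_set (\<lambda>u. \<Sum>a<ds ! j. y a * T (ins j a u)) ?I" by (rule low)
  also have "\<dots> \<le> L2_set (\<lambda>u. \<Sum>a<ds ! j. y a * Th (ins j a u)) ?I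
      + L2_set (\<lambda>u. \<Sum>a<ds ! j. y a * (Th (ins j a u) - T (ins j a u))) ?I"
    using L2_set_diff[of "\<lambda>u. \<Sum>a<ds ! j. y a * Th (ins j a u)" "\<lambda>u. \<Sum>a<ds ! j. y a * (Th (ins j a u) - T (ins j a u))" ?I]
    by (simp add: right_diff_distrib sum_subtractf)
  also have "L2_set (\<lambda>u. \<Sum>a<ds ! j. y a * (Th (ins j a u) - T (ins j a u))) ?I \<le> e * ?W * ?y"
    using L2_set_matvec[of ?J ?I e "\<lambda>a u. Th (ins j a u) - T (ins j a u)" y] dinf ins_in_idx[OF j] e
      prod_list_skip[OF j] by (simp add: card_idx)
  also have "e * ?W * ?y \<le> c / 4 * ?W * ?y" using e by (intro mult_right_mono) auto
  finally show ?thesis by simp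
qed

lemma orthonormal_colsD:
  assumes "orthonormal_cols d p U" "b < p"
  shows "(\<Sum>l<p. (\<Sum>a<d. U a b * U a l) * s l) = s b"
proof -
  have "(\<Sum>l<p. (\<Sum>a<d. U a b * U a l) * s l) = (\<Sum>l<p. idm b l * s l)"
    using assms by (intro sum.cong) (auto simp: orthonormal_cols_def idm_def)
  then show ?thesis using assms by (simp add: idm_mult_left)
qed

text \<open>Let \<open>s\<close> be the vector of column sums of \<open>U 0\<close> and
  \<open>y\<close> its image under \<open>U 0\<close>. Contracting the first mode of
  \<open>T\<close> with \<open>y\<close> gives the same as contracting it with the constant vector
  1, namely zero. Injectivity yields \<open>y = 0\<close>, and then \<open>s = 0\<close>.\<close>

lemma zero_sum_factor:
  assumes ds: "ds \<noteq> []" and len: "length r = length ds"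
    and U: "orthonormal_cols (ds ! 0) (r ! 0) (U 0)"
    and T: "T = mode_product ds r C U" and zs: "zero_sum ds T"
    and inj: "\<And>y a. (\<And>a. a < ds ! 0 \<Longrightarrow> (\<Sum>b<ds ! 0. col_proj (r ! 0) (U 0) a b * y b) = y a) \<Longrightarrow>
      (\<And>u. u \<in> idx (skip_mode 0 ds) \<Longrightarrow> (\<Sum>a<ds ! 0. y a * T (ins 0 a u)) = 0) \<Longrightarrow> a < ds ! 0 \<Longrightarrow> y a = 0"
    and b: "b < r ! 0"
  shows "(\<Sum>a<ds ! 0. U 0 a b) = 0"
proof -
  define s where "s = (\<lambda>b. \<Sum>a<ds ! 0. U 0 a b)"
  define y where "y = (\<lambda>a. \<Sum>l<r ! 0. U 0 a l * s l)"
  have Uy: "(\<Sum>a<ds ! 0. U 0 a b * y a) = s b" if "b < r ! 0" for b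
  proof -
    have "(\<Sum>a<ds ! 0. U 0 a b * y a) = (\<Sum>l<r ! 0. (\<Sum>a<ds ! 0. U 0 a b * U 0 a l) * s l)"
      unfolding y_def sum_distrib_left sum_distrib_right by (subst sum.swap) (simp add: mult_ac)
    then show ?thesis using orthonormal_colsD[OF U that] by simp
  qed
  have "y a = 0" if "a < ds ! 0" for a
  proof (rule inj[OF _ _ that])
    fix a
    have "(\<Sum>b<ds ! 0. col_proj (r ! 0) (U 0) a b * y b)
      = (\<Sum>l<r ! 0. (\<Sum>b<ds ! 0. col_proj (r ! 0) (U 0) a b * U 0 b l) * s l)"
      unfolding y_def sum_distrib_left sum_distrib_right by (subst sum.swap) (simp add: mult_ac)
    also have "\<dots> = y a" unfolding y_def using col_proj_mult[OF U] by (intro sum.cong) auto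
    finally show "(\<Sum>b<ds ! 0. col_proj (r ! 0) (U 0) a b * y b) = y a" .
  next
    fix u assume u: "u \<in> idx (skip_mode 0 ds)"
    define g where "g = (\<lambda>b. mode_product (skip_mode 0 ds) (skip_mode 0 r) (unfold_mode 0 C b) (\<lambda>k. U (shift 0 k)) u)"
    have Tg: "T (ins 0 a u) = (\<Sum>b<r ! 0. U 0 a b * g b)" if "a < ds ! 0" for a
      unfolding T g_def using that u ds len by (intro mode_product_unfold) auto
    have "(\<Sum>a<ds ! 0. y a * T (ins 0 a u)) = (\<Sum>b<r ! 0. (\<Sum>a<ds ! 0. U 0 a b * y a) * g b)"
      using Tg by (simp add: sum_distrib_left sum_distrib_right, subst sum.swap) (simp add: mult_ac)
    also have "\<dots> = (\<Sum>b<r ! 0. s b * g b)" using Uy by simp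
    also have "\<dots> = (\<Sum>a<ds ! 0. T (ins 0 a u))"
      using Tg unfolding s_def by (simp add: sum_distrib_right, subst sum.swap) simp
    also have "\<dots> = 0"
      using zs u ds by (auto simp: zero_sum_def ins_def skip_mode_def drop_Suc hd_conv_nth)
    finally show "(\<Sum>a<ds ! 0. y a * T (ins 0 a u)) = 0" .
  qed
  then show ?thesis using Uy[OF b] by (simp add: s_def)
qed

context tucker
begin

text \<open>Elements of the row space are contractions of \<open>T\<close> with some vector, and
  that vector may be projected first, since \<open>P j\<close> fixes \<open>T\<close>. The lower
  bounds on singular values apply to such projected vectors.\<close>

lemma V_range:
  assumes j: "j < m"
  shows "\<exists>y. (\<forall>a<ds ! j. (\<Sum>b<ds ! j. P j a b * y b) = y a) \<and>
    (\<forall>u\<in>idx (skip_mode j ds). apply_kernel (idx (skip_mode j ds)) (V j) x u = (\<Sum>a<ds ! j. y a * T (ins j a u)))"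
proof -
  let ?I = "idx (skip_mode j ds)"
  obtain n where n: "\<And>u u'. u \<in> ?I \<Longrightarrow> u' \<in> ?I \<Longrightarrow> V j u u' = (\<Sum>b<ds ! j. n b u * T (ins j b u'))"
    using V_coeff[of j] by blast
  define y0 where "y0 = (\<lambda>b. \<Sum>u\<in>?I. n b u * x u)"
  define y where "y = (\<lambda>a. \<Sum>b<ds ! j. P j a b * y0 b)"
  have "(\<Sum>b<ds ! j. P j a b * y b) = y a" for a
  proof -
    have "(\<Sum>b<ds ! j. P j a b * y b) = (\<Sum>c<ds ! j. (\<Sum>b<ds ! j. P j a b * P j b c) * y0 c)"
      unfolding y_def sum_distrib_left sum_distrib_right by (subst sum.swap) (simp add: mult_ac)
    then show ?thesis unfolding y_def P_idem[OF j] .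
  qed
  moreover have "apply_kernel ?I (V j) x u = (\<Sum>a<ds ! j. y a * T (ins j a u))" if u: "u \<in> ?I" for u
  proof -
    have "apply_kernel ?I (V j) x u = (\<Sum>u'\<in>?I. \<Sum>b<ds ! j. n b u' * T (ins j b u) * x u')"
      using n[OF _ u] V_sym[OF u] by (auto simp: apply_kernel_def sum_distrib_right intro!: sum.cong)
    also have "\<dots> = (\<Sum>b<ds ! j. y0 b * T (ins j b u))"
      by (subst sum.swap) (simp add: y0_def sum_distrib_left sum_distrib_right mult_ac)
    also have "\<dots> = (\<Sum>b<ds ! j. y0 b * (\<Sum>a<ds ! j. P j b a * T (ins j a u)))"
      using mode_product_one[OF j _ u, of _ T "P j"] P_one_T[OF j] by simp
    also have "\<dots> = (\<Sum>a<ds ! j. \<Sum>b<ds ! j. P j b a * y0 b * T (ins j a u))"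
      unfolding sum_distrib_left by (subst sum.swap) (simp add: mult_ac)
    also have "\<dots> = (\<Sum>a<ds ! j. y a * T (ins j a u))"
      unfolding y_def sum_distrib_right by (intro sum.cong refl) (subst P_sym, rule refl)
    finally show ?thesis .
  qed
  ultimately show ?thesis by blast
qed

end

text \<open>A vector \<open>w\<close> of the row space of \<open>T\<close> is a contraction of
  \<open>T\<close> with \<open>y\<close>, and the same contraction of \<open>T'\<close> lies in the
  row space of \<open>T'\<close>. Its distance to \<open>w\<close> is at most \<open>e * ?W\<close>
  times the norm of \<open>y\<close>, and the lower bound converts the norm of \<open>y\<close> into
  that of \<open>w\<close>. This is one of the two gaps in \<open>proj_close\<close>.\<close>

lemma wedin_half:
  assumes "tucker ds r C U T" "tucker ds r C' U' T'" and j: "j < length ds"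
    and e: "0 \<le> e" and c: "0 < c"
    and low: "\<And>y. (\<And>a. a < ds ! j \<Longrightarrow> (\<Sum>b<ds ! j. tucker.P r U j a b * y b) = y a) \<Longrightarrow>
      c * sqrt (real (prod_list ds)) * L2_set y {..<ds ! j}
      \<le> L2_set (\<lambda>u. \<Sum>a<ds ! j. y a * T (ins j a u)) (idx (skip_mode j ds))"
    and dinf: "\<And>i. i \<in> idx ds \<Longrightarrow> \<bar>T i - T' i\<bar> \<le> e"
  defines "I \<equiv> idx (skip_mode j ds)"
  shows "L2_set (\<lambda>u. apply_kernel I (tucker.V ds T j) x u
      - apply_kernel I (tucker.V ds T' j) (apply_kernel I (tucker.V ds T j) x) u) I
    \<le> e / c * L2_set (apply_kernel I (tucker.V ds T j) x) I"
proof -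
  interpret A: tucker ds r C U T by fact
  interpret B: tucker ds r C' U' T' by fact
  let ?W = "sqrt (real (prod_list ds))"
  define w where "w = apply_kernel I (A.V j) x"
  obtain y where y: "\<And>a. a < ds ! j \<Longrightarrow> (\<Sum>b<ds ! j. A.P j a b * y b) = y a"
    and w: "\<And>u. u \<in> I \<Longrightarrow> w u = (\<Sum>a<ds ! j. y a * T (ins j a u))"
    using A.V_range[OF j, of x] unfolding w_def I_def by blast
  define g where "g = (\<lambda>u. \<Sum>a<ds ! j. y a * (T (ins j a u) - T' (ins j a u)))"
  define h where "h = (\<lambda>u. \<Sum>a<ds ! j. y a * T' (ins j a u))"
  have wgh: "w u = g u + h u" if "u \<in> I" for u
    using w[OF that] by (simp add: g_def h_def right_diff_distrib sum_subtractf)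
  have Vh: "apply_kernel I (B.V j) h u = h u" if u: "u \<in> I" for u
  proof -
    have "apply_kernel I (B.V j) h u = (\<Sum>a<ds ! j. y a * (\<Sum>u'\<in>I. B.V j u u' * T' (ins j a u')))"
      unfolding apply_kernel_def h_def sum_distrib_left by (subst sum.swap) (simp add: mult_ac)
    also have "\<dots> = h u" unfolding h_def using B.V_T[of _ j u] u by (intro sum.cong) (auto simp: I_def)
    finally show ?thesis .
  qed
  have "apply_kernel I (B.V j) w u = apply_kernel I (B.V j) g u + h u" if "u \<in> I" for u
  proof -
    have "apply_kernel I (B.V j) w u = apply_kernel I (B.V j) (\<lambda>u. g u + h u) u"
      by (rule apply_kernel_cong) (rule wgh)
    then show ?thesis using Vh[OF that] by (simp add: apply_kernel_def distrib_left sum.distrib)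
  qed
  then have "L2_set (\<lambda>u. w u - apply_kernel I (B.V j) w u) I = L2_set (\<lambda>u. g u - apply_kernel I (B.V j) g u) I"
    using wgh by (intro L2_set_cong) auto
  also have "\<dots> \<le> L2_set g I"
    using proj_compl_contraction[OF B.V_proj[of j]] by (simp add: I_def)
  also have "\<dots> \<le> e * ?W * L2_set y {..<ds ! j}"
    unfolding g_def I_def
    using L2_set_matvec[of "{..<ds ! j}" "idx (skip_mode j ds)" e "\<lambda>a u. T (ins j a u) - T' (ins j a u)" y]
      dinf ins_in_idx[OF j] e prod_list_skip[OF j] by (simp add: card_idx)
  also have "\<dots> = e / c * (c * ?W * L2_set y {..<ds ! j})" using c by simp
  also have "\<dots> \<le> e / c * L2_set w I"
  proof (rule mult_left_mono)
    have "L2_set w I = L2_set (\<lambda>u. \<Sum>a<ds ! j. y a * T (ins j a u)) I" using w by (intro L2_set_cong) auto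
    then show "c * ?W * L2_set y {..<ds ! j} \<le> L2_set w I" using low[of y] y by (simp add: I_def)
  qed (use e c in simp)
  finally show ?thesis by (simp add: w_def)
qed

section \<open>The true tensor and its estimate compared\<close>

locale tucker_pair = S: tucker_inc ds r C U T \<rho> + E: tucker_inc ds r Ch Uh Th \<rho>
  for ds r C U T \<rho> Ch Uh Th +
  fixes e c B :: real
  assumes e: "0 \<le> e" "e \<le> 1 / 2" "e \<le> c / 4" and c: "0 < c" and B: "0 \<le> B"
    and drow: "\<And>k a. k < length ds \<Longrightarrow> a < ds ! k \<Longrightarrow>
      L2_set (\<lambda>b. E.P k a b - S.P k a b) {..<ds ! k} \<le> e * sqrt (\<rho> / real (ds ! k))"
    and dmax: "\<And>k a b. k < length ds \<Longrightarrow> a < ds ! k \<Longrightarrow> b < ds ! k \<Longrightarrow>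
      \<bar>E.P k a b - S.P k a b\<bar> \<le> e * (\<rho> / real (ds ! k))"
    and dop: "\<And>k y. k < length ds \<Longrightarrow>
      L2_set (\<lambda>a. \<Sum>b<ds ! k. (E.P k a b - S.P k a b) * y b) {..<ds ! k} \<le> e * L2_set y {..<ds ! k}"
    and dinf: "\<And>i. i \<in> idx ds \<Longrightarrow> \<bar>Th i - T i\<bar> \<le> e"
    and TB: "\<And>i. i \<in> idx ds \<Longrightarrow> \<bar>T i\<bar> \<le> B"
    and low: "\<And>j y. j < length ds \<Longrightarrow>
      c * sqrt (real (prod_list ds)) * L2_set (\<lambda>a. \<Sum>b<ds ! j. S.P j a b * y b) {..<ds ! j}
        \<le> L2_set (\<lambda>u. \<Sum>a<ds ! j. y a * T (ins j a u)) (idx (skip_mode j ds))"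
begin

abbreviation "m \<equiv> length ds"
abbreviation "Wt \<equiv> real (prod_list ds)"

lemma V_apply_diff:
  assumes j: "j < m"
  shows "L2_set (\<lambda>u. apply_kernel (idx (skip_mode j ds)) (E.V j) x u - apply_kernel (idx (skip_mode j ds)) (S.V j) x u)
    (idx (skip_mode j ds)) \<le> 2 * (e / (c / 4)) * L2_set x (idx (skip_mode j ds))"
proof (rule proj_close[OF S.V_proj E.V_proj])
  let ?I = "idx (skip_mode j ds)"
  show "0 \<le> e / (c / 4)" using e c by simp
  show "L2_set (\<lambda>u. apply_kernel ?I (E.V j) x u - apply_kernel ?I (S.V j) (apply_kernel ?I (E.V j) x) u) ?I
    \<le> e / (c / 4) * L2_set (apply_kernel ?I (E.V j) x) ?I" for x
    using perturbed_lower_bound[OF j low[OF j] e c dop[OF j] dinf] e c dinf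
    by (intro wedin_half[OF E.tucker_axioms S.tucker_axioms j]) auto
  \<comment> \<open>At the truth the lower bound holds with \<open>c\<close>; it is weakened so that
    both gaps have the constant \<open>e / (c / 4)\<close>.\<close>
  have "c / 4 * sqrt Wt * L2_set y {..<ds ! j} \<le> L2_set (\<lambda>u. \<Sum>a<ds ! j. y a * T (ins j a u)) ?I"
    if "\<And>a. a < ds ! j \<Longrightarrow> (\<Sum>b<ds ! j. S.P j a b * y b) = y a" for y
  proof -
    have "c / 4 * sqrt Wt * L2_set y {..<ds ! j} \<le> c * sqrt Wt * L2_set y {..<ds ! j}"
      using c by (intro mult_right_mono) auto
    moreover have "L2_set (\<lambda>a. \<Sum>b<ds ! j. S.P j a b * y b) {..<ds ! j} = L2_set y {..<ds ! j}"
      using that by (intro L2_set_cong) auto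
    ultimately show ?thesis using low[OF j, of y] by simp
  qed
  then show "L2_set (\<lambda>u. apply_kernel ?I (S.V j) x u - apply_kernel ?I (E.V j) (apply_kernel ?I (S.V j) x) u) ?I
    \<le> e / (c / 4) * L2_set (apply_kernel ?I (S.V j) x) ?I" for x
    using e c dinf by (intro wedin_half[OF S.tucker_axioms E.tucker_axioms j]) (auto simp: abs_minus_commute)
qed

text \<open>The summand \<open>8 / c\<close> is twice the gap constant \<open>1 / (c / 4)\<close>,
  and the other summand comes from telescoping the kernels \<open>pk\<close>.\<close>

definition A2 :: real where "A2 = 8 / c + real m * 2 ^ m"

text \<open>As V = V pk for both tensors, the difference of rows is (V' - V) pk' + V (pk' - pk). The
  operator-norm bound on V' - V acts on a vector that is already of the incoherent size, so no
  factor is lost in passing to single rows.\<close>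

lemma V_row_diff:
  assumes j: "j < m" and u: "u \<in> idx (skip_mode j ds)"
  shows "L2_set (\<lambda>w. E.V j u w - S.V j u w) (idx (skip_mode j ds)) \<le> A2 * e * sqrt (\<rho> ^ (m - 1) / S.W j)"
proof -
  let ?I = "idx (skip_mode j ds)"
  let ?s = "sqrt (\<rho> ^ (m - 1) / S.W j)"
  have l: "length (skip_mode j ds) = m - 1" using j by (rule length_skip)
  have s0: "0 \<le> ?s" using S.rho S.W_pos[OF j] by simp
  have pd: "L2_set (\<lambda>w. E.pk j u w - S.pk j u w) ?I \<le> real m * 2 ^ m * e * ?s"
  proof -
    have "L2_set (\<lambda>w. kern (length (skip_mode j ds)) (\<lambda>k. E.P (shift j k)) u w
        - kern (length (skip_mode j ds)) (\<lambda>k. S.P (shift j k)) u w) ?I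
      \<le> real (length (skip_mode j ds)) * 2 ^ length (skip_mode j ds) * e * (\<Prod>k<length (skip_mode j ds). sqrt (\<rho> / real (skip_mode j ds ! k)))"
    proof (rule kern_diff_L2)
      fix k assume k: "k < length (skip_mode j ds)"
      then have *: "shift j k < m" "skip_mode j ds ! k = ds ! shift j k" "u ! k < ds ! shift j k"
        using shift_less[OF j] nth_skip[OF j] nth_idx[OF u k] l by auto
      show "0 \<le> sqrt (\<rho> / real (skip_mode j ds ! k))" using S.rho by simp
      show "L2_set (S.P (shift j k) (u ! k)) {..<skip_mode j ds ! k} \<le> sqrt (\<rho> / real (skip_mode j ds ! k))"
        using S.P_row_L2 * by simp
      show "L2_set (\<lambda>b. E.P (shift j k) (u ! k) b - S.P (shift j k) (u ! k) b) {..<skip_mode j ds ! k}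
        \<le> e * sqrt (\<rho> / real (skip_mode j ds ! k))"
        using drow * by simp
    qed (use e in auto)
    also have "\<dots> = real (m - 1) * 2 ^ (m - 1) * e * ?s"
      using prod_sqrt_ratio[OF l, of \<rho>] l by (simp add: S.W_def)
    also have "\<dots> \<le> real m * 2 ^ m * e * ?s"
      using e s0 by (intro mult_right_mono mult_mono power_increasing) auto
    finally show ?thesis by (simp add: E.pk_def S.pk_def l)
  qed
  have "L2_set (\<lambda>w. E.V j u w - S.V j u w) ?I
    = L2_set (\<lambda>w. (apply_kernel ?I (E.V j) (E.pk j u) w - apply_kernel ?I (S.V j) (E.pk j u) w)
        + apply_kernel ?I (S.V j) (\<lambda>w. E.pk j u w - S.pk j u w) w) ?I"
    using E.V_pk[OF j _ u] S.V_pk[OF j _ u] E.V_sym[OF u] S.V_sym[OF u]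
    by (intro L2_set_cong) (auto simp: apply_kernel_diff)
  also have "\<dots> \<le> L2_set (\<lambda>w. apply_kernel ?I (E.V j) (E.pk j u) w - apply_kernel ?I (S.V j) (E.pk j u) w) ?I
    + L2_set (apply_kernel ?I (S.V j) (\<lambda>w. E.pk j u w - S.pk j u w)) ?I" by (rule L2_set_triangle_ineq)
  also have "\<dots> \<le> 2 * (e / (c / 4)) * ?s + real m * 2 ^ m * e * ?s"
  proof (rule add_mono)
    have "2 * (e / (c / 4)) * L2_set (E.pk j u) ?I \<le> 2 * (e / (c / 4)) * ?s"
      using E.pk_L2[OF j u] e c by (intro mult_left_mono) auto
    then show "L2_set (\<lambda>w. apply_kernel ?I (E.V j) (E.pk j u) w - apply_kernel ?I (S.V j) (E.pk j u) w) ?I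
      \<le> 2 * (e / (c / 4)) * ?s" using V_apply_diff[OF j, of "E.pk j u"] by linarith
    show "L2_set (apply_kernel ?I (S.V j) (\<lambda>w. E.pk j u w - S.pk j u w)) ?I \<le> real m * 2 ^ m * e * ?s"
      using proj_contraction[OF S.V_proj, of j "\<lambda>w. E.pk j u w - S.pk j u w"] pd by linarith
  qed
  also have "\<dots> = A2 * e * ?s" by (simp add: A2_def distrib_right)
  finally show ?thesis .
qed

definition A3 :: real where
  "A3 = sqrt (\<rho> ^ m) * (real m * 2 ^ m + real m * ((2 + \<rho>) * A2 + 1))"

lemma A2_nonneg: "0 \<le> A2" using c by (simp add: A2_def)

lemma sqrt_W_le: "j < m \<Longrightarrow> sqrt (\<rho> ^ (m - 1) / S.W j) \<le> sqrt (\<rho> ^ m) * sqrt (dbar ds / Wt)"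
proof -
  assume j: "j < m"
  have "\<rho> ^ (m - 1) * (1 / S.W j) \<le> \<rho> ^ m * (dbar ds / Wt)"
    using S.inv_W[OF j] S.W_pos[OF j] S.rho S.rho_pow by (intro mult_mono) auto
  then show ?thesis by (simp add: real_sqrt_mult[symmetric])
qed

text \<open>The product rule in \<open>Q j\<close> and \<open>V j\<close>; the averaging term of
  \<open>Q 0\<close> cancels in the difference. The scale is the matching one: multiplied by the
  square root of \<open>dstar ds\<close> it becomes \<open>e * sqrt (dbar ds)\<close> up to a
  constant, that is, \<open>e\<close> times the lower bound on the standard deviation.\<close>

lemma Ker_row_diff:
  assumes i: "i \<in> idx ds"
  shows "L2_set (\<lambda>i'. E.Ker i i' - S.Ker i i') (idx ds) \<le> A3 * e * sqrt (dbar ds / Wt)"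
proof -
  let ?d = "sqrt (dbar ds / Wt)" and ?r = "sqrt (\<rho> ^ m)"
  have "L2_set (\<lambda>i'. kern m E.P i i' - kern m S.P i i') (idx ds)
    \<le> real m * 2 ^ m * e * (\<Prod>k<m. sqrt (\<rho> / real (ds ! k)))"
    using e S.rho S.P_row_L2 drow nth_idx[OF i] by (intro kern_diff_L2) auto
  also have "(\<Prod>k<m. sqrt (\<rho> / real (ds ! k))) = ?r * sqrt (1 / Wt)"
    by (subst prod_sqrt_ratio) (simp_all add: real_sqrt_divide)
  also have "real m * 2 ^ m * e * (?r * sqrt (1 / Wt)) \<le> real m * 2 ^ m * e * (?r * ?d)"
    using S.dbar_ge_1 S.Wt_pos e S.rho
    by (intro mult_left_mono real_sqrt_le_mono divide_right_mono) auto
  finally have 1: "L2_set (\<lambda>i'. kern m E.P i i' - kern m S.P i i') (idx ds) \<le> real m * 2 ^ m * e * (?r * ?d)" .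
  have 2: "L2_set (\<lambda>i'. E.Q j (i ! j) (i' ! j) * E.V j (skip_mode j i) (skip_mode j i')
      - S.Q j (i ! j) (i' ! j) * S.V j (skip_mode j i) (skip_mode j i')) (idx ds)
    \<le> ((2 + \<rho>) * A2 + 1) * e * (?r * ?d)" if j: "j < m" for j
  proof -
    let ?I = "idx (skip_mode j ds)"
    define a u where "a = i ! j" and "u = skip_mode j i"
    have a: "a < ds ! j" and u: "u \<in> ?I" using nth_idx[OF i j] skip_in_idx[OF j i] by (auto simp: a_def u_def)
    have "L2_set (\<lambda>i'. E.Q j a (i' ! j) * E.V j u (skip_mode j i') - S.Q j a (i' ! j) * S.V j u (skip_mode j i')) (idx ds)
      = L2_set (\<lambda>i'. E.Q j a (i' ! j) * (\<lambda>w. E.V j u w - S.V j u w) (skip_mode j i')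
          + (\<lambda>b. E.Q j a b - S.Q j a b) (i' ! j) * S.V j u (skip_mode j i')) (idx ds)"
      by (simp add: algebra_simps)
    also have "\<dots> \<le> L2_set (E.Q j a) {..<ds ! j} * L2_set (\<lambda>w. E.V j u w - S.V j u w) ?I
      + L2_set (\<lambda>b. E.Q j a b - S.Q j a b) {..<ds ! j} * L2_set (S.V j u) ?I"
      unfolding L2_set_outer[OF j, symmetric] by (rule L2_set_triangle_ineq)
    also have "\<dots> \<le> (2 + \<rho>) * (A2 * e * (?r * ?d)) + e * (?r * ?d)"
    proof (rule add_mono)
      have "L2_set (E.Q j a) {..<ds ! j} \<le> (\<Sum>b<ds ! j. \<bar>E.Q j a b\<bar>)" by (rule L2_set_le_sum_abs)
      then have q: "L2_set (E.Q j a) {..<ds ! j} \<le> 2 + \<rho>" using E.Q_row_l1[OF j a] by linarith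
      have "L2_set (\<lambda>w. E.V j u w - S.V j u w) ?I \<le> A2 * e * sqrt (\<rho> ^ (m - 1) / S.W j)"
        by (rule V_row_diff[OF j u])
      also have "\<dots> \<le> A2 * e * (?r * ?d)"
        using sqrt_W_le[OF j] A2_nonneg e by (intro mult_left_mono) auto
      finally show "L2_set (E.Q j a) {..<ds ! j} * L2_set (\<lambda>w. E.V j u w - S.V j u w) ?I \<le> (2 + \<rho>) * (A2 * e * (?r * ?d))"
        using q S.rho by (intro mult_mono) auto
      have "L2_set (\<lambda>b. E.Q j a b - S.Q j a b) {..<ds ! j} = L2_set (\<lambda>b. E.P j a b - S.P j a b) {..<ds ! j}"
        by (simp add: E.Q_def S.Q_def L2_set_def power2_commute)
      also have "\<dots> \<le> e * sqrt (\<rho> / real (ds ! j))" by (rule drow[OF j a])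
      finally have "L2_set (\<lambda>b. E.Q j a b - S.Q j a b) {..<ds ! j} * L2_set (S.V j u) ?I
        \<le> e * sqrt (\<rho> / real (ds ! j)) * sqrt (\<rho> ^ (m - 1) / S.W j)"
        using S.V_L2[OF j u] e S.rho by (intro mult_mono) auto
      also have "\<dots> = e * (?r * sqrt (1 / Wt))"
      proof -
        have "\<rho> * \<rho> ^ (m - 1) = \<rho> ^ m" using j by (cases m) auto
        then have "sqrt (\<rho> / real (ds ! j)) * sqrt (\<rho> ^ (m - 1) / S.W j) = sqrt (\<rho> ^ m * (1 / Wt))"
          by (simp add: real_sqrt_mult[symmetric] S.W_eq[OF j])
        then show ?thesis by (simp only: mult.assoc real_sqrt_mult)
      qed
      also have "\<dots> \<le> e * (?r * ?d)"
        using S.dbar_ge_1 S.Wt_pos e S.rho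
        by (intro mult_left_mono real_sqrt_le_mono divide_right_mono) auto
      finally show "L2_set (\<lambda>b. E.Q j a b - S.Q j a b) {..<ds ! j} * L2_set (S.V j u) ?I \<le> e * (?r * ?d)" .
    qed
    also have "\<dots> = ((2 + \<rho>) * A2 + 1) * e * (?r * ?d)" by (simp add: algebra_simps)
    finally show ?thesis by (simp add: a_def u_def)
  qed
  have "L2_set (\<lambda>i'. E.Ker i i' - S.Ker i i') (idx ds)
    = L2_set (\<lambda>i'. (kern m E.P i i' - kern m S.P i i')
      + (\<Sum>j<m. E.Q j (i ! j) (i' ! j) * E.V j (skip_mode j i) (skip_mode j i')
      - S.Q j (i ! j) (i' ! j) * S.V j (skip_mode j i) (skip_mode j i'))) (idx ds)"
    by (simp only: E.Ker_def S.Ker_def sum_subtractf add_diff_add)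
  also have "\<dots> \<le> L2_set (\<lambda>i'. kern m E.P i i' - kern m S.P i i') (idx ds)
      + (\<Sum>j<m. L2_set (\<lambda>i'. E.Q j (i ! j) (i' ! j) * E.V j (skip_mode j i) (skip_mode j i')
      - S.Q j (i ! j) (i' ! j) * S.V j (skip_mode j i) (skip_mode j i')) (idx ds))"
    by (intro order_trans[OF L2_set_triangle_ineq] add_left_mono L2_set_sum) simp
  also have "\<dots> \<le> real m * 2 ^ m * e * (?r * ?d) + (\<Sum>j<m. ((2 + \<rho>) * A2 + 1) * e * (?r * ?d))"
    using 1 2 by (intro add_mono sum_mono) auto
  also have "\<dots> = A3 * e * ?d" by (simp add: A3_def algebra_simps)
  finally show ?thesis .
qed

lemma PT_diff:
  "L2_set (\<lambda>i. E.PT G i - S.PT G i) (idx ds) \<le> A3 * e * sqrt (dbar ds / Wt) * l1_norm ds G"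
proof -
  have "L2_set (\<lambda>i. E.PT G i - S.PT G i) (idx ds)
    = L2_set (\<lambda>i. \<Sum>i'\<in>idx ds. G i' * (E.Ker i' i - S.Ker i' i)) (idx ds)"
    by (rule L2_set_cong) (auto simp: E.PT_def S.PT_def sum_subtractf[symmetric] E.Ker_sym S.Ker_sym algebra_simps intro!: sum.cong)
  also have "\<dots> \<le> (\<Sum>i'\<in>idx ds. \<bar>G i'\<bar> * L2_set (\<lambda>i. E.Ker i' i - S.Ker i' i) (idx ds))"
    by (rule order_trans[OF L2_set_sum]) (auto simp: L2_set_scale)
  also have "\<dots> \<le> (\<Sum>i'\<in>idx ds. \<bar>G i'\<bar> * (A3 * e * sqrt (dbar ds / Wt)))"
    by (intro sum_mono mult_left_mono Ker_row_diff) auto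
  finally show ?thesis by (simp add: l1_norm_def sum_distrib_left sum_distrib_right mult_ac)
qed

text \<open>The factor \<open>1 + S.A1\<close> bounds the l_1 norm of the residual of
  \<open>G\<close>, and the other factor bounds the entries of \<open>T - H\<close> in units of
  \<open>e\<^sup>2\<close>.\<close>

definition A4 :: real where "A4 = (1 + S.A1) * ((real m)\<^sup>2 * \<rho> ^ m * B + real m * \<rho> ^ m)"

text \<open>The velocity \<open>H\<close> at \<open>Th\<close> is the first-order part of \<open>T - Th\<close>. The residual \<open>G - E.PT G\<close> is orthogonal
  to \<open>H\<close>, so only the second-order part of \<open>T\<close> remains.\<close>

lemma remainder:
  "\<bar>tinner ds (\<lambda>i. G i - E.PT G i) T\<bar> \<le> A4 * e\<^sup>2 * l1_norm ds G"
proof -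
  define D where "D = (\<lambda>k a b. S.P k a b - E.P k a b)"
  define H where "H = (\<lambda>i. mode_product ds ds T E.P i + (\<Sum>j<m. mode_product ds ds Th (one j (D j)) i))"
  have "H \<in> tangent_space ds r Th"
    unfolding H_def
    using E.tangent_spaceI[of D T] S.P0_colsum E.P0_colsum by (simp add: D_def sum_subtractf)
  then have orth: "tinner ds (\<lambda>i. G i - E.PT G i) H = 0" by (rule E.PT_orth)
  \<comment> \<open>Since \<open>Th\<close> is fixed by \<open>E.P\<close> in the modes other than
    \<open>j\<close>, its motion in mode \<open>j\<close> is a first-order term of the product
    kernel at \<open>E.P\<close>, which is what \<open>kern_second_order\<close> subtracts.\<close>
  have Th_slot: "mode_product ds ds Th (one j (D j)) = mode_product ds ds Th (E.P(j := D j))" if "j < m" for j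
  proof -
    have "mode_product ds ds Th (E.P(j := idm)) = Th"
      unfolding E.T_def mode_product_comp[OF refl]
      by (rule mode_product_cong) (auto simp: mmul_def E.PU E.len idm_mult_left)
    moreover have "mode_product ds ds (mode_product ds ds Th (E.P(j := idm))) (one j (D j))
      = mode_product ds ds Th (E.P(j := D j))"
      unfolding mode_product_comp[OF refl]
      by (rule mode_product_cong) (auto simp: mmul_def idm_mult_left idm_mult_right)
    ultimately show ?thesis by simp
  qed
  have bound: "\<bar>T i - H i\<bar> \<le> ((real m)\<^sup>2 * \<rho> ^ m * B + real m * \<rho> ^ m) * e\<^sup>2" if i: "i \<in> idx ds" for i
  proof -
    define K where "K = (\<lambda>l. kern m S.P i l - kern m E.P i l - (\<Sum>q<m. kern m (E.P(q := D q)) i l))"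
    have D1: "(\<Sum>b<ds ! k. \<bar>D k (i ! k) b\<bar>) \<le> e * \<rho>" if k: "k < m" for k
    proof -
      have "(\<Sum>b<ds ! k. \<bar>D k (i ! k) b\<bar>) \<le> (\<Sum>b<ds ! k. e * (\<rho> / real (ds ! k)))"
        using dmax[OF k nth_idx[OF i k]] by (intro sum_mono) (auto simp: D_def abs_minus_commute)
      then show ?thesis using S.dk[OF k] by simp
    qed
    have K: "(\<Sum>l\<in>idx ds. \<bar>K l\<bar>) \<le> (real m)\<^sup>2 * \<rho> ^ m * e\<^sup>2"
      unfolding K_def D_def using E.P_row_l1 S.P_row_l1 D1 nth_idx[OF i] e S.rho
      by (intro kern_second_order) (auto simp: D_def)
    have "T i - H i = mode_product ds ds T S.P i - H i" by (simp add: S.P_T)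
    \<comment> \<open>The Taylor remainder \<open>K\<close> acts on \<open>T\<close>, whereas the
      first-order terms of \<open>H\<close> act on \<open>Th\<close>. Exchanging \<open>Th\<close>
      for \<open>T\<close> there costs a factor differing from 0 by \<open>e\<close> in both the
      kernel and the tensor, again of second order.\<close>
    also have "\<dots> = (\<Sum>l\<in>idx ds. K l * T l) + (\<Sum>q<m. \<Sum>l\<in>idx ds. kern m (E.P(q := D q)) i l * (T l - Th l))"
    proof -
      have "(\<Sum>j<m. mode_product ds ds Th (one j (D j)) i) = (\<Sum>q<m. \<Sum>l\<in>idx ds. kern m (E.P(q := D q)) i l * Th l)"
        using Th_slot by (intro sum.cong) (auto simp: mode_product_in[OF i])
      moreover have "(\<Sum>q<m. \<Sum>l\<in>idx ds. kern m (E.P(q := D q)) i l * T l)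
        = (\<Sum>l\<in>idx ds. (\<Sum>q<m. kern m (E.P(q := D q)) i l) * T l)"
        by (subst sum.swap) (simp add: sum_distrib_right)
      ultimately show ?thesis
        by (simp add: H_def K_def mode_product_in[OF i] left_diff_distrib right_diff_distrib sum_subtractf)
    qed
    finally have "\<bar>T i - H i\<bar> = \<bar>(\<Sum>l\<in>idx ds. K l * T l)
      + (\<Sum>q<m. \<Sum>l\<in>idx ds. kern m (E.P(q := D q)) i l * (T l - Th l))\<bar>" by (rule arg_cong)
    also have "\<dots> \<le> (real m)\<^sup>2 * \<rho> ^ m * e\<^sup>2 * B + (\<Sum>q<m. e * \<rho> ^ m * e)"
    proof (rule order_trans[OF abs_triangle_ineq add_mono])
      have "\<bar>\<Sum>l\<in>idx ds. K l * T l\<bar> \<le> (\<Sum>l\<in>idx ds. \<bar>K l\<bar> * B)"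
        using TB by (intro order_trans[OF sum_abs] sum_mono) (auto simp: abs_mult intro!: mult_left_mono)
      also have "\<dots> \<le> (real m)\<^sup>2 * \<rho> ^ m * e\<^sup>2 * B"
        unfolding sum_distrib_right[symmetric] using K B by (rule mult_right_mono)
      finally show "\<bar>\<Sum>l\<in>idx ds. K l * T l\<bar> \<le> (real m)\<^sup>2 * \<rho> ^ m * e\<^sup>2 * B" .
      show "\<bar>\<Sum>q<m. \<Sum>l\<in>idx ds. kern m (E.P(q := D q)) i l * (T l - Th l)\<bar> \<le> (\<Sum>q<m. e * \<rho> ^ m * e)"
      proof (rule order_trans[OF sum_abs], rule sum_mono)
        fix q assume "q \<in> {..<m}"
        then have q: "q < m" by simp
        have "(\<Sum>l\<in>idx ds. \<bar>kern m (E.P(q := D q)) i l\<bar>) \<le> (\<Prod>k<m. (if k = q then e else 1) * \<rho>)"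
          using D1 E.P_row_l1 nth_idx[OF i] by (intro kern_l1_le) auto
        also have "\<dots> = e * \<rho> ^ m" using q by (simp add: prod.distrib prod.delta)
        finally have k1: "(\<Sum>l\<in>idx ds. \<bar>kern m (E.P(q := D q)) i l\<bar>) \<le> e * \<rho> ^ m" .
        have "\<bar>\<Sum>l\<in>idx ds. kern m (E.P(q := D q)) i l * (T l - Th l)\<bar>
          \<le> (\<Sum>l\<in>idx ds. \<bar>kern m (E.P(q := D q)) i l\<bar> * e)"
          using dinf by (intro order_trans[OF sum_abs] sum_mono)
            (auto simp: abs_mult abs_minus_commute intro!: mult_left_mono)
        also have "\<dots> \<le> e * \<rho> ^ m * e"
          unfolding sum_distrib_right[symmetric] using k1 e(1) by (rule mult_right_mono)
        finally show "\<bar>\<Sum>l\<in>idx ds. kern m (E.P(q := D q)) i l * (T l - Th l)\<bar> \<le> e * \<rho> ^ m * e" .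
      qed
    qed
    finally show ?thesis by (simp add: power2_eq_square algebra_simps)
  qed
  let ?b = "(real m)\<^sup>2 * \<rho> ^ m * B + real m * \<rho> ^ m"
  have "\<bar>tinner ds (\<lambda>i. G i - E.PT G i) T\<bar> = \<bar>tinner ds (\<lambda>i. G i - E.PT G i) (\<lambda>i. T i - H i)\<bar>"
    using orth by (simp add: tinner_def right_diff_distrib sum_subtractf)
  also have "\<dots> \<le> (\<Sum>i\<in>idx ds. (\<bar>G i\<bar> + \<bar>E.PT G i\<bar>) * (?b * e\<^sup>2))"
    unfolding tinner_def
    by (rule order_trans[OF sum_abs], rule sum_mono, unfold abs_mult, rule mult_mono) (use bound in auto)
  also have "\<dots> = (l1_norm ds G + l1_norm ds (E.PT G)) * (?b * e\<^sup>2)"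
    by (simp only: l1_norm_def sum_distrib_right[symmetric] sum.distrib)
  also have "\<dots> \<le> ((1 + S.A1) * l1_norm ds G) * (?b * e\<^sup>2)"
    using E.PT_l1[of G] B S.rho by (intro mult_right_mono mult_nonneg_nonneg add_nonneg_nonneg) (auto simp: distrib_right)
  finally show ?thesis by (simp add: A4_def mult_ac)
qed

end

subsection \<open>Spectral bounds\<close>

text \<open>A complex root exists and is real by assumption; its linear factor splits off over the
  reals and the degree drops.\<close>

lemma size_proots_real_rooted:
  fixes q :: "real poly"
  assumes "q \<noteq> 0" "\<And>z. poly (map_poly complex_of_real q) z = 0 \<Longrightarrow> z \<in> \<real>"
  shows "size (proots q) = degree q"
  using assms
proof (induction "degree q" arbitrary: q)
  case 0
  then show ?case using size_proots_le[of q] by simp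
next
  case (Suc n)
  interpret ph: map_poly_comm_ring_hom complex_of_real ..
  have "degree (map_poly complex_of_real q) = degree q" by (rule degree_map_poly) simp
  then have "\<not> constant (poly (map_poly complex_of_real q))" using Suc(2) by (simp add: constant_degree)
  then obtain z where z: "poly (map_poly complex_of_real q) z = 0"
    using fundamental_theorem_of_algebra by blast
  then obtain b where b: "z = of_real b" using Suc.prems(2) by (auto elim: Reals_cases)
  have "complex_of_real (poly q b) = 0" using z unfolding b by simp
  then have "poly q b = 0" by simp
  then obtain q' where q': "q = [:- b, 1:] * q'" by (auto simp: poly_eq_0_iff_dvd elim: dvdE)
  then have q'0: "q' \<noteq> 0" using Suc.prems(1) by auto
  have deg: "degree q = Suc (degree q')" using q'0 unfolding q' by (subst degree_mult_eq) auto
  have "map_poly complex_of_real q = map_poly complex_of_real [:- b, 1:] * map_poly complex_of_real q'"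
    unfolding q' by (rule ph.hom_mult)
  then have "size (proots q') = degree q'"
    using deg Suc.hyps q'0 Suc.prems(2) by (intro Suc.hyps(1)) auto
  moreover have "proots q = proots [:- b, 1:] + proots q'"
    unfolding q' using q'0 by (intro proots_mult) auto
  ultimately show ?case using deg by simp
qed

definition quad :: "nat \<Rightarrow> (nat \<Rightarrow> nat \<Rightarrow> real) \<Rightarrow> (nat \<Rightarrow> real) \<Rightarrow> (nat \<Rightarrow> real) \<Rightarrow> real" where
  "quad p g x y = (\<Sum>i<p. \<Sum>k<p. x i * g i k * y k)"

text \<open>For an eigenvector \<open>v\<close> of a complex eigenvalue \<open>z\<close>, the
  Hermitian form of the real symmetric matrix at \<open>v\<close> is its own conjugate and equals
  \<open>z\<close> times a positive number.\<close>

lemma symmetric_char_poly_splits: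
  fixes g :: "nat \<Rightarrow> nat \<Rightarrow> real"
  assumes sym: "\<And>i k. g i k = g k i"
  shows "size (proots (char_poly (Matrix.mat p p (\<lambda>(i, k). g i k)))) = p"
    and "char_poly (Matrix.mat p p (\<lambda>(i, k). g i k)) \<noteq> 0"
proof -
  let ?G = "Matrix.mat p p (\<lambda>(i, k). g i k)"
  let ?cG = "map_mat complex_of_real ?G"
  have G: "?G \<in> carrier_mat p p" and cG: "?cG \<in> carrier_mat p p" by auto
  have deg: "degree (char_poly ?G) = p" "monic (char_poly ?G)" using degree_monic_char_poly[OF G] by auto
  then show ne: "char_poly ?G \<noteq> 0" by auto
  have "z \<in> \<real>" if "poly (map_poly complex_of_real (char_poly ?G)) z = 0" for z
  proof -
    have "eigenvalue ?cG z"
      using that unfolding eigenvalue_root_char_poly[OF cG] of_real_hom.char_poly_hom[OF G] .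
    then obtain v where v: "v \<in> carrier_vec p" "v \<noteq> 0\<^sub>v p" "?cG *\<^sub>v v = z \<cdot>\<^sub>v v"
      unfolding eigenvalue_def eigenvector_def by auto
    have ev: "(\<Sum>k<p. of_real (g i k) * v $ k) = z * v $ i" if "i < p" for i
    proof -
      have "(?cG *\<^sub>v v) $ i = (\<Sum>k<p. of_real (g i k) * v $ k)"
        using that v(1) by (auto simp: scalar_prod_def lessThan_atLeast0 intro!: sum.cong)
      then show ?thesis using v that by simp
    qed
    define S where "S = (\<Sum>i<p. \<Sum>k<p. cnj (v $ i) * of_real (g i k) * v $ k)"
    define N where "N = (\<Sum>i<p. (cmod (v $ i))\<^sup>2)"
    have "S = (\<Sum>i<p. cnj (v $ i) * (\<Sum>k<p. of_real (g i k) * v $ k))"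
      by (simp add: S_def sum_distrib_left mult_ac)
    also have "\<dots> = (\<Sum>i<p. z * (v $ i * cnj (v $ i)))" using ev by (intro sum.cong) (auto simp: mult_ac)
    also have "\<dots> = (\<Sum>i<p. z * of_real ((cmod (v $ i))\<^sup>2))" by (simp only: complex_norm_square)
    also have "\<dots> = z * of_real N" by (simp add: N_def sum_distrib_left)
    finally have S: "S = z * of_real N" .
    have "cnj S = (\<Sum>i<p. \<Sum>k<p. v $ i * of_real (g i k) * cnj (v $ k))" by (simp add: S_def)
    also have "\<dots> = S" unfolding S_def by (subst sum.swap) (auto intro!: sum.cong simp: sym[of _ "_"] mult_ac)
    finally have "S \<in> \<real>" by (simp add: Reals_cnj_iff)
    obtain i where i: "i < p" "v $ i \<noteq> 0" using v(1,2) by (auto simp: vec_eq_iff)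
    have "0 < (cmod (v $ i))\<^sup>2" using i by simp
    also have "\<dots> \<le> N" unfolding N_def using i by (intro member_le_sum) auto
    finally have "N > 0" .
    then have "z = S / of_real N" using S by simp
    then show "z \<in> \<real>" using \<open>S \<in> \<real>\<close> by (simp add: Reals_divide)
  qed
  then show "size (proots (char_poly ?G)) = p" using size_proots_real_rooted[OF ne] deg by simp
qed

text \<open>Vectors are functions on all of \<open>nat\<close>. Padding with zeros beyond
  \<open>p\<close> makes the sphere a closed subset of a product of compact sets.\<close>

lemma compact_unit_sphere_fun:
  "compact {x :: nat \<Rightarrow> real. (\<forall>i\<ge>p. x i = 0) \<and> (\<Sum>i<p. (x i)\<^sup>2) = 1}" (is "compact ?S")
proof -
  let ?B = "PiE UNIV (\<lambda>i. if i < p then {-1..1} else {0}) :: (nat \<Rightarrow> real) set"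
  have "compactin (product_topology (\<lambda>i. euclidean) UNIV) ?B"
    unfolding compactin_PiE by (auto simp: compactin_euclidean_iff)
  then have B: "compact ?B" by (simp add: euclidean_product_topology compactin_euclidean_iff)
  have "closed {x :: nat \<Rightarrow> real. (\<Sum>i<p. (x i)\<^sup>2) = 1}"
    by (intro closed_Collect_eq continuous_intros) auto
  then have "compact (?B \<inter> {x. (\<Sum>i<p. (x i)\<^sup>2) = 1})" by (rule compact_Int_closed[OF B])
  also have "?B \<inter> {x. (\<Sum>i<p. (x i)\<^sup>2) = 1} = ?S"
  proof (rule subset_antisym; rule subsetI)
    fix x assume x: "x \<in> ?S"
    have "x i \<in> {-1..1}" if "i < p" for i
    proof -
      have "(x i)\<^sup>2 \<le> (\<Sum>i<p. (x i)\<^sup>2)" using that by (intro member_le_sum) auto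
      then have "\<bar>x i\<bar> \<le> 1" using x by (simp add: abs_square_le_1)
      then show ?thesis by (simp add: abs_le_iff)
    qed
    then show "x \<in> ?B \<inter> {x. (\<Sum>i<p. (x i)\<^sup>2) = 1}" using x by (auto simp: PiE_def Pi_def)
  next
    fix x assume x: "x \<in> ?B \<inter> {x. (\<Sum>i<p. (x i)\<^sup>2) = 1}"
    then have "x i \<in> (if i < p then {-1..1} else {0})" for i by (auto simp: PiE_def Pi_def)
    then have "x i = 0" if "i \<ge> p" for i using that by (metis not_le singletonD)
    then show "x \<in> ?S" using x by auto
  qed
  finally show ?thesis .
qed

text \<open>First-order optimality without derivatives: the chosen \<open>t\<close> is so small,
  relative to \<open>b\<close>, that the linear term dominates with a negative sign.\<close>

lemma linear_term_zero:
  fixes a b :: real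
  assumes "\<And>t. 0 \<le> 2 * t * a + t\<^sup>2 * b"
  shows "a = 0"
proof (rule ccontr)
  assume a: "a \<noteq> 0"
  define t where "t = - a / (\<bar>b\<bar> + 1)"
  have t: "t \<noteq> 0" "t * (\<bar>b\<bar> + 1) = - a" using a by (auto simp: t_def)
  have "t\<^sup>2 * b \<le> t\<^sup>2 * (\<bar>b\<bar> + 1)" by (intro mult_left_mono) auto
  also have "\<dots> = t * (- a)" using t by (simp add: power2_eq_square mult.assoc)
  finally have "t\<^sup>2 * b \<le> - (t * a)" by simp
  moreover have "0 \<le> 2 * (t * a) + t\<^sup>2 * b" using assms[of t] by (simp add: mult.assoc)
  moreover have "t * a < 0"
  proof -
    have "t * a = - (a * a / (\<bar>b\<bar> + 1))" by (simp add: t_def)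
    moreover have "0 < a * a / (\<bar>b\<bar> + 1)" using a by (intro divide_pos_pos) (auto simp: zero_less_mult_iff linorder_neq_iff)
    ultimately show ?thesis by linarith
  qed
  ultimately show False by linarith
qed

text \<open>\<open>sing_val\<close> is a list entry, so the characteristic polynomial must be shown to split; the minimal
  Rayleigh quotient of the Gram matrix is then one of its roots.\<close>

lemma sing_val_lower:
  fixes A :: "nat \<Rightarrow> 'j \<Rightarrow> real"
  assumes p: "1 \<le> p"
  shows "sing_val p J A p * L2_set x {..<p} \<le> L2_set (\<lambda>j. \<Sum>i<p. x i * A i j) J"
proof -
  define g where "g = (\<lambda>i i'. \<Sum>j\<in>J. A i j * A i' j)"
  let ?G = "Matrix.mat p p (\<lambda>(i, i'). g i i')"
  have G: "?G \<in> carrier_mat p p" by simp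
  have sym: "g i k = g k i" for i k by (simp add: g_def mult_ac)
  note split = symmetric_char_poly_splits[of g p, OF sym]
  define q where "q = (\<lambda>x. \<Sum>j\<in>J. (\<Sum>i<p. x i * A i j)\<^sup>2)"
  have q_quad: "q x = quad p g x x" for x
  proof -
    have "q x = (\<Sum>j\<in>J. \<Sum>i<p. \<Sum>k<p. (x i * A i j) * (x k * A k j))"
      by (simp add: q_def power2_eq_square sum_product)
    also have "\<dots> = (\<Sum>i<p. \<Sum>j\<in>J. \<Sum>k<p. (x i * A i j) * (x k * A k j))" by (rule sum.swap)
    also have "\<dots> = (\<Sum>i<p. \<Sum>k<p. \<Sum>j\<in>J. (x i * A i j) * (x k * A k j))"
      by (intro sum.cong refl sum.swap)
    also have "\<dots> = quad p g x x"
      unfolding quad_def g_def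
      by (intro sum.cong refl) (simp add: sum_distrib_left sum_distrib_right mult_ac)
    finally show ?thesis .
  qed
  let ?S = "{x :: nat \<Rightarrow> real. (\<forall>i\<ge>p. x i = 0) \<and> (\<Sum>i<p. (x i)\<^sup>2) = 1}"
  have "(\<Sum>i<p. (if i = 0 then 1 else 0 :: real)\<^sup>2) = (\<Sum>i<p. if i = 0 then 1 else 0)"
    by (rule sum.cong) simp_all
  also have "\<dots> = 1" using p by simp
  finally have "(\<lambda>i. if i = 0 then 1 else 0) \<in> ?S" using p by simp
  then have "?S \<noteq> {}" by (metis (no_types, lifting) emptyE)
  moreover have "continuous_on UNIV q"
    unfolding q_def by (intro continuous_intros continuous_on_product_coordinates)
  then have "continuous_on ?S q" by (rule continuous_on_subset) simp
  ultimately have "\<exists>x\<in>?S. \<forall>y\<in>?S. q x \<le> q y"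
    by (intro continuous_attains_inf compact_unit_sphere_fun)
  then obtain x0 where x0: "x0 \<in> ?S" "\<forall>y\<in>?S. q x0 \<le> q y" by (rule bexE)
  define m0 where "m0 = q x0"
  have min: "m0 * (\<Sum>i<p. (x i)\<^sup>2) \<le> q x" for x
  proof (cases "(\<Sum>i<p. (x i)\<^sup>2) = 0")
    case True
    then show ?thesis by (simp add: q_def sum_nonneg)
  next
    case False
    define s where "s = sqrt (\<Sum>i<p. (x i)\<^sup>2)"
    have s2: "s\<^sup>2 = (\<Sum>i<p. (x i)\<^sup>2)" by (simp add: s_def sum_nonneg)
    have s0: "s \<noteq> 0" using False by (simp add: s_def)
    define y where "y = (\<lambda>i. if i < p then x i / s else 0)"
    have "y \<in> ?S" using False s2 by (auto simp: y_def power_divide sum_divide_distrib[symmetric])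
    moreover have "q y = q x / s\<^sup>2"
      by (simp add: q_def y_def sum_divide_distrib[symmetric] power_divide)
    ultimately have "m0 \<le> q x / s\<^sup>2" using bspec[OF x0(2), of y] by (simp add: m0_def)
    then show ?thesis unfolding s2[symmetric] using s0 by (simp add: field_simps)
  qed
  have eig: "(\<Sum>k<p. g i k * x0 k) = m0 * x0 i" if i: "i < p" for i
  proof -
    define h where "h = (\<lambda>k. if k = i then 1 else (0 :: real))"
    have hs: "(\<Sum>k<p. h k * f k) = f i" for f :: "nat \<Rightarrow> real"
      using i by (simp add: h_def if_distrib[of "\<lambda>x. x * _"] cong: if_cong)
    \<comment> \<open>Half the \<open>i\<close>-th partial derivative at \<open>x0\<close> of
      \<open>q x\<close> minus \<open>m0\<close> times the squared norm of \<open>x\<close>. This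
      function is nonnegative and vanishes at \<open>x0\<close>.\<close>
    define a where "a = (\<Sum>k<p. g i k * x0 k) - m0 * x0 i"
    have "0 \<le> 2 * t * a + t\<^sup>2 * (g i i - m0)" for t
    proof -
      have "q (\<lambda>k. x0 k + t * h k) = quad p g x0 x0 + 2 * t * quad p g h x0 + t\<^sup>2 * quad p g h h"
      proof -
        have "quad p g x0 h = quad p g h x0"
          unfolding quad_def by (subst sum.swap) (simp add: sym[of _ "_"] mult_ac)
        moreover have "quad p g (\<lambda>k. x0 k + t * h k) (\<lambda>k. x0 k + t * h k)
          = quad p g x0 x0 + t * quad p g x0 h + t * quad p g h x0 + t\<^sup>2 * quad p g h h"
          by (simp add: quad_def sum.distrib[symmetric] sum_distrib_left) (simp add: algebra_simps power2_eq_square)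
        ultimately show ?thesis by (simp add: q_quad)
      qed
      moreover have "quad p g h x0 = (\<Sum>k<p. g i k * x0 k)"
        using hs[of "\<lambda>i. \<Sum>k<p. g i k * x0 k"] by (simp add: quad_def sum_distrib_left mult_ac)
      moreover have "quad p g h h = g i i"
      proof -
        have "quad p g h h = (\<Sum>i'<p. h i' * (\<Sum>k<p. h k * g i' k))"
          by (simp add: quad_def sum_distrib_left mult_ac)
        then show ?thesis by (simp only: hs)
      qed
      moreover have "(\<Sum>k<p. (x0 k + t * h k)\<^sup>2) = (\<Sum>k<p. (x0 k)\<^sup>2) + 2 * t * x0 i + t\<^sup>2"
      proof -
        have "(\<Sum>k<p. (x0 k + t * h k)\<^sup>2) = (\<Sum>k<p. (x0 k)\<^sup>2) + 2 * t * (\<Sum>k<p. h k * x0 k) + t\<^sup>2 * (\<Sum>k<p. h k * h k)"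
          by (simp add: sum_distrib_left sum.distrib[symmetric]) (simp add: algebra_simps power2_eq_square)
        also have "(\<Sum>k<p. h k * h k) = 1" unfolding hs by (simp add: h_def)
        finally show ?thesis by (simp add: hs)
      qed
      ultimately show ?thesis using min[of "\<lambda>k. x0 k + t * h k"] x0(1)
        by (simp add: m0_def q_quad a_def algebra_simps)
    qed
    then have "a = 0" by (rule linear_term_zero)
    then show ?thesis by (simp add: a_def)
  qed
  have "eigenvalue ?G m0"
    unfolding eigenvalue_def eigenvector_def
  proof (intro exI conjI)
    let ?v = "Matrix.vec p x0"
    show "?v \<in> carrier_vec (dim_row ?G)" by simp
    have "\<exists>k<p. x0 k \<noteq> 0"
    proof (rule ccontr)
      assume "\<not> ?thesis"
      then have "(\<Sum>k<p. (x0 k)\<^sup>2) = 0" by simp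
      then show False using x0(1) by simp
    qed
    then show "?v \<noteq> 0\<^sub>v (dim_row ?G)" by (auto simp: vec_eq_iff)
    show "?G *\<^sub>v ?v = m0 \<cdot>\<^sub>v ?v"
      by (rule eq_vecI) (auto simp: scalar_prod_def lessThan_atLeast0[symmetric] eig)
  qed
  then have root: "poly (char_poly ?G) m0 = 0" using eigenvalue_root_char_poly[OF G] by simp
  define l where "l = sorted_list_of_multiset (proots (char_poly ?G))"
  have l: "length l = p" "sorted l" "set l = {x. poly (char_poly ?G) x = 0}"
  proof -
    have "mset l = proots (char_poly ?G)" by (simp add: l_def)
    then show "length l = p" using split(1) by (metis size_mset)
    show "sorted l" by (simp add: l_def)
    show "set l = {x. poly (char_poly ?G) x = 0}" using split(2) by (simp add: l_def)
  qed
  \<comment> \<open>The list is ascending, so the \<open>p\<close>-th largest of its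
    \<open>p\<close> entries is the head.\<close>
  have "rev l ! (p - 1) = l ! 0" using l(1) p by (simp add: rev_nth)
  moreover have "l ! 0 \<le> m0"
  proof -
    have "m0 \<in> set l" unfolding l(3) using root by (rule CollectI)
    then obtain k where "k < length l" "l ! k = m0" by (auto simp: in_set_conv_nth)
    then show ?thesis using sorted_nth_mono[OF l(2), of 0 k] by simp
  qed
  ultimately have sv: "sing_val p J A p \<le> sqrt m0"
    by (simp add: sing_val_def l_def g_def)
  have "sing_val p J A p * L2_set x {..<p} \<le> sqrt m0 * L2_set x {..<p}"
    by (rule mult_right_mono[OF sv]) simp
  also have "\<dots> = sqrt (m0 * (\<Sum>i<p. (x i)\<^sup>2))" by (simp add: L2_set_def real_sqrt_mult)
  also have "\<dots> \<le> sqrt (q x)" using min by simp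
  finally show ?thesis by (simp add: q_def L2_set_def)
qed

section \<open>Operator norms\<close>

lemma op_norm_bdd:
  assumes "finite I" "finite J"
  shows "bdd_above {L2_set (\<lambda>i. \<Sum>j\<in>J. A i j * x j) I | x. L2_set x J \<le> 1}"
proof (rule bdd_aboveI[of _ "\<Sum>i\<in>I. L2_set (A i) J"])
  fix s assume "s \<in> {L2_set (\<lambda>i. \<Sum>j\<in>J. A i j * x j) I | x. L2_set x J \<le> 1}"
  then obtain x where s: "s = L2_set (\<lambda>i. \<Sum>j\<in>J. A i j * x j) I" and x: "L2_set x J \<le> 1" by auto
  have "s \<le> (\<Sum>i\<in>I. \<bar>\<Sum>j\<in>J. A i j * x j\<bar>)" unfolding s by (rule L2_set_le_sum_abs)
  also have "\<dots> \<le> (\<Sum>i\<in>I. L2_set (A i) J * L2_set x J)" by (intro sum_mono cauchy_schwarz_sum)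
  also have "\<dots> \<le> (\<Sum>i\<in>I. L2_set (A i) J * 1)" using x by (intro sum_mono mult_left_mono) auto
  finally show "s \<le> (\<Sum>i\<in>I. L2_set (A i) J)" by simp
qed

lemma op_norm_upper:
  assumes "finite I" "finite J" "L2_set x J \<le> 1"
  shows "L2_set (\<lambda>i. \<Sum>j\<in>J. A i j * x j) I \<le> op_norm I J A"
  unfolding op_norm_def using op_norm_bdd[OF assms(1,2)] assms(3) by (intro cSup_upper) auto

lemma op_norm_apply:
  assumes "finite I" "finite J"
  shows "L2_set (\<lambda>i. \<Sum>j\<in>J. A i j * y j) I \<le> op_norm I J A * L2_set y J"
proof (cases "L2_set y J = 0")
  case True
  then have "\<forall>j\<in>J. y j = 0" using assms by (simp add: L2_set_eq_0_iff)
  then have "(\<lambda>i. \<Sum>j\<in>J. A i j * y j) = (\<lambda>_. 0)" by simp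
  then show ?thesis using True by (simp add: L2_set_def)
next
  case False
  define s where "s = L2_set y J"
  have s: "s > 0" using False by (simp add: s_def less_le)
  have "L2_set (\<lambda>j. (1 / s) * y j) J = 1" unfolding L2_set_scale using s by (simp add: s_def)
  then have "L2_set (\<lambda>i. \<Sum>j\<in>J. A i j * ((1 / s) * y j)) I \<le> op_norm I J A"
    using assms by (intro op_norm_upper) auto
  also have "(\<lambda>i. \<Sum>j\<in>J. A i j * ((1 / s) * y j)) = (\<lambda>i. (1 / s) * (\<Sum>j\<in>J. A i j * y j))"
    by (simp add: sum_distrib_left mult_ac)
  finally have "L2_set (\<lambda>i. \<Sum>j\<in>J. A i j * y j) I / s \<le> op_norm I J A"
    unfolding L2_set_scale using s by simp
  then show ?thesis using s by (simp add: s_def field_simps)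
qed

text \<open>Applying the matrix to its own row \<open>i\<close> produces the squared norm of that
  row in coordinate \<open>i\<close>, so every row norm is at most the operator norm.\<close>

lemma frob_le_op_norm:
  assumes "finite I" "finite J"
  shows "(\<Sum>i\<in>I. \<Sum>j\<in>J. (A i j)\<^sup>2) \<le> real (card I) * (op_norm I J A)\<^sup>2"
proof -
  have "(\<Sum>j\<in>J. (A i j)\<^sup>2) \<le> (op_norm I J A)\<^sup>2" if i: "i \<in> I" for i
  proof -
    have op0: "0 \<le> op_norm I J A"
      using order_trans[OF L2_set_nonneg op_norm_upper[OF assms, of "\<lambda>_. 0" A]] by (simp add: L2_set_def)
    have "(L2_set (A i) J)\<^sup>2 = \<bar>\<Sum>j\<in>J. A i j * A i j\<bar>"
      by (simp only: L2_set_squared) (simp add: power2_eq_square sum_nonneg)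
    also have "\<dots> \<le> L2_set (\<lambda>i'. \<Sum>j\<in>J. A i' j * A i j) I"
      using member_le_L2_set[OF assms(1) i, of "\<lambda>i'. \<bar>\<Sum>j\<in>J. A i' j * A i j\<bar>"] by (simp add: L2_set_def)
    also have "\<dots> \<le> op_norm I J A * L2_set (A i) J" by (rule op_norm_apply[OF assms])
    finally have "L2_set (A i) J \<le> op_norm I J A"
      using le_if_square_le[OF _ L2_set_nonneg op0, of "A i" J] by (simp add: mult.commute)
    then have "(L2_set (A i) J)\<^sup>2 \<le> (op_norm I J A)\<^sup>2" by (intro power_mono) auto
    then show ?thesis by (simp add: L2_set_squared)
  qed
  then show ?thesis using sum_bounded_above[of I "\<lambda>i. \<Sum>j\<in>J. (A i j)\<^sup>2"] by simp
qed

subsection \<open>A conditional central limit theorem and a Bernstein bound\<close>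

lemma integrable_finite_pmf:
  fixes f :: "'a \<Rightarrow> 'b :: {banach, second_countable_topology}"
  assumes "finite (set_pmf p)"
  shows "integrable (measure_pmf p) f"
  using assms by (rule integrable_measure_pmf_finite)

lemma expectation_pair_pmf:
  fixes f :: "'a \<times> 'b \<Rightarrow> 'c :: {banach, second_countable_topology}"
  assumes "finite (set_pmf p)" "finite (set_pmf q)"
  shows "measure_pmf.expectation (pair_pmf p q) f
    = measure_pmf.expectation p (\<lambda>a. measure_pmf.expectation q (\<lambda>b. f (a, b)))"
proof -
  have "measure_pmf.expectation (pair_pmf p q) f
      = (\<Sum>x\<in>set_pmf p \<times> set_pmf q. pmf (pair_pmf p q) x *\<^sub>R f x)"
    using assms by (intro integral_measure_pmf) auto
  also have "\<dots> = (\<Sum>a\<in>set_pmf p. \<Sum>b\<in>set_pmf q. pmf p a *\<^sub>R (pmf q b *\<^sub>R f (a, b)))"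
    by (subst sum.cartesian_product) (auto simp: pmf_pair intro!: sum.cong)
  also have "\<dots> = (\<Sum>a\<in>set_pmf p. pmf p a *\<^sub>R measure_pmf.expectation q (\<lambda>b. f (a, b)))"
    using assms by (subst integral_measure_pmf[OF assms(2)]) (auto simp: scaleR_sum_right)
  also have "\<dots> = measure_pmf.expectation p (\<lambda>a. measure_pmf.expectation q (\<lambda>b. f (a, b)))"
    using assms by (subst integral_measure_pmf[OF assms(1)]) auto
  finally show ?thesis .
qed

lemma Pi_pmf_lessThan_Suc:
  "Pi_pmf {..<Suc n} d (\<lambda>_. B) = map_pmf (\<lambda>(y, w). w(n := y)) (pair_pmf B (Pi_pmf {..<n} d (\<lambda>_. B)))"
  by (simp add: lessThan_Suc Pi_pmf_insert)

lemma finite_set_Pi_pmf: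
  fixes n :: nat
  assumes "finite (set_pmf B)"
  shows "finite (set_pmf (Pi_pmf {..<n} d (\<lambda>_. B)))"
proof (induction n)
  case (Suc n)
  then show ?case using assms unfolding Pi_pmf_lessThan_Suc by simp
qed simp

lemma expectation_prod_iid:
  fixes g :: "'a \<Rightarrow> 'c :: {real_normed_field, banach, second_countable_topology}" and n :: nat
  assumes B: "finite (set_pmf B)"
  shows "measure_pmf.expectation (Pi_pmf {..<n} d (\<lambda>_. B)) (\<lambda>w. \<Prod>i<n. g (w i))
    = measure_pmf.expectation B g ^ n"
proof (induction n)
  case (Suc n)
  have "measure_pmf.expectation (Pi_pmf {..<Suc n} d (\<lambda>_. B)) (\<lambda>w. \<Prod>i<Suc n. g (w i))
    = measure_pmf.expectation (pair_pmf B (Pi_pmf {..<n} d (\<lambda>_. B))) (\<lambda>x. g (fst x) * (\<Prod>i<n. g (snd x i)))"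
    unfolding Pi_pmf_lessThan_Suc integral_map_pmf
    by (intro Bochner_Integration.integral_cong refl) (auto simp: split_def mult.commute)
  also have "\<dots> = measure_pmf.expectation B g * measure_pmf.expectation B g ^ n"
    by (simp add: expectation_pair_pmf[OF B finite_set_Pi_pmf[OF B]] Suc.IH)
  finally show ?case by simp
qed simp

lemma expectation_abs_le:
  fixes f :: "'a \<Rightarrow> 'b :: {banach, second_countable_topology}"
  assumes "finite (set_pmf p)" "\<And>x. x \<in> set_pmf p \<Longrightarrow> norm (f x) \<le> g x"
  shows "norm (measure_pmf.expectation p f) \<le> measure_pmf.expectation p g"
proof -
  have "norm (measure_pmf.expectation p f) \<le> measure_pmf.expectation p (\<lambda>x. norm (f x))"
    by (rule integral_norm_bound)
  also have "\<dots> \<le> measure_pmf.expectation p g"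
    using assms by (intro integral_mono_AE integrable_finite_pmf) (auto simp: AE_measure_pmf_iff)
  finally show ?thesis .
qed

lemma expectation_mono_pmf:
  fixes f g :: "'a \<Rightarrow> real"
  assumes "finite (set_pmf p)" "\<And>x. x \<in> set_pmf p \<Longrightarrow> f x \<le> g x"
  shows "measure_pmf.expectation p f \<le> measure_pmf.expectation p g"
  using assms by (intro integral_mono_AE integrable_finite_pmf) (auto simp: AE_measure_pmf_iff)

section \<open>Characteristic functions of sums of independent terms\<close>

lemma char_third_order:
  fixes Y :: "'a \<Rightarrow> real"
  assumes fin: "finite (set_pmf p)" and mean: "measure_pmf.expectation p Y = 0"
    and b: "\<And>x. x \<in> set_pmf p \<Longrightarrow> \<bar>Y x\<bar> \<le> b"
    and v: "v = measure_pmf.expectation p (\<lambda>x. (Y x)\<^sup>2)"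
  shows "cmod (measure_pmf.expectation p (\<lambda>x. iexp (s * Y x)) - (1 - s\<^sup>2 * v / 2)) \<le> \<bar>s\<bar> ^ 3 * b * v / 6"
proof -
  let ?E = "measure_pmf.expectation p"
  note int = integrable_finite_pmf[OF fin]
  have A0: "?E (\<lambda>x. \<i> * of_real s * complex_of_real (Y x)) = 0"
    using mean by (simp add: int)
  have "?E (\<lambda>x. of_real (s\<^sup>2 / 2) * complex_of_real ((Y x)\<^sup>2)) = of_real (s\<^sup>2 / 2) * ?E (\<lambda>x. complex_of_real ((Y x)\<^sup>2))"
    by (rule integral_mult_right_zero)
  also have "?E (\<lambda>x. complex_of_real ((Y x)\<^sup>2)) = of_real v" unfolding v by (rule integral_of_real[OF int])
  finally have D0: "?E (\<lambda>x. of_real (s\<^sup>2 / 2) * complex_of_real ((Y x)\<^sup>2)) = of_real (s\<^sup>2 / 2) * of_real v" .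
  have "?E (\<lambda>x. 1 + \<i> * of_real s * complex_of_real (Y x) - of_real (s\<^sup>2 / 2) * complex_of_real ((Y x)\<^sup>2))
      = ?E (\<lambda>x. 1 + \<i> * of_real s * complex_of_real (Y x)) - of_real (s\<^sup>2 / 2) * of_real v"
    unfolding D0[symmetric] by (rule Bochner_Integration.integral_diff[OF int int])
  also have "?E (\<lambda>x. 1 + \<i> * of_real s * complex_of_real (Y x)) = ?E (\<lambda>x. 1) + 0"
    unfolding A0[symmetric] by (rule Bochner_Integration.integral_add[OF int int])
  finally have E: "?E (\<lambda>x. 1 + \<i> * of_real s * complex_of_real (Y x) - of_real (s\<^sup>2 / 2) * complex_of_real ((Y x)\<^sup>2))
      = 1 - of_real (s\<^sup>2 / 2) * of_real v" by simp
  have pt: "cmod (iexp (s * Y x) - (1 + \<i> * of_real s * complex_of_real (Y x) - of_real (s\<^sup>2 / 2) * complex_of_real ((Y x)\<^sup>2)))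
    \<le> \<bar>s\<bar> ^ 3 * b / 6 * (Y x)\<^sup>2" if "x \<in> set_pmf p" for x
  proof -
    have "(\<Sum>k\<le>2. (\<i> * complex_of_real (s * Y x)) ^ k / fact k)
      = 1 + \<i> * of_real s * complex_of_real (Y x) - of_real (s\<^sup>2 / 2) * complex_of_real ((Y x)\<^sup>2)"
      by (simp add: numeral_2_eq_2 power2_eq_square field_simps)
    then have "cmod (iexp (s * Y x) - (1 + \<i> * of_real s * complex_of_real (Y x) - of_real (s\<^sup>2 / 2) * complex_of_real ((Y x)\<^sup>2)))
      \<le> \<bar>s * Y x\<bar> ^ 3 / 6"
      using iexp_approx1[of "s * Y x" 2] by (simp add: fact_numeral numeral_3_eq_3)
    \<comment> \<open>Boundedness turns the third absolute moment into \<open>b\<close> times the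
      variance.\<close>
    also have "\<bar>s * Y x\<bar> ^ 3 = \<bar>s\<bar> ^ 3 * \<bar>Y x\<bar> * (Y x)\<^sup>2"
    proof -
      have "\<bar>Y x\<bar> ^ 3 = \<bar>Y x\<bar> * (Y x)\<^sup>2" by (simp add: power3_eq_cube power2_eq_square)
      then show ?thesis by (simp add: abs_mult power_mult_distrib)
    qed
    also have "\<dots> \<le> \<bar>s\<bar> ^ 3 * b * (Y x)\<^sup>2"
      using b[OF that] by (intro mult_right_mono mult_left_mono) auto
    finally show ?thesis by simp
  qed
  have "?E (\<lambda>x. iexp (s * Y x)) - (1 - s\<^sup>2 * v / 2)
    = ?E (\<lambda>x. iexp (s * Y x) - (1 + \<i> * of_real s * complex_of_real (Y x) - of_real (s\<^sup>2 / 2) * complex_of_real ((Y x)\<^sup>2)))"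
    unfolding Bochner_Integration.integral_diff[OF int int, of "\<lambda>x. iexp (s * Y x)"] E by simp
  then have "cmod (?E (\<lambda>x. iexp (s * Y x)) - (1 - s\<^sup>2 * v / 2)) \<le> ?E (\<lambda>x. \<bar>s\<bar> ^ 3 * b / 6 * (Y x)\<^sup>2)"
    using expectation_abs_le[OF fin pt] by simp
  also have "\<dots> = \<bar>s\<bar> ^ 3 * b / 6 * v" unfolding v by (rule integral_mult_right_zero)
  finally show ?thesis by simp
qed

lemma exp_minus_bound:
  fixes x :: real
  assumes "0 \<le> x"
  shows "\<bar>exp (- x) - (1 - x)\<bar> \<le> x\<^sup>2"
proof -
  have 1: "1 - x \<le> exp (- x)" using exp_ge_add_one_self[of "- x"] by simp
  have "1 + x + x\<^sup>2 / 2 \<le> exp x" by (rule exp_lower_Taylor_quadratic[OF assms])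
  moreover have "1 \<le> (1 + x + x\<^sup>2 / 2) * (1 - x + x\<^sup>2)"
  proof -
    have "(1 + x + x\<^sup>2 / 2) * (1 - x + x\<^sup>2) = 1 + x\<^sup>2 / 2 + x ^ 3 / 2 + x ^ 4 / 2"
      by (simp add: field_simps power2_eq_square power3_eq_cube power4_eq_xxxx)
    then show ?thesis using assms by simp
  qed
  moreover have pos: "0 \<le> 1 - x + x\<^sup>2"
  proof -
    have "1 - x + x\<^sup>2 = (x - 1 / 2)\<^sup>2 + 3 / 4" by (simp add: power2_eq_square field_simps)
    then show ?thesis by (metis add_nonneg_nonneg zero_le_power2 divide_nonneg_nonneg zero_le_numeral)
  qed
  ultimately have "1 \<le> exp x * (1 - x + x\<^sup>2)" by (meson mult_right_mono order_trans)
  then have "exp (- x) * 1 \<le> exp (- x) * (exp x * (1 - x + x\<^sup>2))" by (intro mult_left_mono) auto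
  also have "\<dots> = 1 - x + x\<^sup>2" by (simp add: mult.assoc[symmetric] exp_add[symmetric])
  finally show ?thesis using 1 by simp
qed

lemma exp_quadratic_upper:
  fixes x :: real
  assumes "\<bar>x\<bar> \<le> 1"
  shows "exp x \<le> 1 + x + x\<^sup>2"
proof (cases "0 \<le> x")
  case True
  then show ?thesis using exp_bound[of x] assms by simp
next
  case False
  then show ?thesis using exp_minus_bound[of "- x"] by simp
qed

text \<open>A quantitative central limit theorem with one error \<open>\<delta>\<close>. Only the
  sum of the shift \<open>c\<close> and the drift
  \<open>sqrt (real n) * measure_pmf.expectation B f\<close> is assumed small relative to the
  fluctuation scale; neither is small alone, and their sum is where the bias of the one-step
  estimator appears. Centring is done inside.\<close>

lemma iid_char_approx:
  fixes f :: "'o \<Rightarrow> real"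
  assumes fin: "finite (set_pmf B)" and n: "1 \<le> n" and d: "0 \<le> \<delta>"
    and shift: "\<bar>c + sqrt (real n) * measure_pmf.expectation B f\<bar> \<le> \<delta>"
    and second: "\<bar>measure_pmf.expectation B (\<lambda>x. (f x)\<^sup>2) - 1\<bar> \<le> \<delta>"
    and first: "\<bar>measure_pmf.expectation B f\<bar> \<le> \<delta>"
    and bound: "\<And>x. x \<in> set_pmf B \<Longrightarrow> \<bar>f x\<bar> \<le> \<delta> * sqrt (real n)"
  shows "cmod (measure_pmf.expectation (Pi_pmf {..<n} dflt (\<lambda>_. B))
      (\<lambda>w. iexp (t * (c + (\<Sum>i<n. f (w i)) / sqrt (real n)))) - exp (- (t\<^sup>2 / 2)))
    \<le> \<bar>t\<bar> * \<delta> + \<bar>t\<bar> ^ 3 * \<delta> * (1 + \<delta>) / 3 + t\<^sup>2 * (\<delta> + \<delta>\<^sup>2) / 2 + t ^ 4 / (4 * real n)"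
proof -
  let ?E = "measure_pmf.expectation B"
  let ?W = "measure_pmf.expectation (Pi_pmf {..<n} dflt (\<lambda>_. B))"
  let ?q = "sqrt (real n)"
  have q: "?q > 0" "?q * ?q = real n" using n by auto
  note int = integrable_finite_pmf[OF fin]
  define \<mu> where "\<mu> = ?E f"
  define Y where "Y = (\<lambda>x. f x - \<mu>)"
  define v where "v = ?E (\<lambda>x. (Y x)\<^sup>2)"
  define s where "s = t / ?q"
  define \<phi> where "\<phi> = ?E (\<lambda>x. iexp (s * Y x))"
  have mean: "?E Y = 0" unfolding Y_def by (simp add: Bochner_Integration.integral_diff[OF int int] \<mu>_def)
  have v: "v = ?E (\<lambda>x. (f x)\<^sup>2) - \<mu>\<^sup>2"
  proof -
    have "(\<lambda>x. (Y x)\<^sup>2) = (\<lambda>x. ((f x)\<^sup>2 - 2 * \<mu> * f x) + \<mu>\<^sup>2)"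
      by (auto simp: Y_def power2_eq_square algebra_simps)
    then have "v = ?E (\<lambda>x. (f x)\<^sup>2) - ?E (\<lambda>x. 2 * \<mu> * f x) + ?E (\<lambda>x. \<mu>\<^sup>2)"
      unfolding v_def by (simp only: Bochner_Integration.integral_diff[OF int int] Bochner_Integration.integral_add[OF int int])
    also have "?E (\<lambda>x. 2 * \<mu> * f x) = 2 * \<mu> * \<mu>" unfolding \<mu>_def by (rule integral_mult_right_zero)
    finally show ?thesis by (simp add: power2_eq_square)
  qed
  have mu2: "\<mu>\<^sup>2 \<le> \<delta>\<^sup>2" using first d by (simp add: \<mu>_def abs_le_square_iff[symmetric])
  have v1: "\<bar>v - 1\<bar> \<le> \<delta> + \<delta>\<^sup>2" using second mu2 zero_le_power2[of \<mu>] unfolding v by linarith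
  have v2: "v \<le> 1 + \<delta>" using second zero_le_power2[of \<mu>] unfolding v by linarith
  have v0: "0 \<le> v" unfolding v_def by (intro integral_nonneg_AE) auto
  have q1: "1 \<le> ?q" using n by simp
  have Yb: "\<bar>Y x\<bar> \<le> 2 * \<delta> * ?q" if "x \<in> set_pmf B" for x
  proof -
    have "\<bar>\<mu>\<bar> \<le> \<delta> * ?q" using first mult_left_mono[OF q1 d] by (simp add: \<mu>_def)
    then show ?thesis using bound[OF that] unfolding Y_def by linarith
  qed
  have b: "cmod (\<phi> - (1 - s\<^sup>2 * v / 2)) \<le> \<bar>t\<bar> ^ 3 * \<delta> * (1 + \<delta>) / 3 / real n"
  proof -
    have "cmod (\<phi> - (1 - s\<^sup>2 * v / 2)) \<le> \<bar>s\<bar> ^ 3 * (2 * \<delta> * ?q) * v / 6"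
      unfolding \<phi>_def by (rule char_third_order[OF fin mean Yb v_def])
    also have "\<dots> \<le> \<bar>s\<bar> ^ 3 * (2 * \<delta> * ?q) * (1 + \<delta>) / 6"
      using v2 d q by (intro divide_right_mono mult_left_mono) auto
    also have "\<bar>s\<bar> ^ 3 = \<bar>t\<bar> ^ 3 / (?q * (?q * ?q))"
      using q by (simp add: s_def power_divide power3_eq_cube)
    also have "\<bar>t\<bar> ^ 3 / (?q * (?q * ?q)) * (2 * \<delta> * ?q) * (1 + \<delta>) / 6 = \<bar>t\<bar> ^ 3 * \<delta> * (1 + \<delta>) / 3 / real n"
      unfolding q(2) using q(1) n by (simp add: field_simps)
    finally show ?thesis .
  qed
  \<comment> \<open>The \<open>n\<close>-th root of the Gaussian characteristic function at
    \<open>t\<close>. Both \<open>w\<close> and \<open>\<phi>\<close> lie in the unit disc, so their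
    \<open>n\<close>-th powers differ by at most \<open>n\<close> times their difference.\<close>
  define w where "w = exp (- (t\<^sup>2 / (2 * real n)))"
  have s2: "s\<^sup>2 = t\<^sup>2 / real n" using q by (simp add: s_def power_divide power2_eq_square)
  have w: "\<bar>(1 - s\<^sup>2 * v / 2) - w\<bar> \<le> t\<^sup>2 * (\<delta> + \<delta>\<^sup>2) / 2 / real n + t ^ 4 / (4 * real n) / real n"
  proof -
    have "\<bar>w - (1 - t\<^sup>2 / (2 * real n))\<bar> \<le> (t\<^sup>2 / (2 * real n))\<^sup>2"
      unfolding w_def by (rule exp_minus_bound) simp
    also have "\<dots> = t ^ 4 / (4 * real n) / real n" by (simp add: power_divide power_mult_distrib power2_eq_square power4_eq_xxxx)
    finally have 1: "\<bar>w - (1 - t\<^sup>2 / (2 * real n))\<bar> \<le> t ^ 4 / (4 * real n) / real n" .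
    have "(1 - s\<^sup>2 * v / 2) - (1 - t\<^sup>2 / (2 * real n)) = - (t\<^sup>2 / (2 * real n)) * (v - 1)"
      unfolding s2 using n by (simp add: field_simps)
    then have "\<bar>(1 - s\<^sup>2 * v / 2) - (1 - t\<^sup>2 / (2 * real n))\<bar> = t\<^sup>2 / (2 * real n) * \<bar>v - 1\<bar>"
      by (simp add: abs_mult)
    also have "\<dots> \<le> t\<^sup>2 / (2 * real n) * (\<delta> + \<delta>\<^sup>2)" using v1 by (intro mult_left_mono) auto
    also have "\<dots> = t\<^sup>2 * (\<delta> + \<delta>\<^sup>2) / 2 / real n" by simp
    finally show ?thesis using 1 by linarith
  qed
  have "cmod \<phi> \<le> ?E (\<lambda>x. 1)"
    unfolding \<phi>_def by (rule expectation_abs_le[OF fin]) simp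
  then have phi1: "cmod \<phi> \<le> 1" by simp
  have w1: "cmod (of_real w) \<le> 1" by (simp add: w_def)
  have "cmod (\<phi> - of_real w) \<le> cmod (\<phi> - (1 - s\<^sup>2 * v / 2)) + cmod (of_real ((1 - s\<^sup>2 * v / 2) - w))"
    using norm_triangle_ineq[of "\<phi> - (1 - s\<^sup>2 * v / 2)" "of_real ((1 - s\<^sup>2 * v / 2) - w)"] by simp
  also have "\<dots> \<le> \<bar>t\<bar> ^ 3 * \<delta> * (1 + \<delta>) / 3 / real n
     + (t\<^sup>2 * (\<delta> + \<delta>\<^sup>2) / 2 / real n + t ^ 4 / (4 * real n) / real n)"
    unfolding norm_of_real using b w by (rule add_mono)
  finally have "real n * cmod (\<phi> - of_real w) \<le> real n * (\<bar>t\<bar> ^ 3 * \<delta> * (1 + \<delta>) / 3 / real n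
     + (t\<^sup>2 * (\<delta> + \<delta>\<^sup>2) / 2 / real n + t ^ 4 / (4 * real n) / real n))"
    by (intro mult_left_mono) auto
  also have "\<dots> = \<bar>t\<bar> ^ 3 * \<delta> * (1 + \<delta>) / 3 + (t\<^sup>2 * (\<delta> + \<delta>\<^sup>2) / 2 + t ^ 4 / (4 * real n))"
    using n by (simp only: distrib_left) simp
  finally have diff: "real n * cmod (\<phi> - of_real w) \<le> \<bar>t\<bar> ^ 3 * \<delta> * (1 + \<delta>) / 3 + (t\<^sup>2 * (\<delta> + \<delta>\<^sup>2) / 2 + t ^ 4 / (4 * real n))" .
  have pw: "cmod (\<phi> ^ n - of_real w ^ n) \<le> real n * cmod (\<phi> - of_real w)"
    by (rule norm_power_diff[OF phi1 w1])
  have wn: "w ^ n = exp (- (t\<^sup>2 / 2))"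
    unfolding w_def using n by (simp add: exp_of_nat_mult[symmetric])
  define \<beta> where "\<beta> = c + ?q * \<mu>"
  have "?W (\<lambda>w. iexp (t * (c + (\<Sum>i<n. f (w i)) / ?q))) = ?W (\<lambda>w. iexp (t * \<beta>) * (\<Prod>i<n. iexp (s * Y (w i))))"
  proof (rule Bochner_Integration.integral_cong[OF refl])
    fix w :: "nat \<Rightarrow> 'o"
    have "(\<Sum>i<n. s * Y (w i)) = s * ((\<Sum>i<n. f (w i)) - real n * \<mu>)"
      by (simp add: Y_def sum_distrib_left[symmetric] sum_subtractf)
    also have "\<dots> = t * ((\<Sum>i<n. f (w i)) / ?q - ?q * \<mu>)"
    proof -
      have "real n / ?q = ?q" by (simp add: real_div_sqrt)
      then show ?thesis by (simp add: s_def right_diff_distrib) (metis mult.commute times_divide_eq_right)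
    qed
    finally have eq: "t * (c + (\<Sum>i<n. f (w i)) / ?q) = t * \<beta> + (\<Sum>i<n. s * Y (w i))"
      by (simp add: \<beta>_def algebra_simps)
    show "iexp (t * (c + (\<Sum>i<n. f (w i)) / ?q)) = iexp (t * \<beta>) * (\<Prod>i<n. iexp (s * Y (w i)))"
      unfolding eq by (simp add: exp_add[symmetric] exp_sum[symmetric] distrib_left sum_distrib_left del: of_real_mult)
  qed
  also have "\<dots> = iexp (t * \<beta>) * ?W (\<lambda>w. \<Prod>i<n. iexp (s * Y (w i)))"
    by (rule integral_mult_right_zero)
  also have "?W (\<lambda>w. \<Prod>i<n. iexp (s * Y (w i))) = \<phi> ^ n"
    unfolding \<phi>_def by (rule expectation_prod_iid[OF fin])
  finally have main: "?W (\<lambda>w. iexp (t * (c + (\<Sum>i<n. f (w i)) / ?q))) = iexp (t * \<beta>) * \<phi> ^ n" .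
  have ib: "cmod (iexp (t * \<beta>) - 1) \<le> \<bar>t\<bar> * \<delta>"
  proof -
    have "cmod (iexp (t * \<beta>) - 1) \<le> \<bar>t * \<beta>\<bar>" using iexp_approx1[of "t * \<beta>" 0] by simp
    also have "\<dots> \<le> \<bar>t\<bar> * \<delta>" unfolding abs_mult \<beta>_def \<mu>_def using shift by (intro mult_left_mono) auto
    finally show ?thesis .
  qed
  have "iexp (t * \<beta>) * \<phi> ^ n - exp (- (t\<^sup>2 / 2)) = iexp (t * \<beta>) * (\<phi> ^ n - of_real w ^ n) + (iexp (t * \<beta>) - 1) * of_real w ^ n"
    by (simp add: wn[symmetric] algebra_simps)
  then have "cmod (iexp (t * \<beta>) * \<phi> ^ n - exp (- (t\<^sup>2 / 2))) \<le> cmod (iexp (t * \<beta>) * (\<phi> ^ n - of_real w ^ n)) + cmod ((iexp (t * \<beta>) - 1) * of_real w ^ n)"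
    by (metis norm_triangle_ineq)
  also have "\<dots> = cmod (\<phi> ^ n - of_real w ^ n) + cmod (iexp (t * \<beta>) - 1) * cmod (of_real w) ^ n"
    by (simp add: norm_mult norm_power)
  also have "\<dots> \<le> cmod (\<phi> ^ n - of_real w ^ n) + cmod (iexp (t * \<beta>) - 1) * 1"
    using w1 by (intro add_left_mono mult_left_mono power_le_one) auto
  finally show ?thesis unfolding main using pw diff ib by linarith
qed

text \<open>Given the first stage \<open>z\<close>, the characteristic function is uniformly close
  to the Gaussian one on \<open>G N\<close>, and off \<open>G N\<close> the difference is at most 2.
  Averaging over \<open>z\<close> and continuity of the characteristic function give the
  unconditional limit; the shift and the summands may depend on \<open>z\<close>
  arbitrarily.\<close>

theorem conditional_clt:
  fixes A :: "nat \<Rightarrow> 'z pmf" and B :: "nat \<Rightarrow> 'o pmf" and f :: "nat \<Rightarrow> 'z \<Rightarrow> 'o \<Rightarrow> real"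
    and c :: "nat \<Rightarrow> 'z \<Rightarrow> real" and n :: "nat \<Rightarrow> nat"
  assumes fin: "\<And>N. finite (set_pmf (A N))" "\<And>N. finite (set_pmf (B N))"
    and n: "filterlim n at_top sequentially"
    and d: "\<delta> \<longlonglongrightarrow> 0" and bad: "(\<lambda>N. measure_pmf.prob (A N) (- G N)) \<longlonglongrightarrow> 0"
    and good: "\<forall>\<^sub>F N in sequentially. \<forall>z\<in>G N.
      \<bar>c N z + sqrt (real (n N)) * measure_pmf.expectation (B N) (f N z)\<bar> \<le> \<delta> N \<and>
      \<bar>measure_pmf.expectation (B N) (\<lambda>x. (f N z x)\<^sup>2) - 1\<bar> \<le> \<delta> N \<and>
      \<bar>measure_pmf.expectation (B N) (f N z)\<bar> \<le> \<delta> N \<and>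
      (\<forall>x\<in>set_pmf (B N). \<bar>f N z x\<bar> \<le> \<delta> N * sqrt (real (n N)))"
  shows "weak_conv_m (\<lambda>N. distr (measure_pmf (pair_pmf (A N) (Pi_pmf {..<n N} dflt (\<lambda>_. B N)))) borel
      (\<lambda>(z, w). c N z + (\<Sum>i<n N. f N z (w i)) / sqrt (real (n N)))) std_normal_distribution"
proof (rule levy_continuity)
  let ?S = "\<lambda>N (z, w). c N z + (\<Sum>i<n N. f N z (w i)) / sqrt (real (n N))"
  let ?M = "\<lambda>N. pair_pmf (A N) (Pi_pmf {..<n N} dflt (\<lambda>_. B N))"
  show "real_distribution (distr (measure_pmf (?M N)) borel (?S N))" for N
    by (rule prob_space.real_distribution_distr[OF measure_pmf.prob_space_axioms]) simp
  show "real_distribution std_normal_distribution" by (rule real_dist_normal_dist)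
  fix t :: real
  define h where "h = (\<lambda>N z. measure_pmf.expectation (Pi_pmf {..<n N} dflt (\<lambda>_. B N)) (\<lambda>w. iexp (t * ?S N (z, w))))"
  have char_eq: "char (distr (measure_pmf (?M N)) borel (?S N)) t = measure_pmf.expectation (A N) (h N)" for N
  proof -
    have "char (distr (measure_pmf (?M N)) borel (?S N)) t = measure_pmf.expectation (?M N) (\<lambda>x. iexp (t * ?S N x))"
      unfolding char_def by (subst integral_distr) auto
    also have "\<dots> = measure_pmf.expectation (A N) (h N)"
      unfolding h_def by (rule expectation_pair_pmf[OF fin(1) finite_set_Pi_pmf[OF fin(2)]])
    finally show ?thesis .
  qed
  \<comment> \<open>Absolute values are taken because \<open>\<delta> N\<close> may be negative when
    \<open>G N\<close> is empty, and \<open>R N\<close> must be nonnegative for the estimate off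
    \<open>G N\<close>.\<close>
  define R where "R = (\<lambda>N. \<bar>t\<bar> * \<bar>\<delta> N\<bar> + \<bar>t\<bar> ^ 3 * \<bar>\<delta> N\<bar> * (1 + \<bar>\<delta> N\<bar>) / 3 + t\<^sup>2 * (\<bar>\<delta> N\<bar> + \<bar>\<delta> N\<bar>\<^sup>2) / 2 + t ^ 4 / 4 * (1 / real (n N)))"
  have "(\<lambda>N. 1 / real (n N)) \<longlonglongrightarrow> 0"
    using filterlim_compose[OF lim_1_over_n n] by (simp add: o_def)
  moreover have "(\<lambda>N. \<bar>\<delta> N\<bar>) \<longlonglongrightarrow> 0" using d by (rule tendsto_rabs_zero)
  ultimately have "R \<longlonglongrightarrow> \<bar>t\<bar> * 0 + \<bar>t\<bar> ^ 3 * 0 * (1 + 0) / 3 + t\<^sup>2 * (0 + 0\<^sup>2) / 2 + t ^ 4 / 4 * 0"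
    unfolding R_def by (intro tendsto_intros) auto
  then have R: "R \<longlonglongrightarrow> 0" by simp
  have "(\<lambda>N. char (distr (measure_pmf (?M N)) borel (?S N)) t - exp (- (t\<^sup>2 / 2))) \<longlonglongrightarrow> 0"
  proof (rule Lim_null_comparison)
    show "(\<lambda>N. R N + 2 * measure_pmf.prob (A N) (- G N)) \<longlonglongrightarrow> 0"
      using tendsto_add[OF R tendsto_mult_right_zero[OF bad, of 2]] by simp
    have "\<forall>\<^sub>F N in sequentially. 1 \<le> n N" using n by (simp add: filterlim_at_top)
    with good show "\<forall>\<^sub>F N in sequentially. norm (char (distr (measure_pmf (?M N)) borel (?S N)) t - exp (- (t\<^sup>2 / 2)))
      \<le> R N + 2 * measure_pmf.prob (A N) (- G N)"
    proof eventually_elim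
      case (elim N)
      have R0: "0 \<le> R N" by (simp add: R_def)
      have e1: "cmod (complex_of_real (exp (- (t\<^sup>2 / 2)))) \<le> 1" by simp
      have hb: "cmod (h N z - exp (- (t\<^sup>2 / 2))) \<le> R N + 2 * indicator (- G N) z" for z
      proof (cases "z \<in> G N")
        case True
        then have g: "\<bar>c N z + sqrt (real (n N)) * measure_pmf.expectation (B N) (f N z)\<bar> \<le> \<bar>\<delta> N\<bar>"
          "\<bar>measure_pmf.expectation (B N) (\<lambda>x. (f N z x)\<^sup>2) - 1\<bar> \<le> \<bar>\<delta> N\<bar>"
          "\<bar>measure_pmf.expectation (B N) (f N z)\<bar> \<le> \<bar>\<delta> N\<bar>" using elim(1) by force+
        have "\<bar>f N z x\<bar> \<le> \<bar>\<delta> N\<bar> * sqrt (real (n N))" if "x \<in> set_pmf (B N)" for x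
        proof -
          have "\<bar>f N z x\<bar> \<le> \<delta> N * sqrt (real (n N))" using elim(1) True that by blast
          also have "\<dots> \<le> \<bar>\<delta> N\<bar> * sqrt (real (n N))" by (intro mult_right_mono) auto
          finally show ?thesis .
        qed
        from iid_char_approx[OF fin(2) elim(2) _ g this, where t = t and dflt = dflt] show ?thesis
          using True by (simp add: h_def R_def)
      next
        case False
        have "cmod (h N z) \<le> measure_pmf.expectation (Pi_pmf {..<n N} dflt (\<lambda>_. B N)) (\<lambda>w. 1)"
          unfolding h_def by (rule expectation_abs_le[OF finite_set_Pi_pmf[OF fin(2)]]) simp
        then have "cmod (h N z) \<le> 1" by simp
        then have "cmod (h N z - exp (- (t\<^sup>2 / 2))) \<le> 2"
          using norm_triangle_ineq4[of "h N z" "complex_of_real (exp (- (t\<^sup>2 / 2)))"] e1 by linarith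
        then show ?thesis using False R0 by simp
      qed
      note int = integrable_finite_pmf[OF fin(1)]
      have "char (distr (measure_pmf (?M N)) borel (?S N)) t - exp (- (t\<^sup>2 / 2))
        = measure_pmf.expectation (A N) (\<lambda>z. h N z - exp (- (t\<^sup>2 / 2)))"
        unfolding char_eq by (simp add: Bochner_Integration.integral_diff[OF int int])
      also have "cmod \<dots> \<le> measure_pmf.expectation (A N) (\<lambda>z. R N + 2 * indicator (- G N) z)"
        using hb by (intro expectation_abs_le[OF fin(1)]) auto
      also have "\<dots> = R N + 2 * measure_pmf.prob (A N) (- G N)"
        by (simp add: Bochner_Integration.integral_add[OF int int])
      finally show ?case .
    qed
  qed
  then show "(\<lambda>N. char (distr (measure_pmf (?M N)) borel (?S N)) t) \<longlonglongrightarrow> char std_normal_distribution t"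
    unfolding char_std_normal_distribution by (subst Lim_null) simp
qed

text \<open>The Chernoff method with e^x \<le> 1 + x + x^2 on [-1, 1], which is why
  \<open>l * b \<le> 1\<close> is required. The parameter \<open>l\<close> stays free and is tuned
  by the caller.\<close>

lemma bernstein_upper:
  fixes g :: "'o \<Rightarrow> real"
  assumes fin: "finite (set_pmf B)" and mean: "measure_pmf.expectation B g = 0"
    and b: "\<And>x. x \<in> set_pmf B \<Longrightarrow> \<bar>g x\<bar> \<le> b" and v: "measure_pmf.expectation B (\<lambda>x. (g x)\<^sup>2) \<le> v"
    and l: "0 \<le> l" "l * b \<le> 1"
  shows "measure_pmf.prob (Pi_pmf {..<n} d (\<lambda>_. B)) {w. s \<le> (\<Sum>i<n. g (w i))} \<le> exp (real n * l\<^sup>2 * v - l * s)"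
proof -
  let ?E = "measure_pmf.expectation B"
  let ?Q = "Pi_pmf {..<n} d (\<lambda>_. B)"
  note int = integrable_finite_pmf[OF fin]
  note finQ = finite_set_Pi_pmf[OF fin, of n d]
  have "?E (\<lambda>x. exp (l * g x)) \<le> ?E (\<lambda>x. (1 + l * g x) + l\<^sup>2 * (g x)\<^sup>2)"
  proof (rule expectation_mono_pmf[OF fin])
    fix x assume "x \<in> set_pmf B"
    then have "\<bar>l * g x\<bar> \<le> l * b" using b l by (auto simp: abs_mult intro: mult_left_mono)
    then show "exp (l * g x) \<le> (1 + l * g x) + l\<^sup>2 * (g x)\<^sup>2"
      using exp_quadratic_upper[of "l * g x"] l by (simp add: power_mult_distrib)
  qed
  also have "\<dots> = 1 + l\<^sup>2 * ?E (\<lambda>x. (g x)\<^sup>2)"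
    using mean by (simp add: Bochner_Integration.integral_add[OF int int])
  also have "\<dots> \<le> 1 + l\<^sup>2 * v" using v by (intro add_left_mono mult_left_mono) auto
  also have "\<dots> \<le> exp (l\<^sup>2 * v)" using exp_ge_add_one_self by simp
  finally have mgf: "?E (\<lambda>x. exp (l * g x)) \<le> exp (l\<^sup>2 * v)" .
  have E0: "0 \<le> ?E (\<lambda>x. exp (l * g x))" by (intro integral_nonneg_AE) auto
  have "measure_pmf.prob ?Q {w. s \<le> (\<Sum>i<n. g (w i))} = measure_pmf.expectation ?Q (indicator {w. s \<le> (\<Sum>i<n. g (w i))})"
    by simp
  also have "\<dots> \<le> measure_pmf.expectation ?Q (\<lambda>w. exp (- (l * s)) * (\<Prod>i<n. exp (l * g (w i))))"
  proof (rule expectation_mono_pmf[OF finQ])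
    fix w
    have eq: "exp (- (l * s)) * (\<Prod>i<n. exp (l * g (w i))) = exp (l * ((\<Sum>i<n. g (w i)) - s))"
      by (simp add: exp_sum[symmetric] exp_add[symmetric] sum_distrib_left right_diff_distrib)
    show "indicator {w. s \<le> (\<Sum>i<n. g (w i))} w \<le> exp (- (l * s)) * (\<Prod>i<n. exp (l * g (w i)))"
      unfolding eq using l(1) by (auto simp: indicator_def)
  qed
  also have "\<dots> = exp (- (l * s)) * ?E (\<lambda>x. exp (l * g x)) ^ n"
    by (simp add: expectation_prod_iid[OF fin, of n d "\<lambda>x. exp (l * g x)"])
  also have "\<dots> \<le> exp (- (l * s)) * exp (l\<^sup>2 * v) ^ n"
    using mgf E0 by (intro mult_left_mono power_mono) auto
  also have "\<dots> = exp (real n * l\<^sup>2 * v - l * s)"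
    by (simp add: exp_of_nat_mult[symmetric] exp_add[symmetric] mult.assoc)
  finally show ?thesis .
qed

lemma bernstein:
  fixes g :: "'o \<Rightarrow> real"
  assumes fin: "finite (set_pmf B)" and mean: "measure_pmf.expectation B g = 0"
    and b: "\<And>x. x \<in> set_pmf B \<Longrightarrow> \<bar>g x\<bar> \<le> b" and v: "measure_pmf.expectation B (\<lambda>x. (g x)\<^sup>2) \<le> v"
    and l: "0 \<le> l" "l * b \<le> 1"
  shows "measure_pmf.prob (Pi_pmf {..<n} d (\<lambda>_. B)) {w. s \<le> \<bar>\<Sum>i<n. g (w i)\<bar>} \<le> 2 * exp (real n * l\<^sup>2 * v - l * s)"
proof -
  let ?Q = "Pi_pmf {..<n} d (\<lambda>_. B)"
  have "measure_pmf.prob ?Q {w. s \<le> \<bar>\<Sum>i<n. g (w i)\<bar>}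
    \<le> measure_pmf.prob ?Q ({w. s \<le> (\<Sum>i<n. g (w i))} \<union> {w. s \<le> (\<Sum>i<n. - g (w i))})"
    by (intro measure_pmf.finite_measure_mono) (auto simp: sum_negf abs_if split: if_splits)
  also have "\<dots> \<le> measure_pmf.prob ?Q {w. s \<le> (\<Sum>i<n. g (w i))} + measure_pmf.prob ?Q {w. s \<le> (\<Sum>i<n. - g (w i))}"
    by (rule measure_subadditive) auto
  also have "\<dots> \<le> exp (real n * l\<^sup>2 * v - l * s) + exp (real n * l\<^sup>2 * v - l * s)"
    using bernstein_upper[OF fin mean b v l] bernstein_upper[OF fin _ _ _ l, of "\<lambda>x. - g x" v] mean b v
    by (intro add_mono) auto
  finally show ?thesis by simp
qed

lemma prob_pair_le:
  assumes fin: "finite (set_pmf A)" "finite (set_pmf Q)" and q: "0 \<le> q"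
    and good: "\<And>z. z \<in> G \<Longrightarrow> measure_pmf.prob Q {w. (z, w) \<in> X} \<le> q"
  shows "measure_pmf.prob (pair_pmf A Q) X \<le> measure_pmf.prob A (- G) + q"
proof -
  note int = integrable_finite_pmf[OF fin(1)]
  have "measure_pmf.prob (pair_pmf A Q) X = measure_pmf.expectation (pair_pmf A Q) (indicator X)" by simp
  also have "\<dots> = measure_pmf.expectation A (\<lambda>z. measure_pmf.expectation Q (\<lambda>w. indicator X (z, w)))"
    by (rule expectation_pair_pmf[OF fin])
  also have "\<dots> = measure_pmf.expectation A (\<lambda>z. measure_pmf.prob Q {w. (z, w) \<in> X})"
  proof -
    have "(\<lambda>w. indicator X (z, w)) = (indicator {w. (z, w) \<in> X} :: _ \<Rightarrow> real)" for z
      by (auto simp: indicator_def)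
    then show ?thesis by simp
  qed
  also have "\<dots> \<le> measure_pmf.expectation A (\<lambda>z. indicator (- G) z + q)"
    using good q by (intro expectation_mono_pmf[OF fin(1)]) (auto simp: indicator_def intro: order_trans[OF measure_pmf.prob_le_1])
  also have "\<dots> = measure_pmf.prob A (- G) + q"
    by (simp add: Bochner_Integration.integral_add[OF int int])
  finally show ?thesis .
qed

subsection \<open>The pairwise-comparison model\<close>

lemma sum_pairs:
  fixes g :: "nat \<Rightarrow> nat \<Rightarrow> real"
  assumes "\<And>a b. g a b = g b a" "\<And>a. g a a = 0"
  shows "(\<Sum>(a, b)\<in>{(a, b). a < b \<and> b < d}. g a b) = (\<Sum>a<d. \<Sum>b<d. g a b) / 2"
proof (induction d)
  case (Suc d)
  have fin: "finite {(a, b). a < b \<and> b < d}"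
    by (rule finite_subset[of _ "{..<d} \<times> {..<d}"]) auto
  have "{(a, b). a < b \<and> b < Suc d} = {(a, b). a < b \<and> b < d} \<union> (\<lambda>a. (a, d)) ` {..<d}"
    by (auto simp: less_Suc_eq)
  moreover have "{(a, b). a < b \<and> b < d} \<inter> (\<lambda>a. (a, d)) ` {..<d} = {}" by auto
  ultimately have "(\<Sum>(a, b)\<in>{(a, b). a < b \<and> b < Suc d}. g a b)
    = (\<Sum>(a, b)\<in>{(a, b). a < b \<and> b < d}. g a b) + (\<Sum>(a, b)\<in>(\<lambda>a. (a, d)) ` {..<d}. g a b)"
    using fin by (simp only: sum.union_disjoint finite_imageI finite_lessThan)
  also have "(\<Sum>(a, b)\<in>(\<lambda>a. (a, d)) ` {..<d}. g a b) = (\<Sum>a<d. g a d)"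
    by (subst sum.reindex) (auto simp: inj_on_def)
  finally have "(\<Sum>(a, b)\<in>{(a, b). a < b \<and> b < Suc d}. g a b)
    = (\<Sum>(a, b)\<in>{(a, b). a < b \<and> b < d}. g a b) + (\<Sum>a<d. g a d)" .
  moreover have "(\<Sum>b<d. g d b) = (\<Sum>a<d. g a d)" by (intro sum.cong refl assms(1))
  ultimately show ?case using Suc assms(2)[of d] by (simp add: sum.distrib)
qed simp

definition cmp :: "nat list \<Rightarrow> nat \<Rightarrow> nat \<Rightarrow> tensor" where
  "cmp u a b = (\<lambda>i. unit_tensor (a # u) i - unit_tensor (b # u) i)"

locale design_dims =
  fixes ds :: "nat list"
  assumes ds_ne: "ds \<noteq> []" and hd2: "2 \<le> hd ds" and dk: "\<And>k. k < length ds \<Longrightarrow> 1 \<le> ds ! k"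
begin

lemma idx_split: "a # u \<in> idx ds \<longleftrightarrow> a < hd ds \<and> u \<in> idx (tl ds)"
  using ds_ne by (cases ds) (auto simp: Cons_in_idx)

lemma sum_idx_split: "(\<Sum>i\<in>idx ds. f i) = (\<Sum>u\<in>idx (tl ds). \<Sum>a<hd ds. f (a # u))" for f :: "nat list \<Rightarrow> real"
  using ds_ne by (cases ds) (simp_all add: sum_idx_Cons, rule sum.swap)

lemma tinner_cmp:
  assumes "u \<in> idx (tl ds)" "a < hd ds" "b < hd ds"
  shows "tinner ds A (cmp u a b) = A (a # u) - A (b # u)"
proof -
  have *: "(\<Sum>i\<in>idx ds. A i * unit_tensor k i) = A k" if "k \<in> idx ds" for k
    using that by (simp add: unit_tensor_def if_distrib[of "\<lambda>x. _ * x"] cong: if_cong)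
  show ?thesis
    using assms by (simp add: tinner_def cmp_def right_diff_distrib sum_subtractf * idx_split)
qed

abbreviation "D \<equiv> real (prod_list (tl ds))"
abbreviation "d1 \<equiv> real (hd ds)"

lemma prod_list_eq: "real (prod_list ds) = d1 * D"
  using ds_ne by (cases ds) auto

lemma D_pos: "0 < D"
proof -
  have "k < length (tl ds) \<Longrightarrow> 0 < tl ds ! k" for k using dk[of "Suc k"] by (simp add: nth_tl Suc_le_eq less_diff_conv)
  then have "0 < prod_list (tl ds)" unfolding prod_list_nth by (intro prod_pos) auto
  then show ?thesis by simp
qed

lemma d1_ge: "2 \<le> d1" using hd2 by simp

lemma dstar_pos: "0 < dstar ds"
  using D_pos d1_ge by (simp add: dstar_def)

lemma dstar_le: "dstar ds \<le> real (prod_list ds) / 2"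
  using D_pos by (simp add: dstar_def prod_list_eq field_simps)

lemma dstar_ge: "real (prod_list ds) / 4 \<le> dstar ds"
proof -
  have "d1 / 2 * D \<le> (d1 - 1) * D" using D_pos d1_ge by (intro mult_right_mono) auto
  then show ?thesis by (simp add: dstar_def prod_list_eq field_simps)
qed

definition pairs :: "(nat \<times> nat) set" where "pairs = {(a, b). a < b \<and> b < hd ds}"

lemma pairs: "finite pairs" "pairs \<noteq> {}" "real (card pairs) = d1 * (d1 - 1) / 2"
proof -
  show fin: "finite pairs" unfolding pairs_def
    by (rule finite_subset[of _ "{..<hd ds} \<times> {..<hd ds}"]) auto
  have "(0, 1) \<in> pairs" using hd2 by (simp add: pairs_def)
  then show "pairs \<noteq> {}" by blast
  have "real (card pairs) = (\<Sum>(a, b)\<in>{(a, b). a < b \<and> b < hd ds}. if a = b then 0 else 1)"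
    unfolding real_of_card pairs_def[symmetric] by (intro sum.cong) (auto simp: pairs_def)
  also have "\<dots> = (\<Sum>a<hd ds. \<Sum>b<hd ds. if a = b then 0 else 1) / 2" by (rule sum_pairs) auto
  also have "(\<Sum>a<hd ds. \<Sum>b<hd ds. if a = b then 0 else 1 :: real) = (\<Sum>a<hd ds. d1 - 1)"
  proof (rule sum.cong[OF refl])
    fix a assume "a \<in> {..<hd ds}"
    then show "(\<Sum>b<hd ds. if a = b then 0 else 1 :: real) = d1 - 1"
      by (subst sum.remove[of _ a]) (auto simp: of_nat_diff Suc_leI)
  qed
  finally show "real (card pairs) = d1 * (d1 - 1) / 2" by simp
qed

lemma idx_tl: "idx (tl ds) \<noteq> {}" "real (card (idx (tl ds))) = D"
proof -
  show "real (card (idx (tl ds))) = D" by (simp add: card_idx)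
  moreover have "real (card {}) = 0" by simp
  ultimately show "idx (tl ds) \<noteq> {}" using D_pos by (metis less_irrefl)
qed

lemma design_eq: "design ds = map_pmf (\<lambda>(u, a, b). cmp u a b) (pair_pmf (pmf_of_set (idx (tl ds))) (pmf_of_set pairs))"
  unfolding design_def pairs_def cmp_def by (rule arg_cong[of _ _ "\<lambda>f. map_pmf f _"]) auto

lemma set_design:
  assumes "X \<in> set_pmf (design ds)"
  obtains u a b where "X = cmp u a b" "u \<in> idx (tl ds)" "a < hd ds" "b < hd ds"
proof -
  obtain u a b where "X = cmp u a b" "u \<in> idx (tl ds)" "(a, b) \<in> pairs"
    using assms pairs(1,2) idx_tl(1) unfolding design_eq by (auto simp: set_pmf_of_set)
  then show ?thesis using that by (auto simp: pairs_def)
qed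

lemma finite_design: "finite (set_pmf (design ds))"
  unfolding design_eq using pairs idx_tl by (simp add: set_pmf_of_set)

text \<open>Unordered pairs are replaced by all ordered pairs at half weight, the diagonal
  contributing 0. The number of designs is D d_1 (d_1 - 1) / 2 = d_1 d^*, whence the
  denominator.\<close>

lemma expectation_design:
  fixes F :: "tensor \<Rightarrow> real"
  assumes sym: "\<And>u a b. u \<in> idx (tl ds) \<Longrightarrow> a < hd ds \<Longrightarrow> b < hd ds \<Longrightarrow> F (cmp u a b) = g u a b"
    and g: "\<And>u a b. g u a b = g u b a" "\<And>u a. g u a a = 0"
  shows "measure_pmf.expectation (design ds) F
    = (\<Sum>u\<in>idx (tl ds). \<Sum>a<hd ds. \<Sum>b<hd ds. g u a b) / (2 * d1 * dstar ds)"
proof -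
  have "measure_pmf.expectation (design ds) F
    = measure_pmf.expectation (pmf_of_set (idx (tl ds))) (\<lambda>u. measure_pmf.expectation (pmf_of_set pairs) (\<lambda>(a, b). F (cmp u a b)))"
    unfolding design_eq integral_map_pmf using pairs idx_tl
    by (subst expectation_pair_pmf) (auto simp: set_pmf_of_set split_def)
  also have "\<dots> = (\<Sum>u\<in>idx (tl ds). (\<Sum>(a, b)\<in>pairs. F (cmp u a b)) / real (card pairs)) / D"
    using pairs(1,2) idx_tl by (simp add: integral_pmf_of_set split_def sum_divide_distrib)
  also have "\<dots> = (\<Sum>u\<in>idx (tl ds). (\<Sum>a<hd ds. \<Sum>b<hd ds. g u a b) / 2 / real (card pairs)) / D"
  proof -
    have "(\<Sum>(a, b)\<in>pairs. F (cmp u a b)) = (\<Sum>a<hd ds. \<Sum>b<hd ds. g u a b) / 2" if "u \<in> idx (tl ds)" for u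
      unfolding sum_pairs[of "g u" "hd ds", OF g, symmetric] pairs_def
      using sym[OF that] by (intro sum.cong) auto
    then show ?thesis by (intro arg_cong[where f = "\<lambda>x. x / D"] sum.cong refl) (simp only:)
  qed
  also have "\<dots> = (\<Sum>u\<in>idx (tl ds). \<Sum>a<hd ds. \<Sum>b<hd ds. g u a b) / (2 * d1 * dstar ds)"
  proof -
    have "s / 2 / (d * x / 2) / D' = s / (2 * d * (D' * x / 2))" for s d x D' :: real by (simp add: mult_ac)
    then show ?thesis unfolding pairs(3) dstar_def sum_divide_distrib[symmetric] .
  qed
  finally show ?thesis .
qed

text \<open>Expanding the product, the cross terms contain the sum of \<open>H\<close> over the
  first mode, which vanishes. \<open>A\<close> is arbitrary, so this is the identity defining d^*,
  tested against an arbitrary tensor.\<close>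

lemma expectation_product:
  assumes H: "zero_sum ds H"
  shows "measure_pmf.expectation (design ds) (\<lambda>X. tinner ds A X * tinner ds H X) = tinner ds A H / dstar ds"
proof -
  define g where "g = (\<lambda>u a b. (A (a # u) - A (b # u)) * (H (a # u) - H (b # u)))"
  have inner: "(\<Sum>a<hd ds. \<Sum>b<hd ds. g u a b) = 2 * d1 * (\<Sum>a<hd ds. A (a # u) * H (a # u))"
    if u: "u \<in> idx (tl ds)" for u
  proof -
    define x y where "x = (\<lambda>a. A (a # u))" and "y = (\<lambda>a. H (a # u))"
    define s where "s = (\<Sum>a<hd ds. x a * y a)"
    have z: "(\<Sum>b<hd ds. y b) = 0" using H u by (simp add: zero_sum_def y_def)
    have "(\<Sum>b<hd ds. g u a b) = d1 * (x a * y a) - (\<Sum>b<hd ds. x b) * y a + s" for a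
    proof -
      have "(\<Sum>b<hd ds. g u a b) = (\<Sum>b<hd ds. ((x a * y a - x a * y b) - x b * y a) + x b * y b)"
        by (rule sum.cong) (simp_all add: g_def x_def y_def algebra_simps)
      also have "\<dots> = d1 * (x a * y a) - x a * (\<Sum>b<hd ds. y b) - (\<Sum>b<hd ds. x b) * y a + s"
        unfolding sum.distrib sum_subtractf sum_distrib_left[symmetric] sum_distrib_right[symmetric] s_def by simp
      finally show ?thesis using z by simp
    qed
    then have "(\<Sum>a<hd ds. \<Sum>b<hd ds. g u a b) = (\<Sum>a<hd ds. d1 * (x a * y a) - (\<Sum>b<hd ds. x b) * y a + s)"
      by simp
    also have "\<dots> = d1 * s - (\<Sum>b<hd ds. x b) * (\<Sum>a<hd ds. y a) + d1 * s"
      unfolding sum.distrib sum_subtractf sum_distrib_left[symmetric] s_def by simp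
    finally show ?thesis using z by (simp add: s_def x_def y_def)
  qed
  have "measure_pmf.expectation (design ds) (\<lambda>X. tinner ds A X * tinner ds H X)
     = (\<Sum>u\<in>idx (tl ds). \<Sum>a<hd ds. \<Sum>b<hd ds. g u a b) / (2 * d1 * dstar ds)"
    by (rule expectation_design) (auto simp: tinner_cmp g_def algebra_simps)
  also have "(\<Sum>u\<in>idx (tl ds). \<Sum>a<hd ds. \<Sum>b<hd ds. g u a b) = 2 * d1 * tinner ds A H"
    unfolding tinner_def sum_idx_split by (subst sum_distrib_left) (rule sum.cong[OF refl inner])
  also have "2 * d1 * tinner ds A H / (2 * d1 * dstar ds) = tinner ds A H / dstar ds"
    using d1_ge by simp
  finally show ?thesis .
qed

lemma expectation_abs:
  "measure_pmf.expectation (design ds) (\<lambda>X. \<bar>tinner ds A X\<bar>) \<le> l1_norm ds A / dstar ds"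
proof -
  define g where "g = (\<lambda>u a b. \<bar>A (a # u) - A (b # u)\<bar>)"
  have "measure_pmf.expectation (design ds) (\<lambda>X. \<bar>tinner ds A X\<bar>)
     = (\<Sum>u\<in>idx (tl ds). \<Sum>a<hd ds. \<Sum>b<hd ds. g u a b) / (2 * d1 * dstar ds)"
    by (rule expectation_design) (auto simp: tinner_cmp g_def)
  also have "\<dots> \<le> (\<Sum>u\<in>idx (tl ds). \<Sum>a<hd ds. \<Sum>b<hd ds. \<bar>A (a # u)\<bar> + \<bar>A (b # u)\<bar>) / (2 * d1 * dstar ds)"
    using d1_ge dstar_pos by (intro divide_right_mono sum_mono) (auto simp: g_def)
  also have "(\<Sum>u\<in>idx (tl ds). \<Sum>a<hd ds. \<Sum>b<hd ds. \<bar>A (a # u)\<bar> + \<bar>A (b # u)\<bar>) = 2 * d1 * l1_norm ds A"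
    by (simp add: l1_norm_def sum_idx_split sum.distrib sum_distrib_left mult.assoc)
  also have "2 * d1 * l1_norm ds A / (2 * d1 * dstar ds) = l1_norm ds A / dstar ds"
    using d1_ge by simp
  finally show ?thesis .
qed

lemma tinner_bound:
  assumes "X \<in> set_pmf (design ds)" "\<And>i. i \<in> idx ds \<Longrightarrow> \<bar>A i\<bar> \<le> x"
  shows "\<bar>tinner ds A X\<bar> \<le> 2 * x"
proof -
  obtain u a b where X: "X = cmp u a b" "u \<in> idx (tl ds)" "a < hd ds" "b < hd ds"
    using set_design[OF assms(1)] by blast
  have "\<bar>A (a # u)\<bar> \<le> x" "\<bar>A (b # u)\<bar> \<le> x" using X assms(2) by (auto simp: idx_split)
  then show ?thesis using X by (simp add: tinner_cmp)
qed

lemma obs_law_eq: "obs_law ds T = bind_pmf (design ds) (\<lambda>X. map_pmf (\<lambda>y. (X, of_bool y)) (bernoulli_pmf (sigma (tinner ds T X))))"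
  by (simp add: obs_law_def map_pmf_def bind_assoc_pmf bind_return_pmf)

lemma finite_obs_law: "finite (set_pmf (obs_law ds T))"
  unfolding obs_law_eq using finite_design by (auto intro: finite_subset[OF subset_UNIV])

lemma set_obs_law:
  assumes "(X, y) \<in> set_pmf (obs_law ds T)"
  shows "X \<in> set_pmf (design ds)" "y = 0 \<or> y = 1"
  using assms unfolding obs_law_eq by auto

lemma sigma_in_01: "0 < sigma z" "sigma z < 1"
  by (auto simp: sigma_def add_pos_pos)

lemma expectation_obs_law:
  fixes F :: "obs \<Rightarrow> real"
  shows "measure_pmf.expectation (obs_law ds T) F = measure_pmf.expectation (design ds)
    (\<lambda>X. sigma (tinner ds T X) * F (X, 1) + (1 - sigma (tinner ds T X)) * F (X, 0))"
proof -
  have "measure_pmf.expectation (obs_law ds T) F = (\<Sum>X\<in>set_pmf (design ds). pmf (design ds) X *\<^sub>R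
     measure_pmf.expectation (map_pmf (\<lambda>y. (X, of_bool y)) (bernoulli_pmf (sigma (tinner ds T X)))) F)"
    unfolding obs_law_eq by (rule pmf_expectation_bind) (auto simp: finite_design intro: finite_subset[OF subset_UNIV])
  also have "\<dots> = (\<Sum>X\<in>set_pmf (design ds). pmf (design ds) X *\<^sub>R
     (sigma (tinner ds T X) * F (X, 1) + (1 - sigma (tinner ds T X)) * F (X, 0)))"
    using sigma_in_01 by (intro sum.cong refl) (simp add: less_imp_le)
  also have "\<dots> = measure_pmf.expectation (design ds)
    (\<lambda>X. sigma (tinner ds T X) * F (X, 1) + (1 - sigma (tinner ds T X)) * F (X, 0))"
    by (subst integral_measure_pmf[OF finite_design]) auto
  finally show ?thesis .
qed

end

section \<open>The logistic link\<close>

lemma sigma_alt: "1 - sigma z = 1 / (1 + exp z)"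
proof -
  have "1 + exp z \<noteq> 0" using exp_gt_zero[of z] by linarith
  then show ?thesis by (simp add: sigma_def exp_minus field_simps)
qed

lemma info_eq: "info z = 1 / (2 + exp z + exp (- z))"
proof -
  have "info z = 1 / ((1 + exp (- z)) * (1 + exp z))" unfolding info_def sigma_alt by (simp add: sigma_def)
  also have "(1 + exp (- z)) * (1 + exp z) = 2 + exp z + exp (- z)"
    by (simp add: algebra_simps exp_add[symmetric])
  finally show ?thesis .
qed

lemma info_pos: "0 < info z"
  unfolding info_eq by (simp add: add_pos_pos)

lemma info_le: "info z \<le> 1 / 4"
proof -
  have "(sigma z - 1 / 2)\<^sup>2 \<ge> 0" by simp
  then show ?thesis by (simp add: info_def power2_eq_square algebra_simps)
qed

lemma inverse_info_le:
  assumes "\<bar>z\<bar> \<le> R"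
  shows "1 / info z \<le> 4 * exp R"
proof -
  have "exp z \<le> exp R" "exp (- z) \<le> exp R" "1 \<le> exp R" using assms by auto
  moreover have "1 / info z = 2 + exp z + exp (- z)" by (simp add: info_eq)
  ultimately show ?thesis by linarith
qed

lemma sigma_deriv: "(sigma has_real_derivative info z) (at z)"
proof -
  have "1 + exp (- z) \<noteq> 0" using exp_gt_zero[of "- z"] by linarith
  then have "((\<lambda>z. 1 / (1 + exp (- z))) has_real_derivative (exp (- z) / (1 + exp (- z))\<^sup>2)) (at z)"
    by (auto intro!: derivative_eq_intros simp: power2_eq_square)
  moreover have "exp (- z) / (1 + exp (- z))\<^sup>2 = info z"
    using \<open>1 + exp (- z) \<noteq> 0\<close> by (simp add: info_def sigma_def field_simps power2_eq_square)
  ultimately show ?thesis by (simp add: sigma_def[abs_def])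
qed

lemma sigma_mvt: "\<exists>w. \<bar>w - y\<bar> \<le> \<bar>x - y\<bar> \<and> sigma x - sigma y = info w * (x - y)"
proof -
  consider "x = y" | "x < y" | "y < x" by linarith
  then show ?thesis
  proof cases
    case 2
    obtain w where "x < w" "w < y" "sigma y - sigma x = (y - x) * info w"
      using MVT2[OF 2, of sigma info] sigma_deriv by blast
    then show ?thesis by (intro exI[of _ w]) (auto simp: algebra_simps)
  next
    case 3
    obtain w where "y < w" "w < x" "sigma x - sigma y = (x - y) * info w"
      using MVT2[OF 3, of sigma info] sigma_deriv by blast
    then show ?thesis by (intro exI[of _ w]) (auto simp: algebra_simps)
  qed auto
qed

lemma sigma_lipschitz: "\<bar>sigma x - sigma y\<bar> \<le> \<bar>x - y\<bar> / 4"
proof -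
  obtain w where "sigma x - sigma y = info w * (x - y)" using sigma_mvt by blast
  then have "\<bar>sigma x - sigma y\<bar> = info w * \<bar>x - y\<bar>" using info_pos[of w] by (simp add: abs_mult)
  also have "\<dots> \<le> 1 / 4 * \<bar>x - y\<bar>" by (intro mult_right_mono info_le) auto
  finally show ?thesis by simp
qed

lemma info_lipschitz: "\<bar>info x - info y\<bar> \<le> \<bar>x - y\<bar>"
proof -
  have "0 < sigma z \<and> sigma z < 1" for z by (auto simp: sigma_def add_pos_pos)
  then have "0 < sigma x" "sigma x < 1" "0 < sigma y" "sigma y < 1" by blast+
  then have "\<bar>1 - sigma x - sigma y\<bar> \<le> 1" by linarith
  moreover have "info x - info y = (sigma x - sigma y) * (1 - sigma x - sigma y)"
    by (simp add: info_def algebra_simps)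
  ultimately have "\<bar>info x - info y\<bar> \<le> \<bar>sigma x - sigma y\<bar> * 1"
    unfolding abs_mult by (metis abs_ge_zero abs_mult mult_left_mono)
  then have "\<bar>info x - info y\<bar> \<le> \<bar>sigma x - sigma y\<bar>" by simp
  also have "\<dots> \<le> \<bar>x - y\<bar> / 4" by (rule sigma_lipschitz)
  also have "\<dots> \<le> \<bar>x - y\<bar>" by simp
  finally show ?thesis .
qed

lemma sigma_taylor: "\<bar>sigma x - sigma y - info y * (x - y)\<bar> \<le> (x - y)\<^sup>2"
proof -
  obtain w where w: "\<bar>w - y\<bar> \<le> \<bar>x - y\<bar>" "sigma x - sigma y = info w * (x - y)" using sigma_mvt by blast
  have "\<bar>sigma x - sigma y - info y * (x - y)\<bar> = \<bar>info w - info y\<bar> * \<bar>x - y\<bar>"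
    by (simp add: w(2) abs_mult[symmetric] algebra_simps)
  also have "\<dots> \<le> \<bar>x - y\<bar> * \<bar>x - y\<bar>"
    using info_lipschitz[of w y] w(1) by (intro mult_right_mono) auto
  finally show ?thesis by (simp add: power2_eq_square)
qed

section \<open>Bias, moments and size of the summands\<close>

text \<open>The interface between geometry and probability: \<open>Hh\<close> and \<open>Hs\<close>
  stand for the projections of \<open>G\<close> at the estimate and at the truth, not yet scaled by
  \<open>dstar ds\<close>, and \<open>A\<close> absorbs all geometric constants. \<open>orth\<close>
  reflects that a tensor lies in its own tangent space, \<open>Hs_lower\<close> is the alignment
  assumption with the l_1 norm of \<open>G\<close> on the left.\<close>

locale plug_in = design_dims +
  fixes T Th G Hh Hs :: tensor and A B e a :: real
  assumes zs: "zero_sum ds Hh" "zero_sum ds Hs"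
    and TB: "\<And>i. i \<in> idx ds \<Longrightarrow> \<bar>T i\<bar> \<le> B"
    and diff: "\<And>i. i \<in> idx ds \<Longrightarrow> \<bar>Th i - T i\<bar> \<le> e" and e: "0 < e" "e \<le> 1"
    and A: "0 < A" and a: "0 < a" and L: "0 < l1_norm ds G" and db: "1 \<le> dbar ds"
    and Hh_l1: "l1_norm ds Hh \<le> A * l1_norm ds G"
    and Hh_inf: "\<And>i. i \<in> idx ds \<Longrightarrow> \<bar>Hh i\<bar> \<le> A * (dbar ds / real (prod_list ds)) * l1_norm ds G"
    and rem: "\<bar>tinner ds (\<lambda>i. G i - Hh i) T\<bar> \<le> A * e\<^sup>2 * l1_norm ds G"
    and orth: "tinner ds (\<lambda>i. G i - Hh i) Th = 0"
    and Hdiff: "L2_set (\<lambda>i. Hh i - Hs i) (idx ds) \<le> A * e * sqrt (dbar ds / real (prod_list ds)) * l1_norm ds G"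
    and Hs_lower: "a * sqrt (dbar ds) * l1_norm ds G \<le> sqrt (dstar ds) * L2_set Hs (idx ds)"
begin

abbreviation "L \<equiv> l1_norm ds G"
abbreviation ED :: "(tensor \<Rightarrow> real) \<Rightarrow> real" where "ED \<equiv> measure_pmf.expectation (design ds)"
abbreviation EO :: "(obs \<Rightarrow> real) \<Rightarrow> real" where "EO \<equiv> measure_pmf.expectation (obs_law ds T)"

text \<open>A contrast of two entries is at most \<open>2 * B\<close> at the truth and at most
  \<open>2 * B + 2 * e\<close> at the estimate, with \<open>e \<le> 1\<close>;
  \<open>inverse_info_le\<close> then covers both.\<close>

definition cI :: real where "cI = 4 * exp (2 * B + 2)"
definition \<eta> :: "tensor \<Rightarrow> real" where "\<eta> X = tinner ds T X"
definition \<eta>h :: "tensor \<Rightarrow> real" where "\<eta>h X = tinner ds Th X"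
definition h :: "tensor \<Rightarrow> real" where "h X = dstar ds * tinner ds Hh X"
definition hs :: "tensor \<Rightarrow> real" where "hs X = dstar ds * tinner ds Hs X"
definition phi :: "obs \<Rightarrow> real" where "phi = (\<lambda>(X, y). score_ws y (\<eta>h X) * h X)"
definition V :: real where "V = ED (\<lambda>X. (hs X)\<^sup>2 / info (\<eta> X))"
text \<open>The root mean square of \<open>hs\<close> under the design, by
  \<open>ED_square\<close>.\<close>

definition N :: real where "N = sqrt (dstar ds) * L2_set Hs (idx ds)"

lemma B0: "0 \<le> B"
proof -
  obtain u where u: "u \<in> idx (tl ds)" using idx_tl(1) by blast
  have "0 # u \<in> idx ds" using u hd2 by (simp add: idx_split)
  from TB[OF this] show ?thesis by linarith
qed

lemma cI1: "1 \<le> cI"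
proof -
  have "1 \<le> exp (2 * B + 2)" using B0 by simp
  then show ?thesis unfolding cI_def by linarith
qed

lemma etas:
  assumes "X \<in> set_pmf (design ds)"
  shows "\<bar>\<eta> X - \<eta>h X\<bar> \<le> 2 * e" "1 / info (\<eta> X) \<le> cI" "1 / info (\<eta>h X) \<le> cI"
proof -
  have "\<bar>\<eta>h X - \<eta> X\<bar> = \<bar>tinner ds (\<lambda>i. Th i - T i) X\<bar>"
    by (simp add: \<eta>h_def \<eta>_def tinner_def left_diff_distrib sum_subtractf)
  also have "\<dots> \<le> 2 * e" by (rule tinner_bound[OF assms diff])
  finally show 1: "\<bar>\<eta> X - \<eta>h X\<bar> \<le> 2 * e" by (simp only: abs_minus_commute)
  have 2: "\<bar>\<eta> X\<bar> \<le> 2 * B" unfolding \<eta>_def by (rule tinner_bound[OF assms TB])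
  show "1 / info (\<eta> X) \<le> cI" unfolding cI_def by (rule inverse_info_le) (use 2 in linarith)
  show "1 / info (\<eta>h X) \<le> cI" unfolding cI_def by (rule inverse_info_le) (use 1 2 e in linarith)
qed

lemma sigma_diff:
  assumes "X \<in> set_pmf (design ds)"
  shows "\<bar>sigma (\<eta> X) - sigma (\<eta>h X)\<bar> \<le> e"
proof -
  have "\<bar>sigma (\<eta> X) - sigma (\<eta>h X)\<bar> \<le> \<bar>\<eta> X - \<eta>h X\<bar> / 4" by (rule sigma_lipschitz)
  also have "\<dots> \<le> (2 * e) / 4" using etas(1)[OF assms] by (rule divide_right_mono) simp
  also have "\<dots> \<le> e" using e by simp
  finally show ?thesis .
qed

lemma ED_mono: "(\<And>X. X \<in> set_pmf (design ds) \<Longrightarrow> F X \<le> F' X) \<Longrightarrow> ED F \<le> ED F'"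
  by (rule expectation_mono_pmf[OF finite_design]) blast

lemma ED_abs: "(\<And>X. X \<in> set_pmf (design ds) \<Longrightarrow> \<bar>F X\<bar> \<le> F' X) \<Longrightarrow> \<bar>ED F\<bar> \<le> ED F'"
  using expectation_abs_le[OF finite_design, of F F'] by simp

lemma ED_diff: "ED (\<lambda>X. F X - F' X) = ED F - ED F'"
  by (rule Bochner_Integration.integral_diff[OF integrable_finite_pmf integrable_finite_pmf, OF finite_design finite_design])

lemma ED_add: "ED (\<lambda>X. F X + F' X) = ED F + ED F'"
  by (rule Bochner_Integration.integral_add[OF integrable_finite_pmf integrable_finite_pmf, OF finite_design finite_design])

lemma ED_scale: "ED (\<lambda>X. c * F X) = c * ED F" for c :: real
  by (rule integral_mult_right_zero)

lemma ED_square: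
  assumes "zero_sum ds H"
  shows "ED (\<lambda>X. (dstar ds * tinner ds H X)\<^sup>2) = (sqrt (dstar ds) * L2_set H (idx ds))\<^sup>2"
proof -
  have "ED (\<lambda>X. (dstar ds * tinner ds H X)\<^sup>2) = ED (\<lambda>X. (dstar ds)\<^sup>2 * (tinner ds H X * tinner ds H X))"
    by (simp add: power2_eq_square mult_ac)
  also have "\<dots> = (dstar ds)\<^sup>2 * (tinner ds H H / dstar ds)"
    unfolding ED_scale expectation_product[OF assms] ..
  also have "\<dots> = dstar ds * tinner ds H H" using dstar_pos by (simp add: power2_eq_square)
  also have "tinner ds H H = (L2_set H (idx ds))\<^sup>2" by (simp only: L2_set_squared) (simp add: tinner_def power2_eq_square)
  finally show ?thesis using dstar_pos by (simp add: power_mult_distrib)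
qed

lemma N_lower: "a * sqrt (dbar ds) * L \<le> N"
  using Hs_lower by (simp add: N_def)

lemma N_pos: "0 < N"
  using N_lower a L db by (smt (verit) mult_pos_pos real_sqrt_gt_zero)

lemma V_lower: "N\<^sup>2 \<le> V"
proof -
  have "N\<^sup>2 = ED (\<lambda>X. (hs X)\<^sup>2)" unfolding hs_def N_def by (rule ED_square[OF zs(2), symmetric])
  also have "\<dots> \<le> V" unfolding V_def
  proof (rule ED_mono)
    fix X
    have "(hs X)\<^sup>2 * 1 \<le> (hs X)\<^sup>2 * (1 / info (\<eta> X))"
      using info_le[of "\<eta> X"] info_pos[of "\<eta> X"] by (intro mult_left_mono) (auto simp: field_simps)
    then show "(hs X)\<^sup>2 \<le> (hs X)\<^sup>2 / info (\<eta> X)" by simp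
  qed
  finally show ?thesis .
qed

lemma V_pos: "0 < V"
  using V_lower N_pos zero_less_power[of N 2] by linarith

lemma sqrtV_lower: "a * sqrt (dbar ds) * L \<le> sqrt V"
  using N_lower real_le_rsqrt[OF V_lower] by linarith

text \<open>The \<open>l_1\<close> bound is needed here: bounding the expectation by the root mean square of \<open>h\<close> would
  cost a factor of order \<open>sqrt (dbar ds)\<close> and require \<open>n\<close> to dominate \<open>dbar ds ^ 2\<close>.\<close>

lemma E_abs_h: "ED (\<lambda>X. \<bar>h X\<bar>) \<le> A * L"
proof -
  have "ED (\<lambda>X. \<bar>h X\<bar>) = ED (\<lambda>X. dstar ds * \<bar>tinner ds Hh X\<bar>)"
    using dstar_pos by (simp add: h_def abs_mult)
  also have "\<dots> \<le> dstar ds * (l1_norm ds Hh / dstar ds)"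
    unfolding ED_scale using dstar_pos by (intro mult_left_mono expectation_abs) auto
  also have "\<dots> \<le> A * L" using dstar_pos Hh_l1 by simp
  finally show ?thesis .
qed

lemma E_phi: "EO phi = ED (\<lambda>X. (sigma (\<eta> X) - sigma (\<eta>h X)) / info (\<eta>h X) * h X)"
proof -
  have "s * (score_ws 1 z * y) + (1 - s) * (score_ws 0 z * y) = (s - sigma z) / info z * y" for s z y :: real
    using info_pos[of z] by (simp add: score_ws_def score_def field_simps)
  then show ?thesis unfolding expectation_obs_law by (simp add: phi_def \<eta>_def)
qed

lemma E_phi2: "EO (\<lambda>x. (phi x)\<^sup>2) = ED (\<lambda>X. (info (\<eta> X) + (sigma (\<eta> X) - sigma (\<eta>h X))\<^sup>2) / (info (\<eta>h X))\<^sup>2 * (h X)\<^sup>2)"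
proof -
  have "s * (score_ws 1 z * y)\<^sup>2 + (1 - s) * (score_ws 0 z * y)\<^sup>2 = (s * (1 - s) + (s - sigma z)\<^sup>2) / (info z)\<^sup>2 * y\<^sup>2" for s z y :: real
  proof -
    have "s * (score_ws 1 z * y)\<^sup>2 + (1 - s) * (score_ws 0 z * y)\<^sup>2
      = (s * (1 - sigma z)\<^sup>2 + (1 - s) * (0 - sigma z)\<^sup>2) / (info z)\<^sup>2 * y\<^sup>2"
      by (simp add: score_ws_def score_def power_mult_distrib power_divide add_divide_distrib distrib_right)
    also have "s * (1 - sigma z)\<^sup>2 + (1 - s) * (0 - sigma z)\<^sup>2 = s * (1 - s) + (s - sigma z)\<^sup>2"
      by (simp add: power2_eq_square algebra_simps)
    finally show ?thesis .
  qed
  then show ?thesis unfolding expectation_obs_law by (simp add: phi_def \<eta>_def info_def)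
qed

lemma phi_bound:
  assumes "x \<in> set_pmf (obs_law ds T)"
  shows "\<bar>phi x\<bar> \<le> cI * A * dbar ds * L"
proof -
  obtain X y where x: "x = (X, y)" by (cases x)
  have X: "X \<in> set_pmf (design ds)" and y: "y = 0 \<or> y = 1" using set_obs_law assms x by auto
  have "\<bar>y - sigma (\<eta>h X)\<bar> \<le> 1" using y sigma_in_01[of "\<eta>h X"] by auto
  then have "\<bar>score_ws y (\<eta>h X)\<bar> \<le> 1 * (1 / info (\<eta>h X))"
    using info_pos[of "\<eta>h X"] by (simp add: score_ws_def score_def abs_divide divide_right_mono)
  then have 1: "\<bar>score_ws y (\<eta>h X)\<bar> \<le> cI" using etas(3)[OF X] by linarith
  have W: "0 < real (prod_list ds)" using dstar_pos dstar_le by linarith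
  have "\<bar>h X\<bar> \<le> dstar ds * (2 * (A * (dbar ds / real (prod_list ds)) * L))"
  proof -
    have "\<bar>tinner ds Hh X\<bar> \<le> 2 * (A * (dbar ds / real (prod_list ds)) * L)" by (rule tinner_bound[OF X Hh_inf])
    then show ?thesis unfolding h_def abs_mult abs_of_pos[OF dstar_pos] by (rule mult_left_mono) (use dstar_pos in simp)
  qed
  also have "\<dots> \<le> real (prod_list ds) / 2 * (2 * (A * (dbar ds / real (prod_list ds)) * L))"
    using dstar_le A db L W by (intro mult_right_mono) auto
  also have "\<dots> = A * dbar ds * L"
  proof -
    have "w / 2 * (2 * (x * (y / w) * z)) = x * y * z" if "0 < w" for w x y z :: real using that by simp
    from this[OF W] show ?thesis .
  qed
  finally have 2: "\<bar>h X\<bar> \<le> A * dbar ds * L" .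
  have "\<bar>phi x\<bar> \<le> cI * (A * dbar ds * L)"
    unfolding x phi_def prod.case abs_mult using 1 2 cI1 by (intro mult_mono) auto
  then show ?thesis by simp
qed

lemma mean_bound: "\<bar>EO phi\<bar> \<le> cI * A * e * L"
proof -
  have "\<bar>EO phi\<bar> \<le> ED (\<lambda>X. (e * cI) * \<bar>h X\<bar>)"
    unfolding E_phi
  proof (rule ED_abs)
    fix X assume X: "X \<in> set_pmf (design ds)"
    have "\<bar>sigma (\<eta> X) - sigma (\<eta>h X)\<bar> \<le> e"
      by (rule sigma_diff[OF X])
    then have "\<bar>sigma (\<eta> X) - sigma (\<eta>h X)\<bar> * (1 / info (\<eta>h X)) \<le> e * cI"
      using etas(3)[OF X] info_pos[of "\<eta>h X"] e by (intro mult_mono) auto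
    then show "\<bar>(sigma (\<eta> X) - sigma (\<eta>h X)) / info (\<eta>h X) * h X\<bar> \<le> e * cI * \<bar>h X\<bar>"
      unfolding abs_mult abs_divide using info_pos[of "\<eta>h X"] by (intro mult_right_mono) auto
  qed
  also have "\<dots> \<le> e * cI * (A * L)"
    unfolding ED_scale using E_abs_h e cI1 by (intro mult_left_mono) auto
  finally show ?thesis by (simp add: mult_ac)
qed

text \<open>Linearising \<open>sigma\<close> at the estimated contrast, the linear part has
  expectation \<langle>T - Th, Hh\<rangle> exactly. Together with \<langle>G, Th - T\<rangle> and
  \<open>orth\<close> this collapses to -\<langle>G - Hh, T\<rangle>, which \<open>rem\<close>
  bounds. The Taylor remainder gives 4 and \<open>rem\<close> gives 1 of the factor 5.\<close>

lemma bias_bound: "\<bar>tinner ds G Th - tinner ds G T + EO phi\<bar> \<le> 5 * cI * A * e\<^sup>2 * L"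
proof -
  let ?r = "\<lambda>X. (sigma (\<eta> X) - sigma (\<eta>h X) - info (\<eta>h X) * (\<eta> X - \<eta>h X)) / info (\<eta>h X) * h X"
  have "EO phi = ED (\<lambda>X. ?r X + (\<eta> X - \<eta>h X) * h X)"
  proof -
    have "(sigma (\<eta> X) - sigma (\<eta>h X)) / info (\<eta>h X) * h X = ?r X + (\<eta> X - \<eta>h X) * h X" for X
      using info_pos[of "\<eta>h X"] by (simp add: field_simps)
    then show ?thesis unfolding E_phi by simp
  qed
  also have "\<dots> = ED ?r + ED (\<lambda>X. (\<eta> X - \<eta>h X) * h X)" by (rule ED_add)
  also have "ED (\<lambda>X. (\<eta> X - \<eta>h X) * h X) = ED (\<lambda>X. dstar ds * (tinner ds (\<lambda>i. T i - Th i) X * tinner ds Hh X))"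
  proof -
    have "\<eta> X - \<eta>h X = tinner ds (\<lambda>i. T i - Th i) X" for X
      by (simp add: \<eta>_def \<eta>h_def tinner_def left_diff_distrib sum_subtractf)
    then show ?thesis by (simp add: h_def mult_ac)
  qed
  also have "\<dots> = tinner ds (\<lambda>i. T i - Th i) Hh"
    unfolding ED_scale expectation_product[OF zs(1)] using dstar_pos by simp
  finally have "tinner ds G Th - tinner ds G T + EO phi
     = ED ?r + (tinner ds G Th - tinner ds G T + tinner ds (\<lambda>i. T i - Th i) Hh)" by simp
  also have "tinner ds G Th - tinner ds G T + tinner ds (\<lambda>i. T i - Th i) Hh = - tinner ds (\<lambda>i. G i - Hh i) T"
    using orth by (simp add: tinner_def algebra_simps sum_subtractf)
  finally have "\<bar>tinner ds G Th - tinner ds G T + EO phi\<bar> \<le> \<bar>ED ?r\<bar> + A * e\<^sup>2 * L"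
    using rem by linarith
  moreover have "\<bar>ED ?r\<bar> \<le> ED (\<lambda>X. (4 * e\<^sup>2 * cI) * \<bar>h X\<bar>)"
  proof (rule ED_abs)
    fix X assume X: "X \<in> set_pmf (design ds)"
    have "(\<eta> X - \<eta>h X)\<^sup>2 \<le> (2 * e)\<^sup>2"
      using etas(1)[OF X] e by (intro abs_le_square_iff[THEN iffD1]) (auto simp: abs_minus_commute)
    then have "\<bar>sigma (\<eta> X) - sigma (\<eta>h X) - info (\<eta>h X) * (\<eta> X - \<eta>h X)\<bar> \<le> 4 * e\<^sup>2"
      using sigma_taylor[of "\<eta> X" "\<eta>h X"] by (simp add: power_mult_distrib)
    then have "\<bar>sigma (\<eta> X) - sigma (\<eta>h X) - info (\<eta>h X) * (\<eta> X - \<eta>h X)\<bar> * (1 / info (\<eta>h X)) \<le> 4 * e\<^sup>2 * cI"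
      using etas(3)[OF X] info_pos[of "\<eta>h X"] e by (intro mult_mono) auto
    then show "\<bar>?r X\<bar> \<le> 4 * e\<^sup>2 * cI * \<bar>h X\<bar>"
      unfolding abs_mult abs_divide using info_pos[of "\<eta>h X"] by (intro mult_right_mono) auto
  qed
  moreover have "ED (\<lambda>X. (4 * e\<^sup>2 * cI) * \<bar>h X\<bar>) \<le> 4 * e\<^sup>2 * cI * (A * L)"
    unfolding ED_scale using E_abs_h e cI1 by (intro mult_left_mono) auto
  moreover have "A * e\<^sup>2 * L \<le> cI * (A * e\<^sup>2 * L)"
    using cI1 A L mult_right_mono[of 1 cI "A * e\<^sup>2 * L"] by simp
  ultimately have "\<bar>tinner ds G Th - tinner ds G T + EO phi\<bar> \<le> 4 * e\<^sup>2 * cI * (A * L) + cI * (A * e\<^sup>2 * L)" by linarith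
  also have "\<dots> = 5 * cI * A * e\<^sup>2 * L" by (simp add: algebra_simps)
  finally show ?thesis .
qed

text \<open>Converts bounds stated with \<open>A * sqrt (dbar ds) * L\<close> into bounds relative
  to \<open>N\<close>.\<close>

definition q :: real where "q = A / a"

definition K2 :: real where "K2 = 6 * cI ^ 3 * (2 * (1 + q\<^sup>2)) + cI * (2 * q\<^sup>2 + 1)"

text \<open>Two exchanges: the weight at the estimated contrast for the weight at the true one, at a
  pointwise cost of order \<open>e\<close>, and \<open>h\<close> for \<open>hs\<close>, whose
  distance in mean square is at most \<open>q * e * N\<close>.\<close>

lemma second_moment: "\<bar>EO (\<lambda>x. (phi x)\<^sup>2) - V\<bar> \<le> K2 * e * V"
proof -
  have W: "0 < real (prod_list ds)" using dstar_pos dstar_le by linarith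
  have q0: "0 \<le> q" using A a by (simp add: q_def)
  have dN: "ED (\<lambda>X. (h X - hs X)\<^sup>2) \<le> (q * e * N)\<^sup>2"
  proof -
    have "(\<lambda>X. (h X - hs X)\<^sup>2) = (\<lambda>X. (dstar ds * tinner ds (\<lambda>i. Hh i - Hs i) X)\<^sup>2)"
      by (simp add: h_def hs_def tinner_def left_diff_distrib sum_subtractf right_diff_distrib)
    moreover have "zero_sum ds (\<lambda>i. Hh i - Hs i)" using zs by (simp add: zero_sum_def sum_subtractf)
    ultimately have "ED (\<lambda>X. (h X - hs X)\<^sup>2) = (sqrt (dstar ds) * L2_set (\<lambda>i. Hh i - Hs i) (idx ds))\<^sup>2"
      by (simp only: ED_square)
    also have "\<dots> \<le> (q * e * N)\<^sup>2"
    proof (rule power_mono)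
      have "sqrt (dstar ds) * L2_set (\<lambda>i. Hh i - Hs i) (idx ds)
        \<le> sqrt (real (prod_list ds)) * (A * e * sqrt (dbar ds / real (prod_list ds)) * L)"
        using Hdiff dstar_le dstar_pos by (intro mult_mono) auto
      also have "\<dots> = A * e * (sqrt (real (prod_list ds)) * sqrt (dbar ds / real (prod_list ds))) * L"
        by (simp only: mult_ac)
      also have "sqrt (real (prod_list ds)) * sqrt (dbar ds / real (prod_list ds)) = sqrt (dbar ds)"
      proof -
        have "w * (x / w) = x" if "0 < w" for w x :: real using that by simp
        from this[OF W] show ?thesis by (simp only: real_sqrt_mult[symmetric])
      qed
      also have "A * e * sqrt (dbar ds) * L = q * e * (a * sqrt (dbar ds) * L)" using a by (simp add: q_def)
      also have "\<dots> \<le> q * e * N" using N_lower q0 e by (intro mult_left_mono) auto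
      finally show "sqrt (dstar ds) * L2_set (\<lambda>i. Hh i - Hs i) (idx ds) \<le> q * e * N" .
    qed (use dstar_pos in simp)
    finally show ?thesis .
  qed
  have sN: "ED (\<lambda>X. (hs X)\<^sup>2) = N\<^sup>2" unfolding hs_def N_def by (rule ED_square[OF zs(2)])
  have e2: "e\<^sup>2 \<le> e" using e by (simp add: power2_eq_square)
  have hN: "ED (\<lambda>X. (h X)\<^sup>2) \<le> 2 * (1 + q\<^sup>2) * N\<^sup>2"
  proof -
    have "ED (\<lambda>X. (h X)\<^sup>2) \<le> ED (\<lambda>X. 2 * (h X - hs X)\<^sup>2 + 2 * (hs X)\<^sup>2)"
    proof (rule ED_mono)
      fix X
      have "2 * (h X - hs X)\<^sup>2 + 2 * (hs X)\<^sup>2 - (h X)\<^sup>2 = (h X - 2 * hs X)\<^sup>2"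
        by (simp add: power2_eq_square algebra_simps)
      then show "(h X)\<^sup>2 \<le> 2 * (h X - hs X)\<^sup>2 + 2 * (hs X)\<^sup>2" using zero_le_power2[of "h X - 2 * hs X"] by linarith
    qed
    also have "\<dots> \<le> 2 * (q * e * N)\<^sup>2 + 2 * N\<^sup>2"
      unfolding ED_add ED_scale sN using dN by simp
    also have "(q * e * N)\<^sup>2 = e\<^sup>2 * (q\<^sup>2 * N\<^sup>2)" by (simp add: power_mult_distrib)
    also have "2 * (e\<^sup>2 * (q\<^sup>2 * N\<^sup>2)) + 2 * N\<^sup>2 \<le> 2 * (1 * (q\<^sup>2 * N\<^sup>2)) + 2 * N\<^sup>2"
      using e e2 by (intro add_right_mono mult_left_mono mult_right_mono) auto
    finally show ?thesis by (simp add: algebra_simps)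
  qed
  let ?w = "\<lambda>X. (info (\<eta> X) + (sigma (\<eta> X) - sigma (\<eta>h X))\<^sup>2) / (info (\<eta>h X))\<^sup>2"
  have w: "\<bar>?w X - 1 / info (\<eta> X)\<bar> \<le> 6 * e * cI ^ 3" if X: "X \<in> set_pmf (design ds)" for X
  proof -
    let ?I = "info (\<eta> X)" and ?J = "info (\<eta>h X)"
    have IJ: "0 < ?I" "0 < ?J" "?I \<le> 1 / 4" "?J \<le> 1 / 4" by (rule info_pos info_le)+
    have c: "1 / ?I \<le> cI" "1 / ?J \<le> cI" using etas[OF X] by auto
    have "\<bar>?I - ?J\<bar> \<le> 2 * e" using info_lipschitz[of "\<eta> X" "\<eta>h X"] etas(1)[OF X] by linarith
    moreover have "\<bar>?I + ?J\<bar> \<le> 1" using IJ by linarith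
    ultimately have n1: "\<bar>(?I - ?J) * (?I + ?J)\<bar> \<le> 2 * e * 1"
      unfolding abs_mult using e by (intro mult_mono) auto
    have "\<bar>sigma (\<eta> X) - sigma (\<eta>h X)\<bar> \<le> e"
      by (rule sigma_diff[OF X])
    then have n2: "(sigma (\<eta> X) - sigma (\<eta>h X))\<^sup>2 \<le> e"
      using e e2 power_mono[of "\<bar>sigma (\<eta> X) - sigma (\<eta>h X)\<bar>" e 2] by simp
    have J2: "(1 / ?J)\<^sup>2 \<le> cI\<^sup>2" using c IJ by (intro power_mono) auto
    have J2': "(1 / ?J)\<^sup>2 \<le> cI ^ 3"
      using J2 cI1 power_increasing[of 2 3 cI] by linarith
    have J3: "(1 / ?J)\<^sup>2 * (1 / ?I) \<le> cI ^ 3"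
    proof -
      have "(1 / ?J)\<^sup>2 * (1 / ?I) \<le> cI\<^sup>2 * cI" using J2 c IJ by (intro mult_mono) auto
      then show ?thesis by (simp add: power3_eq_cube power2_eq_square)
    qed
    have "?w X - 1 / ?I = (?I - ?J) * (?I + ?J) * ((1 / ?J)\<^sup>2 * (1 / ?I)) + (sigma (\<eta> X) - sigma (\<eta>h X))\<^sup>2 * (1 / ?J)\<^sup>2"
      using IJ by (simp add: field_simps power2_eq_square)
    have "\<bar>?w X - 1 / ?I\<bar> \<le> \<bar>(?I - ?J) * (?I + ?J)\<bar> * ((1 / ?J)\<^sup>2 * (1 / ?I)) + (sigma (\<eta> X) - sigma (\<eta>h X))\<^sup>2 * (1 / ?J)\<^sup>2"
    proof -
      have tri: "\<bar>p * k + s * l\<bar> \<le> \<bar>p\<bar> * k + s * l" if "0 \<le> k" "0 \<le> s" "0 \<le> l" for p k s l :: real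
        using abs_triangle_ineq[of "p * k" "s * l"] that by (simp add: abs_mult)
      have "0 \<le> (1 / ?J)\<^sup>2 * (1 / ?I)" using IJ by simp
      then show ?thesis unfolding \<open>?w X - 1 / ?I = _\<close> by (rule tri) simp_all
    qed
    also have "\<dots> \<le> 2 * e * 1 * cI ^ 3 + e * cI ^ 3"
      using n1 n2 J2' J3 e IJ by (intro add_mono mult_mono) auto
    also have "\<dots> \<le> 6 * e * cI ^ 3" using e cI1 by simp
    finally show ?thesis .
  qed
  have 1: "\<bar>EO (\<lambda>x. (phi x)\<^sup>2) - ED (\<lambda>X. 1 / info (\<eta> X) * (h X)\<^sup>2)\<bar> \<le> 6 * e * cI ^ 3 * (2 * (1 + q\<^sup>2) * N\<^sup>2)"
  proof -
    have "\<bar>EO (\<lambda>x. (phi x)\<^sup>2) - ED (\<lambda>X. 1 / info (\<eta> X) * (h X)\<^sup>2)\<bar> = \<bar>ED (\<lambda>X. (?w X - 1 / info (\<eta> X)) * (h X)\<^sup>2)\<bar>"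
      unfolding E_phi2 ED_diff[symmetric] by (simp add: left_diff_distrib)
    also have "\<dots> \<le> ED (\<lambda>X. 6 * e * cI ^ 3 * (h X)\<^sup>2)"
      using w by (intro ED_abs) (simp add: abs_mult mult_right_mono)
    also have "\<dots> \<le> 6 * e * cI ^ 3 * (2 * (1 + q\<^sup>2) * N\<^sup>2)"
      unfolding ED_scale using hN e cI1 by (intro mult_left_mono) auto
    finally show ?thesis .
  qed
  have 2: "\<bar>ED (\<lambda>X. 1 / info (\<eta> X) * (h X)\<^sup>2) - V\<bar> \<le> cI * ((2 * q\<^sup>2 + 1) * e * N\<^sup>2)"
  proof -
    have "\<bar>ED (\<lambda>X. 1 / info (\<eta> X) * (h X)\<^sup>2) - V\<bar> = \<bar>ED (\<lambda>X. 1 / info (\<eta> X) * ((h X)\<^sup>2 - (hs X)\<^sup>2))\<bar>"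
      unfolding V_def ED_diff[symmetric] by (simp add: diff_divide_distrib)
    also have "\<dots> \<le> ED (\<lambda>X. cI * ((1 + 1 / e) * (h X - hs X)\<^sup>2 + e * (hs X)\<^sup>2))"
    proof (rule ED_abs)
      fix X assume X: "X \<in> set_pmf (design ds)"
      define x y where "x = h X - hs X" and "y = hs X"
      \<comment> \<open>The cross term is split with weight \<open>e\<close>: the mean square of
        \<open>h - hs\<close> is of order \<open>e\<^sup>2\<close>, so dividing it by
        \<open>e\<close> still leaves order \<open>e\<close>, the same as for the other
        part.\<close>
      have amgm: "2 * \<bar>y\<bar> * \<bar>x\<bar> \<le> e * y\<^sup>2 + 1 / e * x\<^sup>2"
      proof -
        have "0 \<le> (e * \<bar>y\<bar> - \<bar>x\<bar>)\<^sup>2 / e" using e by simp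
        also have "\<dots> = e * y\<^sup>2 + 1 / e * x\<^sup>2 - 2 * \<bar>y\<bar> * \<bar>x\<bar>"
          using e by (simp add: power2_eq_square field_simps)
        finally show ?thesis by linarith
      qed
      have "(h X)\<^sup>2 - (hs X)\<^sup>2 = x\<^sup>2 + 2 * y * x" by (simp add: x_def y_def power2_eq_square algebra_simps)
      then have "\<bar>(h X)\<^sup>2 - (hs X)\<^sup>2\<bar> \<le> x\<^sup>2 + 2 * \<bar>y\<bar> * \<bar>x\<bar>"
        using abs_triangle_ineq[of "x\<^sup>2" "2 * y * x"] by (simp add: abs_mult)
      then have "\<bar>(h X)\<^sup>2 - (hs X)\<^sup>2\<bar> \<le> (1 + 1 / e) * x\<^sup>2 + e * y\<^sup>2" using amgm by (simp add: distrib_right)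
      then show "\<bar>1 / info (\<eta> X) * ((h X)\<^sup>2 - (hs X)\<^sup>2)\<bar> \<le> cI * ((1 + 1 / e) * (h X - hs X)\<^sup>2 + e * (hs X)\<^sup>2)"
        unfolding abs_mult x_def y_def
        using etas(2)[OF X] info_pos[of "\<eta> X"] cI1 by (intro mult_mono) auto
    qed
    also have "\<dots> = cI * ((1 + 1 / e) * ED (\<lambda>X. (h X - hs X)\<^sup>2) + e * N\<^sup>2)"
      unfolding ED_scale ED_add sN ..
    also have "\<dots> \<le> cI * ((1 + 1 / e) * (q * e * N)\<^sup>2 + e * N\<^sup>2)"
      using dN e cI1 by (intro mult_left_mono add_right_mono) auto
    also have "(1 + 1 / e) * (q * e * N)\<^sup>2 = (e\<^sup>2 + e) * (q\<^sup>2 * N\<^sup>2)"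
      using e by (simp add: power2_eq_square field_simps)
    also have "cI * ((e\<^sup>2 + e) * (q\<^sup>2 * N\<^sup>2) + e * N\<^sup>2) \<le> cI * ((2 * e) * (q\<^sup>2 * N\<^sup>2) + e * N\<^sup>2)"
      using e2 cI1 by (intro mult_left_mono add_right_mono mult_right_mono) auto
    finally show ?thesis by (simp add: algebra_simps)
  qed
  have "\<bar>EO (\<lambda>x. (phi x)\<^sup>2) - V\<bar> \<le> 6 * e * cI ^ 3 * (2 * (1 + q\<^sup>2) * N\<^sup>2) + cI * ((2 * q\<^sup>2 + 1) * e * N\<^sup>2)"
    using 1 2 by linarith
  also have "\<dots> = K2 * e * N\<^sup>2" by (simp add: K2_def algebra_simps)
  also have "\<dots> \<le> K2 * e * V"
    using V_lower e cI1 by (intro mult_left_mono) (auto simp: K2_def)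
  finally show ?thesis .
qed

definition K1 :: real where "K1 = 5 * cI * A / a + K2"

lemma K2_nonneg: "0 \<le> K2" using cI1 by (simp add: K2_def)

lemma norm_by_V:
  assumes "\<bar>x\<bar> \<le> k * y * L" "0 \<le> k" "k / a \<le> K1" "0 \<le> y"
  shows "\<bar>x\<bar> / sqrt V \<le> K1 * (y / sqrt (dbar ds))"
proof -
  have s: "0 < a * sqrt (dbar ds) * L" using a db L by simp
  have "\<bar>x\<bar> / sqrt V \<le> k * y * L / (a * sqrt (dbar ds) * L)"
    using assms L s sqrtV_lower by (intro frac_le) auto
  also have "\<dots> = k / a * (y / sqrt (dbar ds))" using L by simp
  also have "\<dots> \<le> K1 * (y / sqrt (dbar ds))" using assms db by (intro mult_right_mono) auto
  finally show ?thesis .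
qed

lemma K1_ge: "cI * A / a \<le> K1" "5 * cI * A / a \<le> K1" "K2 \<le> K1" "0 \<le> K1"
  using K2_nonneg cI1 A a by (auto simp: K1_def add_increasing2 divide_right_mono)

text \<open>All bounds are divided by \<open>sqrt V\<close>, which is at least
  \<open>a * sqrt (dbar ds) * L\<close>, so \<open>L\<close> disappears. The bias keeps the gain
  \<open>1 / sqrt (dbar ds)\<close>; without it the condition on \<open>n\<close> would be stronger.
  The last bound serves as the Lindeberg condition.\<close>

theorem conclusions:
  shows "\<bar>tinner ds G Th - tinner ds G T + EO phi\<bar> / sqrt V \<le> K1 * (e\<^sup>2 / sqrt (dbar ds))"
    and "\<bar>EO phi\<bar> / sqrt V \<le> K1 * e"
    and "\<bar>EO (\<lambda>x. (phi x)\<^sup>2) / V - 1\<bar> \<le> K1 * e"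
    and "x \<in> set_pmf (obs_law ds T) \<Longrightarrow> \<bar>phi x\<bar> / sqrt V \<le> K1 * sqrt (dbar ds)"
proof -
  show "\<bar>tinner ds G Th - tinner ds G T + EO phi\<bar> / sqrt V \<le> K1 * (e\<^sup>2 / sqrt (dbar ds))"
    using bias_bound K1_ge cI1 A by (intro norm_by_V[of _ "5 * cI * A"]) auto
  have "\<bar>EO phi\<bar> / sqrt V \<le> K1 * (e / sqrt (dbar ds))"
    using mean_bound K1_ge cI1 A e by (intro norm_by_V[of _ "cI * A"]) auto
  also have "\<dots> \<le> K1 * (e / 1)" using K1_ge e db by (intro mult_left_mono divide_left_mono) auto
  finally show "\<bar>EO phi\<bar> / sqrt V \<le> K1 * e" by simp
  have "\<bar>EO (\<lambda>x. (phi x)\<^sup>2) / V - 1\<bar> = \<bar>EO (\<lambda>x. (phi x)\<^sup>2) - V\<bar> / V"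
  proof -
    have "EO (\<lambda>x. (phi x)\<^sup>2) / V - 1 = (EO (\<lambda>x. (phi x)\<^sup>2) - V) / V"
      using V_pos by (simp add: diff_divide_distrib)
    then show ?thesis using V_pos by (simp only: abs_divide abs_of_pos)
  qed
  also have "\<dots> \<le> K2 * e" using second_moment V_pos by (simp add: divide_le_eq)
  also have "\<dots> \<le> K1 * e" using K1_ge e by (intro mult_right_mono) auto
  finally show "\<bar>EO (\<lambda>x. (phi x)\<^sup>2) / V - 1\<bar> \<le> K1 * e" .
  show "\<bar>phi x\<bar> / sqrt V \<le> K1 * sqrt (dbar ds)" if "x \<in> set_pmf (obs_law ds T)"
  proof -
    have "\<bar>phi x\<bar> / sqrt V \<le> K1 * (dbar ds / sqrt (dbar ds))"
      using phi_bound[OF that] K1_ge cI1 A db by (intro norm_by_V[of _ "cI * A"]) auto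
    then show ?thesis using db by (simp add: real_div_sqrt)
  qed
qed

end

subsection \<open>One problem of the sequence\<close>

text \<open>The core is not assumed to vanish off its index set, as the contracted unfoldings in
  \<open>low\<close> may not.\<close>

lemma mode_product_isometry_L2:
  assumes len: "length rs = length ds"
    and U: "\<And>k. k < length ds \<Longrightarrow> orthonormal_cols (ds ! k) (rs ! k) (U k)"
  shows "L2_set (mode_product ds rs C U) (idx ds) = L2_set C (idx rs)"
proof -
  define C' where "C' = (\<lambda>l. if l \<in> idx rs then C l else 0)"
  have "mode_product ds rs C U = mode_product ds rs C' U"
    by (rule mode_product_cong[OF len]) (auto simp: C'_def)
  moreover have "(\<Sum>i\<in>idx ds. (mode_product ds rs C' U i)\<^sup>2) = (\<Sum>l\<in>idx rs. (C' l)\<^sup>2)"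
    by (rule mode_product_isometry[OF len U]) (auto simp: C'_def tensors_def)
  moreover have "(\<Sum>l\<in>idx rs. (C' l)\<^sup>2) = (\<Sum>l\<in>idx rs. (C l)\<^sup>2)" by (rule sum.cong) (auto simp: C'_def)
  ultimately show ?thesis by (simp add: L2_set_def)
qed

lemma orthonormal_cols_isometry:
  assumes "orthonormal_cols d p U"
  shows "L2_set (\<lambda>a. \<Sum>b<p. U a b * x b) {..<d} = L2_set x {..<p}"
proof -
  have "(\<Sum>a<d. (\<Sum>b<p. U a b * x b)\<^sup>2) = (\<Sum>a<d. \<Sum>b<p. \<Sum>l<p. U a b * x b * (U a l * x l))"
    by (simp add: power2_eq_square sum_product)
  also have "\<dots> = (\<Sum>b<p. \<Sum>a<d. \<Sum>l<p. U a b * x b * (U a l * x l))" by (rule sum.swap)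
  also have "\<dots> = (\<Sum>b<p. x b * (\<Sum>l<p. (\<Sum>a<d. U a b * U a l) * x l))"
    unfolding sum_distrib_left sum_distrib_right by (rule sum.cong[OF refl], subst sum.swap) (simp add: mult_ac)
  also have "\<dots> = (\<Sum>b<p. (x b)\<^sup>2)"
    using orthonormal_colsD[OF assms] by (intro sum.cong) (auto simp: power2_eq_square)
  finally show ?thesis by (simp add: L2_set_def)
qed

lemma tucker_contract:
  assumes len: "length r = length ds" and j: "j < length ds"
    and T: "T = mode_product ds r C U" and u: "u \<in> idx (skip_mode j ds)"
  shows "(\<Sum>a<ds ! j. y a * T (ins j a u)) = mode_product (skip_mode j ds) (skip_mode j r)
    (\<lambda>l. \<Sum>b<r ! j. (\<Sum>a<ds ! j. U j a b * y a) * unfold_mode j C b l) (\<lambda>k. U (shift j k)) u"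
proof -
  define g where "g = (\<lambda>b. mode_product (skip_mode j ds) (skip_mode j r) (unfold_mode j C b) (\<lambda>k. U (shift j k)) u)"
  have Tg: "T (ins j a u) = (\<Sum>b<r ! j. U j a b * g b)" if "a < ds ! j" for a
    unfolding T g_def by (rule mode_product_unfold[OF j len that u])
  have "(\<Sum>a<ds ! j. y a * T (ins j a u)) = (\<Sum>a<ds ! j. \<Sum>b<r ! j. U j a b * y a * g b)"
    using Tg by (intro sum.cong) (auto simp: sum_distrib_left mult_ac)
  also have "\<dots> = (\<Sum>b<r ! j. (\<Sum>a<ds ! j. U j a b * y a) * g b)"
    by (subst sum.swap) (simp add: sum_distrib_right)
  finally show ?thesis unfolding mode_product_sum g_def .
qed

text \<open>If fewer than \<open>r ! k\<close> columns spanned all columns, some nonzero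
  \<open>c\<close> would be orthogonal to their images under the transposed \<open>U k\<close>. Then
  \<open>y\<close>, the image of \<open>c\<close> under \<open>U k\<close>, annihilates every
  column, so \<open>inj\<close> gives \<open>y = 0\<close> and hence \<open>c = 0\<close>.\<close>

lemma tucker_rank:
  assumes len: "length r = length ds" and k: "k < length ds"
    and U: "orthonormal_cols (ds ! k) (r ! k) (U k)" and T: "T = mode_product ds r C U"
    and inj: "\<And>y a. (\<And>a. a < ds ! k \<Longrightarrow> (\<Sum>b<ds ! k. col_proj (r ! k) (U k) a b * y b) = y a) \<Longrightarrow>
      (\<And>u. u \<in> idx (skip_mode k ds) \<Longrightarrow> (\<Sum>a<ds ! k. y a * T (ins k a u)) = 0) \<Longrightarrow> a < ds ! k \<Longrightarrow> y a = 0"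
  shows "mat_rank {..<ds ! k} (idx (skip_mode k ds)) (unfold_mode k T) = r ! k"
proof (rule antisym)
  let ?I = "idx (skip_mode k ds)"
  show "mat_rank {..<ds ! k} ?I (unfold_mode k T) \<le> r ! k"
    using mat_rank_le[of ?I "{..<r ! k}" "{..<ds ! k}" "unfold_mode k T" "U k"]
      mode_product_unfold[OF k len, of _ _ C U] by (auto simp: unfold_mode_ins T)
  show "r ! k \<le> mat_rank {..<ds ! k} ?I (unfold_mode k T)"
  proof (rule ccontr)
    assume *: "\<not> ?thesis"
    obtain S where S: "S \<subseteq> ?I" "indep_columns {..<ds ! k} (unfold_mode k T) S"
      "card S = mat_rank {..<ds ! k} ?I (unfold_mode k T)"
      using mat_rank_attained[OF finite_idx] by blast
    have fS: "finite S" using S(1) finite_idx finite_subset by blast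
    obtain c where c: "\<exists>b\<in>{..<r ! k}. c b \<noteq> 0"
      "\<forall>s\<in>S. (\<Sum>b<r ! k. c b * (\<Sum>a<ds ! k. U k a b * T (ins k a s))) = 0"
      using homogeneous_solution[OF fS, of "{..<r ! k}" "\<lambda>s b. \<Sum>a<ds ! k. U k a b * T (ins k a s)"] S(3) * by auto
    define y where "y = (\<lambda>a. \<Sum>b<r ! k. U k a b * c b)"
    have Uy: "(\<Sum>a<ds ! k. U k a b * y a) = c b" if "b < r ! k" for b
    proof -
      have "(\<Sum>a<ds ! k. U k a b * y a) = (\<Sum>l<r ! k. (\<Sum>a<ds ! k. U k a b * U k a l) * c l)"
        unfolding y_def sum_distrib_left sum_distrib_right by (subst sum.swap) (simp add: mult_ac)
      then show ?thesis using orthonormal_colsD[OF U that] by simp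
    qed
    have yS: "(\<Sum>a<ds ! k. y a * T (ins k a s)) = 0" if "s \<in> S" for s
    proof -
      have "(\<Sum>a<ds ! k. y a * T (ins k a s)) = (\<Sum>b<r ! k. c b * (\<Sum>a<ds ! k. U k a b * T (ins k a s)))"
        unfolding y_def sum_distrib_left sum_distrib_right by (subst sum.swap) (simp add: mult_ac)
      then show ?thesis using c(2) that by simp
    qed
    have "y a = 0" if "a < ds ! k" for a
    proof (rule inj[OF _ _ that])
      fix a
      have "(\<Sum>b<ds ! k. col_proj (r ! k) (U k) a b * y b)
        = (\<Sum>l<r ! k. (\<Sum>b<ds ! k. col_proj (r ! k) (U k) a b * U k b l) * c l)"
        unfolding y_def sum_distrib_left sum_distrib_right by (subst sum.swap) (simp add: mult_ac)
      also have "\<dots> = y a" unfolding y_def using col_proj_mult[OF U] by (intro sum.cong) auto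
      finally show "(\<Sum>b<ds ! k. col_proj (r ! k) (U k) a b * y b) = y a" .
    next
      fix u assume u: "u \<in> ?I"
      obtain \<beta> where \<beta>: "\<forall>a\<in>{..<ds ! k}. unfold_mode k T a u = (\<Sum>s\<in>S. \<beta> s * unfold_mode k T a s)"
        using max_indep_columns_span[OF finite_idx S(1,2) _ u] S(3) by auto
      have "(\<Sum>a<ds ! k. y a * T (ins k a u)) = (\<Sum>a<ds ! k. \<Sum>s\<in>S. \<beta> s * (y a * T (ins k a s)))"
        using \<beta> by (intro sum.cong) (auto simp: unfold_mode_ins sum_distrib_left mult_ac)
      also have "\<dots> = (\<Sum>s\<in>S. \<beta> s * (\<Sum>a<ds ! k. y a * T (ins k a s)))"
        by (subst sum.swap) (simp add: sum_distrib_left)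
      finally show "(\<Sum>a<ds ! k. y a * T (ins k a u)) = 0" using yS by simp
    qed
    then have "c b = 0" if "b < r ! k" for b using Uy[OF that] by simp
    then show False using c(1) by auto
  qed
qed

lemma injective_if_lower_bound:
  fixes d :: nat
  assumes "0 < c" "0 < w" "c * sqrt w * L2_set y {..<d} \<le> L2_set g I"
    and "\<And>u. u \<in> I \<Longrightarrow> g u = 0" and "a < d"
  shows "y a = (0 :: real)"
proof -
  have "L2_set g I = L2_set (\<lambda>_. 0) I" using assms(4) by (intro L2_set_cong) auto
  then have "c * sqrt w * L2_set y {..<d} \<le> 0" using assms(3) by (simp add: L2_set_def)
  then have "L2_set y {..<d} \<le> 0" using assms(1,2) by (simp add: mult_le_0_iff)
  then have "L2_set y {..<d} = 0" using L2_set_nonneg[of y "{..<d}"] by linarith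
  then show ?thesis using assms(5) by (simp add: L2_set_eq_0_iff)
qed

lemma l1_le_sqrt_card:
  assumes "finite S" shows "(\<Sum>i\<in>S. \<bar>f i\<bar>) \<le> sqrt (real (card S)) * L2_set f S"
  using cauchy_schwarz_sum[of "\<lambda>_. 1" "\<lambda>i. \<bar>f i\<bar>" S] by (simp add: L2_set_def sum_nonneg)

text \<open>Cauchy-Schwarz on the support, the place where sparsity of \<Gamma> enters. The
  \<open>+ 1\<close> keeps the constant positive for \<open>M = 0\<close>, as \<open>aa\<close>
  divides by it.\<close>

lemma l1_le_frob:
  assumes "card {i \<in> idx ds. G i \<noteq> 0} \<le> M"
  shows "l1_norm ds G \<le> sqrt (real M + 1) * frob_norm ds G"
proof -
  let ?S = "{i \<in> idx ds. G i \<noteq> 0}"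
  have fin: "finite ?S" by simp
  have "l1_norm ds G = (\<Sum>i\<in>?S. \<bar>G i\<bar>)" unfolding l1_norm_def by (intro sum.mono_neutral_right) auto
  also have "\<dots> \<le> sqrt (real (card ?S)) * L2_set G ?S" by (rule l1_le_sqrt_card[OF fin])
  also have "L2_set G ?S = L2_set G (idx ds)"
    unfolding L2_set_def by (intro arg_cong[of _ _ sqrt] sum.mono_neutral_left) auto
  also have "sqrt (real (card ?S)) * L2_set G (idx ds) \<le> sqrt (real M + 1) * L2_set G (idx ds)"
    using assms by (intro mult_right_mono) auto
  finally show ?thesis by (simp add: frob_norm_def)
qed

lemma linf_norm_le: "linf_norm ds H \<le> x \<Longrightarrow> i \<in> idx ds \<Longrightarrow> \<bar>H i\<bar> \<le> x"
  unfolding linf_norm_def by (rule order_trans[OF Max_ge]) auto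

section \<open>One problem with the parameters of the sequence fixed\<close>

locale comparison_problem =
  fixes r :: "nat list" and \<mu> \<kappa> B :: real and M :: nat and C\<psi> \<alpha> cF c0 c\<epsilon> C1 :: real and P :: problem
  assumes r2: "2 \<le> length r" and r1: "\<And>j. j < length r \<Longrightarrow> 1 \<le> r ! j"
    and pos: "0 < \<alpha>" "0 < cF" "0 < C1"
    and signal: "signal_assms r \<mu> \<kappa> P" and functional: "functional_assms M C\<psi> P"
    and gam_ne: "\<exists>i. gam P i \<noteq> 0"
    and TB: "linf_norm (dims P) (Tstar r P) \<le> B"
    and init: "initial_estimator r \<mu> c0 c\<epsilon> C1 P"
    and frob: "cF * sqrt (dstar (dims P)) \<le> frob_norm (dims P) (Tstar r P)"
    and lower: "\<alpha> * dbar (dims P) powr (1 / 2) * dstar (dims P) powr (- 1 / 2) * frob_norm (dims P) (gam P)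
      \<le> frob_norm (dims P) (tangent_proj (dims P) r (Tstar r P) (gam P))"
begin

abbreviation "ds \<equiv> dims P"
abbreviation "T \<equiv> Tstar r P"
abbreviation "U \<equiv> factor P"

text \<open>Dominates \<open>2 * \<mu> * real (r ! k)\<close> for every mode, so that the true
  factors (constant \<mu>) and the estimated ones (constant 2 \<mu>) satisfy the same incoherence
  condition.\<close>

definition \<rho> :: real where "\<rho> = 1 + 2 * \<bar>\<mu>\<bar> * (\<Sum>k<length r. real (r ! k))"
text \<open>The singular-value constant. The factor 1/2 comes from d^* being at least a quarter of
  the number of entries, \<open>sqrt (real (r ! 0))\<close> from passing from Frobenius to operator
  norm, and \<kappa> from passing from the largest to the smallest singular value.
  \<open>max \<kappa> 1\<close> makes positivity immediate.\<close>

definition cc :: real where "cc = cF / (2 * max \<kappa> 1 * sqrt (real (r ! 0)))"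

lemma len: "length r = length ds" using signal by (simp add: signal_assms_def)

lemma ds_ne: "ds \<noteq> []" using len r2 by auto

lemma dk: "k < length ds \<Longrightarrow> 1 \<le> ds ! k" using signal len by (auto simp: signal_assms_def)

sublocale design_dims ds
  using signal ds_ne dk by unfold_locales (auto simp: signal_assms_def)

lemma orth: "k < length ds \<Longrightarrow> orthonormal_cols (ds ! k) (r ! k) (U k)"
  using signal len by (auto simp: signal_assms_def)

lemma T_eq: "T = mode_product ds r (core P) U" by (simp add: Tstar_def)

lemma rho1: "1 \<le> \<rho>"
  unfolding \<rho>_def by (simp add: sum_nonneg)

lemma rho_ge: "k < length r \<Longrightarrow> 2 * \<bar>\<mu>\<bar> * real (r ! k) \<le> \<rho>"
proof -
  assume "k < length r"
  then have "real (r ! k) \<le> (\<Sum>k<length r. real (r ! k))" by (intro member_le_sum) auto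
  then have "2 * \<bar>\<mu>\<bar> * real (r ! k) \<le> 2 * \<bar>\<mu>\<bar> * (\<Sum>k<length r. real (r ! k))" by (intro mult_left_mono) auto
  then show ?thesis by (simp add: \<rho>_def)
qed

lemma mu_le_rho: "k < length r \<Longrightarrow> \<mu> * real (r ! k) \<le> \<rho>"
proof -
  assume k: "k < length r"
  have "\<mu> * real (r ! k) \<le> 2 * \<bar>\<mu>\<bar> * real (r ! k)" by (intro mult_right_mono) auto
  then show ?thesis using rho_ge[OF k] by linarith
qed

lemma mu2_le_rho: "k < length r \<Longrightarrow> 2 * \<mu> * real (r ! k) \<le> \<rho>"
proof -
  assume k: "k < length r"
  have "2 * \<mu> * real (r ! k) \<le> 2 * \<bar>\<mu>\<bar> * real (r ! k)" by (intro mult_right_mono) auto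
  then show ?thesis using rho_ge[OF k] by linarith
qed

lemma B0: "0 \<le> B"
proof -
  obtain u where u: "u \<in> idx (tl ds)" using idx_tl(1) by blast
  have "0 # u \<in> idx ds" using u hd2 by (simp add: idx_split)
  from linf_norm_le[OF TB this] show ?thesis by linarith
qed

abbreviation "Wt \<equiv> real (prod_list ds)"

lemma Wt_pos: "0 < Wt" using dstar_pos dstar_le by linarith

lemma cc_pos: "0 < cc"
proof -
  have "0 < length r" using r2 by linarith
  then have "0 < r ! 0" using r1[of 0] by linarith
  then show ?thesis using pos by (auto simp: cc_def intro!: divide_pos_pos mult_pos_pos)
qed

lemma lambda_min_ge: "cc * sqrt Wt \<le> lambda_min r (core P)"
proof -
  let ?op = "op_norm {..<r ! 0} (idx (skip_mode 0 r)) (unfold_mode 0 (core P))"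
  have l0: "0 < length r" using r2 by linarith
  have "frob_norm ds T = L2_set (core P) (idx r)"
    unfolding frob_norm_def T_eq by (rule mode_product_isometry_L2[OF len orth])
  moreover have "(L2_set (core P) (idx r))\<^sup>2 = (\<Sum>a<r ! 0. \<Sum>u\<in>idx (skip_mode 0 r). (unfold_mode 0 (core P) a u)\<^sup>2)"
    unfolding L2_set_squared sum_unfold[OF l0] unfold_mode_ins ..
  moreover have "\<dots> \<le> real (r ! 0) * ?op\<^sup>2"
    using frob_le_op_norm[of "{..<r ! 0}" "idx (skip_mode 0 r)" "unfold_mode 0 (core P)"] by simp
  ultimately have "(frob_norm ds T)\<^sup>2 \<le> real (r ! 0) * ?op\<^sup>2" by simp
  moreover have op0: "0 \<le> ?op"
    using op_norm_upper[of "{..<r ! 0}" "idx (skip_mode 0 r)" "\<lambda>_. 0" "unfold_mode 0 (core P)"]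
    by (simp add: L2_set_def)
  ultimately have "frob_norm ds T \<le> sqrt (real (r ! 0)) * ?op"
    using real_le_rsqrt[of "frob_norm ds T" "real (r ! 0) * ?op\<^sup>2"] by (simp add: real_sqrt_mult)
  moreover have "cF * (sqrt Wt / 2) \<le> frob_norm ds T"
  proof -
    have "sqrt Wt / 2 = sqrt (Wt / 4)" by (simp add: real_sqrt_divide)
    also have "\<dots> \<le> sqrt (dstar ds)" using dstar_ge by simp
    finally show ?thesis using frob pos by (meson mult_left_mono less_imp_le order_trans)
  qed
  moreover have "?op \<le> lambda_max r (core P)"
    unfolding lambda_max_def using l0 by (intro Max_ge) auto
  ultimately have "cF * (sqrt Wt / 2) \<le> sqrt (real (r ! 0)) * lambda_max r (core P)"
    by (meson mult_left_mono order_trans real_sqrt_ge_zero of_nat_0_le_iff)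
  moreover have r0: "0 < sqrt (real (r ! 0))" using r1[OF l0] by simp
  ultimately have 1: "cF * (sqrt Wt / 2) / sqrt (real (r ! 0)) \<le> lambda_max r (core P)"
    by (simp add: field_simps)
  have lm: "0 < lambda_min r (core P)" "lambda_max r (core P) / lambda_min r (core P) \<le> \<kappa>"
    using signal by (auto simp: signal_assms_def)
  then have "lambda_max r (core P) \<le> \<kappa> * lambda_min r (core P)" by (simp add: field_simps)
  also have "\<dots> \<le> max \<kappa> 1 * lambda_min r (core P)" using lm by (intro mult_right_mono) auto
  finally have "cF * (sqrt Wt / 2) / sqrt (real (r ! 0)) \<le> max \<kappa> 1 * lambda_min r (core P)" using 1 by linarith
  moreover have "0 < max \<kappa> 1" by simp
  ultimately have "cF * (sqrt Wt / 2) / sqrt (real (r ! 0)) / max \<kappa> 1 \<le> lambda_min r (core P)"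
    by (metis mult.commute pos_divide_le_eq)
  moreover have "cc * sqrt Wt = cF * (sqrt Wt / 2) / sqrt (real (r ! 0)) / max \<kappa> 1"
    by (simp add: cc_def)
  ultimately show ?thesis by simp
qed

text \<open>Contracting an unfolding of \<open>T\<close> with \<open>y\<close> acts on the core
  unfolding through the transposed \<open>U j\<close> applied to \<open>y\<close>. The other factors
  are isometries, so the smallest singular value of the core unfolding decides.\<close>

lemma low:
  assumes j: "j < length ds"
  shows "cc * sqrt Wt * L2_set (\<lambda>a. \<Sum>b<ds ! j. col_proj (r ! j) (U j) a b * y b) {..<ds ! j}
    \<le> L2_set (\<lambda>u. \<Sum>a<ds ! j. y a * T (ins j a u)) (idx (skip_mode j ds))"
proof -
  define x where "x = (\<lambda>b. \<Sum>a<ds ! j. U j a b * y a)"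
  have jr: "j < length r" using j len by simp
  have "(\<Sum>b<ds ! j. col_proj (r ! j) (U j) a b * y b) = (\<Sum>b<r ! j. U j a b * x b)" for a
    unfolding col_proj_def x_def sum_distrib_left sum_distrib_right by (subst sum.swap) (simp add: mult_ac)
  then have "L2_set (\<lambda>a. \<Sum>b<ds ! j. col_proj (r ! j) (U j) a b * y b) {..<ds ! j} = L2_set x {..<r ! j}"
    using orthonormal_cols_isometry[OF orth[OF j], of x] by simp
  then have "cc * sqrt Wt * L2_set (\<lambda>a. \<Sum>b<ds ! j. col_proj (r ! j) (U j) a b * y b) {..<ds ! j}
    \<le> lambda_min r (core P) * L2_set x {..<r ! j}"
    using lambda_min_ge by (simp add: mult_right_mono)
  also have "\<dots> \<le> sing_val (r ! j) (idx (skip_mode j r)) (unfold_mode j (core P)) (r ! j) * L2_set x {..<r ! j}"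
    unfolding lambda_min_def using jr by (intro mult_right_mono Min_le) auto
  also have "\<dots> \<le> L2_set (\<lambda>l. \<Sum>b<r ! j. x b * unfold_mode j (core P) b l) (idx (skip_mode j r))"
    by (rule sing_val_lower[OF r1[OF jr]])
  also have "\<dots> = L2_set (mode_product (skip_mode j ds) (skip_mode j r) (\<lambda>l. \<Sum>b<r ! j. x b * unfold_mode j (core P) b l) (\<lambda>k. U (shift j k))) (idx (skip_mode j ds))"
  proof (rule mode_product_isometry_L2[symmetric])
    show "length (skip_mode j r) = length (skip_mode j ds)" using j jr len by (simp add: length_skip)
    fix k assume "k < length (skip_mode j ds)"
    then show "orthonormal_cols (skip_mode j ds ! k) (skip_mode j r ! k) (U (shift j k))"
      using j jr len orth[OF shift_less[OF j]] by (simp add: length_skip nth_skip)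
  qed
  also have "\<dots> = L2_set (\<lambda>u. \<Sum>a<ds ! j. y a * T (ins j a u)) (idx (skip_mode j ds))"
    using tucker_contract[OF len j T_eq] by (intro L2_set_cong) (auto simp: x_def)
  finally show ?thesis .
qed

lemma inj:
  assumes j: "j < length ds"
    and y: "\<And>a. a < ds ! j \<Longrightarrow> (\<Sum>b<ds ! j. col_proj (r ! j) (U j) a b * y b) = y a"
    and T0: "\<And>u. u \<in> idx (skip_mode j ds) \<Longrightarrow> (\<Sum>a<ds ! j. y a * T (ins j a u)) = 0" and a: "a < ds ! j"
  shows "y a = 0"
proof (rule injective_if_lower_bound[OF cc_pos Wt_pos _ T0 a])
  have "L2_set (\<lambda>a. \<Sum>b<ds ! j. col_proj (r ! j) (U j) a b * y b) {..<ds ! j} = L2_set y {..<ds ! j}"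
    using y by (intro L2_set_cong) auto
  then show "cc * sqrt Wt * L2_set y {..<ds ! j} \<le> L2_set (\<lambda>u. \<Sum>a<ds ! j. y a * T (ins j a u)) (idx (skip_mode j ds))"
    using low[OF j, of y] by simp
qed

lemma length_ds_pos: "0 < length ds" using ds_ne by simp

lemma S_tucker: "tucker_inc ds r (core P) U T \<rho>"
proof
  show "length r = length ds" "ds \<noteq> []" by (fact len, fact ds_ne)
  show "1 \<le> ds ! 0" by (rule dk[OF length_ds_pos])
  show "core P \<in> tensors r" using signal by (simp add: signal_assms_def)
  show "orthonormal_cols (ds ! k) (r ! k) (U k)" if "k < length ds" for k using orth[OF that] .
  show "T = mode_product ds r (core P) U" by (rule T_eq)
  \<comment> \<open>For the truth the Tucker rank is a consequence of the singular-value bound,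
    whereas for the estimate it is part of \<open>initial_estimator\<close>.\<close>
  show "T \<in> tucker_manifold ds r"
  proof -
    have "mat_rank {..<ds ! k} (idx (skip_mode k ds)) (unfold_mode k T) = r ! k" if k: "k < length ds" for k
    proof (rule tucker_rank[OF len k orth[OF k] T_eq])
      fix y a
      assume "\<And>a. a < ds ! k \<Longrightarrow> (\<Sum>b<ds ! k. col_proj (r ! k) (U k) a b * y b) = y a"
        "\<And>u. u \<in> idx (skip_mode k ds) \<Longrightarrow> (\<Sum>a<ds ! k. y a * T (ins k a u)) = 0" "a < ds ! k"
      then show "y a = 0" by (rule inj[OF k])
    qed
    moreover have "T \<in> tensors ds" unfolding T_eq by (rule mode_product_tensors)
    ultimately show ?thesis by (simp add: tucker_manifold_def)
  qed
  show "(\<Sum>a<ds ! 0. U 0 a b) = 0" if "b < r ! 0" for b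
  proof (rule zero_sum_factor[OF ds_ne len orth[OF length_ds_pos] T_eq _ _ that])
    show "zero_sum ds T" using signal by (simp add: signal_assms_def)
    fix y a
    assume "\<And>a. a < ds ! 0 \<Longrightarrow> (\<Sum>b<ds ! 0. col_proj (r ! 0) (U 0) a b * y b) = y a"
      "\<And>u. u \<in> idx (skip_mode 0 ds) \<Longrightarrow> (\<Sum>a<ds ! 0. y a * T (ins 0 a u)) = 0" "a < ds ! 0"
    then show "y a = 0" by (rule inj[OF length_ds_pos])
  qed
  show "1 \<le> ds ! k" if "k < length ds" for k by (rule dk[OF that])
  show "1 \<le> \<rho>" by (rule rho1)
  show "(L2_set (U k a) {..<r ! k})\<^sup>2 \<le> \<rho> / real (ds ! k)" if "k < length ds" "a < ds ! k" for k a
  proof -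
    have "(L2_set (U k a) {..<r ! k})\<^sup>2 \<le> \<mu> * real (r ! k) / real (ds ! k)"
      using signal that len by (auto simp: signal_assms_def)
    also have "\<dots> \<le> \<rho> / real (ds ! k)" using mu_le_rho[of k] that len by (intro divide_right_mono) auto
    finally show ?thesis .
  qed
qed

definition e :: real where "e = C1 * rate c\<epsilon> P"

text \<open>Rank and factorisation of the estimate hold for all samples in the support, the error
  bounds only with high probability; both are needed of the same \<open>z\<close>.\<close>

definition admissible :: "(nat \<Rightarrow> obs) \<Rightarrow> bool" where
  "admissible z \<longleftrightarrow> z \<in> set_pmf (first_law r P) \<and> good_estimate r \<mu> c\<epsilon> C1 P z"

context
  fixes z
  assumes z: "admissible z" and small: "0 < rate c\<epsilon> P" "e \<le> 1 / 2" "e \<le> cc / 4"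
begin

abbreviation "Th \<equiv> est P z"
abbreviation "Uh \<equiv> est_factor P z"

lemma e_pos: "0 < e" using small pos by (simp add: e_def)

lemma est_facts:
  "Th \<in> tucker_manifold ds r" "\<And>k. k < length ds \<Longrightarrow> orthonormal_cols (ds ! k) (r ! k) (Uh k)"
  "\<exists>C\<in>tensors r. Th = mode_product ds r C Uh"
  using init z len unfolding initial_estimator_def admissible_def by auto

lemma good_facts:
  "zero_sum ds Th" "linf_norm ds (\<lambda>i. Th i - T i) \<le> e"
  "\<And>k. k < length ds \<Longrightarrow> op_norm {..<ds ! k} {..<ds ! k} (\<lambda>a b. col_proj (r ! k) (Uh k) a b - col_proj (r ! k) (U k) a b) \<le> e"
  "\<And>k. k < length ds \<Longrightarrow> two_inf_norm {..<ds ! k} {..<ds ! k} (\<lambda>a b. col_proj (r ! k) (Uh k) a b - col_proj (r ! k) (U k) a b)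
     \<le> e * sqrt (\<mu> * real (r ! k) / real (ds ! k))"
  "\<And>k. k < length ds \<Longrightarrow> max_norm {..<ds ! k} {..<ds ! k} (\<lambda>a b. col_proj (r ! k) (Uh k) a b - col_proj (r ! k) (U k) a b)
     \<le> e * \<mu> * real (r ! k) / real (ds ! k)"
  "\<And>k a. k < length ds \<Longrightarrow> a < ds ! k \<Longrightarrow> (L2_set (Uh k a) {..<r ! k})\<^sup>2 \<le> 2 * \<mu> * real (r ! k) / real (ds ! k)"
  using z len unfolding admissible_def good_estimate_def e_def Let_def by auto

lemma dop:
  assumes k: "k < length ds"
  shows "L2_set (\<lambda>a. \<Sum>b<ds ! k. (col_proj (r ! k) (Uh k) a b - col_proj (r ! k) (U k) a b) * y b) {..<ds ! k}
    \<le> e * L2_set y {..<ds ! k}"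
  by (rule order_trans[OF op_norm_apply mult_right_mono[OF good_facts(3)[OF k]]]) auto

lemma dinf: "i \<in> idx ds \<Longrightarrow> \<bar>Th i - T i\<bar> \<le> e"
  using linf_norm_le[OF good_facts(2)] by simp

lemma inj_hat:
  assumes j: "j < length ds"
    and y: "\<And>a. a < ds ! j \<Longrightarrow> (\<Sum>b<ds ! j. col_proj (r ! j) (Uh j) a b * y b) = y a"
    and T0: "\<And>u. u \<in> idx (skip_mode j ds) \<Longrightarrow> (\<Sum>a<ds ! j. y a * Th (ins j a u)) = 0" and a: "a < ds ! j"
  shows "y a = 0"
proof (rule injective_if_lower_bound[OF _ Wt_pos _ T0 a])
  show "0 < cc / 4" using cc_pos by simp
  show "cc / 4 * sqrt Wt * L2_set y {..<ds ! j} \<le> L2_set (\<lambda>u. \<Sum>a<ds ! j. y a * Th (ins j a u)) (idx (skip_mode j ds))"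
    using perturbed_lower_bound[OF j low[OF j] _ small(2,3) cc_pos dop[OF j] dinf y] e_pos by simp
qed

lemma pair: "\<exists>C\<in>tensors r. tucker_pair ds r (core P) U T \<rho> C Uh Th e cc B"
proof -
  obtain C where C: "C \<in> tensors r" "Th = mode_product ds r C Uh" using est_facts(3) by blast
  have E: "tucker_inc ds r C Uh Th \<rho>"
  proof
    show "length r = length ds" "ds \<noteq> []" by (fact len, fact ds_ne)
    show "1 \<le> ds ! 0" by (rule dk[OF length_ds_pos])
    show "C \<in> tensors r" "Th = mode_product ds r C Uh" by (fact C)+
    show "orthonormal_cols (ds ! k) (r ! k) (Uh k)" if "k < length ds" for k using est_facts(2)[OF that] .
    show "Th \<in> tucker_manifold ds r" by (rule est_facts(1))
    show "(\<Sum>a<ds ! 0. Uh 0 a b) = 0" if "b < r ! 0" for b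
    proof (rule zero_sum_factor[OF ds_ne len est_facts(2)[OF length_ds_pos] C(2) good_facts(1) _ that])
      fix y a
      assume "\<And>a. a < ds ! 0 \<Longrightarrow> (\<Sum>b<ds ! 0. col_proj (r ! 0) (Uh 0) a b * y b) = y a"
        "\<And>u. u \<in> idx (skip_mode 0 ds) \<Longrightarrow> (\<Sum>a<ds ! 0. y a * Th (ins 0 a u)) = 0" "a < ds ! 0"
      then show "y a = 0" by (rule inj_hat[OF length_ds_pos])
    qed
    show "1 \<le> ds ! k" if "k < length ds" for k by (rule dk[OF that])
    show "1 \<le> \<rho>" by (rule rho1)
    show "(L2_set (Uh k a) {..<r ! k})\<^sup>2 \<le> \<rho> / real (ds ! k)" if "k < length ds" "a < ds ! k" for k a
    proof -
      have "(L2_set (Uh k a) {..<r ! k})\<^sup>2 \<le> 2 * \<mu> * real (r ! k) / real (ds ! k)" by (rule good_facts(6)[OF that])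
      also have "\<dots> \<le> \<rho> / real (ds ! k)" using mu2_le_rho[of k] that len by (intro divide_right_mono) auto
      finally show ?thesis .
    qed
  qed
  interpret S: tucker_inc ds r "core P" U T \<rho> by (rule S_tucker)
  interpret E: tucker_inc ds r C Uh Th \<rho> by (rule E)
  have "tucker_pair ds r (core P) U T \<rho> C Uh Th e cc B"
  proof
    show "0 \<le> e" "e \<le> 1 / 2" "e \<le> cc / 4" "0 < cc" "0 \<le> B" using e_pos small cc_pos B0 by auto
    show "L2_set (\<lambda>b. E.P k a b - S.P k a b) {..<ds ! k} \<le> e * sqrt (\<rho> / real (ds ! k))"
      if "k < length ds" "a < ds ! k" for k a
    proof -
      have "L2_set (\<lambda>b. E.P k a b - S.P k a b) {..<ds ! k} \<le> two_inf_norm {..<ds ! k} {..<ds ! k} (\<lambda>a b. E.P k a b - S.P k a b)"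
        unfolding two_inf_norm_def using that by (intro Max_ge) auto
      also have "\<dots> \<le> e * sqrt (\<mu> * real (r ! k) / real (ds ! k))"
        unfolding E.P_def S.P_def by (rule good_facts(4)[OF that(1)])
      also have "\<dots> \<le> e * sqrt (\<rho> / real (ds ! k))"
        using mu_le_rho[of k] that len e_pos by (intro mult_left_mono real_sqrt_le_mono divide_right_mono) auto
      finally show ?thesis .
    qed
    show "\<bar>E.P k a b - S.P k a b\<bar> \<le> e * (\<rho> / real (ds ! k))" if "k < length ds" "a < ds ! k" "b < ds ! k" for k a b
    proof -
      have "\<bar>E.P k a b - S.P k a b\<bar> \<le> max_norm {..<ds ! k} {..<ds ! k} (\<lambda>a b. E.P k a b - S.P k a b)"
        unfolding max_norm_def using that by (intro Max_ge) force+
      also have "\<dots> \<le> e * \<mu> * real (r ! k) / real (ds ! k)"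
        unfolding E.P_def S.P_def by (rule good_facts(5)[OF that(1)])
      also have "\<dots> = e * (\<mu> * real (r ! k) / real (ds ! k))" by simp
      also have "\<dots> \<le> e * (\<rho> / real (ds ! k))"
        using mu_le_rho[of k] that len e_pos by (intro mult_left_mono divide_right_mono) auto
      finally show ?thesis .
    qed
    show "L2_set (\<lambda>a. \<Sum>b<ds ! k. (E.P k a b - S.P k a b) * y b) {..<ds ! k} \<le> e * L2_set y {..<ds ! k}"
      if "k < length ds" for k y
      unfolding E.P_def S.P_def by (rule dop[OF that])
    show "\<bar>Th i - T i\<bar> \<le> e" if "i \<in> idx ds" for i by (rule dinf[OF that])
    show "\<bar>T i\<bar> \<le> B" if "i \<in> idx ds" for i by (rule linf_norm_le[OF TB that])
    show "cc * sqrt Wt * L2_set (\<lambda>a. \<Sum>b<ds ! j. S.P j a b * y b) {..<ds ! j}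
        \<le> L2_set (\<lambda>u. \<Sum>a<ds ! j. y a * T (ins j a u)) (idx (skip_mode j ds))" if "j < length ds" for j y
      unfolding S.P_def by (rule low[OF that])
  qed
  then show ?thesis using C(1) by blast
qed

end

text \<open>\<open>A1 + A3 + A4\<close> of the locale \<open>tucker_pair\<close> written out in the
  fixed parameters, because the final constant must be chosen before the problem and the first-stage
  sample.\<close>

definition AA :: real where
  "AA = (let m = real (length r); R = \<rho> ^ length r; a1 = R + m * (2 + \<rho>) * R; a2 = 8 / cc + m * 2 ^ length r in
     a1 + sqrt R * (m * 2 ^ length r + m * ((2 + \<rho>) * a2 + 1)) + (1 + a1) * (m\<^sup>2 * R * B + m * R))"

definition aa :: real where "aa = \<alpha> / sqrt (real M + 1)"

lemma ws_instance:
  assumes z: "admissible z" and small: "0 < rate c\<epsilon> P" "e \<le> 1 / 2" "e \<le> cc / 4"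
  shows "plug_in ds T (est P z) (gam P) (tangent_proj ds r (est P z) (gam P)) (tangent_proj ds r T (gam P)) AA B e aa"
proof -
  obtain C where "tucker_pair ds r (core P) U T \<rho> C (est_factor P z) (est P z) e cc B"
    using pair[OF assms] by blast
  then interpret tp: tucker_pair ds r "core P" U T \<rho> C "est_factor P z" "est P z" e cc B .
  let ?G = "gam P"
  have Hh: "tangent_proj ds r (est P z) ?G = tp.E.PT ?G" by (rule tp.E.tangent_proj_eq)
  have Hs: "tangent_proj ds r T ?G = tp.S.PT ?G" by (rule tp.S.tangent_proj_eq)
  have A1: "0 \<le> tp.S.A1" "0 \<le> tp.A3" "0 \<le> tp.A4"
    using tp.S.A1_ge_1 tp.A2_nonneg rho1 B0 by (auto simp: tp.A3_def tp.A4_def)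
  have AA: "AA = tp.S.A1 + tp.A3 + tp.A4"
    by (simp add: AA_def tp.S.A1_def tp.A3_def tp.A2_def tp.A4_def len Let_def)
  have L: "0 < l1_norm ds ?G"
  proof -
    obtain i where i: "?G i \<noteq> 0" using gam_ne by blast
    then have "i \<in> idx ds" using functional by (auto simp: functional_assms_def tensors_def)
    then have "\<bar>?G i\<bar> \<le> l1_norm ds ?G" unfolding l1_norm_def by (intro member_le_sum) auto
    then show ?thesis using i by linarith
  qed
  have db: "1 \<le> dbar ds" by (rule tp.S.dbar_ge_1)
  show ?thesis
  proof
    show "zero_sum ds (tangent_proj ds r (est P z) ?G)"
      unfolding Hh using tp.E.PT_in_tangent_space[of ?G] by (simp add: tangent_space_def)
    show "zero_sum ds (tangent_proj ds r T ?G)"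
      unfolding Hs using tp.S.PT_in_tangent_space[of ?G] by (simp add: tangent_space_def)
    show "\<bar>T i\<bar> \<le> B" if "i \<in> idx ds" for i by (rule tp.TB[OF that])
    show "\<bar>est P z i - T i\<bar> \<le> e" if "i \<in> idx ds" for i by (rule tp.dinf[OF that])
    show "0 < e" by (rule e_pos[OF assms])
    show "e \<le> 1" using small by simp
    show "0 < AA" unfolding AA using tp.S.A1_ge_1 A1 by linarith
    show "0 < aa" using pos by (simp add: aa_def add_nonneg_pos)
    show "0 < l1_norm ds ?G" by (rule L)
    show "1 \<le> dbar ds" by (rule db)
    have "tp.S.A1 * l1_norm ds ?G \<le> AA * l1_norm ds ?G"
      unfolding AA using A1 L by (intro mult_right_mono) auto
    then show "l1_norm ds (tangent_proj ds r (est P z) ?G) \<le> AA * l1_norm ds ?G"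
      unfolding Hh using tp.E.PT_l1[of ?G] by linarith
    show "\<bar>tangent_proj ds r (est P z) ?G i\<bar> \<le> AA * (dbar ds / Wt) * l1_norm ds ?G" if i: "i \<in> idx ds" for i
    proof -
      have "tp.S.A1 * (dbar ds / Wt) * l1_norm ds ?G \<le> AA * (dbar ds / Wt) * l1_norm ds ?G"
        unfolding AA using A1 L db by (intro mult_right_mono) auto
      then show ?thesis unfolding Hh using tp.E.PT_abs[OF i, of ?G] by linarith
    qed
    have "tp.A4 * e\<^sup>2 * l1_norm ds ?G \<le> AA * e\<^sup>2 * l1_norm ds ?G"
      unfolding AA using A1 L by (intro mult_right_mono) auto
    then show "\<bar>tinner ds (\<lambda>i. ?G i - tangent_proj ds r (est P z) ?G i) T\<bar> \<le> AA * e\<^sup>2 * l1_norm ds ?G"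
      unfolding Hh using tp.remainder[of ?G] by linarith
    \<comment> \<open>The tangent vector with \<open>Y = 0\<close> and \<open>G\<close> the estimate
      itself, which is fixed by its factor projectors.\<close>
    have "est P z \<in> tangent_space ds r (est P z)"
    proof -
      have "mode_product ds ds (est P z) (one j (\<lambda>_ _. 0)) i = 0" if "j < length ds" for j i
        using that by (simp add: mode_product_eq kern_upd)
      then show ?thesis using tp.E.tangent_spaceI[of "\<lambda>_ _ _. 0" "est P z"] by (simp add: tp.E.P_T)
    qed
    then show "tinner ds (\<lambda>i. ?G i - tangent_proj ds r (est P z) ?G i) (est P z) = 0"
      unfolding Hh by (rule tp.E.PT_orth)
    have "tp.A3 * e * sqrt (dbar ds / Wt) * l1_norm ds ?G \<le> AA * e * sqrt (dbar ds / Wt) * l1_norm ds ?G"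
      unfolding AA using A1 L db tp.e by (intro mult_right_mono) auto
    then show "L2_set (\<lambda>i. tangent_proj ds r (est P z) ?G i - tangent_proj ds r T ?G i) (idx ds)
      \<le> AA * e * sqrt (dbar ds / Wt) * l1_norm ds ?G"
      unfolding Hh Hs using tp.PT_diff[of ?G] by linarith
    show "aa * sqrt (dbar ds) * l1_norm ds ?G \<le> sqrt (dstar ds) * L2_set (tangent_proj ds r T ?G) (idx ds)"
    proof -
      let ?s = "sqrt (real M + 1)"
      have s: "0 < ?s" by (simp add: add_nonneg_pos)
      have "l1_norm ds ?G \<le> ?s * frob_norm ds ?G"
        using functional by (intro l1_le_frob) (simp add: functional_assms_def)
      then have "aa * sqrt (dbar ds) * l1_norm ds ?G \<le> aa * sqrt (dbar ds) * (?s * frob_norm ds ?G)"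
        using pos db by (intro mult_left_mono) (auto simp: aa_def)
      also have "\<dots> = \<alpha> * sqrt (dbar ds) * frob_norm ds ?G" using s by (simp add: aa_def)
      also have "\<dots> = sqrt (dstar ds) * (\<alpha> * dbar ds powr (1 / 2) * dstar ds powr (- 1 / 2) * frob_norm ds ?G)"
      proof -
        have "dstar ds powr (- (1 / 2)) = 1 / sqrt (dstar ds)"
          unfolding powr_minus_divide using dstar_pos by (simp add: powr_half_sqrt)
        then have p1: "dstar ds powr (- 1 / 2) = 1 / sqrt (dstar ds)" by simp
        have p2: "dbar ds powr (1 / 2) = sqrt (dbar ds)" using db by (simp add: powr_half_sqrt)
        have "x * y * z = s * (x * y * (1 / s) * z)" if "0 < s" for x y z s :: real using that by simp
        then show ?thesis unfolding p1 p2 using dstar_pos by simp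
      qed
      also have "\<dots> \<le> sqrt (dstar ds) * frob_norm ds (tangent_proj ds r T ?G)"
        using lower dstar_pos by (intro mult_left_mono) auto
      finally show ?thesis by (simp add: frob_norm_def)
    qed
  qed
qed

end

section \<open>Rates for the normalised summands\<close>

context comparison_problem
begin

abbreviation "K \<equiv> plug_in.K1 AA B aa"
abbreviation "d \<equiv> dbar ds"
abbreviation "obs \<equiv> obs_law ds T"

lemma influence_bounds:
  assumes z: "admissible z" and small: "0 < rate c\<epsilon> P" "e \<le> 1 / 2" "e \<le> cc / 4"
  shows "0 \<le> K" "0 < V_ws r P" "1 \<le> d"
    "\<bar>psi P (est P z) - psi P T + measure_pmf.expectation obs (phi_ws r P (est P z))\<bar> / sqrt (V_ws r P) \<le> K * (e\<^sup>2 / sqrt d)"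
    "\<bar>measure_pmf.expectation obs (phi_ws r P (est P z))\<bar> / sqrt (V_ws r P) \<le> K * e"
    "\<bar>measure_pmf.expectation obs (\<lambda>x. (phi_ws r P (est P z) x)\<^sup>2) / V_ws r P - 1\<bar> \<le> K * e"
    "\<And>x. x \<in> set_pmf obs \<Longrightarrow> \<bar>phi_ws r P (est P z) x\<bar> / sqrt (V_ws r P) \<le> K * sqrt d"
proof -
  interpret w: plug_in ds T "est P z" "gam P" "tangent_proj ds r (est P z) (gam P)" "tangent_proj ds r T (gam P)" AA B e aa
    by (rule ws_instance[OF assms])
  have scale: "tinner ds (\<lambda>i. x * H i) X = x * tinner ds H X" for x H X
    by (simp add: tinner_def sum_distrib_left mult_ac)
  have phi: "phi_ws r P (est P z) = w.phi"
    by (simp add: phi_ws_def w.phi_def H_ws_def w.\<eta>h_def w.h_def scale)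
  have V: "V_ws r P = w.V"
  proof -
    have comb: "s * x + (1 - s) * x = x" for s x :: real by (simp add: algebra_simps)
    show ?thesis
      unfolding V_ws_def expectation_obs_law w.V_def prod.case comb
      by (simp add: H_ws_def w.hs_def w.\<eta>_def scale)
  qed
  show "0 \<le> K" by (rule w.K1_ge(4))
  show "0 < V_ws r P" unfolding V by (rule w.V_pos)
  show "1 \<le> d" by (rule w.db)
  show "\<bar>psi P (est P z) - psi P T + measure_pmf.expectation obs (phi_ws r P (est P z))\<bar> / sqrt (V_ws r P) \<le> K * (e\<^sup>2 / sqrt d)"
    "\<bar>measure_pmf.expectation obs (phi_ws r P (est P z))\<bar> / sqrt (V_ws r P) \<le> K * e"
    "\<bar>measure_pmf.expectation obs (\<lambda>x. (phi_ws r P (est P z) x)\<^sup>2) / V_ws r P - 1\<bar> \<le> K * e"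
    "\<And>x. x \<in> set_pmf obs \<Longrightarrow> \<bar>phi_ws r P (est P z) x\<bar> / sqrt (V_ws r P) \<le> K * sqrt d"
    unfolding phi V psi_def using w.conclusions by auto
qed

lemma finite_first_law: "finite (set_pmf (first_law r P))"
  unfolding first_law_def iid_law_def by (rule finite_set_Pi_pmf[OF finite_obs_law])

lemma prob_inadmissible: "measure_pmf.prob (first_law r P) (- {z. admissible z}) \<le> d powr (- c0)"
proof -
  let ?p = "first_law r P"
  have "measure_pmf.prob ?p (- {z. admissible z}) = measure_pmf.prob ?p (- {z. good_estimate r \<mu> c\<epsilon> C1 P z})"
    by (rule measure_prob_cong_0) (auto simp: admissible_def set_pmf_iff)
  also have "\<dots> = 1 - measure_pmf.prob ?p {z. good_estimate r \<mu> c\<epsilon> C1 P z}"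
    using measure_pmf.prob_compl[of "{z. good_estimate r \<mu> c\<epsilon> C1 P z}" ?p] by (simp add: Compl_eq_Diff_UNIV)
  finally show ?thesis using init by (simp add: initial_estimator_def)
qed

text \<open>The exponent \<open>2 * c\<epsilon>\<close> arises from squaring
  \<open>rate c\<epsilon> P\<close> in the bias, and the additional 1 covers the \<open>ln d\<close>
  spent in the Bernstein bound. The growth condition of the theorem says that this quantity tends to
  0.\<close>

definition \<tau> :: real where "\<tau> = sqrt (d * ln d powr (2 * c\<epsilon> + 1) / real (nobs P))"

lemma rates:
  assumes n: "1 \<le> nobs P" and ln: "1 \<le> ln d" and d1: "1 \<le> d" and ce: "0 < c\<epsilon>"
  shows "0 < rate c\<epsilon> P" "rate c\<epsilon> P \<le> \<tau>" "sqrt (real (nobs P)) * ((rate c\<epsilon> P)\<^sup>2 / sqrt d) \<le> \<tau>"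
    "sqrt d / sqrt (real (nobs P)) \<le> \<tau>" "sqrt (d * ln d / real (nobs P)) \<le> \<tau>"
    "sqrt (d * ln d / real (nobs P)) \<le> rate (c\<epsilon> + 1) P" "rate c\<epsilon> P \<le> rate (c\<epsilon> + 1) P"
proof -
  let ?n = "real (nobs P)"
  have n0: "0 < ?n" using n by simp
  have pw: "ln d powr x \<le> ln d powr y" if "x \<le> y" for x y using ln that by (intro powr_mono) auto
  have mono: "sqrt (d * u / ?n) \<le> sqrt (d * v / ?n)" if "u \<le> v" for u v
    using that d1 n0 by (intro real_sqrt_le_mono divide_right_mono mult_left_mono) auto
  have ln1: "ln d = ln d powr 1" using ln by simp
  have "0 < d" "0 < ln d powr c\<epsilon>" using d1 ln by auto
  then show "0 < rate c\<epsilon> P" unfolding rate_def using n0 by (intro real_sqrt_gt_zero divide_pos_pos mult_pos_pos)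
  show "rate c\<epsilon> P \<le> \<tau>" unfolding rate_def \<tau>_def by (rule mono[OF pw]) (use ce in simp)
  show "rate c\<epsilon> P \<le> rate (c\<epsilon> + 1) P" unfolding rate_def by (rule mono[OF pw]) simp
  show "sqrt (d * ln d / ?n) \<le> \<tau>" unfolding \<tau>_def by (rule mono, subst ln1, rule pw) (use ce in simp)
  show "sqrt (d * ln d / ?n) \<le> rate (c\<epsilon> + 1) P" unfolding rate_def by (rule mono, subst ln1, rule pw) (use ce in simp)
  have "1 \<le> ln d powr (2 * c\<epsilon> + 1)" using pw[of 0 "2 * c\<epsilon> + 1"] ce ln by simp
  from mono[OF this] show "sqrt d / sqrt ?n \<le> \<tau>" by (simp add: \<tau>_def real_sqrt_divide)
  have "(rate c\<epsilon> P)\<^sup>2 = d * ln d powr c\<epsilon> / ?n" unfolding rate_def using n0 d1 by simp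
  then have "sqrt ?n * ((rate c\<epsilon> P)\<^sup>2 / sqrt d) = sqrt ?n * (d * ln d powr c\<epsilon> / ?n / sqrt d)" by simp
  also have "\<dots> = (sqrt ?n / ?n) * (d / sqrt d) * ln d powr c\<epsilon>" by simp
  also have "d / sqrt d = sqrt d" using d1 by (simp add: real_div_sqrt)
  also have "sqrt ?n / ?n = 1 / sqrt ?n" using n0 by (simp add: field_simps)
  also have "ln d powr c\<epsilon> = sqrt (ln d powr (2 * c\<epsilon>))"
    using ln by (simp add: powr_half_sqrt[symmetric] powr_powr)
  also have "1 / sqrt ?n * sqrt d * sqrt (ln d powr (2 * c\<epsilon>)) = sqrt (d * ln d powr (2 * c\<epsilon>) / ?n)"
    by (simp add: real_sqrt_mult real_sqrt_divide)
  also have "\<dots> \<le> \<tau>" unfolding \<tau>_def by (rule mono[OF pw]) simp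
  finally show "sqrt ?n * ((rate c\<epsilon> P)\<^sup>2 / sqrt d) \<le> \<tau>" .
qed

text \<open>One \<open>\<delta>\<close> serves all four conditions: \<open>C1\<^sup>2\<close> comes
  from the quadratic bias, \<open>C1\<close> from the moment errors, and 1 from the size of the
  summands.\<close>

lemma clt_conditions:
  assumes z: "admissible z" and small: "e \<le> 1 / 2" "e \<le> cc / 4"
    and n: "1 \<le> nobs P" and ln: "1 \<le> ln d" and d1: "1 \<le> d" and ce: "0 < c\<epsilon>"
  defines "\<delta> \<equiv> K * (C1\<^sup>2 + C1 + 1) * \<tau>"
    and "f \<equiv> \<lambda>x. phi_ws r P (est P z) x / sqrt (V_ws r P)"
    and "c \<equiv> sqrt (real (nobs P)) * (psi P (est P z) - psi P T) / sqrt (V_ws r P)"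
  shows "\<bar>c + sqrt (real (nobs P)) * measure_pmf.expectation obs f\<bar> \<le> \<delta>"
    "\<bar>measure_pmf.expectation obs (\<lambda>x. (f x)\<^sup>2) - 1\<bar> \<le> \<delta>"
    "\<bar>measure_pmf.expectation obs f\<bar> \<le> \<delta>"
    "\<forall>x\<in>set_pmf obs. \<bar>f x\<bar> \<le> \<delta> * sqrt (real (nobs P))"
proof -
  let ?q = "sqrt (real (nobs P))" and ?V = "V_ws r P" and ?E = "measure_pmf.expectation obs"
  let ?phi = "phi_ws r P (est P z)"
  note rt = rates[OF n ln d1 ce]
  note ib = influence_bounds[OF z rt(1) small]
  have q0: "0 < ?q" using n by simp
  have tau0: "0 \<le> \<tau>" using d1 by (simp add: \<tau>_def)
  have s0: "0 < sqrt ?V" using ib(2) by simp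
  have Ef: "?E f = ?E ?phi / sqrt ?V" unfolding f_def by (rule integral_divide_zero)
  have parts: "K * (C1 * \<tau>) \<le> \<delta>" "K * (C1\<^sup>2 * \<tau>) \<le> \<delta>" "K * \<tau> \<le> \<delta>"
  proof -
    have "0 \<le> K * (C1 * \<tau>)" "0 \<le> K * (C1\<^sup>2 * \<tau>)" "0 \<le> K * \<tau>" using ib(1) tau0 pos by auto
    then show "K * (C1 * \<tau>) \<le> \<delta>" "K * (C1\<^sup>2 * \<tau>) \<le> \<delta>" "K * \<tau> \<le> \<delta>"
      unfolding \<delta>_def by (simp_all add: distrib_left distrib_right mult.assoc)
  qed
  have Ke: "K * e \<le> \<delta>"
  proof -
    have "K * e \<le> K * (C1 * \<tau>)" unfolding e_def using rt(2) ib(1) pos by (intro mult_left_mono) auto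
    then show ?thesis using parts by linarith
  qed
  have "\<bar>c + ?q * ?E f\<bar> = \<bar>?q * ((psi P (est P z) - psi P T + ?E ?phi) / sqrt ?V)\<bar>"
    unfolding c_def Ef by (simp add: add_divide_distrib distrib_left)
  also have "\<dots> = ?q * (\<bar>psi P (est P z) - psi P T + ?E ?phi\<bar> / sqrt ?V)"
    using q0 s0 by (simp add: abs_mult)
  also have "\<dots> \<le> ?q * (K * (e\<^sup>2 / sqrt d))" using ib(4) q0 by (intro mult_left_mono) auto
  also have "\<dots> = K * (C1\<^sup>2 * (?q * ((rate c\<epsilon> P)\<^sup>2 / sqrt d)))" by (simp add: e_def power_mult_distrib mult_ac)
  also have "\<dots> \<le> K * (C1\<^sup>2 * \<tau>)" using rt(3) ib(1) by (intro mult_left_mono) auto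
  also have "\<dots> \<le> \<delta>" by (rule parts)
  finally show "\<bar>c + ?q * ?E f\<bar> \<le> \<delta>" .
  have "?E (\<lambda>x. (f x)\<^sup>2) = ?E (\<lambda>x. (?phi x)\<^sup>2) / ?V"
    unfolding f_def power_divide using ib(2) by simp
  then show "\<bar>?E (\<lambda>x. (f x)\<^sup>2) - 1\<bar> \<le> \<delta>" using ib(6) Ke by simp
  have "\<bar>?E f\<bar> = \<bar>?E ?phi\<bar> / sqrt ?V" unfolding Ef using s0 by simp
  then show "\<bar>?E f\<bar> \<le> \<delta>" using ib(5) Ke by simp
  show "\<forall>x\<in>set_pmf obs. \<bar>f x\<bar> \<le> \<delta> * ?q"
  proof
    fix x assume "x \<in> set_pmf obs"
    then have "\<bar>f x\<bar> \<le> K * sqrt d" using ib(7)[of x] s0 by (simp add: f_def)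
    also have "\<dots> = K * (sqrt d / ?q) * ?q" using q0 by simp
    also have "\<dots> \<le> K * \<tau> * ?q" using rt(4) ib(1) q0 by (intro mult_right_mono mult_left_mono) auto
    also have "\<dots> \<le> \<delta> * ?q" using parts q0 by (intro mult_right_mono) auto
    finally show "\<bar>f x\<bar> \<le> \<delta> * ?q" .
  qed
qed

text \<open>The first term is the deviation \<open>s / n\<close> allowed in the Bernstein bound, the
  second the error of the conditional second moment.\<close>

definition CV :: real where "CV = 3 * (K + 1)\<^sup>2 + K * C1"

text \<open>The squared normalised summands are nonnegative, bounded by order \<open>d\<close> and
  have mean of order 1. Their variance is therefore of order \<open>d\<close> and not
  \<open>d\<^sup>2\<close>, which gives the rate sqrt(d ln d / n).\<close>

lemma variance_concentration:
  assumes z: "admissible z" and small: "e \<le> 1 / 2" "e \<le> cc / 4"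
    and n: "1 \<le> nobs P" and ln: "1 \<le> ln d" and d1: "1 \<le> d" and ce: "0 < c\<epsilon>" and tau: "\<tau> \<le> 1"
  shows "measure_pmf.prob (iid_law ds T (nobs P))
    {w. \<not> \<bar>(V_hat_ws r P (z, w) - V_ws r P) / V_ws r P\<bar> \<le> CV * rate (c\<epsilon> + 1) P} \<le> 2 / d"
proof -
  let ?n = "real (nobs P)" and ?V = "V_ws r P" and ?E = "measure_pmf.expectation obs"
  let ?phi = "phi_ws r P (est P z)"
  note rt = rates[OF n ln d1 ce]
  note ib = influence_bounds[OF z rt(1) small]
  have n0: "0 < ?n" using n by simp
  \<comment> \<open>\<open>K\<close> is only known to be nonnegative, while \<open>l\<close> divides
    by \<open>k\<^sup>2\<close>.\<close>
  define k where "k = K + 1"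
  have k: "1 \<le> k" "K \<le> k" using ib(1) by (auto simp: k_def)
  define y where "y = (\<lambda>x. (?phi x)\<^sup>2 / ?V)"
  define \<mu>y where "\<mu>y = ?E y"
  define g where "g = (\<lambda>x. y x - \<mu>y)"
  define x0 where "x0 = sqrt (d * ln d / ?n)"
  have x0: "0 < x0" "x0 \<le> 1" "?n * x0\<^sup>2 = d * ln d"
  proof -
    have "0 < d" "0 < ln d" using d1 ln by linarith+
    then have "0 < d * ln d / ?n" using n0 by (intro divide_pos_pos mult_pos_pos)
    then show "0 < x0" "?n * x0\<^sup>2 = d * ln d" using n0 by (auto simp: x0_def)
    show "x0 \<le> 1" unfolding x0_def using rt(5) tau by linarith
  qed
  note fin = finite_obs_law[of T]
  note int = integrable_finite_pmf[OF fin]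
  have mean: "?E g = 0" unfolding g_def by (simp add: Bochner_Integration.integral_diff[OF int int] \<mu>y_def)
  have y0: "0 \<le> y x" for x using ib(2) by (simp add: y_def)
  have yb: "y x \<le> k\<^sup>2 * d" if "x \<in> set_pmf obs" for x
  proof -
    have "y x = (\<bar>?phi x\<bar> / sqrt ?V)\<^sup>2" using ib(2) by (simp add: y_def power_divide)
    also have "\<dots> \<le> (k * sqrt d)\<^sup>2"
    proof (rule power_mono)
      have "K * sqrt d \<le> k * sqrt d" using k d1 by (intro mult_right_mono) auto
      then show "\<bar>?phi x\<bar> / sqrt ?V \<le> k * sqrt d" using ib(7)[OF that] by linarith
    qed (use ib(2) in simp)
    finally show ?thesis using d1 by (simp add: power_mult_distrib)
  qed
  have mu_eq: "\<mu>y = ?E (\<lambda>x. (?phi x)\<^sup>2) / ?V" unfolding \<mu>y_def y_def by (rule integral_divide_zero)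
  have e1: "K * e \<le> K * 1" using small ib(1) by (intro mult_left_mono) auto
  have mu1: "\<mu>y \<le> 1 + k" "\<bar>\<mu>y - 1\<bar> \<le> K * e" using ib(6) e1 k unfolding mu_eq by linarith+
  have mu0: "0 \<le> \<mu>y" unfolding \<mu>y_def by (intro integral_nonneg_AE) (simp add: y0)
  have mub: "\<mu>y \<le> k\<^sup>2 * d"
  proof -
    have "\<mu>y \<le> ?E (\<lambda>x. k\<^sup>2 * d)" unfolding \<mu>y_def by (rule expectation_mono_pmf[OF fin yb])
    then show ?thesis by simp
  qed
  have gb: "\<bar>g x\<bar> \<le> k\<^sup>2 * d" if "x \<in> set_pmf obs" for x
    using yb[OF that] y0[of x] mub mu0 unfolding g_def by linarith
  have v: "?E (\<lambda>x. (g x)\<^sup>2) \<le> k\<^sup>2 * d * (1 + k)"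
  proof -
    have "?E (\<lambda>x. (g x)\<^sup>2) = ?E (\<lambda>x. ((y x)\<^sup>2 - 2 * \<mu>y * y x) + \<mu>y\<^sup>2)"
      by (simp add: g_def power2_eq_square algebra_simps)
    also have "\<dots> = ?E (\<lambda>x. (y x)\<^sup>2) - ?E (\<lambda>x. 2 * \<mu>y * y x) + ?E (\<lambda>x. \<mu>y\<^sup>2)"
      by (simp only: Bochner_Integration.integral_diff[OF int int] Bochner_Integration.integral_add[OF int int])
    also have "?E (\<lambda>x. 2 * \<mu>y * y x) = 2 * \<mu>y * \<mu>y" unfolding \<mu>y_def by (rule integral_mult_right_zero)
    also have "?E (\<lambda>x. (y x)\<^sup>2) - 2 * \<mu>y * \<mu>y + ?E (\<lambda>x. \<mu>y\<^sup>2) \<le> ?E (\<lambda>x. (y x)\<^sup>2)"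
      by (simp add: power2_eq_square)
    also have "\<dots> \<le> ?E (\<lambda>x. k\<^sup>2 * d * y x)"
      using yb y0 by (intro expectation_mono_pmf[OF fin]) (auto simp: power2_eq_square intro!: mult_right_mono)
    also have "\<dots> = k\<^sup>2 * d * \<mu>y" unfolding \<mu>y_def by (rule integral_mult_right_zero)
    also have "\<dots> \<le> k\<^sup>2 * d * (1 + k)" using mu1 d1 by (intro mult_left_mono) auto
    finally show ?thesis .
  qed
  \<comment> \<open>Tuned so that the quadratic term of the exponent is at most
    \<open>2 * ln d\<close> and \<open>l * s = 3 * ln d\<close>, leaving 1/d. The constraint on
    \<open>l\<close> becomes \<open>x0 \<le> 1\<close>, which follows from
    \<open>\<tau> \<le> 1\<close>.\<close>
  define l where "l = x0 / (k\<^sup>2 * d)"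
  define s where "s = ?n * (3 * k\<^sup>2 * x0)"
  have kd: "0 < k\<^sup>2 * d" using k d1 by simp
  have l: "0 \<le> l" "l * (k\<^sup>2 * d) \<le> 1" using x0 kd by (auto simp: l_def)
  have "?n * l\<^sup>2 * (k\<^sup>2 * d * (1 + k)) = (?n * x0\<^sup>2) * ((1 + k) / (k\<^sup>2 * d))"
  proof -
    have "n * (x / w)\<^sup>2 * (w * y) = (n * x\<^sup>2) * (y / w)" if "0 < w" for n x w y :: real
      using that by (simp add: power2_eq_square)
    from this[OF kd] show ?thesis unfolding l_def .
  qed
  also have "\<dots> = ln d * ((1 + k) / k\<^sup>2)" unfolding x0(3) using d1 by simp
  also have "\<dots> \<le> ln d * 2"
  proof (rule mult_left_mono)
    have "k * 1 \<le> k * k" using k by (intro mult_left_mono) auto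
    then have "1 + k \<le> 2 * k\<^sup>2" using k unfolding power2_eq_square by linarith
    then show "(1 + k) / k\<^sup>2 \<le> 2" using k by (simp add: divide_le_eq)
  qed (use ln in simp)
  finally have e_1: "?n * l\<^sup>2 * (k\<^sup>2 * d * (1 + k)) \<le> 2 * ln d" by simp
  have "l * s = 3 * (?n * x0\<^sup>2) / d" using k d1 by (simp add: l_def s_def power2_eq_square)
  also have "\<dots> = 3 * ln d" unfolding x0(3) using d1 by simp
  finally have e_2: "l * s = 3 * ln d" .
  have "measure_pmf.prob (iid_law ds T (nobs P)) {w. s \<le> \<bar>\<Sum>i<nobs P. g (w i)\<bar>}
    \<le> 2 * exp (?n * l\<^sup>2 * (k\<^sup>2 * d * (1 + k)) - l * s)"
    unfolding iid_law_def by (rule bernstein[OF fin mean gb v l])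
  also have "\<dots> \<le> 2 * exp (- ln d)" using e_1 e_2 by simp
  also have "\<dots> = 2 / d" using d1 by (simp add: exp_minus divide_inverse)
  finally have main: "measure_pmf.prob (iid_law ds T (nobs P)) {w. s \<le> \<bar>\<Sum>i<nobs P. g (w i)\<bar>} \<le> 2 / d" .
  have "{w. \<not> \<bar>(V_hat_ws r P (z, w) - ?V) / ?V\<bar> \<le> CV * rate (c\<epsilon> + 1) P} \<subseteq> {w. s \<le> \<bar>\<Sum>i<nobs P. g (w i)\<bar>}"
  proof (rule subsetI, rule CollectI, rule ccontr)
    fix w assume w: "w \<in> {w. \<not> \<bar>(V_hat_ws r P (z, w) - ?V) / ?V\<bar> \<le> CV * rate (c\<epsilon> + 1) P}"
      and "\<not> s \<le> \<bar>\<Sum>i<nobs P. g (w i)\<bar>"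
    then have "\<bar>\<Sum>i<nobs P. g (w i)\<bar> \<le> ?n * (3 * k\<^sup>2 * x0)" by (simp add: s_def)
    then have avg: "\<bar>(\<Sum>i<nobs P. g (w i)) / ?n\<bar> \<le> 3 * k\<^sup>2 * x0"
      using n0 by (simp add: divide_le_eq mult.commute)
    have sum_g: "(\<Sum>i<nobs P. g (w i)) = (\<Sum>i<nobs P. y (w i)) - ?n * \<mu>y"
      by (simp add: g_def sum_subtractf)
    have "(V_hat_ws r P (z, w) - ?V) / ?V = (\<Sum>i<nobs P. y (w i)) / ?n - 1"
      using ib(2) by (simp add: V_hat_ws_def emp_mean_def y_def diff_divide_distrib sum_divide_distrib mult.commute)
    also have "\<dots> = (\<Sum>i<nobs P. g (w i)) / ?n + (\<mu>y - 1)"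
      unfolding sum_g using n0 by (simp add: diff_divide_distrib)
    finally have "\<bar>(V_hat_ws r P (z, w) - ?V) / ?V\<bar> \<le> 3 * k\<^sup>2 * x0 + K * e" using avg mu1(2) by linarith
    also have "\<dots> \<le> 3 * k\<^sup>2 * rate (c\<epsilon> + 1) P + K * (C1 * rate (c\<epsilon> + 1) P)"
      unfolding e_def x0_def using rt(6,7) k ib(1) pos by (intro add_mono mult_left_mono) auto
    also have "\<dots> = CV * rate (c\<epsilon> + 1) P" by (simp add: CV_def k_def distrib_right)
    finally show False using w by simp
  qed
  then have "measure_pmf.prob (iid_law ds T (nobs P)) {w. \<not> \<bar>(V_hat_ws r P (z, w) - ?V) / ?V\<bar> \<le> CV * rate (c\<epsilon> + 1) P}
    \<le> measure_pmf.prob (iid_law ds T (nobs P)) {w. s \<le> \<bar>\<Sum>i<nobs P. g (w i)\<bar>}"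
    by (intro measure_pmf.finite_measure_mono) auto
  then show ?thesis using main by linarith
qed

lemma variance_probability:
  assumes small: "e \<le> 1 / 2" "e \<le> cc / 4"
    and n: "1 \<le> nobs P" and ln: "1 \<le> ln d" and d1: "1 \<le> d" and ce: "0 < c\<epsilon>" and tau: "\<tau> \<le> 1"
  shows "1 - (d powr (- c0) + 2 / d) \<le> measure_pmf.prob (sample_law r P)
    {\<omega>. \<bar>(V_hat_ws r P \<omega> - V_ws r P) / V_ws r P\<bar> \<le> CV * rate (c\<epsilon> + 1) P}"
proof -
  let ?X = "{\<omega>. \<not> \<bar>(V_hat_ws r P \<omega> - V_ws r P) / V_ws r P\<bar> \<le> CV * rate (c\<epsilon> + 1) P}"
  have finQ: "finite (set_pmf (iid_law ds T (nobs P)))"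
    unfolding iid_law_def by (rule finite_set_Pi_pmf[OF finite_obs_law])
  have "measure_pmf.prob (sample_law r P) ?X \<le> measure_pmf.prob (first_law r P) (- {z. admissible z}) + 2 / d"
    unfolding sample_law_def
    using variance_concentration[OF _ assms] d1
    by (intro prob_pair_le[OF finite_first_law finQ]) auto
  then have "measure_pmf.prob (sample_law r P) ?X \<le> d powr (- c0) + 2 / d" using prob_inadmissible by linarith
  moreover have "measure_pmf.prob (sample_law r P) (- ?X) = 1 - measure_pmf.prob (sample_law r P) ?X"
    using measure_pmf.prob_compl[of ?X "sample_law r P"] by (simp add: Compl_eq_Diff_UNIV)
  moreover have "- ?X = {\<omega>. \<bar>(V_hat_ws r P \<omega> - V_ws r P) / V_ws r P\<bar> \<le> CV * rate (c\<epsilon> + 1) P}" by auto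
  ultimately show ?thesis by simp
qed

lemma studentized_eq:
  "(\<lambda>\<omega>. sqrt (real (nobs P)) * (psi_hat_ws r P \<omega> - psi P T) / sqrt (V_ws r P))
   = (\<lambda>(z, w). sqrt (real (nobs P)) * (psi P (est P z) - psi P T) / sqrt (V_ws r P)
      + (\<Sum>i<nobs P. phi_ws r P (est P z) (w i) / sqrt (V_ws r P)) / sqrt (real (nobs P)))"
proof -
  have "sqrt x * (S / x) = S / sqrt x" if "0 \<le> x" for x S :: real
    using that real_div_sqrt[OF that] by (cases "x = 0") (auto simp: field_simps)
  note root = this[of "real (nobs P)"]
  have "sqrt (real (nobs P)) * (a + S / real (nobs P) - b) / v
    = sqrt (real (nobs P)) * (a - b) / v + S / v / sqrt (real (nobs P))" for a S b v :: real
  proof -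
    have "sqrt (real (nobs P)) * (a + S / real (nobs P) - b) / v
      = sqrt (real (nobs P)) * (a - b) / v + sqrt (real (nobs P)) * (S / real (nobs P)) / v"
      by (simp only: add_divide_distrib[symmetric] distrib_left[symmetric]) (simp add: algebra_simps)
    then show ?thesis by (simp only: root[OF of_nat_0_le_iff]) (simp add: mult.commute)
  qed
  then show ?thesis
    by (auto simp: fun_eq_iff psi_hat_ws_def emp_mean_def sum_divide_distrib[symmetric])
qed

end

section \<open>Uniform constants and passage to the limit\<close>

theorem theorem5p2:
  fixes m M :: nat and r :: "nat list"
    and \<mu> \<kappa> B C\<psi> \<alpha>\<^sub>\<Gamma> c\<^sub>F c\<^sub>0 c\<^sub>\<epsilon> C\<^sub>1 K :: real
  assumes "m \<ge> 2" and "length r = m" and "\<forall>j<m. r ! j \<ge> 1"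
    and "\<alpha>\<^sub>\<Gamma> > 0" and "c\<^sub>F > 0" and "c\<^sub>0 > 0" and "c\<^sub>\<epsilon> > 0" and "C\<^sub>1 > 0" and "K > 0"
  shows "\<exists>c\<^sub>n>0. \<exists>c\<^sub>V>0. \<exists>c\<^sub>p>0. \<exists>C>0. \<forall>P :: nat \<Rightarrow> problem.
      (\<forall>N. signal_assms r \<mu> \<kappa> (P N)) \<and>
      (\<forall>N. functional_assms M C\<psi> (P N)) \<and>
      (\<forall>N. \<exists>i. gam (P N) i \<noteq> 0) \<and>
      (\<forall>N. real (nobs (P N)) \<le> K * real (nfirst (P N)) \<and>
           real (nfirst (P N)) \<le> K * real (nobs (P N))) \<and>
      (\<forall>N. linf_norm (dims (P N)) (Tstar r (P N)) \<le> B) \<and>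
      (\<forall>N. initial_estimator r \<mu> c\<^sub>0 c\<^sub>\<epsilon> C\<^sub>1 (P N)) \<and>
      (\<forall>N. frob_norm (dims (P N)) (Tstar r (P N)) \<ge> c\<^sub>F * sqrt (dstar (dims (P N)))) \<and>
      (\<forall>N. frob_norm (dims (P N)) (tangent_proj (dims (P N)) r (Tstar r (P N)) (gam (P N)))
           \<ge> \<alpha>\<^sub>\<Gamma> * dbar (dims (P N)) powr (1/2) * dstar (dims (P N)) powr (-1/2)
              * frob_norm (dims (P N)) (gam (P N))) \<and>
      filterlim (\<lambda>N. nobs (P N)) at_top sequentially \<and>
      filterlim (\<lambda>N. dbar (dims (P N))) at_top sequentially \<and>
      filterlim (\<lambda>N. real (nobs (P N)) / (dbar (dims (P N)) * ln (dbar (dims (P N))) powr c\<^sub>n))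
        at_top sequentially
      \<longrightarrow>
      weak_conv_m
        (\<lambda>N. distr (measure_pmf (sample_law r (P N))) borel
          (\<lambda>\<omega>. sqrt (real (nobs (P N))) * (psi_hat_ws r (P N) \<omega> - psi (P N) (Tstar r (P N)))
               / sqrt (V_ws r (P N))))
        std_normal_distribution \<and>
      (\<forall>\<^sub>F N in sequentially.
        measure_pmf.prob (sample_law r (P N))
          {\<omega>. \<bar>(V_hat_ws r (P N) \<omega> - V_ws r (P N)) / V_ws r (P N)\<bar> \<le> C * rate c\<^sub>V (P N)}
        \<ge> 1 - dbar (dims (P N)) powr (- c\<^sub>p))"
proof -
  \<comment> \<open>The constants of \<open>comparison_problem\<close> do not involve the problem,
    so they can be named before the sequence is introduced.\<close>
  define k where "k = plug_in.K1 (comparison_problem.AA r \<mu> \<kappa> B c\<^sub>F) B (comparison_problem.aa M \<alpha>\<^sub>\<Gamma>)"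
  define CV where "CV = 3 * (k + 1)\<^sup>2 + k * C\<^sub>1"
  \<comment> \<open>The failure probability is at most three times
    \<open>dbar (dims (P N)) powr (- (2 * c\<^sub>p))\<close>. Halving the exponent leaves one
    factor \<open>dbar (dims (P N)) powr (- c\<^sub>p)\<close>, eventually below 1/3, to absorb the
    3.\<close>
  define c\<^sub>p where "c\<^sub>p = min c\<^sub>0 1 / 2"
  have cp: "0 < c\<^sub>p" "2 * c\<^sub>p \<le> c\<^sub>0" "2 * c\<^sub>p \<le> 1" using assms by (auto simp: c\<^sub>p_def)
  show ?thesis
  \<comment> \<open>The logarithmic power in the growth condition is that of \<open>\<tau>\<close>;
    the one in the variance rate exceeds \<open>c\<^sub>\<epsilon>\<close> by 1 to absorb the
    Bernstein logarithm. \<open>max CV 1\<close> guarantees a positive constant.\<close>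
  proof (rule exI[of _ "2 * c\<^sub>\<epsilon> + 1"], rule conjI, use assms in simp,
      rule exI[of _ "c\<^sub>\<epsilon> + 1"], rule conjI, use assms in simp,
      rule exI[of _ c\<^sub>p], rule conjI, rule cp(1),
      rule exI[of _ "max CV 1"], rule conjI, simp, intro allI impI, elim conjE)
    fix P :: "nat \<Rightarrow> problem"
    assume signal: "\<forall>N. signal_assms r \<mu> \<kappa> (P N)" and functional: "\<forall>N. functional_assms M C\<psi> (P N)"
      and gam: "\<forall>N. \<exists>i. gam (P N) i \<noteq> 0"
      and TB: "\<forall>N. linf_norm (dims (P N)) (Tstar r (P N)) \<le> B"
      and init: "\<forall>N. initial_estimator r \<mu> c\<^sub>0 c\<^sub>\<epsilon> C\<^sub>1 (P N)"
      and frob: "\<forall>N. frob_norm (dims (P N)) (Tstar r (P N)) \<ge> c\<^sub>F * sqrt (dstar (dims (P N)))"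
      and lower: "\<forall>N. frob_norm (dims (P N)) (tangent_proj (dims (P N)) r (Tstar r (P N)) (gam (P N)))
           \<ge> \<alpha>\<^sub>\<Gamma> * dbar (dims (P N)) powr (1/2) * dstar (dims (P N)) powr (-1/2)
              * frob_norm (dims (P N)) (gam (P N))"
      and nlim: "filterlim (\<lambda>N. nobs (P N)) at_top sequentially"
      and dlim: "filterlim (\<lambda>N. dbar (dims (P N))) at_top sequentially"
      and ratio: "filterlim (\<lambda>N. real (nobs (P N)) / (dbar (dims (P N)) * ln (dbar (dims (P N))) powr (2 * c\<^sub>\<epsilon> + 1)))
        at_top sequentially"
    interpret pa: comparison_problem r \<mu> \<kappa> B M C\<psi> \<alpha>\<^sub>\<Gamma> c\<^sub>F c\<^sub>0 c\<^sub>\<epsilon> C\<^sub>1 "P N" for N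
      using assms signal functional gam TB init frob lower by unfold_locales auto
    let ?d = "\<lambda>N. dbar (dims (P N))"
    let ?G = "\<lambda>N. {z. pa.admissible N z}"
    have tau0: "(\<lambda>N. pa.\<tau> N) \<longlonglongrightarrow> 0"
    proof -
      have "(\<lambda>N. inverse (real (nobs (P N)) / (?d N * ln (?d N) powr (2 * c\<^sub>\<epsilon> + 1)))) \<longlonglongrightarrow> 0"
        by (rule tendsto_inverse_0_at_top[OF ratio])
      then have "(\<lambda>N. sqrt (inverse (real (nobs (P N)) / (?d N * ln (?d N) powr (2 * c\<^sub>\<epsilon> + 1))))) \<longlonglongrightarrow> sqrt 0"
        by (rule tendsto_real_sqrt)
      then show ?thesis by (simp add: pa.\<tau>_def)
    qed
    have ev_n: "\<forall>\<^sub>F N in sequentially. 1 \<le> nobs (P N)" using nlim by (simp add: filterlim_at_top)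
    have ev_d: "\<forall>\<^sub>F N in sequentially. exp 1 \<le> ?d N" using dlim by (simp add: filterlim_at_top)
    have ev_ln: "\<forall>\<^sub>F N in sequentially. 1 \<le> ln (?d N) \<and> 1 \<le> ?d N"
      using ev_d
    proof eventually_elim
      case (elim N)
      have "1 \<le> exp (1 :: real)" by simp
      then have "1 \<le> ?d N" using elim by linarith
      moreover have "1 \<le> ln (?d N)" using elim \<open>1 \<le> ?d N\<close> by (subst ln_ge_iff) auto
      ultimately show ?case by blast
    qed
    have ev_tau: "\<forall>\<^sub>F N in sequentially. pa.\<tau> N \<le> t" if "0 < t" for t
      using order_tendstoD(2)[OF tau0 that] by eventually_elim simp
    have cc: "0 < comparison_problem.cc r \<kappa> c\<^sub>F" by (rule pa.cc_pos)
    have ev_e: "\<forall>\<^sub>F N in sequentially. pa.e N \<le> 1 / 2 \<and> pa.e N \<le> comparison_problem.cc r \<kappa> c\<^sub>F / 4"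
    proof -
      define t where "t = min (1 / 2) (comparison_problem.cc r \<kappa> c\<^sub>F / 4) / C\<^sub>1"
      have "0 < t" using cc assms by (simp add: t_def)
      show ?thesis using ev_tau[OF \<open>0 < t\<close>] ev_ln ev_n
      proof eventually_elim
        case (elim N)
        then have "rate c\<^sub>\<epsilon> (P N) \<le> t" using pa.rates(2)[of N] assms by force
        then have "C\<^sub>1 * rate c\<^sub>\<epsilon> (P N) \<le> C\<^sub>1 * t" using assms by (intro mult_left_mono) auto
        then have "pa.e N \<le> min (1 / 2) (comparison_problem.cc r \<kappa> c\<^sub>F / 4)" using assms by (simp add: pa.e_def t_def)
        then show ?case by simp
      qed
    qed
    have powr0: "(\<lambda>N. ?d N powr (- c)) \<longlonglongrightarrow> 0" if "0 < c" for c
      by (rule tendsto_neg_powr[OF _ dlim]) (use that in simp)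
    show "weak_conv_m
        (\<lambda>N. distr (measure_pmf (sample_law r (P N))) borel
          (\<lambda>\<omega>. sqrt (real (nobs (P N))) * (psi_hat_ws r (P N) \<omega> - psi (P N) (Tstar r (P N)))
               / sqrt (V_ws r (P N))))
        std_normal_distribution \<and>
      (\<forall>\<^sub>F N in sequentially.
        1 - dbar (dims (P N)) powr (- c\<^sub>p) \<le> measure_pmf.prob (sample_law r (P N))
          {\<omega>. \<bar>(V_hat_ws r (P N) \<omega> - V_ws r (P N)) / V_ws r (P N)\<bar> \<le> max CV 1 * rate (c\<^sub>\<epsilon> + 1) (P N)})"
    proof
      show "weak_conv_m
        (\<lambda>N. distr (measure_pmf (sample_law r (P N))) borel
          (\<lambda>\<omega>. sqrt (real (nobs (P N))) * (psi_hat_ws r (P N) \<omega> - psi (P N) (Tstar r (P N)))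
               / sqrt (V_ws r (P N))))
        std_normal_distribution"
        unfolding pa.studentized_eq sample_law_def iid_law_def
      \<comment> \<open>The normalised first-stage error is the shift, and the weighted scores at
        the estimate, divided by the standard deviation, are the summands.\<close>
      proof (rule conditional_clt[where G = ?G and \<delta> = "\<lambda>N. k * (C\<^sub>1\<^sup>2 + C\<^sub>1 + 1) * pa.\<tau> N"])
        show "finite (set_pmf (first_law r (P N)))" for N by (rule pa.finite_first_law)
        show "finite (set_pmf (obs_law (dims (P N)) (Tstar r (P N))))" for N by (rule pa.finite_obs_law)
        show "filterlim (\<lambda>N. nobs (P N)) at_top sequentially" by (rule nlim)
        show "(\<lambda>N. k * (C\<^sub>1\<^sup>2 + C\<^sub>1 + 1) * pa.\<tau> N) \<longlonglongrightarrow> 0"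
          by (rule tendsto_mult_right_zero[OF tau0])
        show "(\<lambda>N. measure_pmf.prob (first_law r (P N)) (- ?G N)) \<longlonglongrightarrow> 0"
        proof (rule Lim_null_comparison)
          show "(\<lambda>N. ?d N powr (- c\<^sub>0)) \<longlonglongrightarrow> 0" by (rule powr0) (use assms in simp)
          show "\<forall>\<^sub>F N in sequentially. norm (measure_pmf.prob (first_law r (P N)) (- ?G N)) \<le> ?d N powr (- c\<^sub>0)"
            using pa.prob_inadmissible by (intro always_eventually) simp
        qed
        show "\<forall>\<^sub>F N in sequentially. \<forall>z\<in>?G N.
          \<bar>sqrt (real (nobs (P N))) * (psi (P N) (est (P N) z) - psi (P N) (Tstar r (P N))) / sqrt (V_ws r (P N))
            + sqrt (real (nobs (P N))) * measure_pmf.expectation (obs_law (dims (P N)) (Tstar r (P N)))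
               (\<lambda>x. phi_ws r (P N) (est (P N) z) x / sqrt (V_ws r (P N)))\<bar> \<le> k * (C\<^sub>1\<^sup>2 + C\<^sub>1 + 1) * pa.\<tau> N \<and>
          \<bar>measure_pmf.expectation (obs_law (dims (P N)) (Tstar r (P N)))
             (\<lambda>x. (phi_ws r (P N) (est (P N) z) x / sqrt (V_ws r (P N)))\<^sup>2) - 1\<bar> \<le> k * (C\<^sub>1\<^sup>2 + C\<^sub>1 + 1) * pa.\<tau> N \<and>
          \<bar>measure_pmf.expectation (obs_law (dims (P N)) (Tstar r (P N)))
             (\<lambda>x. phi_ws r (P N) (est (P N) z) x / sqrt (V_ws r (P N)))\<bar> \<le> k * (C\<^sub>1\<^sup>2 + C\<^sub>1 + 1) * pa.\<tau> N \<and>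
          (\<forall>x\<in>set_pmf (obs_law (dims (P N)) (Tstar r (P N))).
             \<bar>phi_ws r (P N) (est (P N) z) x / sqrt (V_ws r (P N))\<bar> \<le> k * (C\<^sub>1\<^sup>2 + C\<^sub>1 + 1) * pa.\<tau> N * sqrt (real (nobs (P N))))"
          using ev_e ev_ln ev_n
        proof eventually_elim
          case (elim N)
          then show ?case
            using pa.clt_conditions[of N] assms unfolding k_def by auto
        qed
      qed
      have "\<forall>\<^sub>F N in sequentially. ?d N powr (- c\<^sub>p) < 1 / 3"
        by (rule order_tendstoD(2)[OF powr0[OF cp(1)]]) simp
      then show "\<forall>\<^sub>F N in sequentially.
        1 - dbar (dims (P N)) powr (- c\<^sub>p) \<le> measure_pmf.prob (sample_law r (P N))
          {\<omega>. \<bar>(V_hat_ws r (P N) \<omega> - V_ws r (P N)) / V_ws r (P N)\<bar> \<le> max CV 1 * rate (c\<^sub>\<epsilon> + 1) (P N)}"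
        using ev_e ev_ln ev_n ev_tau[of 1, simplified]
      proof eventually_elim
        case (elim N)
        let ?D = "?d N"
        have D: "1 \<le> ?D" using elim by simp
        have "?D powr (- c\<^sub>0) \<le> ?D powr (- (2 * c\<^sub>p))" using D cp by (intro powr_mono) auto
        moreover have "2 / ?D \<le> 2 * ?D powr (- (2 * c\<^sub>p))"
        proof -
          have "?D powr (- 1) \<le> ?D powr (- (2 * c\<^sub>p))" using D cp by (intro powr_mono) auto
          moreover have "?D powr (- 1) = 1 / ?D" using D by (simp add: powr_minus divide_inverse)
          ultimately show ?thesis by simp
        qed
        moreover have "3 * ?D powr (- (2 * c\<^sub>p)) \<le> ?D powr (- c\<^sub>p)"
        proof -
          have "?D powr (- (2 * c\<^sub>p)) = ?D powr (- c\<^sub>p) * ?D powr (- c\<^sub>p)"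
            by (simp add: powr_add[symmetric])
          also have "\<dots> \<le> 1 / 3 * ?D powr (- c\<^sub>p)" using elim by (intro mult_right_mono) auto
          finally show ?thesis by simp
        qed
        ultimately have "1 - ?D powr (- c\<^sub>p) \<le> 1 - (?D powr (- c\<^sub>0) + 2 / ?D)" by linarith
        also have "\<dots> \<le> measure_pmf.prob (sample_law r (P N))
          {\<omega>. \<bar>(V_hat_ws r (P N) \<omega> - V_ws r (P N)) / V_ws r (P N)\<bar> \<le> CV * rate (c\<^sub>\<epsilon> + 1) (P N)}"
          using pa.variance_probability[of N] elim assms unfolding pa.CV_def CV_def k_def by auto
        also have "\<dots> \<le> measure_pmf.prob (sample_law r (P N))
          {\<omega>. \<bar>(V_hat_ws r (P N) \<omega> - V_ws r (P N)) / V_ws r (P N)\<bar> \<le> max CV 1 * rate (c\<^sub>\<epsilon> + 1) (P N)}"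
        proof (rule measure_pmf.finite_measure_mono)
          have "0 \<le> rate (c\<^sub>\<epsilon> + 1) (P N)" using D by (simp add: rate_def)
          then have "CV * rate (c\<^sub>\<epsilon> + 1) (P N) \<le> max CV 1 * rate (c\<^sub>\<epsilon> + 1) (P N)" by (intro mult_right_mono) auto
          then show "{\<omega>. \<bar>(V_hat_ws r (P N) \<omega> - V_ws r (P N)) / V_ws r (P N)\<bar> \<le> CV * rate (c\<^sub>\<epsilon> + 1) (P N)}
            \<subseteq> {\<omega>. \<bar>(V_hat_ws r (P N) \<omega> - V_ws r (P N)) / V_ws r (P N)\<bar> \<le> max CV 1 * rate (c\<^sub>\<epsilon> + 1) (P N)}" by auto
        qed simp
        finally show ?case .
      qed
    qed
  qed
qed

end
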